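(* Let $a_c=-\lambda'(1)$ and $\bar a=\lim_{\theta\to\max(\underline\theta,0)}(-\lambda'(\theta))$. Let $a_c<a<\bar a$, let $\theta\in(0,1)$ satisfy $a=-\lambda'(\theta)$, let $b\in\mathbb R$, and let $(j_n)_{n\in\mathbb N}$ be positive integers with $\lim_{n\to\infty}(\log n-aj_n)/(\log n)^{1/2}=b$. Then almost surely, as $n\to\infty$, $K_n^{(j_n)}=\dfrac{\Gamma(1-\theta)}{\theta(2\pi\lambda''(\theta))^{1/2}}\,e^{-ab^2/(2\lambda''(\theta))}\,W(\theta)\,\dfrac{n^\theta e^{\lambda(\theta)j_n}}{j_n^{1/2}}(1+o(1)).$
   Context: Standing setup. Let $(P_k)_{k\in\mathbb N}$ be nonnegative random variables with an arbitrary joint law such that $\sum_{k\ge1}P_k=1$ a.s. and $\mathbb E\,\#\{k:P_k>0\}>1$. Let $\mathbb V=\bigcup_{n\ge0}\mathbb N^n$ be the set of finite words (root $\varnothing$; $|u|$ is the length of $u$; $uk$ is the word $u$ followed by $k$), and let $((P_k(u))_{k\in\mathbb N})_{u\in\mathbb V}$ be independent copies of $(P_k)_{k\in\mathbb N}$. Set $P(\varnothing)=1$ and $P(uk)=P(u)P_k(u)$. For $|u|=j$ let $I_u=[\sum_{|v|=j,\,v\prec u}P(v),\ \sum_{|v|=j,\,v\preceq u}P(v))$, where $\prec$ is the lexicographic order on $\mathbb N^j$. Let $U_1,U_2,\dots$ be i.i.d. uniform on $[0,1]$, independent of the weights (ball $i$ falls into every box $u$ with $U_i\in I_u$). For $j,n,k\in\mathbb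 N$ let $K_n^{(j)}(k)=\#\{u:|u|=j,\ \#\{i\le n:U_i\in I_u\}\ge k\}$ (number of level-$j$ boxes containing at least $k$ of the first $n$ balls), and $K_n^{(j)}=K_n^{(j)}(1)$. Branching random walk: $V(u)=-\log P(u)$ ($V(u)=\infty$ if $P(u)=0$; sums over $|u|=j$ ignore such $u$). Nonlattice assumption: for all $a>0$, $b\in\mathbb R$, $\mathbb P(V(u)\in a\mathbb Z+b\text{ for all }|u|=1)<1$. Let $\lambda(\theta)=\log\mathbb E\sum_{|u|=1}e^{-\theta V(u)}\in(-\infty,\infty]$ and $\underline\theta=\inf\{\theta:\lambda(\theta)<\infty\}$ (so $\lambda(1)=0$, $\underline\theta\le 1$, and $\lambda$ is strictly convex and decreasing on its domain). It is assumed that there exists $\theta^*$ with $\theta^*\lambda'(\theta^* )-\lambda(\theta^* )=0$ (then $\theta^*>1$). For $\theta>\underline\theta$ let $W_j(\theta)=\sum_{|u|=j}e^{-\theta V(u)-\lambda(\theta)j}$ and $W(\theta)=\lim_{j\to\infty}W_j(\theta)$ a.s. (limit of a nonnegative martingale). *)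

theory Defs
  imports "HOL-Probability.Probability"
begin

text \<open>A realisation of the weights: Q u k = P_k(u) for a word u (a list; root = []).
  Children are labelled by nat (starting at 0).\<close>

definition Pprod :: "(nat list \<Rightarrow> nat \<Rightarrow> real) \<Rightarrow> nat list \<Rightarrow> real" where
  "Pprod Q u = (\<Prod>i<length u. Q (take i u) (u ! i))"

definition lexlt :: "nat list \<Rightarrow> nat list \<Rightarrow> bool" where
  "lexlt v u \<longleftrightarrow> (v, u) \<in> lexord {(x, y). x < y}"

definition box_left :: "(nat list \<Rightarrow> nat \<Rightarrow> real) \<Rightarrow> nat list \<Rightarrow> real" where
  "box_left Q u = (\<Sum>\<^sub>\<infinity> v \<in> {v. length v = length u \<and> lexlt v u}. Pprod Q v)"

definition box :: "(nat list \<Rightarrow> nat \<Rightarrow> real) \<Rightarrow> nat list \<Rightarrow> real set" where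
  "box Q u = {box_left Q u ..< box_left Q u + Pprod Q u}"

definition Kcount :: "(nat list \<Rightarrow> nat \<Rightarrow> real) \<Rightarrow> (nat \<Rightarrow> real) \<Rightarrow> nat \<Rightarrow> nat \<Rightarrow> nat \<Rightarrow> nat" where
  "Kcount Q U j n k = card {u. length u = j \<and> card {i \<in> {1..n}. U i \<in> box Q u} \<ge> k}"

definition Kocc :: "(nat list \<Rightarrow> nat \<Rightarrow> real) \<Rightarrow> (nat \<Rightarrow> real) \<Rightarrow> nat \<Rightarrow> nat \<Rightarrow> nat" where
  "Kocc Q U j n = Kcount Q U j n 1"

text \<open>E sum_{|u|=1} e^{-theta V(u)} = E sum_k P_k^theta (terms with P_k = 0 ignored;
  note 0 powr theta = 0 in Isabelle).\<close>
definition mgf :: "'a measure \<Rightarrow> ('a \<Rightarrow> nat \<Rightarrow> real) \<Rightarrow> real \<Rightarrow> ennreal" where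
  "mgf M X \<theta> = (\<integral>\<^sup>+ \<omega>. (\<Sum>k. ennreal (X \<omega> k powr \<theta>)) \<partial>M)"

definition lam :: "'a measure \<Rightarrow> ('a \<Rightarrow> nat \<Rightarrow> real) \<Rightarrow> real \<Rightarrow> real" where
  "lam M X \<theta> = ln (enn2real (mgf M X \<theta>))"

definition theta_low :: "'a measure \<Rightarrow> ('a \<Rightarrow> nat \<Rightarrow> real) \<Rightarrow> ereal" where
  "theta_low M X = Inf {ereal \<theta> | \<theta>. mgf M X \<theta> < \<infinity>}"

text \<open>Additive martingale W_j(theta); lam_val is lambda(theta).\<close>
definition Wj :: "(nat list \<Rightarrow> nat \<Rightarrow> real) \<Rightarrow> real \<Rightarrow> real \<Rightarrow> nat \<Rightarrow> real" where
  "Wj Q lam_val \<theta> j = (\<Sum>\<^sub>\<infinity> u \<in> {u. length u = j}. Pprod Q u powr \<theta>) * exp (- lam_val * real j)"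

definition Wlim :: "(nat list \<Rightarrow> nat \<Rightarrow> real) \<Rightarrow> real \<Rightarrow> real \<Rightarrow> real" where
  "Wlim Q lam_val \<theta> = lim (\<lambda>j. Wj Q lam_val \<theta> j)"

end

theory Submission
  imports Defs "HOL-Real_Asymp.Real_Asymp"
begin

text \<open>
  Conditionally on the weights, the number of occupied boxes on level \<open>j\<close> is concentrated around
  \<open>\<Sum>\<^sub>|\<^sub>u\<^sub>|\<^sub>=\<^sub>j (1 - exp (- n P(u)))\<close>, because the occupation indicators of different boxes are negatively correlated.
  That sum equals \<open>n\<^sup>\<theta> e\<^bsup>\<lambda>(\<theta>)j\<^esup> \<Sum>\<^sub>|\<^sub>u\<^sub>|\<^sub>=\<^sub>j e\<^bsup>-\<theta>V(u)-\<lambda>(\<theta>)j\<^esup> h(V(u) - log n)\<close>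
  with \<open>h y = e\<^bsup>\<theta>y\<^esup> (1 - exp (- e\<^bsup>-y\<^esup>))\<close>, whose integral is \<open>\<Gamma>(1-\<theta>)/\<theta>\<close>.
  Conditioning on the first \<open>i\<close> generations, with \<open>i\<close> of order \<open>log j\<close>, replaces the tail of the tree by the
  expectation of \<open>h\<close> under a random walk with the tilted step law; the error is exponentially small in \<open>i\<close>, by
  moments of order greater than 1. A local limit theorem for this walk, proved
  with Fejer kernels, gives the Gaussian factor, and the first \<open>i\<close> generations contribute \<open>W(\<theta>)\<close>, which is positive by
  a zero-one argument. All estimates are summable along the grid of ball numbers \<open>\<lceil>e\<^bsup>i/m\<^esup>\<rceil>\<close>, and monotonicity of the
  number of occupied boxes in \<open>n\<close> fills the gaps as \<open>m \<rightarrow> \<infinity>\<close>.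
\<close>

section \<open>Sums of independent random variables\<close>

text \<open>The obstacle is the rate of convergence. A level j is shared by exponentially many ball
  numbers n, because j_n is close to (log n)/a, while the error of the conditioning argument is r^i
  with i of order log j, hence only a negative power of j; it cannot be summed over n. Every almost
  sure statement therefore bounds, for each level j, the sum of all errors over the O(j) grid points
  that this level can meet, and this is summable in j. The same balance fixes the depth i: r^i has
  to beat the number of grid points, and i has to be o(sqrt j), so that the first i generations do
  not move the Gaussian factor. What remains along a given sequence j_n is deterministic for each
  realisation in one event of probability 1.

  Moments of order greater than 1 exist because \<theta> is interior to the domain of \<lambda> and
  the weights of siblings sum to 1: Jensen's inequality bounds a moment of the sum of P_k^\<theta>
  by a sum of powers of P_k with an exponent slightly below \<theta>. Positivity of W(\<theta>)
  turns a limit of the normalised count into a statement with relative error o(1).\<close>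

lemma AE_summable_of_summable_nn_integral:
  fixes f :: "nat \<Rightarrow> 'a \<Rightarrow> real"
  assumes [measurable]: "\<And>n. f n \<in> borel_measurable M"
    and nonneg: "\<And>n x. 0 \<le> f n x"
    and bound: "\<And>n. (\<integral>\<^sup>+x. ennreal (f n x) \<partial>M) \<le> ennreal (c n)"
    and c: "summable c" "\<And>n. 0 \<le> c n"
  shows "AE x in M. summable (\<lambda>n. f n x)"
proof -
  have "(\<integral>\<^sup>+x. (\<Sum>n. ennreal (f n x)) \<partial>M) = (\<Sum>n. \<integral>\<^sup>+x. ennreal (f n x) \<partial>M)"
    by (rule nn_integral_suminf) simp
  also have "\<dots> \<le> (\<Sum>n. ennreal (c n))"
    by (intro suminf_le bound summableI)
  also have "\<dots> = ennreal (\<Sum>n. c n)"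
    by (rule suminf_ennreal2[OF c(2) c(1)])
  also have "\<dots> < \<infinity>" by simp
  finally have "AE x in M. (\<Sum>n. ennreal (f n x)) \<noteq> \<infinity>"
    by (intro nn_integral_noteq_infinite) (auto)
  then show ?thesis
    by eventually_elim (auto intro: summable_suminf_not_top[OF nonneg])
qed

lemma borel_measurable_nn_integral_count_space:
  fixes X :: "'i \<Rightarrow> 'a \<Rightarrow> ennreal"
  assumes "countable I" and [measurable]: "\<And>i. i \<in> I \<Longrightarrow> X i \<in> borel_measurable M"
  shows "(\<lambda>x. \<integral>\<^sup>+i. X i x \<partial>count_space I) \<in> borel_measurable M"
proof cases
  assume "finite I" then show ?thesis by (simp add: nn_integral_count_space_finite)
next
  assume "infinite I"
  then have [simp]: "I \<noteq> {}" by auto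
  note * = bij_betw_from_nat_into[OF \<open>countable I\<close> \<open>infinite I\<close>]
  have **: "\<And>f. (\<integral>\<^sup>+i. f i \<partial>count_space I) = (\<Sum>n. f (from_nat_into I n) :: ennreal)"
    by (simp add: nn_integral_bij_count_space[symmetric, OF *] nn_integral_count_space_nat)
  show ?thesis
    unfolding ** by (intro borel_measurable_suminf_order assms) (auto simp: from_nat_into)
qed

text \<open>Nonpositive correlation is enough, since the covariances enter only through an upper
  bound. This covers both uses: the truncated independent summands below, and the occupation
  indicators of boxes, which are dependent. The right-hand side may be infinite.\<close>

lemma (in prob_space) second_moment_sum_le:
  fixes X :: "'i \<Rightarrow> 'a \<Rightarrow> ennreal"
  assumes I: "countable I" and [measurable]: "\<And>i. i \<in> I \<Longrightarrow> X i \<in> borel_measurable M"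
    and neg: "\<And>i j. i \<in> I \<Longrightarrow> j \<in> I \<Longrightarrow> i \<noteq> j \<Longrightarrow>
      (\<integral>\<^sup>+x. X i x * X j x \<partial>M) \<le> (\<integral>\<^sup>+x. X i x \<partial>M) * (\<integral>\<^sup>+x. X j x \<partial>M)"
    and fin: "(\<integral>\<^sup>+i. \<integral>\<^sup>+x. X i x \<partial>M \<partial>count_space I) < \<infinity>"
  shows "(\<integral>\<^sup>+x. ennreal ((enn2real (\<integral>\<^sup>+i. X i x \<partial>count_space I)
           - enn2real (\<integral>\<^sup>+i. \<integral>\<^sup>+x. X i x \<partial>M \<partial>count_space I))\<^sup>2) \<partial>M)
      \<le> (\<integral>\<^sup>+i. \<integral>\<^sup>+x. (X i x)\<^sup>2 \<partial>M \<partial>count_space I)"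
proof -
  define S where "S x = (\<integral>\<^sup>+i. X i x \<partial>count_space I)" for x
  define m where "m = (\<integral>\<^sup>+i. \<integral>\<^sup>+x. X i x \<partial>M \<partial>count_space I)"
  define V where "V = (\<integral>\<^sup>+i. \<integral>\<^sup>+x. (X i x)\<^sup>2 \<partial>M \<partial>count_space I)"
  have [measurable]: "S \<in> borel_measurable M"
    unfolding S_def by (intro borel_measurable_nn_integral_count_space I) auto
  have ES: "(\<integral>\<^sup>+x. S x \<partial>M) = m"
    unfolding S_def m_def by (rule nn_integral_count_space_nn_integral[OF I]) auto
  have mfin: "m < \<infinity>" using fin by (simp add: m_def)
  have Sfin: "AE x in M. S x \<noteq> \<infinity>"
    using ES mfin by (intro nn_integral_noteq_infinite) auto
  have "(\<integral>\<^sup>+x. (S x)\<^sup>2 \<partial>M) = (\<integral>\<^sup>+x. \<integral>\<^sup>+i. X i x * S x \<partial>count_space I \<partial>M)"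
    by (intro nn_integral_cong) (simp add: power2_eq_square nn_integral_multc S_def)
  also have "\<dots> = (\<integral>\<^sup>+i. \<integral>\<^sup>+x. X i x * S x \<partial>M \<partial>count_space I)"
    by (rule nn_integral_count_space_nn_integral[OF I]) auto
  also have "\<dots> = (\<integral>\<^sup>+i. \<integral>\<^sup>+j. \<integral>\<^sup>+x. X i x * X j x \<partial>M \<partial>count_space I \<partial>count_space I)"
  proof (intro nn_integral_cong)
    fix i assume "i \<in> space (count_space I)"
    then have i[measurable]: "X i \<in> borel_measurable M" by simp
    have "(\<integral>\<^sup>+x. X i x * S x \<partial>M) = (\<integral>\<^sup>+x. \<integral>\<^sup>+j. X i x * X j x \<partial>count_space I \<partial>M)"
      by (intro nn_integral_cong) (simp add: nn_integral_cmult S_def)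
    also have "\<dots> = (\<integral>\<^sup>+j. \<integral>\<^sup>+x. X i x * X j x \<partial>M \<partial>count_space I)"
      by (rule nn_integral_count_space_nn_integral[OF I]) auto
    finally show "(\<integral>\<^sup>+x. X i x * S x \<partial>M) = \<dots>" .
  qed
  \<comment> \<open>On the diagonal the product of the means is kept and the second moment is added
    to it; this wastes a little, but lets the double sum collapse to
    \<open>m * m + V\<close>.\<close>
  also have "\<dots> \<le> (\<integral>\<^sup>+i. \<integral>\<^sup>+j. (\<integral>\<^sup>+x. X i x \<partial>M) * (\<integral>\<^sup>+x. X j x \<partial>M)
       + (\<integral>\<^sup>+x. (X i x)\<^sup>2 \<partial>M) * indicator {i} j \<partial>count_space I \<partial>count_space I)"
  proof (intro nn_integral_mono)
    fix i j assume "i \<in> space (count_space I)" "j \<in> space (count_space I)"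
    then show "(\<integral>\<^sup>+x. X i x * X j x \<partial>M) \<le> (\<integral>\<^sup>+x. X i x \<partial>M) * (\<integral>\<^sup>+x. X j x \<partial>M)
       + (\<integral>\<^sup>+x. (X i x)\<^sup>2 \<partial>M) * indicator {i} j"
      using neg[of i j] by (cases "i = j") (auto simp: power2_eq_square)
  qed
  also have "\<dots> = (\<integral>\<^sup>+i. (\<integral>\<^sup>+x. X i x \<partial>M) * m + (\<integral>\<^sup>+x. (X i x)\<^sup>2 \<partial>M) \<partial>count_space I)"
  proof (intro nn_integral_cong)
    fix i assume i: "i \<in> space (count_space I)"
    show "(\<integral>\<^sup>+j. (\<integral>\<^sup>+x. X i x \<partial>M) * (\<integral>\<^sup>+x. X j x \<partial>M)
       + (\<integral>\<^sup>+x. (X i x)\<^sup>2 \<partial>M) * indicator {i} j \<partial>count_space I)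
       = (\<integral>\<^sup>+x. X i x \<partial>M) * m + (\<integral>\<^sup>+x. (X i x)\<^sup>2 \<partial>M)"
      using i by (simp add: nn_integral_add nn_integral_cmult m_def)
  qed
  also have "\<dots> = m * m + V"
    by (simp add: nn_integral_add nn_integral_multc m_def V_def)
  finally have ES2: "(\<integral>\<^sup>+x. (S x)\<^sup>2 \<partial>M) \<le> m * m + V" .
  define D where "D x = ennreal ((enn2real (S x) - enn2real m)\<^sup>2)" for x
  have [measurable]: "D \<in> borel_measurable M" by (simp add: D_def[abs_def])
  \<comment> \<open>The expansion of the square is written with sums only, because subtraction
    truncates in \<open>ennreal\<close>. The term \<open>2 * m * m\<close> is cancelled at the very
    end, where finiteness of \<open>m\<close> is used.\<close>
  have "AE x in M. D x + 2 * m * S x = (S x)\<^sup>2 + m * m"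
    using Sfin
  proof eventually_elim
    case (elim x)
    then obtain s where s: "S x = ennreal s" "s \<ge> 0" by (cases "S x") auto
    obtain r where r: "m = ennreal r" "r \<ge> 0" using mfin by (cases m) auto
    have "D x + 2 * m * S x = ennreal ((s - r)\<^sup>2) + ennreal (2 * r * s)"
      using s r by (simp add: D_def ennreal_mult ennreal_numeral)
    also have "\<dots> = ennreal ((s - r)\<^sup>2 + 2 * r * s)"
      using s r by (simp add: ennreal_plus)
    also have "(s - r)\<^sup>2 + 2 * r * s = s\<^sup>2 + r * r" by (simp add: power2_eq_square algebra_simps)
    also have "ennreal \<dots> = (S x)\<^sup>2 + m * m"
      using s r by (simp add: ennreal_plus ennreal_mult ennreal_power)
    finally show ?case .
  qed
  then have "(\<integral>\<^sup>+x. D x + 2 * m * S x \<partial>M) = (\<integral>\<^sup>+x. (S x)\<^sup>2 + m * m \<partial>M)"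
    by (rule nn_integral_cong_AE)
  then have "(\<integral>\<^sup>+x. D x \<partial>M) + 2 * m * m = (\<integral>\<^sup>+x. (S x)\<^sup>2 \<partial>M) + m * m"
    by (simp add: nn_integral_add nn_integral_cmult ES emeasure_space_1)
  also have "\<dots> \<le> (m * m + V) + m * m"
    by (rule add_right_mono[OF ES2])
  also have "\<dots> = V + 2 * m * m"
    by (simp add: mult_2 distrib_right add.assoc add.left_commute add.commute)
  finally have "(\<integral>\<^sup>+x. D x \<partial>M) \<le> V"
    using mfin by (simp add: ennreal_mult_eq_top_iff ennreal_mult_less_top) (auto simp: top.not_eq_extremum)
  then show ?thesis by (simp add: D_def S_def m_def V_def)
qed

text \<open>The arithmetic-geometric mean inequality with a free parameter. It passes from second to
  first moments without square roots of integrals; the parameter is later a power of the contraction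
  rate.\<close>

lemma abs_le_square_div:
  fixes y \<epsilon> :: real assumes "\<epsilon> > 0"
  shows "\<bar>y\<bar> \<le> (\<epsilon> + y\<^sup>2 / \<epsilon>) / 2"
proof -
  have "0 \<le> (\<bar>y\<bar> - \<epsilon>)\<^sup>2" by simp
  then have "2 * \<epsilon> * \<bar>y\<bar> \<le> \<epsilon>\<^sup>2 + y\<^sup>2" by (simp add: power2_eq_square algebra_simps abs_mult_self_eq)
  then show ?thesis using assms by (simp add: field_simps power2_eq_square)
qed

text \<open>Truncating at 1 replaces the von Bahr--Esseen inequality: the small part is
  controlled in \<open>L\<^sup>2\<close>, the large part in \<open>L\<^sup>1\<close>, both by the \<open>p\<close>-th moments.\<close>

lemma (in prob_space) L1_deviation_sum_le:
  fixes X :: "'i \<Rightarrow> 'a \<Rightarrow> real"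
  assumes I: "countable I" and ind: "indep_vars (\<lambda>_. borel) X I"
    and nonneg: "\<And>i x. 0 \<le> X i x"
    and p: "1 \<le> p" "p \<le> 2" and \<epsilon>: "\<epsilon> > 0"
    and fin: "(\<integral>\<^sup>+i. \<integral>\<^sup>+x. ennreal (X i x) \<partial>M \<partial>count_space I) < \<infinity>"
  shows "(\<integral>\<^sup>+x. ennreal \<bar>enn2real (\<integral>\<^sup>+i. ennreal (X i x) \<partial>count_space I)
           - enn2real (\<integral>\<^sup>+i. \<integral>\<^sup>+x. ennreal (X i x) \<partial>M \<partial>count_space I)\<bar> \<partial>M)
      \<le> ennreal (\<epsilon> / 2) + ennreal (1 / (2 * \<epsilon>) + 2)
          * (\<integral>\<^sup>+i. \<integral>\<^sup>+x. ennreal (X i x powr p) \<partial>M \<partial>count_space I)"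
proof -
  have [measurable]: "\<And>i. i \<in> I \<Longrightarrow> X i \<in> borel_measurable M"
    using ind by (simp add: indep_vars_def)
  define Y where "Y i x = (if X i x \<le> 1 then ennreal (X i x) else 0)" for i x
  define Z where "Z i x = (if X i x \<le> 1 then 0 else ennreal (X i x))" for i x
  have [measurable]: "\<And>i. i \<in> I \<Longrightarrow> Y i \<in> borel_measurable M" "\<And>i. i \<in> I \<Longrightarrow> Z i \<in> borel_measurable M"
    by (auto simp: Y_def[abs_def] Z_def[abs_def])
  define \<alpha> where "\<alpha> = (\<integral>\<^sup>+i. \<integral>\<^sup>+x. ennreal (X i x powr p) \<partial>M \<partial>count_space I)"
  define SY where "SY x = (\<integral>\<^sup>+i. Y i x \<partial>count_space I)" for x
  define SZ where "SZ x = (\<integral>\<^sup>+i. Z i x \<partial>count_space I)" for x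
  define SX where "SX x = (\<integral>\<^sup>+i. ennreal (X i x) \<partial>count_space I)" for x
  define mX where "mX = (\<integral>\<^sup>+i. \<integral>\<^sup>+x. ennreal (X i x) \<partial>M \<partial>count_space I)"
  define mY where "mY = (\<integral>\<^sup>+i. \<integral>\<^sup>+x. Y i x \<partial>M \<partial>count_space I)"
  define mZ where "mZ = (\<integral>\<^sup>+i. \<integral>\<^sup>+x. Z i x \<partial>M \<partial>count_space I)"
  have [measurable]: "SY \<in> borel_measurable M" "SZ \<in> borel_measurable M" "SX \<in> borel_measurable M"
    unfolding SY_def[abs_def] SZ_def[abs_def] SX_def[abs_def]
    by (intro borel_measurable_nn_integral_count_space I; simp)+
  have XYZ: "ennreal (X i x) = Y i x + Z i x" for i x by (simp add: Y_def Z_def)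
  have SXYZ: "SX x = SY x + SZ x" for x
    unfolding SX_def SY_def SZ_def XYZ by (rule nn_integral_add) auto
  have mXYZ: "mX = mY + mZ"
    unfolding mX_def mY_def mZ_def XYZ
    by (subst nn_integral_add[symmetric]) (auto intro!: nn_integral_cong nn_integral_add)
  have fins: "mX < \<infinity>" "mY < \<infinity>" "mZ < \<infinity>"
    using fin mXYZ by (auto simp: mX_def[symmetric] top.not_eq_extremum)
  have ESX: "(\<integral>\<^sup>+x. SX x \<partial>M) = mX"
    unfolding SX_def mX_def by (rule nn_integral_count_space_nn_integral[OF I]) auto
  have ESZ: "(\<integral>\<^sup>+x. SZ x \<partial>M) = mZ"
    unfolding SZ_def mZ_def by (rule nn_integral_count_space_nn_integral[OF I]) auto
  \<comment> \<open>Above 1 the first power is below the p-th power, which uses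
    \<open>1 \<le> p\<close>; below 1 the square is, which uses \<open>p \<le> 2\<close> in
    \<open>Yle\<close>.\<close>
  have Zle: "Z i x \<le> ennreal (X i x powr p)" for i x
  proof (cases "X i x \<le> 1")
    case False
    then have "X i x powr 1 \<le> X i x powr p" using p by (intro powr_mono) auto
    then show ?thesis using False by (auto simp: Z_def intro!: ennreal_leI)
  qed (simp add: Z_def)
  have Yle: "(Y i x)\<^sup>2 \<le> ennreal (X i x powr p)" for i x
  proof (cases "X i x \<le> 1 \<and> X i x \<noteq> 0")
    case True
    then have "X i x powr 2 \<le> X i x powr p"
      using p nonneg[of i x] by (intro powr_mono') auto
    then show ?thesis
      using True nonneg[of i x]
      by (auto simp: Y_def ennreal_power powr_numeral intro!: ennreal_leI)
  qed (auto simp: Y_def)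
  have mZle: "mZ \<le> \<alpha>"
    unfolding mZ_def \<alpha>_def by (intro nn_integral_mono Zle)
  have indY: "(\<integral>\<^sup>+x. Y i x * Y j x \<partial>M) \<le> (\<integral>\<^sup>+x. Y i x \<partial>M) * (\<integral>\<^sup>+x. Y j x \<partial>M)"
    if ij: "i \<in> I" "j \<in> I" "i \<noteq> j" for i j
  proof -
    have *: "indep_vars (\<lambda>_. borel) Y {i, j}"
      unfolding Y_def[abs_def]
      by (rule indep_vars_compose2[OF indep_vars_subset[OF ind], where Y="\<lambda>_ y. if y \<le> 1 then ennreal y else 0"])
        (use ij in auto)
    have "(\<integral>\<^sup>+x. (\<Prod>k\<in>{i, j}. Y k x) \<partial>M) = (\<Prod>k\<in>{i, j}. \<integral>\<^sup>+x. Y k x \<partial>M)"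
      by (rule indep_vars_nn_integral[OF _ *]) auto
    then show ?thesis using ij by simp
  qed
  have V: "(\<integral>\<^sup>+x. ennreal ((enn2real (SY x) - enn2real mY)\<^sup>2) \<partial>M) \<le> \<alpha>"
  proof -
    have "(\<integral>\<^sup>+x. ennreal ((enn2real (SY x) - enn2real mY)\<^sup>2) \<partial>M)
       \<le> (\<integral>\<^sup>+i. \<integral>\<^sup>+x. (Y i x)\<^sup>2 \<partial>M \<partial>count_space I)"
      unfolding SY_def mY_def
      by (rule second_moment_sum_le[OF I]) (use fins in \<open>auto simp: mY_def intro: indY\<close>)
    also have "\<dots> \<le> \<alpha>"
      unfolding \<alpha>_def by (intro nn_integral_mono Yle)
    finally show ?thesis .
  qed
  have SXfin: "AE x in M. SX x \<noteq> \<infinity>"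
    using ESX fins by (intro nn_integral_noteq_infinite) auto
  \<comment> \<open>The constants of the claim arise here: 1/(2\<epsilon>) from the truncated part
    through \<open>abs_le_square_div\<close>, and 2 because the large part is estimated by itself
    plus its mean.\<close>
  have "AE x in M. ennreal \<bar>enn2real (SX x) - enn2real mX\<bar> \<le>
     ennreal (\<epsilon> / 2) + ennreal (1 / (2 * \<epsilon>)) * ennreal ((enn2real (SY x) - enn2real mY)\<^sup>2) + SZ x + mZ"
    using SXfin
  proof eventually_elim
    case (elim x)
    have "SY x \<noteq> \<infinity>" "SZ x \<noteq> \<infinity>" using elim by (auto simp: SXYZ)
    then obtain s z where sz: "SY x = ennreal s" "SZ x = ennreal z" "s \<ge> 0" "z \<ge> 0"
      by (cases "SY x"; cases "SZ x") auto
    obtain s' z' where sz': "mY = ennreal s'" "mZ = ennreal z'" "s' \<ge> 0" "z' \<ge> 0"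
      using fins by (cases mY; cases mZ) auto
    have X: "SX x = ennreal (s + z)" "mX = ennreal (s' + z')"
      using sz sz' by (simp_all add: SXYZ mXYZ)
    have "\<bar>(s + z) - (s' + z')\<bar> \<le> \<bar>s - s'\<bar> + z + z'" using sz sz' by simp
    also have "\<dots> \<le> (\<epsilon> + (s - s')\<^sup>2 / \<epsilon>) / 2 + z + z'"
      using abs_le_square_div[OF \<epsilon>, of "s - s'"] by simp
    also have "\<dots> = \<epsilon> / 2 + 1 / (2 * \<epsilon>) * (s - s')\<^sup>2 + z + z'" by (simp add: field_simps)
    finally have "ennreal \<bar>(s + z) - (s' + z')\<bar> \<le> ennreal (\<epsilon> / 2 + 1 / (2 * \<epsilon>) * (s - s')\<^sup>2 + z + z')"
      by (rule ennreal_leI)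
    also have "\<dots> = ennreal (\<epsilon> / 2) + ennreal (1 / (2 * \<epsilon>)) * ennreal ((s - s')\<^sup>2) + ennreal z + ennreal z'"
      using \<epsilon> sz sz' by (simp flip: ennreal_plus ennreal_mult)
    finally show ?case using sz sz' by (simp add: X del: ennreal_plus)
  qed
  then have "(\<integral>\<^sup>+x. ennreal \<bar>enn2real (SX x) - enn2real mX\<bar> \<partial>M) \<le>
     (\<integral>\<^sup>+x. ennreal (\<epsilon> / 2) + ennreal (1 / (2 * \<epsilon>)) * ennreal ((enn2real (SY x) - enn2real mY)\<^sup>2) + SZ x + mZ \<partial>M)"
    by (rule nn_integral_mono_AE)
  also have "\<dots> = ennreal (\<epsilon> / 2) + ennreal (1 / (2 * \<epsilon>)) * (\<integral>\<^sup>+x. ennreal ((enn2real (SY x) - enn2real mY)\<^sup>2) \<partial>M) + mZ + mZ"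
    by (simp add: nn_integral_add nn_integral_cmult ESZ emeasure_space_1)
  also have "\<dots> \<le> ennreal (\<epsilon> / 2) + ennreal (1 / (2 * \<epsilon>)) * \<alpha> + \<alpha> + \<alpha>"
    by (intro add_mono mult_left_mono V mZle) auto
  also have "\<dots> = ennreal (\<epsilon> / 2) + ennreal (1 / (2 * \<epsilon>) + 2) * \<alpha>"
    using \<epsilon> by (simp add: distrib_right add.assoc flip: mult_2)
  finally show ?thesis by (simp add: SX_def mX_def \<alpha>_def)
qed

section \<open>The Fejer kernel\<close>

text \<open>A probability law in one variable and a majorant in the other variable alone give
  integrability on the product. The majorants used are \<open>tri T\<close> for Fourier inversion
  and a multiple of |h| for the smoothed test function.\<close>

lemma Fubini_dominated:
  fixes f :: "real \<times> real \<Rightarrow> real"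
  assumes "prob_space \<nu>" and [measurable_cong]: "sets \<nu> = sets borel"
    and [measurable]: "f \<in> borel_measurable (borel \<Otimes>\<^sub>M borel)"
    and g: "integrable lborel g" and le: "\<And>s t. \<bar>f (s, t)\<bar> \<le> g t"
  shows "(\<integral>s. (\<integral>t. f (s, t) \<partial>lborel) \<partial>\<nu>) = (\<integral>t. (\<integral>s. f (s, t) \<partial>\<nu>) \<partial>lborel)"
    and "integrable \<nu> (\<lambda>s. \<integral>t. f (s, t) \<partial>lborel)"
    and "integrable lborel (\<lambda>t. \<integral>s. f (s, t) \<partial>\<nu>)"
proof -
  interpret \<nu>: prob_space \<nu> by fact
  interpret pair_sigma_finite \<nu> lborel by unfold_locales
  have int: "integrable lborel (\<lambda>t. f (s, t))" for s
    by (rule Bochner_Integration.integrable_bound[OF g]) (auto intro!: AE_I2 order_trans[OF le])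
  have "integrable \<nu> (\<lambda>s. \<integral>t. norm (f (s, t)) \<partial>lborel)"
  proof (rule \<nu>.integrable_const_bound[where B="\<integral>t. g t \<partial>lborel"])
    show "AE s in \<nu>. norm (\<integral>t. norm (f (s, t)) \<partial>lborel) \<le> (\<integral>t. g t \<partial>lborel)"
    proof (intro AE_I2)
      fix s
      have "(\<integral>t. norm (f (s, t)) \<partial>lborel) \<le> (\<integral>t. g t \<partial>lborel)"
        using int[of s] g le by (intro integral_mono) auto
      then show "norm (\<integral>t. norm (f (s, t)) \<partial>lborel) \<le> (\<integral>t. g t \<partial>lborel)" by simp
    qed
  qed measurable
  then have "integrable (\<nu> \<Otimes>\<^sub>M lborel) f"
    using int by (intro Fubini_integrable) auto
  then show "(\<integral>s. (\<integral>t. f (s, t) \<partial>lborel) \<partial>\<nu>) = (\<integral>t. (\<integral>s. f (s, t) \<partial>\<nu>) \<partial>lborel)"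
    "integrable \<nu> (\<lambda>s. \<integral>t. f (s, t) \<partial>lborel)" "integrable lborel (\<lambda>t. \<integral>s. f (s, t) \<partial>\<nu>)"
    using Fubini_integral[of "\<lambda>s t. f (s, t)"] integrable_fst[of "\<lambda>s t. f (s, t)"] integrable_snd[of "\<lambda>s t. f (s, t)"]
    by (simp_all add: split_beta')
qed

lemma integrable_cauchy: "integrable lborel (\<lambda>x::real. 1 / (1 + x\<^sup>2))"
  and integral_cauchy: "(\<integral>x. 1 / (1 + (x::real)\<^sup>2) \<partial>lborel) = pi"
  using integrable_inverse_1_plus_square LBINT_inverse_1_plus_square
  by (simp_all add: set_integrable_def interval_lebesgue_integral_def set_lebesgue_integral_def divide_inverse)

text \<open>The real part of the characteristic function of the standard normal law, rescaled. It
  normalises the Fejer kernel and later evaluates the limit in the local limit theorem.\<close>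

lemma gaussian_cos_integral:
  assumes c: "c > 0"
  shows "integrable lborel (\<lambda>x. cos (t * x) * exp (- (c\<^sup>2 * x\<^sup>2 / 2)))" (is ?I)
    and "(\<integral>x. cos (t * x) * exp (- (c\<^sup>2 * x\<^sup>2 / 2)) \<partial>lborel) = sqrt (2 * pi) / c * exp (- (t\<^sup>2 / (2 * c\<^sup>2)))" (is ?E)
proof -
  have int: "integrable lborel (\<lambda>x. std_normal_density x *\<^sub>R iexp (u * x))" for u
    by (rule Bochner_Integration.integrable_bound[OF integrable_normal_density[of 1 0]]) (auto simp: normal_density_nonneg)
  have "(CLINT x|lborel. std_normal_density x *\<^sub>R iexp (u * x)) = complex_of_real (exp (- u\<^sup>2 / 2))" for u
    using char_std_normal_distribution unfolding char_def fun_eq_iff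
    by (subst (asm) integral_density) (auto simp: normal_density_nonneg)
  then have E: "Re (CLINT x|lborel. std_normal_density x *\<^sub>R iexp (u * x)) = exp (- u\<^sup>2 / 2)" for u
    by simp
  have re: "Re (std_normal_density x *\<^sub>R iexp (u * x)) = std_normal_density x * cos (u * x)" for u x
    by (simp add: Re_exp)
  have 1: "(\<integral>x. std_normal_density x * cos (u * x) \<partial>lborel) = exp (- u\<^sup>2 / 2)" for u
    unfolding re[symmetric] integral_Re[OF int] E ..
  have 2: "integrable lborel (\<lambda>x. std_normal_density x * cos (u * x))" for u
    using integrable_Re[OF int[of u]] unfolding re .
  have h: "has_bochner_integral lborel (\<lambda>x. std_normal_density x * cos (u * x)) (exp (- u\<^sup>2 / 2))" for u
    using 1 2 by (simp add: has_bochner_integral_iff)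
  have "has_bochner_integral lborel (\<lambda>x. std_normal_density (0 + c * x) * cos (t / c * (0 + c * x))) (exp (- (t / c)\<^sup>2 / 2) /\<^sub>R \<bar>c\<bar>)"
    using h[of "t / c"] c by (subst (asm) lborel_has_bochner_integral_real_affine_iff[where c=c and t=0]) auto
  then have "has_bochner_integral lborel (\<lambda>x. sqrt (2 * pi) * (std_normal_density (0 + c * x) * cos (t / c * (0 + c * x))))
     (sqrt (2 * pi) * (exp (- (t / c)\<^sup>2 / 2) /\<^sub>R \<bar>c\<bar>))"
    by (rule has_bochner_integral_mult_right)
  moreover have "sqrt (2 * pi) * (std_normal_density (0 + c * x) * cos (t / c * (0 + c * x)))
      = cos (t * x) * exp (- (c\<^sup>2 * x\<^sup>2 / 2))" for x
    using c by (simp add: std_normal_density_def power_mult_distrib)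
  moreover have "sqrt (2 * pi) * (exp (- (t / c)\<^sup>2 / 2) /\<^sub>R \<bar>c\<bar>) = sqrt (2 * pi) / c * exp (- (t\<^sup>2 / (2 * c\<^sup>2)))"
    using c by (simp add: power_divide field_simps)
  ultimately have "has_bochner_integral lborel (\<lambda>x. cos (t * x) * exp (- (c\<^sup>2 * x\<^sup>2 / 2))) (sqrt (2 * pi) / c * exp (- (t\<^sup>2 / (2 * c\<^sup>2))))"
    by (simp only:)
  then show ?I ?E by (simp_all add: has_bochner_integral_iff)
qed

text \<open>The value at 0 is the continuous extension, and the normalisation gives total mass 1.
  The Fourier transform is \<open>tri T\<close>, which vanishes outside [-T, T], so that only the
  values of a characteristic function on a compact set will matter.\<close>

definition fejer :: "real \<Rightarrow> real \<Rightarrow> real" where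
  "fejer T x = (if x = 0 then T / (2 * pi) else (1 - cos (T * x)) / (pi * T * x\<^sup>2))"

definition tri :: "real \<Rightarrow> real \<Rightarrow> real" where
  "tri T t = max 0 (1 - \<bar>t\<bar> / T)"

lemma fejer_measurable [measurable]: "fejer T \<in> borel_measurable borel"
  unfolding fejer_def[abs_def] by measurable

lemma tri_measurable [measurable]: "tri T \<in> borel_measurable borel"
  unfolding tri_def[abs_def] by measurable

lemma fejer_nonneg: "T > 0 \<Longrightarrow> 0 \<le> fejer T x"
  by (simp add: fejer_def)

lemma one_minus_cos_le: "1 - cos x \<le> x\<^sup>2 / 2" for x :: real
proof -
  have "\<bar>sin (x/2)\<bar> \<le> \<bar>x/2\<bar>" by (rule abs_sin_x_le_abs_x)
  then have "(sin (x/2))\<^sup>2 \<le> (x/2)\<^sup>2" by (simp only: abs_le_square_iff)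
  moreover have "cos x = 1 - 2 * (sin (x/2))\<^sup>2" using cos_double_sin[of "x/2"] by simp
  ultimately show ?thesis by (simp add: power_divide)
qed

lemma fejer_mult_square: "T > 0 \<Longrightarrow> fejer T x * x\<^sup>2 = (1 - cos (T * x)) / (pi * T)"
  by (simp add: fejer_def field_simps)

lemma fejer_le_const: assumes "T > 0" shows "fejer T x \<le> T / (2 * pi)"
proof (cases "x = 0")
  case False
  have "(1 - cos (T * x)) / (pi * T * x\<^sup>2) \<le> ((T * x)\<^sup>2 / 2) / (pi * T * x\<^sup>2)"
    using assms by (intro divide_right_mono one_minus_cos_le) auto
  also have "\<dots> = T / (2 * pi)" using False assms by (simp add: power2_eq_square)
  finally show ?thesis using False by (simp add: fejer_def)
qed (simp add: fejer_def)

lemma fejer_le: assumes "T > 0" shows "fejer T x \<le> (T / (2 * pi) + 2 / (pi * T)) / (1 + x\<^sup>2)"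
proof -
  have "fejer T x * x\<^sup>2 \<le> 2 / (pi * T)"
    unfolding fejer_mult_square[OF assms]
    using assms cos_ge_minus_one[of "T * x"] by (intro divide_right_mono) auto
  then have "fejer T x * (1 + x\<^sup>2) \<le> T / (2 * pi) + 2 / (pi * T)"
    using fejer_le_const[OF assms, of x] by (simp add: algebra_simps)
  then show ?thesis by (simp add: pos_le_divide_eq add_pos_nonneg)
qed

lemma integrable_fejer: assumes "T > 0" shows "integrable lborel (fejer T)"
proof -
  have "0 \<le> T / (2 * pi) + 2 / (pi * T)" using assms by simp
  note C = this
  show ?thesis
    by (rule Bochner_Integration.integrable_bound[OF integrable_mult_right[OF integrable_cauchy, of "T / (2 * pi) + 2 / (pi * T)"]])
      (use C fejer_le[OF assms] fejer_nonneg[OF assms] in \<open>auto intro!: AE_I2\<close>)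
qed

text \<open>A single Fejer kernel has zeros and cannot dominate a Cauchy density. But 1 - cos x and
  1 - cos (x + pi) add up to 2, so two kernels shifted by pi do. This carries the uniform bound for
  Fejer kernels over to every function of quadratic decay.\<close>

lemma fejer_pair_lower: "1 / (1 + x\<^sup>2) \<le> pi^3 * (fejer 1 x + fejer 1 (x + pi))"
proof -
  have p: "pi\<^sup>2 \<ge> 1" using pi_gt3 by (intro one_le_power) auto
  have "x\<^sup>2 \<le> 2 * (pi\<^sup>2 * (1 + x\<^sup>2))"
    using mult_right_mono[OF p zero_le_power2[of x]] zero_le_power2[of x] p unfolding distrib_left by linarith
  then have 1: "fejer 1 x * (2 * pi\<^sup>2 * (1 + x\<^sup>2)) \<ge> fejer 1 x * x\<^sup>2"
    by (intro mult_left_mono fejer_nonneg) auto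
  have "(x + pi)\<^sup>2 \<le> 2 * (x\<^sup>2 + pi\<^sup>2)" using sum_squares_bound[of x pi] by (simp add: power2_sum)
  also have "\<dots> \<le> 2 * (pi\<^sup>2 * (1 + x\<^sup>2))"
    using mult_right_mono[OF p, of "x\<^sup>2"] by (simp add: algebra_simps)
  finally have 2: "fejer 1 (x + pi) * (2 * pi\<^sup>2 * (1 + x\<^sup>2)) \<ge> fejer 1 (x + pi) * (x + pi)\<^sup>2"
    by (intro mult_left_mono fejer_nonneg) auto
  have "fejer 1 x * x\<^sup>2 + fejer 1 (x + pi) * (x + pi)\<^sup>2 = 2 / pi"
    by (simp add: fejer_mult_square field_simps)
  then have "2 / pi \<le> (fejer 1 x + fejer 1 (x + pi)) * (2 * pi\<^sup>2 * (1 + x\<^sup>2))"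
    using 1 2 by (simp add: distrib_right)
  moreover have "1 + x\<^sup>2 > 0" by (simp add: add_pos_nonneg)
  ultimately show ?thesis
    by (simp add: field_simps power2_eq_square power3_eq_cube)
qed

lemma tri_nonneg: "0 \<le> tri T t" and tri_le_1: "T > 0 \<Longrightarrow> tri T t \<le> 1"
  and tri_eq_0: "T > 0 \<Longrightarrow> \<bar>t\<bar> > T \<Longrightarrow> tri T t = 0"
  by (auto simp: tri_def)

lemma tri_cos_integral:
  assumes T: "T > 0"
  shows "integrable lborel (\<lambda>t. tri T t * cos (t * x))" (is ?I)
    and "(\<integral>t. tri T t * cos (t * x) \<partial>lborel) = 2 * pi * fejer T x" (is ?E)
proof -
  have right: "has_bochner_integral lborel (\<lambda>t. ((1 - t / T) * cos (t * x)) * indicator {0..T} t) (pi * fejer T x)"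
  proof (cases "x = 0")
    case True
    have "has_bochner_integral lborel (\<lambda>t. (1 - t / T) * indicator {0..T} t) ((T - T\<^sup>2 / (2 * T)) - (0 - 0\<^sup>2 / (2 * T)))"
      by (rule has_bochner_integral_FTC_Icc_real)
         (use T in \<open>auto intro!: derivative_eq_intros continuous_intros\<close>)
    then show ?thesis using T True by (simp add: fejer_def power2_eq_square)
  next
    case False
    \<comment> \<open>The antiderivative found by integrating by parts once.\<close>
    define F where "F t = (1 - t / T) * (sin (t * x) / x) - cos (t * x) / (T * x\<^sup>2)" for t
    have "has_bochner_integral lborel (\<lambda>t. ((1 - t / T) * cos (t * x)) * indicator {0..T} t) (F T - F 0)"
      unfolding F_def
      by (rule has_bochner_integral_FTC_Icc_real)
         (use T False in \<open>auto intro!: derivative_eq_intros continuous_intros simp: field_simps power2_eq_square\<close>)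
    moreover have "F T - F 0 = pi * fejer T x"
      using T False by (simp add: F_def fejer_def field_simps)
    ultimately show ?thesis by simp
  qed
  then have left: "has_bochner_integral lborel (\<lambda>t. ((1 - (0 + (-1) * t) / T) * cos ((0 + (-1) * t) * x)) * indicator {0..T} (0 + (-1) * t)) (pi * fejer T x)"
    by (subst (asm) lborel_has_bochner_integral_real_affine_iff[where c="-1" and t=0]) auto
  have "has_bochner_integral lborel (\<lambda>t. ((1 - t / T) * cos (t * x)) * indicator {0..T} t + 
      ((1 - (0 + (-1) * t) / T) * cos ((0 + (-1) * t) * x)) * indicator {0..T} (0 + (-1) * t)) (pi * fejer T x + pi * fejer T x)"
    by (intro has_bochner_integral_add left right)
  \<comment> \<open>The point 0 is counted by both halves, hence equality only almost
    everywhere.\<close>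
  moreover have "AE t in lborel. ((1 - t / T) * cos (t * x)) * indicator {0..T} t + 
      ((1 - (0 + (-1) * t) / T) * cos ((0 + (-1) * t) * x)) * indicator {0..T} (0 + (-1) * t) = tri T t * cos (t * x)"
    using AE_lborel_singleton[of 0]
    by eventually_elim (use T in \<open>auto simp: tri_def indicator_def field_simps max_def\<close>)
  ultimately have "has_bochner_integral lborel (\<lambda>t. tri T t * cos (t * x)) (2 * pi * fejer T x)"
    by (subst (asm) has_bochner_integral_cong_AE) (auto simp: mult.assoc)
  then show ?I ?E by (simp_all add: has_bochner_integral_iff mult.assoc)
qed

lemma integrable_tri: "T > 0 \<Longrightarrow> integrable lborel (tri T)"
  using tri_cos_integral(1)[of T 0] by simp

text \<open>Fourier inversion at the origin with a Gaussian factor \<open>g n\<close> tending to 1: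
  Fubini moves the transform from the kernel to the Gaussian, and rescaling leaves
  \<open>tri T\<close> evaluated at s/(1 + n), which tends to \<open>tri T 0 = 1\<close>.\<close>

lemma integral_fejer:
  assumes T: "T > 0" shows "(\<integral>x. fejer T x \<partial>lborel) = 1"
proof -
  define g where "g n x = exp (- ((1 / (1 + real n))\<^sup>2 * x\<^sup>2 / 2))" for n x
  have [measurable]: "\<And>n. g n \<in> borel_measurable borel" by (simp add: g_def[abs_def])
  have lim1: "(\<lambda>n. \<integral>x. fejer T x * g n x \<partial>lborel) \<longlonglongrightarrow> (\<integral>x. fejer T x \<partial>lborel)"
  proof (rule integral_dominated_convergence[where w="fejer T"])
    show "AE x in lborel. (\<lambda>n. fejer T x * g n x) \<longlonglongrightarrow> fejer T x"
    proof (intro AE_I2)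
      fix x
      have "(\<lambda>n. g n x) \<longlonglongrightarrow> 1" unfolding g_def by real_asymp
      then show "(\<lambda>n. fejer T x * g n x) \<longlonglongrightarrow> fejer T x" by (auto intro!: tendsto_eq_intros)
    qed
    show "AE x in lborel. norm (fejer T x * g n x) \<le> fejer T x" for n
      using fejer_nonneg[OF T] by (auto simp: g_def abs_mult intro!: mult_left_le)
  qed (auto intro: integrable_fejer T)
  have eq: "(\<integral>x. fejer T x * g n x \<partial>lborel) = (\<integral>s. tri T (s / (1 + real n)) * exp (- (s\<^sup>2 / 2)) \<partial>lborel) / sqrt (2 * pi)" for n
  proof -
    define c where "c = 1 / (1 + real n)"
    have c: "c > 0" by (simp add: c_def)
    define Z where "Z = sqrt (2 * pi) / c"
    have Z: "Z > 0" using c by (simp add: Z_def)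
    have gi: "integrable lborel (g n)" "(\<integral>x. g n x \<partial>lborel) = Z"
      using gaussian_cos_integral[OF c, of 0] by (simp_all add: g_def[abs_def] c_def[symmetric] Z_def)
    \<comment> \<open>The Gaussian factor is normalised to a probability law so that
      \<open>Fubini_dominated\<close> applies.\<close>
    define \<nu> where "\<nu> = density lborel (\<lambda>x. ennreal (g n x / Z))"
    have gZ: "0 \<le> g n x / Z" for x using Z by (simp add: g_def)
    have \<nu>: "prob_space \<nu>"
    proof
      have "emeasure \<nu> (space \<nu>) = (\<integral>\<^sup>+x. ennreal (g n x / Z) \<partial>lborel)"
        by (simp add: \<nu>_def emeasure_density)
      also have "\<dots> = ennreal (\<integral>x. g n x / Z \<partial>lborel)"
        using gi gZ by (intro nn_integral_eq_integral) auto
      finally show "emeasure \<nu> (space \<nu>) = 1" using gi Z by simp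
    qed
    have \<nu>i: "(\<integral>x. f x \<partial>\<nu>) = (\<integral>x. f x * g n x \<partial>lborel) / Z" if [measurable]: "f \<in> borel_measurable borel" for f :: "real \<Rightarrow> real"
      unfolding \<nu>_def by (subst integral_density) (use gZ in \<open>auto simp: mult.commute\<close>)
    have le: "\<bar>tri T t * cos (t * x)\<bar> \<le> tri T t" for t x
      by (simp add: abs_mult tri_nonneg mult_left_le)
    have "(\<integral>x. fejer T x * g n x \<partial>lborel) / Z = (\<integral>x. fejer T x \<partial>\<nu>)" by (rule \<nu>i[symmetric]) simp
    also have "\<dots> = (\<integral>x. (\<integral>t. tri T t * cos (t * x) \<partial>lborel) / (2 * pi) \<partial>\<nu>)"
      by (simp add: tri_cos_integral[OF T])
    also have "\<dots> = (\<integral>x. (\<integral>t. tri T t * cos (t * x) \<partial>lborel) \<partial>\<nu>) / (2 * pi)"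
      by simp
    also have "(\<integral>x. (\<integral>t. tri T t * cos (t * x) \<partial>lborel) \<partial>\<nu>) = (\<integral>t. (\<integral>x. tri T t * cos (t * x) \<partial>\<nu>) \<partial>lborel)"
      using Fubini_dominated(1)[OF \<nu>, of "\<lambda>(x, t). tri T t * cos (t * x)" "tri T"] le integrable_tri[OF T]
      by (simp add: \<nu>_def)
    also have "\<dots> = (\<integral>t. tri T t * exp (- (t\<^sup>2 / (2 * c\<^sup>2))) \<partial>lborel)"
    proof (intro Bochner_Integration.integral_cong refl)
      fix t
      have "(\<integral>x. cos (t * x) \<partial>\<nu>) = exp (- (t\<^sup>2 / (2 * c\<^sup>2)))"
        using gaussian_cos_integral(2)[OF c, of t] c
        by (subst \<nu>i) (auto simp: Z_def g_def c_def[symmetric])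
      then show "(\<integral>x. tri T t * cos (t * x) \<partial>\<nu>) = tri T t * exp (- (t\<^sup>2 / (2 * c\<^sup>2)))" by simp
    qed
    also have "\<dots> = \<bar>c\<bar> *\<^sub>R (\<integral>s. tri T (0 + c * s) * exp (- ((0 + c * s)\<^sup>2 / (2 * c\<^sup>2))) \<partial>lborel)"
      by (rule lborel_integral_real_affine) (use c in auto)
    also have "\<dots> = c * (\<integral>s. tri T (s / (1 + real n)) * exp (- (s\<^sup>2 / 2)) \<partial>lborel)"
      using c by (simp add: power_divide c_def)
    finally have *: "(\<integral>x. fejer T x * g n x \<partial>lborel) / Z
        = c * (\<integral>s. tri T (s / (1 + real n)) * exp (- (s\<^sup>2 / 2)) \<partial>lborel) / (2 * pi)" .
    define r where "r = sqrt (2 * pi)"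
    have "r > 0" "2 * pi = r * r" by (simp_all add: r_def)
    moreover have "A / (r / c) = c * B / (2 * pi) \<Longrightarrow> A = B / r" for A B
      using calculation c by (simp add: field_simps)
    ultimately show ?thesis using * unfolding Z_def r_def[symmetric] by blast
  qed
  have lim2: "(\<lambda>n. \<integral>s. tri T (s / (1 + real n)) * exp (- (s\<^sup>2 / 2)) \<partial>lborel) \<longlonglongrightarrow> (\<integral>s. exp (- (s\<^sup>2 / 2)) \<partial>lborel)"
  proof (rule integral_dominated_convergence[where w="\<lambda>s. exp (- (s\<^sup>2 / 2))"])
    show "AE x in lborel. (\<lambda>n. tri T (x / (1 + real n)) * exp (- (x\<^sup>2 / 2))) \<longlonglongrightarrow> exp (- (x\<^sup>2 / 2))"
    proof (intro AE_I2)
      fix x :: real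
      have "(\<lambda>n. x / (1 + real n)) \<longlonglongrightarrow> 0" by real_asymp
      then have "(\<lambda>n. tri T (x / (1 + real n))) \<longlonglongrightarrow> max 0 (1 - \<bar>0\<bar> / T)"
        unfolding tri_def by (intro tendsto_max tendsto_const tendsto_diff tendsto_divide tendsto_rabs) (use T in auto)
      then have "(\<lambda>n. tri T (x / (1 + real n))) \<longlonglongrightarrow> 1" by simp
      then show "(\<lambda>n. tri T (x / (1 + real n)) * exp (- (x\<^sup>2 / 2))) \<longlonglongrightarrow> exp (- (x\<^sup>2 / 2))"
        by (auto intro!: tendsto_eq_intros)
    qed
  next
    fix n show "AE x in lborel. norm (tri T (x / (1 + real n)) * exp (- (x\<^sup>2 / 2))) \<le> exp (- (x\<^sup>2 / 2))"
      using tri_nonneg tri_le_1[OF T] by (auto simp: abs_mult intro!: mult_left_le_one_le)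
  qed (use gaussian_cos_integral(1)[of 1 0] in \<open>auto\<close>)
  have "(\<integral>s. exp (- ((s::real)\<^sup>2 / 2)) \<partial>lborel) = sqrt (2 * pi)"
    using gaussian_cos_integral(2)[of 1 0] by simp
  then have "(\<lambda>n. \<integral>x. fejer T x * g n x \<partial>lborel) \<longlonglongrightarrow> sqrt (2 * pi) / sqrt (2 * pi)"
    unfolding eq using lim2 by (intro tendsto_divide) auto
  with lim1 show ?thesis using LIMSEQ_unique by fastforce
qed

section \<open>Local limit theorem\<close>

text \<open>The law of the random walk as an iterated convolution, so that no probability space has
  to carry the steps. The new step is put first, which matches conditioning on the next
  generation.\<close>

primrec walk :: "real measure \<Rightarrow> nat \<Rightarrow> real measure" where
  "walk \<mu> 0 = return borel 0"
| "walk \<mu> (Suc m) = distr (\<mu> \<Otimes>\<^sub>M walk \<mu> m) borel (\<lambda>(x, y). x + y)"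

lemma real_distribution_walk:
  assumes "real_distribution \<mu>" shows "real_distribution (walk \<mu> m)"
proof (induction m)
  case 0
  show ?case by (auto simp: real_distribution_def real_distribution_axioms_def intro!: prob_space_return)
next
  case (Suc m)
  interpret \<mu>: real_distribution \<mu> by fact
  interpret w: real_distribution "walk \<mu> m" by fact
  interpret pair_prob_space \<mu> "walk \<mu> m" ..
  have "(\<lambda>(x, y). x + y) \<in> borel_measurable (\<mu> \<Otimes>\<^sub>M walk \<mu> m)"
    by measurable
  then show ?case
    by (auto simp: real_distribution_def real_distribution_axioms_def intro!: prob_space_distr)
qed

lemma nn_integral_walk_Suc:
  assumes "real_distribution \<mu>" and [measurable]: "f \<in> borel_measurable borel"
  shows "(\<integral>\<^sup>+s. f s \<partial>walk \<mu> (Suc m)) = (\<integral>\<^sup>+x. \<integral>\<^sup>+y. f (x + y) \<partial>walk \<mu> m \<partial>\<mu>)"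
proof -
  interpret \<mu>: real_distribution \<mu> by fact
  interpret w: real_distribution "walk \<mu> m" using assms(1) by (rule real_distribution_walk)
  have "(\<integral>\<^sup>+s. f s \<partial>walk \<mu> (Suc m)) = (\<integral>\<^sup>+p. f (fst p + snd p) \<partial>(\<mu> \<Otimes>\<^sub>M walk \<mu> m))"
    by (simp add: nn_integral_distr split_beta')
  also have "\<dots> = (\<integral>\<^sup>+x. \<integral>\<^sup>+y. f (x + y) \<partial>walk \<mu> m \<partial>\<mu>)"
    by (subst w.nn_integral_fst[symmetric]) auto
  finally show ?thesis .
qed

lemma char_walk:
  assumes "real_distribution \<mu>" shows "char (walk \<mu> m) t = char \<mu> t ^ m"
proof (induction m)
  case 0
  show ?case by (simp add: char_def integral_return)
next
  case (Suc m)
  interpret \<mu>: real_distribution \<mu> by fact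
  interpret w: real_distribution "walk \<mu> m" using assms by (rule real_distribution_walk)
  interpret pair_prob_space \<mu> "walk \<mu> m" ..
  have "char (walk \<mu> (Suc m)) t = (\<integral>p. iexp (t * (fst p + snd p)) \<partial>(\<mu> \<Otimes>\<^sub>M walk \<mu> m))"
    unfolding char_def by (simp add: integral_distr split_beta')
  also have "\<dots> = (\<integral>x. \<integral>y. iexp (t * (x + y)) \<partial>walk \<mu> m \<partial>\<mu>)"
    by (subst integral_fst'[symmetric]) (auto intro!: integrable_const_bound[where B=1])
  also have "\<dots> = (\<integral>x. \<integral>y. iexp (t * x) * iexp (t * y) \<partial>walk \<mu> m \<partial>\<mu>)"
    by (simp add: distrib_left exp_add)
  also have "\<dots> = char \<mu> t * char (walk \<mu> m) t"
    by (simp add: char_def)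
  finally show ?case using Suc.IH by simp
qed

text \<open>Parseval's identity for the Fejer window centred at y. The right-hand side sees the
  characteristic function only on [-T, T].\<close>

lemma expectation_fejer:
  assumes "real_distribution \<nu>" and T: "T > 0"
  shows "(\<integral>s. fejer T (s - y) \<partial>\<nu>) = (\<integral>t. tri T t * Re (iexp (- (t * y)) * char \<nu> t) \<partial>lborel) / (2 * pi)"
proof -
  interpret \<nu>: real_distribution \<nu> by fact
  have le: "\<bar>tri T t * cos (t * x)\<bar> \<le> tri T t" for t x
    by (simp add: abs_mult tri_nonneg mult_left_le)
  have "(\<integral>s. fejer T (s - y) \<partial>\<nu>) = (\<integral>s. (\<integral>t. tri T t * cos (t * (s - y)) \<partial>lborel) / (2 * pi) \<partial>\<nu>)"
    by (simp add: tri_cos_integral[OF T])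
  also have "\<dots> = (\<integral>s. (\<integral>t. tri T t * cos (t * (s - y)) \<partial>lborel) \<partial>\<nu>) / (2 * pi)" by simp
  also have "(\<integral>s. (\<integral>t. tri T t * cos (t * (s - y)) \<partial>lborel) \<partial>\<nu>)
      = (\<integral>t. (\<integral>s. tri T t * cos (t * (s - y)) \<partial>\<nu>) \<partial>lborel)"
    using Fubini_dominated(1)[OF \<nu>.prob_space_axioms, of "\<lambda>(s, t). tri T t * cos (t * (s - y))" "tri T"]
      le integrable_tri[OF T]
    by (simp)
  also have "\<dots> = (\<integral>t. tri T t * Re (iexp (- (t * y)) * char \<nu> t) \<partial>lborel)"
  proof (intro Bochner_Integration.integral_cong refl)
    fix t
    have "iexp (- (t * y)) * char \<nu> t = (\<integral>s. iexp (- (t * y)) * iexp (t * s) \<partial>\<nu>)"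
      by (simp add: char_def)
    also have "\<dots> = (\<integral>s. iexp (t * (s - y)) \<partial>\<nu>)"
      by (simp add: exp_add[symmetric] algebra_simps)
    finally have "Re (iexp (- (t * y)) * char \<nu> t) = Re (\<integral>s. iexp (t * (s - y)) \<partial>\<nu>)" by simp
    also have "\<dots> = (\<integral>s. Re (iexp (t * (s - y))) \<partial>\<nu>)"
      by (rule integral_Re[symmetric]) (auto intro!: \<nu>.integrable_const_bound[where B=1])
    also have "\<dots> = (\<integral>s. cos (t * (s - y)) \<partial>\<nu>)" by (simp add: Re_exp)
    finally show "(\<integral>s. tri T t * cos (t * (s - y)) \<partial>\<nu>) = tri T t * Re (iexp (- (t * y)) * char \<nu> t)"
      by simp
  qed
  finally show ?thesis .
qed

text \<open>The nonlattice condition has the form in which Fourier analysis uses it: away from 0 the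
  characteristic function has modulus different from 1. The third absolute moment yields a cubic
  remainder in the expansion at 0.\<close>

locale nonlattice_law = real_distribution \<mu> for \<mu> +
  fixes a \<sigma> :: real
  assumes int1: "integrable \<mu> (\<lambda>x. x)" and int2: "integrable \<mu> (\<lambda>x. (x - a)\<^sup>2)"
    and int3: "integrable \<mu> (\<lambda>x. \<bar>x - a\<bar>^3)"
    and mean: "(\<integral>x. x \<partial>\<mu>) = a" and var: "(\<integral>x. (x - a)\<^sup>2 \<partial>\<mu>) = \<sigma>\<^sup>2" and \<sigma>: "\<sigma> > 0"
    and nonlattice: "\<And>t. t \<noteq> 0 \<Longrightarrow> cmod (char \<mu> t) \<noteq> 1"
begin

text \<open>The characteristic function of the centred step.\<close>

definition \<psi> :: "real \<Rightarrow> complex" where "\<psi> t = iexp (- (t * a)) * char \<mu> t"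

lemma char_eq_\<psi>: "char \<mu> t = iexp (t * a) * \<psi> t"
  by (simp add: \<psi>_def exp_add[symmetric] mult.assoc[symmetric])

lemma cmod_\<psi>: "cmod (\<psi> t) = cmod (char \<mu> t)"
  by (simp add: \<psi>_def norm_mult)

lemma cmod_\<psi>_le_1: "cmod (\<psi> t) \<le> 1"
  unfolding cmod_\<psi> by (rule cmod_char_le_1)

lemma \<psi>_measurable [measurable]: "\<psi> \<in> borel_measurable borel"
  unfolding \<psi>_def[abs_def] using char_measurable by measurable

lemma \<psi>_expansion: obtains K where "K \<ge> 0" "\<And>t. cmod (\<psi> t - of_real (1 - t\<^sup>2 * \<sigma>\<^sup>2 / 2)) \<le> K * \<bar>t\<bar>^3"
proof
  define \<nu> where "\<nu> = distr \<mu> borel (\<lambda>x. x - a)"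
  interpret \<nu>: real_distribution \<nu> unfolding \<nu>_def by simp
  have \<psi>: "\<psi> t = char \<nu> t" for t
  proof -
    have "char \<nu> t = (\<integral>x. iexp (t * (x - a)) \<partial>\<mu>)" by (simp add: char_def \<nu>_def integral_distr)
    also have "\<dots> = (\<integral>x. iexp (- (t * a)) * iexp (t * x) \<partial>\<mu>)"
      by (simp add: exp_add[symmetric] algebra_simps)
    finally show ?thesis by (simp add: \<psi>_def char_def)
  qed
  have i1: "integrable \<nu> (\<lambda>x. x)" unfolding \<nu>_def by (subst integrable_distr_eq) (auto intro: int1)
  have i2: "integrable \<nu> (\<lambda>x. x\<^sup>2)" unfolding \<nu>_def by (subst integrable_distr_eq) (auto intro: int2)
  have i3: "integrable \<nu> (\<lambda>x. \<bar>x\<bar>^3)" unfolding \<nu>_def by (subst integrable_distr_eq) (auto intro: int3)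
  have "(\<integral>x. x \<partial>\<nu>) = (\<integral>x. x - a \<partial>\<mu>)" unfolding \<nu>_def by (subst integral_distr) auto
  also have "\<dots> = (\<integral>x. x \<partial>\<mu>) - (\<integral>x. a \<partial>\<mu>)"
    by (rule Bochner_Integration.integral_diff[OF int1]) simp
  also have "(\<integral>x. a \<partial>\<mu>) = a" using prob_space by simp
  finally have m: "(\<integral>x. x \<partial>\<nu>) = 0" using mean by simp
  have v: "(\<integral>x. x\<^sup>2 \<partial>\<nu>) = \<sigma>\<^sup>2" unfolding \<nu>_def by (subst integral_distr) (auto intro: var)
  define K where "K = (\<integral>x. \<bar>x\<bar>^3 \<partial>\<nu>) / 6"
  show "K \<ge> 0" by (simp add: K_def)
  fix t
  have "cmod (char \<nu> t - (1 - t\<^sup>2 * \<sigma>\<^sup>2 / 2)) \<le> (t\<^sup>2 / 6) * \<nu>.expectation (\<lambda>x. min (6 * x\<^sup>2) (\<bar>t\<bar> * \<bar>x\<bar>^3))"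
    by (rule \<nu>.char_approx3) (use i1 i2 m v in auto)
  also have "\<nu>.expectation (\<lambda>x. min (6 * x\<^sup>2) (\<bar>t\<bar> * \<bar>x\<bar>^3)) \<le> \<nu>.expectation (\<lambda>x. \<bar>t\<bar> * \<bar>x\<bar>^3)"
    by (intro integral_mono Bochner_Integration.integrable_bound[OF integrable_mult_right[OF i3, of "\<bar>t\<bar>"]] integrable_mult_right i3) auto
  also have "\<nu>.expectation (\<lambda>x. \<bar>t\<bar> * \<bar>x\<bar>^3) = \<bar>t\<bar> * (6 * K)" by (simp add: K_def)
  also have "(t\<^sup>2 / 6) * (\<bar>t\<bar> * (6 * K)) = K * \<bar>t\<bar>^3"
    by (simp add: power3_eq_cube power2_eq_square)
  finally show "cmod (\<psi> t - of_real (1 - t\<^sup>2 * \<sigma>\<^sup>2 / 2)) \<le> K * \<bar>t\<bar>^3"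
    by (simp add: \<psi> mult_left_mono)
qed

text \<open>Near 0 the expansion gives Gaussian decay; on the compact remainder of [-T, T]
  continuity and \<open>nonlattice\<close> bound the modulus by some r < 1. After the substitution t
  = s / sqrt m the m-th power is below a Gaussian in s that does not depend on m, and this is the
  majorant for dominated convergence.\<close>

lemma \<psi>_gaussian_bound:
  assumes T: "T > 0"
  obtains c where "c > 0" "\<And>t. \<bar>t\<bar> \<le> T \<Longrightarrow> cmod (\<psi> t) \<le> exp (- (c * t\<^sup>2))"
proof -
  obtain K where K: "K \<ge> 0" "\<And>t. cmod (\<psi> t - of_real (1 - t\<^sup>2 * \<sigma>\<^sup>2 / 2)) \<le> K * \<bar>t\<bar>^3"
    using \<psi>_expansion by blast
  \<comment> \<open>The first entry keeps the main term 1 - t^2 \<sigma>^2 / 2 nonnegative; the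
    second lets the cubic remainder consume at most half of the quadratic term.\<close>
  define \<delta> where "\<delta> = min (1 / \<sigma>) (\<sigma>\<^sup>2 / (4 * (K + 1)))"
  have \<delta>: "\<delta> > 0" using \<sigma> K by (simp add: \<delta>_def)
  have small: "cmod (\<psi> t) \<le> exp (- (\<sigma>\<^sup>2 / 4 * t\<^sup>2))" if t: "\<bar>t\<bar> \<le> \<delta>" for t
  proof -
    have "\<bar>t\<bar> * \<sigma> \<le> 1 / \<sigma> * \<sigma>" using t \<sigma> by (intro mult_right_mono) (auto simp: \<delta>_def)
    then have "(\<bar>t\<bar> * \<sigma>)\<^sup>2 \<le> 1\<^sup>2" using \<sigma> by (intro power_mono) auto
    then have 1: "t\<^sup>2 * \<sigma>\<^sup>2 \<le> 1" by (simp add: power_mult_distrib)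
    have "\<bar>t\<bar> \<le> \<sigma>\<^sup>2 / (4 * (K + 1))" using t by (simp add: \<delta>_def)
    then have "\<bar>t\<bar> * (K + 1) \<le> \<sigma>\<^sup>2 / 4" using K by (simp add: field_simps)
    moreover have "K * \<bar>t\<bar> \<le> \<bar>t\<bar> * (K + 1)" by (simp add: algebra_simps)
    ultimately have "K * \<bar>t\<bar> * \<bar>t\<bar>\<^sup>2 \<le> \<sigma>\<^sup>2 / 4 * \<bar>t\<bar>\<^sup>2" by (intro mult_right_mono) auto
    then have 2: "K * \<bar>t\<bar>^3 \<le> \<sigma>\<^sup>2 / 4 * t\<^sup>2" by (simp add: power3_eq_cube power2_eq_square mult.assoc)
    have "cmod (\<psi> t) \<le> cmod (of_real (1 - t\<^sup>2 * \<sigma>\<^sup>2 / 2)) + cmod (\<psi> t - of_real (1 - t\<^sup>2 * \<sigma>\<^sup>2 / 2))"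
      by (rule norm_triangle_sub)
    also have "cmod (of_real (1 - t\<^sup>2 * \<sigma>\<^sup>2 / 2)) = 1 - t\<^sup>2 * \<sigma>\<^sup>2 / 2"
      using 1 by (subst norm_of_real) simp
    finally have "cmod (\<psi> t) \<le> 1 + (- (\<sigma>\<^sup>2 / 4 * t\<^sup>2))"
      using 2 K(2)[of t] by (simp add: field_simps)
    also have "\<dots> \<le> exp (- (\<sigma>\<^sup>2 / 4 * t\<^sup>2))" by (rule exp_ge_add_one_self)
    finally show ?thesis .
  qed
  define S where "S = cbox (-T) T \<inter> {t. \<bar>t\<bar> \<ge> \<delta>}"
  obtain r where r: "0 < r" "r < 1" "\<And>t. t \<in> S \<Longrightarrow> cmod (\<psi> t) \<le> r"
  proof (cases "S = {}")
    case True
    then show ?thesis using that[of "1/2"] by auto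
  next
    case False
    have "closed {t::real. \<bar>t\<bar> \<ge> \<delta>}" by (intro closed_Collect_le continuous_intros)
    then have "compact S" unfolding S_def by (intro compact_Int_closed compact_cbox)
    moreover have "continuous_on S (\<lambda>t. cmod (\<psi> t))"
      unfolding cmod_\<psi> by (intro continuous_on_norm continuous_at_imp_continuous_on ballI isCont_char)
    ultimately obtain t0 where t0: "t0 \<in> S" "\<And>t. t \<in> S \<Longrightarrow> cmod (\<psi> t) \<le> cmod (\<psi> t0)"
      using continuous_attains_sup[OF _ False] by blast
    have "t0 \<noteq> 0" using t0(1) \<delta> by (auto simp: S_def)
    then have "cmod (\<psi> t0) < 1" using nonlattice[of t0] cmod_\<psi>_le_1[of t0] by (simp add: cmod_\<psi>)
    then have "max (1/2) (cmod (\<psi> t0)) < 1" by simp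
    moreover have "\<And>t. t \<in> S \<Longrightarrow> cmod (\<psi> t) \<le> max (1/2) (cmod (\<psi> t0))"
      using t0(2) by (intro max.coboundedI2)
    ultimately show ?thesis by (intro that[of "max (1/2) (cmod (\<psi> t0))"]) auto
  qed
  \<comment> \<open>The second entry ensures exp(-c T^2) \<ge> r, which covers the compact set away
    from 0.\<close>
  define c where "c = min (\<sigma>\<^sup>2 / 4) (- ln r / T\<^sup>2)"
  show ?thesis
  proof
    have "ln r < 0" using r by simp
    then show "c > 0" using \<sigma> T by (simp add: c_def divide_neg_pos)
    fix t assume t: "\<bar>t\<bar> \<le> T"
    show "cmod (\<psi> t) \<le> exp (- (c * t\<^sup>2))"
    proof (cases "\<bar>t\<bar> \<le> \<delta>")
      case True
      have "c \<le> \<sigma>\<^sup>2 / 4" unfolding c_def by (rule min.cobounded1)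
      then have "c * t\<^sup>2 \<le> \<sigma>\<^sup>2 / 4 * t\<^sup>2" by (rule mult_right_mono) simp
      then have "exp (- (\<sigma>\<^sup>2 / 4 * t\<^sup>2)) \<le> exp (- (c * t\<^sup>2))" by simp
      with small[OF True] show ?thesis by linarith
    next
      case False
      then have "t \<in> S" using t by (auto simp: S_def)
      have "t\<^sup>2 \<le> T\<^sup>2" using t by (simp add: abs_le_square_iff[symmetric])
      then have "c * t\<^sup>2 \<le> (- ln r / T\<^sup>2) * T\<^sup>2"
        using \<sigma> r T by (intro mult_mono) (auto simp: c_def divide_le_0_iff)
      then have "ln r \<le> - (c * t\<^sup>2)" using T by simp
      then have "exp (ln r) \<le> exp (- (c * t\<^sup>2))" by (simp del: exp_ln)
      then show ?thesis using r(3)[OF \<open>t \<in> S\<close>] r(1) by simp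
    qed
  qed
qed

definition E :: "nat \<Rightarrow> (real \<Rightarrow> real) \<Rightarrow> real" where "E m f = (\<integral>s. f s \<partial>walk \<mu> m)"

lemma walk_rd: "real_distribution (walk \<mu> m)"
  by (rule real_distribution_walk) unfold_locales

text \<open>The substitution t = s / sqrt m puts the integral on the scale on which the m-th power
  of \<psi> converges. The mean a m of the walk has moved into the phase, so that the target y
  enters only through its standardised position.\<close>

lemma fejer_scaled:
  assumes T: "T > 0" and m: "m > 0"
  shows "sqrt m * E m (\<lambda>s. fejer T (s - y))
    = (\<integral>s. tri T (s / sqrt m) * Re (iexp (- (s * ((y - a * m) / sqrt m))) * \<psi> (s / sqrt m) ^ m) \<partial>lborel) / (2 * pi)"
proof -
  define r where "r = sqrt (real m)"
  have r: "r > 0" using m by (simp add: r_def)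
  have rd: "real_distribution \<mu>" by unfold_locales
  have eq: "iexp (- (t * y)) * char (walk \<mu> m) t = iexp (- (t * (y - a * m))) * \<psi> t ^ m" for t
    unfolding char_walk[OF rd] char_eq_\<psi> power_mult_distrib exp_of_nat_mult[symmetric]
    by (simp add: mult.assoc[symmetric] exp_add[symmetric]) (simp add: algebra_simps)
  have "E m (\<lambda>s. fejer T (s - y)) = (\<integral>t. tri T t * Re (iexp (- (t * (y - a * m))) * \<psi> t ^ m) \<partial>lborel) / (2 * pi)"
    unfolding E_def expectation_fejer[OF walk_rd T] eq ..
  also have "(\<integral>t. tri T t * Re (iexp (- (t * (y - a * m))) * \<psi> t ^ m) \<partial>lborel)
     = \<bar>1 / r\<bar> *\<^sub>R (\<integral>s. tri T (0 + 1 / r * s) * Re (iexp (- ((0 + 1 / r * s) * (y - a * m))) * \<psi> (0 + 1 / r * s) ^ m) \<partial>lborel)"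
    by (rule lborel_integral_real_affine) (use r in auto)
  finally show ?thesis using r by (simp add: r_def[symmetric])
qed

lemma fejer_integrand_bound:
  assumes T: "T > 0" and c: "\<And>t. \<bar>t\<bar> \<le> T \<Longrightarrow> cmod (\<psi> t) \<le> exp (- (c * t\<^sup>2))" and m: "m > 0"
  shows "\<bar>tri T (s / sqrt m) * Re (iexp u * \<psi> (s / sqrt m) ^ m)\<bar> \<le> exp (- (c * s\<^sup>2))"
proof (cases "\<bar>s / sqrt m\<bar> \<le> T")
  case True
  have "\<bar>Re (iexp u * \<psi> (s / sqrt m) ^ m)\<bar> \<le> cmod (iexp u * \<psi> (s / sqrt m) ^ m)"
    by (rule abs_Re_le_cmod)
  also have "\<dots> = cmod (\<psi> (s / sqrt m)) ^ m" by (simp add: norm_mult norm_power)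
  also have "\<dots> \<le> exp (- (c * (s / sqrt m)\<^sup>2)) ^ m"
    by (intro power_mono c True) simp
  also have "\<dots> = exp (- (c * s\<^sup>2))"
    using m by (simp add: exp_of_nat_mult[symmetric] power_divide)
  finally have "\<bar>Re (iexp u * \<psi> (s / sqrt m) ^ m)\<bar> \<le> exp (- (c * s\<^sup>2))" .
  then have "tri T (s / sqrt m) * \<bar>Re (iexp u * \<psi> (s / sqrt m) ^ m)\<bar> \<le> 1 * exp (- (c * s\<^sup>2))"
    by (intro mult_mono tri_le_1[OF T]) auto
  then show ?thesis by (simp add: abs_mult tri_nonneg)
next
  case False
  then show ?thesis using tri_eq_0[OF T] by simp
qed

lemma integrable_gauss: "c > 0 \<Longrightarrow> integrable lborel (\<lambda>s. exp (- (c * s\<^sup>2)))" for c :: real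
  using gaussian_cos_integral(1)[of "sqrt (2 * c)" 0] by simp

text \<open>The target y occurs only in a phase of modulus 1, hence the bound is uniform in
  y.\<close>

lemma fejer_uniform_bound:
  assumes T: "T > 0"
  obtains C where "C \<ge> 0" "\<And>m y. m > 0 \<Longrightarrow> sqrt m * E m (\<lambda>s. fejer T (s - y)) \<le> C"
proof -
  obtain c where c: "c > 0" "\<And>t. \<bar>t\<bar> \<le> T \<Longrightarrow> cmod (\<psi> t) \<le> exp (- (c * t\<^sup>2))"
    using \<psi>_gaussian_bound[OF T] by blast
  show ?thesis
  proof
    show "(\<integral>s. exp (- (c * s\<^sup>2)) \<partial>lborel) / (2 * pi) \<ge> 0" by simp
    fix m :: nat and y :: real assume m: "m > 0"
    define f where "f s = tri T (s / sqrt m) * Re (iexp (- (s * ((y - a * m) / sqrt m))) * \<psi> (s / sqrt m) ^ m)" for s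
    have [measurable]: "f \<in> borel_measurable borel" unfolding f_def[abs_def] by measurable
    have f: "\<bar>f s\<bar> \<le> exp (- (c * s\<^sup>2))" for s
      unfolding f_def by (rule fejer_integrand_bound[OF T c(2) m])
    have "integrable lborel f"
      using f by (intro Bochner_Integration.integrable_bound[OF integrable_gauss[OF c(1)]]) auto
    then have "\<bar>\<integral>s. f s \<partial>lborel\<bar> \<le> (\<integral>s. exp (- (c * s\<^sup>2)) \<partial>lborel)"
      using f by (intro order_trans[OF integral_abs_bound] integral_mono integrable_abs integrable_gauss c) auto
    then show "sqrt m * E m (\<lambda>s. fejer T (s - y)) \<le> (\<integral>s. exp (- (c * s\<^sup>2)) \<partial>lborel) / (2 * pi)"
      unfolding fejer_scaled[OF T m] f_def by (intro divide_right_mono) auto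
  qed
qed

text \<open>Among numbers of modulus at most 1, k-th powers differ by at most k times the difference
  of the bases. Compared with 1 + x/k, the base is off by O(k^(-3/2)), and the powers of 1 + x/k
  tend to exp x.\<close>

lemma \<psi>_power_tendsto:
  fixes m :: "nat \<Rightarrow> nat"
  assumes m: "filterlim m at_top sequentially" "\<And>n. m n > 0"
  shows "(\<lambda>n. \<psi> (s / sqrt (m n)) ^ m n) \<longlonglongrightarrow> of_real (exp (- (\<sigma>\<^sup>2 * s\<^sup>2 / 2)))"
proof -
  obtain K where K: "K \<ge> 0" "\<And>t. cmod (\<psi> t - of_real (1 - t\<^sup>2 * \<sigma>\<^sup>2 / 2)) \<le> K * \<bar>t\<bar>^3"
    using \<psi>_expansion by blast
  define x where "x = - (\<sigma>\<^sup>2 * s\<^sup>2 / 2)"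
  have lim: "(\<lambda>k. \<psi> (s / sqrt (real k)) ^ k) \<longlonglongrightarrow> of_real (exp x)"
  proof -
    have e: "(\<lambda>k. complex_of_real ((1 + x / real k) ^ k)) \<longlonglongrightarrow> of_real (exp x)"
      by (rule tendsto_of_real) (rule tendsto_exp_limit_sequentially)
    have ev: "\<forall>\<^sub>F k in sequentially. k > 0 \<and> \<bar>1 + x / real k\<bar> \<le> 1"
    proof -
      have "\<forall>\<^sub>F k in sequentially. real k \<ge> - x" by (rule eventually_mono[OF eventually_ge_at_top[of "nat \<lceil>- x\<rceil>"]]) linarith
      moreover have "\<forall>\<^sub>F k in sequentially. k > (0::nat)" by (rule eventually_gt_at_top)
      ultimately show ?thesis
      proof eventually_elim
        case (elim k)
        have "x \<le> 0" by (simp add: x_def)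
        then have "- 1 \<le> x / k" "x / k \<le> 0" using elim by (auto simp: field_simps)
        then show ?case using elim by auto
      qed
    qed
    have "(\<lambda>k. \<psi> (s / sqrt (real k)) ^ k - complex_of_real ((1 + x / real k) ^ k)) \<longlonglongrightarrow> 0"
    proof (rule Lim_null_comparison)
      show "\<forall>\<^sub>F k in sequentially. norm (\<psi> (s / sqrt (real k)) ^ k - complex_of_real ((1 + x / real k) ^ k)) \<le> K * \<bar>s\<bar>^3 / sqrt k"
        using ev
      proof eventually_elim
        case (elim k)
        then have k: "k > 0" by simp
        have "norm (\<psi> (s / sqrt (real k)) ^ k - of_real (1 + x / real k) ^ k) \<le> k * norm (\<psi> (s / sqrt (real k)) - of_real (1 + x / real k))"
          using elim cmod_\<psi>_le_1 by (intro norm_power_diff) (auto simp del: of_real_add simp: norm_of_real)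
        also have "\<dots> \<le> k * (K * \<bar>s / sqrt k\<bar>^3)"
        proof (intro mult_left_mono)
          have *: "1 + x / real k = 1 - (s / sqrt k)\<^sup>2 * \<sigma>\<^sup>2 / 2"
            using k by (simp add: x_def power_divide mult.commute)
          show "norm (\<psi> (s / sqrt (real k)) - of_real (1 + x / real k)) \<le> K * \<bar>s / sqrt k\<bar>^3"
            unfolding * by (rule K)
        qed simp
        also have "\<dots> = K * \<bar>s\<bar>^3 * (k / sqrt k ^ 3)"
          by (simp add: power_divide)
        also have "k / sqrt k ^ 3 = 1 / sqrt k"
          using k by (simp add: power3_eq_cube)
        finally show ?case by simp
      qed
      show "(\<lambda>k. K * \<bar>s\<bar>^3 / sqrt (real k)) \<longlonglongrightarrow> 0" by real_asymp
    qed
    from tendsto_add[OF this e] show ?thesis by simp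
  qed
  show ?thesis
    using filterlim_compose[OF lim m(1)] by (simp add: x_def)
qed

text \<open>After scaling, the triangle flattens to 1 pointwise, so the limit is the Gaussian
  density whatever the value of T.\<close>

lemma fejer_local_limit:
  fixes m :: "nat \<Rightarrow> nat" and y :: "nat \<Rightarrow> real"
  assumes T: "T > 0" and m: "filterlim m at_top sequentially" "\<And>n. m n > 0"
    and y: "(\<lambda>n. (y n - a * m n) / sqrt (m n)) \<longlonglongrightarrow> z"
  shows "(\<lambda>n. sqrt (m n) * E (m n) (\<lambda>s. fejer T (s - y n))) \<longlonglongrightarrow> exp (- (z\<^sup>2 / (2 * \<sigma>\<^sup>2))) / (sqrt (2 * pi) * \<sigma>)"
proof -
  obtain c where c: "c > 0" "\<And>t. \<bar>t\<bar> \<le> T \<Longrightarrow> cmod (\<psi> t) \<le> exp (- (c * t\<^sup>2))"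
    using \<psi>_gaussian_bound[OF T] by blast
  define f where "f n s = tri T (s / sqrt (m n)) * Re (iexp (- (s * ((y n - a * m n) / sqrt (m n)))) * \<psi> (s / sqrt (m n)) ^ m n)" for n s
  have "(\<lambda>n. \<integral>s. f n s \<partial>lborel) \<longlonglongrightarrow> (\<integral>s. cos (z * s) * exp (- (\<sigma>\<^sup>2 * s\<^sup>2 / 2)) \<partial>lborel)"
  proof (rule integral_dominated_convergence[where w="\<lambda>s. exp (- (c * s\<^sup>2))"])
    show "AE s in lborel. (\<lambda>n. f n s) \<longlonglongrightarrow> cos (z * s) * exp (- (\<sigma>\<^sup>2 * s\<^sup>2 / 2))"
    proof (intro AE_I2)
      fix s :: real
      have "(\<lambda>k. s / sqrt (real k)) \<longlonglongrightarrow> 0" by real_asymp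
      from filterlim_compose[OF this m(1)]
      have "(\<lambda>n. tri T (s / sqrt (m n))) \<longlonglongrightarrow> max 0 (1 - \<bar>0\<bar> / T)"
        unfolding tri_def by (intro tendsto_max tendsto_const tendsto_diff tendsto_divide tendsto_rabs) (use T in auto)
      then have "(\<lambda>n. tri T (s / sqrt (m n))) \<longlonglongrightarrow> 1" by simp
      moreover have "(\<lambda>n. iexp (- (s * ((y n - a * m n) / sqrt (m n))))) \<longlonglongrightarrow> iexp (- (s * z))"
        by (intro isCont_tendsto_compose[OF isCont_iexp] tendsto_intros y)
      moreover note \<psi>_power_tendsto[OF m, of s]
      ultimately have "(\<lambda>n. f n s) \<longlonglongrightarrow> 1 * Re (iexp (- (s * z)) * of_real (exp (- (\<sigma>\<^sup>2 * s\<^sup>2 / 2))))"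
        unfolding f_def by (intro tendsto_mult tendsto_Re)
      also have "1 * Re (iexp (- (s * z)) * of_real (exp (- (\<sigma>\<^sup>2 * s\<^sup>2 / 2)))) = cos (z * s) * exp (- (\<sigma>\<^sup>2 * s\<^sup>2 / 2))"
        by (simp add: Re_exp Im_exp mult.commute)
      finally show "(\<lambda>n. f n s) \<longlonglongrightarrow> cos (z * s) * exp (- (\<sigma>\<^sup>2 * s\<^sup>2 / 2))" .
    qed
    show "AE s in lborel. norm (f n s) \<le> exp (- (c * s\<^sup>2))" for n
      unfolding f_def real_norm_def by (intro AE_I2 fejer_integrand_bound[OF T c(2) m(2)])
    show "f n \<in> borel_measurable lborel" for n unfolding f_def[abs_def] by measurable
  qed (auto intro: integrable_gauss c)
  then have "(\<lambda>n. (\<integral>s. f n s \<partial>lborel) / (2 * pi)) \<longlonglongrightarrow> (sqrt (2 * pi) / \<sigma> * exp (- (z\<^sup>2 / (2 * \<sigma>\<^sup>2)))) / (2 * pi)"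
    unfolding gaussian_cos_integral(2)[OF \<sigma>] by (intro tendsto_divide) auto
  moreover have "sqrt (m n) * E (m n) (\<lambda>s. fejer T (s - y n)) = (\<integral>s. f n s \<partial>lborel) / (2 * pi)" for n
    unfolding fejer_scaled[OF T m(2)] f_def ..
  moreover have "(sqrt (2 * pi) / \<sigma> * exp (- (z\<^sup>2 / (2 * \<sigma>\<^sup>2)))) / (2 * pi) = exp (- (z\<^sup>2 / (2 * \<sigma>\<^sup>2))) / (sqrt (2 * pi) * \<sigma>)"
  proof -
    define r where "r = sqrt (2 * pi)"
    have "r > 0" "2 * pi = r * r" by (simp_all add: r_def)
    with \<sigma> show ?thesis unfolding r_def[symmetric] by (simp add: field_simps)
  qed
  ultimately show ?thesis by simp
qed

end

section \<open>Smoothing of test functions with quadratic decay\<close>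

lemma inverse_square_product_le:
  fixes u v :: real
  shows "1 / ((1 + u\<^sup>2) * (1 + v\<^sup>2)) \<le> (2 / (1 + v\<^sup>2) + 2 / (1 + u\<^sup>2)) / (1 + (u + v)\<^sup>2)"
proof -
  have p: "1 + u\<^sup>2 > 0" "1 + v\<^sup>2 > 0" "1 + (u + v)\<^sup>2 > 0" by (simp_all add: add_pos_nonneg)
  have "1 + (u + v)\<^sup>2 \<le> 2 * (1 + u\<^sup>2) + 2 * (1 + v\<^sup>2)"
    using sum_squares_bound[of u v] by (simp add: power2_sum)
  then have "(1 + (u + v)\<^sup>2) / ((1 + u\<^sup>2) * (1 + v\<^sup>2)) \<le> (2 * (1 + u\<^sup>2) + 2 * (1 + v\<^sup>2)) / ((1 + u\<^sup>2) * (1 + v\<^sup>2))"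
    using p by (intro divide_right_mono) auto
  also have "\<dots> = 2 / (1 + v\<^sup>2) + 2 / (1 + u\<^sup>2)"
  proof -
    have "X > 0 \<Longrightarrow> Y > 0 \<Longrightarrow> (2 * X + 2 * Y) / (X * Y) = 2 / Y + 2 / X" for X Y :: real
      by (simp add: add_divide_distrib)
    then show ?thesis using p by blast
  qed
  finally show ?thesis using p(3) by (simp add: pos_le_divide_eq)
qed

lemma divide_double_mult: "c > 0 \<Longrightarrow> x / (2 * c) * c = x / 2" for c x :: real
  by simp

lemma fejer_le_tail:
  assumes T: "T > 0" and \<delta>: "\<delta> > 0" and u: "\<bar>u\<bar> \<ge> \<delta>"
  shows "fejer T u \<le> (2 / pi * (1 + 1 / \<delta>\<^sup>2) / T) / (1 + u\<^sup>2)"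
proof -
  have "fejer T u * u\<^sup>2 \<le> 2 / (pi * T)"
    unfolding fejer_mult_square[OF T]
    using T cos_ge_minus_one[of "T * u"] by (intro divide_right_mono) auto
  moreover have "fejer T u \<le> (fejer T u * u\<^sup>2) * (1 / \<delta>\<^sup>2)"
  proof -
    have "\<delta>\<^sup>2 \<le> u\<^sup>2" using \<delta> u by (simp add: abs_le_square_iff[symmetric])
    then have "fejer T u * \<delta>\<^sup>2 \<le> fejer T u * u\<^sup>2" by (intro mult_left_mono fejer_nonneg T)
    then show ?thesis using \<delta> by (simp add: field_simps)
  qed
  moreover have "(fejer T u * u\<^sup>2) * (1 / \<delta>\<^sup>2) \<le> 2 / (pi * T) * (1 / \<delta>\<^sup>2)"
    using calculation(1) by (intro mult_right_mono) auto
  ultimately have "fejer T u * (1 + u\<^sup>2) \<le> 2 / (pi * T) * (1 + 1 / \<delta>\<^sup>2)"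
    by (simp add: distrib_left)
  then show ?thesis using T by (simp add: pos_le_divide_eq add_pos_nonneg field_simps)
qed

text \<open>The error has to keep the quadratic decay: it is going to be integrated against sqrt m
  times the law of the walk, and only functions of this decay are known to give bounded results
  there. Shifts |u| \<le> \<delta> are handled by the local Lipschitz bound, larger ones by the
  kernel tail of order 1/T.\<close>

lemma fejer_smoothing_error:
  fixes h :: "real \<Rightarrow> real"
  assumes [measurable]: "h \<in> borel_measurable borel" and B: "B \<ge> 0"
    and dec: "\<And>x. \<bar>h x\<bar> \<le> B / (1 + x\<^sup>2)"
    and lip: "\<And>x u. \<bar>u\<bar> \<le> 1 \<Longrightarrow> \<bar>h x - h (x - u)\<bar> \<le> B * \<bar>u\<bar> / (1 + x\<^sup>2)"
    and \<epsilon>: "\<epsilon> > 0"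
  obtains T where "T > 0" "\<And>x. \<bar>h x - (\<integral>w. h w * fejer T (x - w) \<partial>lborel)\<bar> \<le> \<epsilon> / (1 + x\<^sup>2)"
proof -
  define \<delta> where "\<delta> = min 1 (\<epsilon> / (2 * (B + 1)))"
  have \<delta>: "0 < \<delta>" "\<delta> \<le> 1" using \<epsilon> B by (auto simp: \<delta>_def)
  have \<delta>B: "\<delta> * B \<le> \<epsilon> / 2"
  proof -
    have "\<delta> * B \<le> \<epsilon> / (2 * (B + 1)) * (B + 1)" using B \<epsilon> by (intro mult_mono) (auto simp: \<delta>_def)
    also have "\<dots> = \<epsilon> / 2" using B by (intro divide_double_mult) simp
    finally show ?thesis .
  qed
  define D where "D = 2 / pi * (1 + 1 / \<delta>\<^sup>2)"
  have D: "D > 0" using \<delta> by (simp add: D_def add_pos_nonneg)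
  \<comment> \<open>The bracket in the bound \<open>b\<close> below contains 3 + 2 Cauchy integrals,
    that is 5 pi; this T makes their contribution at most \<epsilon>/2.\<close>
  define T where "T = 10 * pi * D * (B + 1) / \<epsilon>"
  have T: "T > 0" using D B \<epsilon> by (simp add: T_def)
  define G where "G = D / T * B"
  have G: "G \<ge> 0" using D T B by (simp add: G_def)
  have "G * (5 * pi) \<le> D / T * (B + 1) * (5 * pi)" using D T unfolding G_def by (intro mult_right_mono mult_left_mono) auto
  also have "\<dots> = \<epsilon> / 2" using D B \<epsilon> by (simp add: T_def)
  finally have G5: "G * (5 * pi) \<le> \<epsilon> / 2" .
  have ci: "integrable lborel (\<lambda>u. 1 / (1 + (x - u)\<^sup>2))" "(\<integral>u. 1 / (1 + (x - u)\<^sup>2) \<partial>lborel) = pi" for x :: real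
    using lborel_integrable_real_affine[OF integrable_cauchy, of "-1" x]
      lborel_integral_real_affine[of "-1" "\<lambda>x. 1 / (1 + (x::real)\<^sup>2)" x] by (simp_all add: integral_cauchy)
  have key: "\<bar>h x - (\<integral>w. h w * fejer T (x - w) \<partial>lborel)\<bar> \<le> \<epsilon> / (1 + x\<^sup>2)" for x
  proof -
    have x: "1 + x\<^sup>2 > 0" by (simp add: add_pos_nonneg)
    define b where "b u = (\<delta> * B * fejer T u + G * (3 * (1 / (1 + u\<^sup>2)) + 2 * (1 / (1 + (x - u)\<^sup>2)))) / (1 + x\<^sup>2)" for u
    have "has_bochner_integral lborel b ((\<delta> * B * 1 + G * (3 * pi + 2 * pi)) / (1 + x\<^sup>2))"
      unfolding b_def[abs_def]
      by (intro has_bochner_integral_divide has_bochner_integral_add has_bochner_integral_mult_right)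
         (use integrable_fejer[OF T] integrable_cauchy ci[of x] integral_cauchy integral_fejer[OF T] in
           \<open>simp_all add: has_bochner_integral_iff\<close>)
    then have bi: "integrable lborel b" and "(\<integral>u. b u \<partial>lborel) = (\<delta> * B + G * (5 * pi)) / (1 + x\<^sup>2)"
      by (simp_all add: has_bochner_integral_iff)
    note this(2)
    also have "\<dots> \<le> \<epsilon> / (1 + x\<^sup>2)" using \<delta>B G5 x by (intro divide_right_mono) auto
    finally have bI: "(\<integral>u. b u \<partial>lborel) \<le> \<epsilon> / (1 + x\<^sup>2)" .
    have pw: "\<bar>(h x - h (x - u)) * fejer T u\<bar> \<le> b u" for u
    proof (cases "\<bar>u\<bar> \<le> \<delta>")
      case True
      have "\<bar>h x - h (x - u)\<bar> \<le> B * \<bar>u\<bar> / (1 + x\<^sup>2)" using True \<delta> by (intro lip) auto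
      also have "\<dots> \<le> B * \<delta> / (1 + x\<^sup>2)" using True B x by (intro divide_right_mono mult_left_mono) auto
      finally have "\<bar>h x - h (x - u)\<bar> * fejer T u \<le> B * \<delta> / (1 + x\<^sup>2) * fejer T u"
        by (intro mult_right_mono fejer_nonneg T)
      also have "\<dots> = (\<delta> * B * fejer T u) / (1 + x\<^sup>2)" by simp
      also have "\<dots> \<le> b u" unfolding b_def using x G by (intro divide_right_mono) auto
      finally show ?thesis using fejer_nonneg[OF T] by (simp add: abs_mult)
    next
      case False
      have p: "1 + u\<^sup>2 > 0" "1 + (x - u)\<^sup>2 > 0" by (simp_all add: add_pos_nonneg)
      have k: "fejer T u \<le> (D / T) / (1 + u\<^sup>2)"
        using fejer_le_tail[OF T \<delta>(1), of u] False by (simp add: D_def)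
      have "\<bar>h x - h (x - u)\<bar> \<le> B / (1 + x\<^sup>2) + B / (1 + (x - u)\<^sup>2)"
        using dec[of x] dec[of "x - u"] by linarith
      then have "\<bar>h x - h (x - u)\<bar> * fejer T u \<le> (B / (1 + x\<^sup>2) + B / (1 + (x - u)\<^sup>2)) * ((D / T) / (1 + u\<^sup>2))"
        using B x p by (intro mult_mono k fejer_nonneg T) auto
      also have "\<dots> = G * (1 / (1 + u\<^sup>2) / (1 + x\<^sup>2) + 1 / ((1 + u\<^sup>2) * (1 + (x - u)\<^sup>2)))"
      proof -
        have "(b / X + b / Z) * (d / Y) = d * b * (1 / Y / X + 1 / (Y * Z))" for b d X Y Z :: real
          by (simp add: divide_inverse distrib_left distrib_right ac_simps)
        then show ?thesis unfolding G_def by blast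
      qed
      \<comment> \<open>A product of Cauchy factors in u and x - u decays in the sum x of the two
        arguments, and the common factor 1/(1 + x^2) can be pulled out.\<close>
      also have "\<dots> \<le> G * (1 / (1 + u\<^sup>2) / (1 + x\<^sup>2) + (2 / (1 + (x - u)\<^sup>2) + 2 / (1 + u\<^sup>2)) / (1 + x\<^sup>2))"
        using inverse_square_product_le[of u "x - u"] G by (intro mult_left_mono add_left_mono) auto
      also have "\<dots> = (G * (3 * (1 / (1 + u\<^sup>2)) + 2 * (1 / (1 + (x - u)\<^sup>2)))) / (1 + x\<^sup>2)"
      proof -
        have "g * (1 / Y / X + (2 / Z + 2 / Y) / X) = (g * (3 * (1 / Y) + 2 * (1 / Z))) / X" for g X Y Z :: real
          by (simp add: divide_inverse distrib_left distrib_right ac_simps)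
        then show ?thesis by blast
      qed
      also have "\<dots> \<le> b u" unfolding b_def using x \<delta> B fejer_nonneg[OF T, of u] by (intro divide_right_mono) auto
      finally show ?thesis using fejer_nonneg[OF T] by (simp add: abs_mult)
    qed
    have i1: "integrable lborel (\<lambda>u. (h x - h (x - u)) * fejer T u)"
      using pw order_trans[OF abs_ge_zero pw] by (intro Bochner_Integration.integrable_bound[OF bi]) auto
    have i2: "integrable lborel (\<lambda>u. h x * fejer T u)" by (intro integrable_mult_right integrable_fejer T)
    have "(\<integral>w. h w * fejer T (x - w) \<partial>lborel) = (\<integral>u. h (x - u) * fejer T u \<partial>lborel)"
      using lborel_integral_real_affine[of "-1" "\<lambda>w. h w * fejer T (x - w)" x] by simp
    also have "\<dots> = (\<integral>u. h x * fejer T u - (h x - h (x - u)) * fejer T u \<partial>lborel)"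
      by (simp add: algebra_simps)
    also have "\<dots> = h x - (\<integral>u. (h x - h (x - u)) * fejer T u \<partial>lborel)"
      by (subst Bochner_Integration.integral_diff[OF i2 i1]) (simp add: integral_fejer[OF T])
    finally have "\<bar>h x - (\<integral>w. h w * fejer T (x - w) \<partial>lborel)\<bar> = \<bar>\<integral>u. (h x - h (x - u)) * fejer T u \<partial>lborel\<bar>"
      by simp
    also have "\<dots> \<le> (\<integral>u. b u \<partial>lborel)"
      using pw by (intro order_trans[OF integral_abs_bound] integral_mono integrable_abs i1 bi) auto
    also note bI
    finally show ?thesis .
  qed
  show ?thesis using that[OF T key] .
qed

context nonlattice_law
begin

lemma integrable_walk_bounded:
  assumes [measurable]: "f \<in> borel_measurable borel" and "\<And>x. \<bar>f x\<bar> \<le> (C::real)"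
  shows "integrable (walk \<mu> m) f"
proof -
  interpret w: real_distribution "walk \<mu> m" by (rule walk_rd)
  show ?thesis using assms(2) by (intro w.integrable_const_bound[where B=C]) auto
qed

lemma cauchy_uniform_bound:
  obtains C where "C \<ge> 0" "\<And>m y. m > 0 \<Longrightarrow> sqrt m * E m (\<lambda>s. 1 / (1 + (s - y)\<^sup>2)) \<le> C"
proof -
  obtain C1 where C1: "C1 \<ge> 0" "\<And>m y. m > 0 \<Longrightarrow> sqrt m * E m (\<lambda>s. fejer 1 (s - y)) \<le> C1"
    using fejer_uniform_bound[of 1] by auto
  show ?thesis
  proof
    show "pi^3 * (C1 + C1) \<ge> 0" using C1 by simp
    fix m :: nat and y :: real assume m: "m > 0"
    have i: "integrable (walk \<mu> m) (\<lambda>s. fejer 1 (s - y))" for y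
      by (rule integrable_walk_bounded[where C="1 / (2 * pi)"]) (use fejer_nonneg[of 1] fejer_le_const[of 1] in auto)
    have "E m (\<lambda>s. 1 / (1 + (s - y)\<^sup>2)) \<le> E m (\<lambda>s. pi^3 * (fejer 1 (s - y) + fejer 1 (s - (y - pi))))"
      unfolding E_def
    proof (rule integral_mono)
      show "integrable (walk \<mu> m) (\<lambda>s. 1 / (1 + (s - y)\<^sup>2))"
        by (rule integrable_walk_bounded[where C=1]) (auto simp: add_pos_nonneg divide_le_eq)
      show "integrable (walk \<mu> m) (\<lambda>s. pi^3 * (fejer 1 (s - y) + fejer 1 (s - (y - pi))))"
        by (intro integrable_mult_right Bochner_Integration.integrable_add i)
      show "1 / (1 + (s - y)\<^sup>2) \<le> pi^3 * (fejer 1 (s - y) + fejer 1 (s - (y - pi)))" for s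
        using fejer_pair_lower[of "s - y"] by (simp add: algebra_simps)
    qed
    also have "\<dots> = pi^3 * (E m (\<lambda>s. fejer 1 (s - y)) + E m (\<lambda>s. fejer 1 (s - (y - pi))))"
      unfolding E_def using i by simp
    finally have "sqrt m * E m (\<lambda>s. 1 / (1 + (s - y)\<^sup>2)) \<le>
       sqrt m * (pi^3 * (E m (\<lambda>s. fejer 1 (s - y)) + E m (\<lambda>s. fejer 1 (s - (y - pi)))))"
      by (intro mult_left_mono) auto
    also have "\<dots> = pi^3 * (sqrt m * E m (\<lambda>s. fejer 1 (s - y)) + sqrt m * E m (\<lambda>s. fejer 1 (s - (y - pi))))"
      by (simp add: algebra_simps)
    also have "\<dots> \<le> pi^3 * (C1 + C1)" by (intro mult_left_mono add_mono C1 m) auto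
    finally show "sqrt m * E m (\<lambda>s. 1 / (1 + (s - y)\<^sup>2)) \<le> pi^3 * (C1 + C1)" .
  qed
qed

lemma local_limit_bound:
  assumes [measurable]: "h \<in> borel_measurable borel" and B: "B \<ge> 0"
    and dec: "\<And>x. \<bar>h x\<bar> \<le> B / (1 + x\<^sup>2)"
  obtains C where "C \<ge> 0" "\<And>m y. m > 0 \<Longrightarrow> sqrt m * E m (\<lambda>s. \<bar>h (s - y)\<bar>) \<le> C"
proof -
  obtain C1 where C1: "C1 \<ge> 0" "\<And>m y. m > 0 \<Longrightarrow> sqrt m * E m (\<lambda>s. 1 / (1 + (s - y)\<^sup>2)) \<le> C1"
    using cauchy_uniform_bound by blast
  show ?thesis
  proof
    show "B * C1 \<ge> 0" using B C1 by simp
    fix m :: nat and y :: real assume m: "m > 0"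
    have i: "integrable (walk \<mu> m) (\<lambda>s. 1 / (1 + (s - y)\<^sup>2))"
      by (rule integrable_walk_bounded[where C=1]) (auto simp: add_pos_nonneg divide_le_eq)
    have "E m (\<lambda>s. \<bar>h (s - y)\<bar>) \<le> E m (\<lambda>s. B * (1 / (1 + (s - y)\<^sup>2)))"
      unfolding E_def using dec B
      by (intro integral_mono integrable_mult_right i integrable_walk_bounded[where C=B])
         (auto intro: order_trans[OF dec] simp: divide_le_eq add_pos_nonneg mult_left_le[OF _ B] distrib_left)
    also have "\<dots> = B * E m (\<lambda>s. 1 / (1 + (s - y)\<^sup>2))"
      unfolding E_def by (simp only: integral_mult_right_zero)
    finally have "sqrt m * E m (\<lambda>s. \<bar>h (s - y)\<bar>) \<le> sqrt m * (B * E m (\<lambda>s. 1 / (1 + (s - y)\<^sup>2)))"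
      by (intro mult_left_mono) auto
    also have "\<dots> = B * (sqrt m * E m (\<lambda>s. 1 / (1 + (s - y)\<^sup>2)))" by simp
    also have "\<dots> \<le> B * C1" by (intro mult_left_mono C1 m B)
    finally show "sqrt m * E m (\<lambda>s. \<bar>h (s - y)\<bar>) \<le> B * C1" .
  qed
qed

text \<open>Stone's local limit theorem, for directly Riemann integrable test functions with
  quadratic decay: compare with the Fejer smoothing, whose Fourier transform has compact support.\<close>

theorem local_limit:
  fixes h :: "real \<Rightarrow> real" and m :: "nat \<Rightarrow> nat" and y :: "nat \<Rightarrow> real"
  assumes [measurable]: "h \<in> borel_measurable borel" and B: "B \<ge> 0"
    and dec: "\<And>x. \<bar>h x\<bar> \<le> B / (1 + x\<^sup>2)"
    and lip: "\<And>x u. \<bar>u\<bar> \<le> 1 \<Longrightarrow> \<bar>h x - h (x - u)\<bar> \<le> B * \<bar>u\<bar> / (1 + x\<^sup>2)"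
    and m: "filterlim m at_top sequentially" "\<And>n. m n > 0"
    and y: "(\<lambda>n. (y n - a * m n) / sqrt (m n)) \<longlonglongrightarrow> z"
  shows "(\<lambda>n. sqrt (m n) * E (m n) (\<lambda>s. h (s - y n)))
           \<longlonglongrightarrow> (\<integral>x. h x \<partial>lborel) * (exp (- (z\<^sup>2 / (2 * \<sigma>\<^sup>2))) / (sqrt (2 * pi) * \<sigma>))"
proof (rule LIMSEQ_I)
  fix \<epsilon> :: real assume \<epsilon>: "0 < \<epsilon>"
  define L where "L = exp (- (z\<^sup>2 / (2 * \<sigma>\<^sup>2))) / (sqrt (2 * pi) * \<sigma>)"
  have hi: "integrable lborel h"
    using dec B by (intro Bochner_Integration.integrable_bound[OF integrable_mult_right[OF integrable_cauchy, of B]]) auto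
  obtain C1 where C1: "C1 \<ge> 0" "\<And>m y. m > 0 \<Longrightarrow> sqrt m * E m (\<lambda>s. 1 / (1 + (s - y)\<^sup>2)) \<le> C1"
    using cauchy_uniform_bound by blast
  \<comment> \<open>The smoothing accuracy in units of 1/(1 + x^2): integrated against sqrt m times
    the law of the walk it costs at most \<eta> C1, hence \<epsilon>/2, for all n at once.\<close>
  define \<eta> where "\<eta> = \<epsilon> / (2 * (C1 + 1))"
  have \<eta>: "\<eta> > 0" using \<epsilon> C1 by (simp add: \<eta>_def)
  have \<eta>C: "\<eta> * C1 \<le> \<epsilon> / 2"
  proof -
    have "\<eta> * C1 \<le> \<eta> * (C1 + 1)" using \<eta> by (intro mult_left_mono) auto
    also have "\<dots> = \<epsilon> / 2" unfolding \<eta>_def using C1 by (intro divide_double_mult) simp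
    finally show ?thesis .
  qed
  obtain T where T: "T > 0" "\<And>x. \<bar>h x - (\<integral>w. h w * fejer T (x - w) \<partial>lborel)\<bar> \<le> \<eta> / (1 + x\<^sup>2)"
    using fejer_smoothing_error[OF assms(1) B dec lip \<eta>] by blast
  obtain C2 where C2: "C2 \<ge> 0" "\<And>m y. m > 0 \<Longrightarrow> sqrt m * E m (\<lambda>s. fejer T (s - y)) \<le> C2"
    using fejer_uniform_bound[OF T(1)] by blast
  define hT where "hT x = (\<integral>w. h w * fejer T (x - w) \<partial>lborel)" for x
  have [measurable]: "hT \<in> borel_measurable borel" unfolding hT_def[abs_def] by measurable
  \<comment> \<open>Fubini writes the smoothed expectation as a mixture of Fejer windows shifted by
    w. A fixed shift disappears on the scale sqrt m, so all of them have the same limit, and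
    \<open>\<bar>h w\<bar> * C2\<close> dominates.\<close>
  have ET: "E k (\<lambda>s. hT (s - y')) = (\<integral>w. h w * E k (\<lambda>s. fejer T (s - (y' + w))) \<partial>lborel)"
    and hTi: "integrable (walk \<mu> k) (\<lambda>s. hT (s - y'))" for k y'
  proof -
    interpret w: real_distribution "walk \<mu> k" by (rule walk_rd)
    have le: "\<bar>h w * fejer T x\<bar> \<le> \<bar>h w\<bar> * (T / (2 * pi))" for w x
    proof -
      have "\<bar>h w\<bar> * fejer T x \<le> \<bar>h w\<bar> * (T / (2 * pi))" by (intro mult_left_mono fejer_le_const T) auto
      then show ?thesis using fejer_nonneg[OF T(1), of x] by (simp add: abs_mult)
    qed
    note F = Fubini_dominated[OF w.prob_space_axioms, of "\<lambda>(s, w). h w * fejer T (s - y' - w)" "\<lambda>w. \<bar>h w\<bar> * (T / (2 * pi))"]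
    have "E k (\<lambda>s. hT (s - y')) = (\<integral>w. (\<integral>s. h w * fejer T (s - y' - w) \<partial>walk \<mu> k) \<partial>lborel)"
      unfolding E_def hT_def using F(1) hi le by simp
    then show "E k (\<lambda>s. hT (s - y')) = (\<integral>w. h w * E k (\<lambda>s. fejer T (s - (y' + w))) \<partial>lborel)"
      unfolding E_def by (simp add: diff_diff_eq)
    show "integrable (walk \<mu> k) (\<lambda>s. hT (s - y'))"
      unfolding hT_def using F(2) hi le by simp
  qed
  have limT: "(\<lambda>n. sqrt (m n) * E (m n) (\<lambda>s. hT (s - y n))) \<longlonglongrightarrow> (\<integral>w. h w * L \<partial>lborel)"
  proof -
    have "(\<lambda>n. \<integral>w. h w * (sqrt (m n) * E (m n) (\<lambda>s. fejer T (s - (y n + w)))) \<partial>lborel) \<longlonglongrightarrow> (\<integral>w. h w * L \<partial>lborel)"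
    proof (rule integral_dominated_convergence[where w="\<lambda>w. \<bar>h w\<bar> * C2"])
      show "AE w in lborel. (\<lambda>n. h w * (sqrt (m n) * E (m n) (\<lambda>s. fejer T (s - (y n + w))))) \<longlonglongrightarrow> h w * L"
      proof (intro AE_I2 tendsto_intros)
        fix w :: real
        have "(\<lambda>k. w / sqrt (real k)) \<longlonglongrightarrow> 0" by real_asymp
        from tendsto_add[OF y filterlim_compose[OF this m(1)]]
        have "(\<lambda>n. (y n + w - a * m n) / sqrt (m n)) \<longlonglongrightarrow> z"
          by (simp add: add_divide_distrib diff_divide_distrib algebra_simps)
        from fejer_local_limit[OF T(1) m this]
        show "(\<lambda>n. sqrt (m n) * E (m n) (\<lambda>s. fejer T (s - (y n + w)))) \<longlonglongrightarrow> L" unfolding L_def .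
      qed
      show "AE w in lborel. norm (h w * (sqrt (m n) * E (m n) (\<lambda>s. fejer T (s - (y n + w))))) \<le> \<bar>h w\<bar> * C2" for n
      proof (intro AE_I2)
        fix w
        have "0 \<le> sqrt (m n) * E (m n) (\<lambda>s. fejer T (s - (y n + w)))"
          unfolding E_def by (intro mult_nonneg_nonneg integral_nonneg_AE AE_I2 fejer_nonneg T) auto
        with C2(2)[OF m(2), of n "y n + w"]
        show "norm (h w * (sqrt (m n) * E (m n) (\<lambda>s. fejer T (s - (y n + w))))) \<le> \<bar>h w\<bar> * C2"
          by (auto simp: abs_mult intro!: mult_left_mono)
      qed
      show "(\<lambda>w. h w * (sqrt (m n) * E (m n) (\<lambda>s. fejer T (s - (y n + w))))) \<in> borel_measurable lborel" for n
      proof -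
        interpret w: real_distribution "walk \<mu> (m n)" by (rule walk_rd)
        show ?thesis unfolding E_def by measurable
      qed
    qed (use hi in auto)
    moreover have "(\<integral>w. h w * (sqrt (m n) * E (m n) (\<lambda>s. fejer T (s - (y n + w)))) \<partial>lborel)
       = sqrt (m n) * E (m n) (\<lambda>s. hT (s - y n))" for n
    proof -
      have "h w * (sqrt (m n) * e) = sqrt (m n) * (h w * e)" for w e by simp
      then show ?thesis unfolding ET by (simp only: integral_mult_right_zero)
    qed
    ultimately show ?thesis by simp
  qed
  have close: "\<bar>sqrt (m n) * E (m n) (\<lambda>s. h (s - y n)) - sqrt (m n) * E (m n) (\<lambda>s. hT (s - y n))\<bar> \<le> \<epsilon> / 2" for n
  proof -
    have i0: "integrable (walk \<mu> (m n)) (\<lambda>s. h (s - y n))"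
      by (rule integrable_walk_bounded[where C=B])
        (auto intro: order_trans[OF dec] simp: divide_le_eq add_pos_nonneg mult_left_le[OF _ B] distrib_left B)
    have i: "integrable (walk \<mu> (m n)) (\<lambda>s. 1 / (1 + (s - y n)\<^sup>2))"
      by (rule integrable_walk_bounded[where C=1]) (auto simp: add_pos_nonneg divide_le_eq)
    have "\<bar>E (m n) (\<lambda>s. h (s - y n)) - E (m n) (\<lambda>s. hT (s - y n))\<bar> = \<bar>E (m n) (\<lambda>s. h (s - y n) - hT (s - y n))\<bar>"
      unfolding E_def using i0 hTi by simp
    also have "\<dots> \<le> E (m n) (\<lambda>s. \<eta> * (1 / (1 + (s - y n)\<^sup>2)))"
      unfolding E_def using T(2) i0 hTi i
      by (intro order_trans[OF integral_abs_bound] integral_mono integrable_abs Bochner_Integration.integrable_diff integrable_mult_right)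
         (auto simp: hT_def)
    also have "\<dots> = \<eta> * E (m n) (\<lambda>s. 1 / (1 + (s - y n)\<^sup>2))"
      unfolding E_def by (simp only: integral_mult_right_zero)
    finally have "sqrt (m n) * \<bar>E (m n) (\<lambda>s. h (s - y n)) - E (m n) (\<lambda>s. hT (s - y n))\<bar>
        \<le> sqrt (m n) * (\<eta> * E (m n) (\<lambda>s. 1 / (1 + (s - y n)\<^sup>2)))" by (intro mult_left_mono) auto
    also have "\<dots> = \<eta> * (sqrt (m n) * E (m n) (\<lambda>s. 1 / (1 + (s - y n)\<^sup>2)))" by simp
    also have "\<dots> \<le> \<eta> * C1" using \<eta> by (intro mult_left_mono C1 m(2)) auto
    also note \<eta>C
    finally show ?thesis by (simp add: right_diff_distrib[symmetric] abs_mult)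
  qed
  from LIMSEQ_D[OF limT, of "\<epsilon> / 2"] \<epsilon> obtain N where N: "\<And>n. n \<ge> N \<Longrightarrow>
     norm (sqrt (m n) * E (m n) (\<lambda>s. hT (s - y n)) - (\<integral>w. h w * L \<partial>lborel)) < \<epsilon> / 2" by auto
  show "\<exists>no. \<forall>n\<ge>no. norm (sqrt (m n) * E (m n) (\<lambda>s. h (s - y n)) - integral\<^sup>L lborel h * (exp (- (z\<^sup>2 / (2 * \<sigma>\<^sup>2))) / (sqrt (2 * pi) * \<sigma>))) < \<epsilon>"
  proof (intro exI[of _ N] allI impI)
    fix n assume "N \<le> n"
    from N[OF this] close[of n]
    show "norm (sqrt (m n) * E (m n) (\<lambda>s. h (s - y n)) - integral\<^sup>L lborel h * (exp (- (z\<^sup>2 / (2 * \<sigma>\<^sup>2))) / (sqrt (2 * pi) * \<sigma>))) < \<epsilon>"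
      unfolding L_def[symmetric] real_norm_def integral_mult_left_zero by linarith
  qed
qed

end

section \<open>The occupancy profile, its regularity and its integral\<close>

definition occ :: "real \<Rightarrow> real \<Rightarrow> real" where
  "occ \<theta> y = exp (\<theta> * y) * (1 - exp (- exp (- y)))"

lemma occ_measurable [measurable]: "occ \<theta> \<in> borel_measurable borel"
  unfolding occ_def[abs_def] by measurable

lemma occ_nonneg: "0 \<le> occ \<theta> y"
  by (simp add: occ_def)

lemma occ_deriv: "(occ \<theta> has_real_derivative \<theta> * occ \<theta> y - exp (\<theta> * y) * (exp (- y) * exp (- exp (- y)))) (at y)"
  unfolding occ_def[abs_def] by (auto intro!: derivative_eq_intros simp: algebra_simps)

lemma exp_mult_exp_exp_le: "exp (- y) * exp (- exp (- y)) \<le> 1" for y :: real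
proof -
  have "- y - exp (- y) \<le> 0" using exp_ge_add_one_self[of "- y"] by simp
  then have "exp (- y - exp (- y)) \<le> 1" by simp
  then show ?thesis by (simp add: exp_diff exp_minus divide_inverse)
qed

context
  fixes \<theta> :: real assumes \<theta>: "0 < \<theta>" "\<theta> < 1"
begin

text \<open>The bound r \<le> exp(-y) settles positive y with exponent 1 - \<theta>, and r \<le> 1
  settles negative y with exponent \<theta>: both ends need 0 < \<theta> < 1. It is applied to the
  profile itself and to the second term of its derivative.\<close>

lemma exp_min_bound:
  assumes "r \<le> 1" "r \<le> exp (- y)"
  shows "exp (\<theta> * y) * r \<le> exp (- (min \<theta> (1 - \<theta>) * \<bar>y\<bar>))"
proof (cases "y \<ge> 0")
  case True
  have "exp (\<theta> * y) * r \<le> exp (\<theta> * y) * exp (- y)" using assms by (intro mult_left_mono) auto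
  also have "\<dots> = exp (- ((1 - \<theta>) * y))" by (simp add: exp_add[symmetric] algebra_simps)
  also have "\<dots> \<le> exp (- (min \<theta> (1 - \<theta>) * \<bar>y\<bar>))" using True by (simp add: mult_right_mono)
  finally show ?thesis .
next
  case False
  have "exp (\<theta> * y) * r \<le> exp (\<theta> * y) * 1" using assms by (intro mult_left_mono) auto
  also have "\<dots> = exp (- (\<theta> * \<bar>y\<bar>))" using False by simp
  also have "\<dots> \<le> exp (- (min \<theta> (1 - \<theta>) * \<bar>y\<bar>))" by (simp add: mult_right_mono)
  finally show ?thesis .
qed

lemma one_minus_exp_le: "1 - exp (- exp (- y)) \<le> exp (- y)" for y :: real
  using exp_ge_add_one_self[of "- exp (- y)"] by simp

lemma occ_le: "occ \<theta> y \<le> exp (- (min \<theta> (1 - \<theta>) * \<bar>y\<bar>))"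
  unfolding occ_def by (rule exp_min_bound) (auto simp: one_minus_exp_le)

lemma occ_le_1: "occ \<theta> y \<le> 1"
proof -
  have "0 \<le> min \<theta> (1 - \<theta>) * \<bar>y\<bar>" using \<theta> by auto
  then show ?thesis using occ_le[of y] by (smt (verit) one_le_exp_iff exp_le_one_iff)
qed

lemma exp_le_cauchy:
  "exp (- (min \<theta> (1 - \<theta>) * \<bar>y\<bar>)) \<le> (2 / (min \<theta> (1 - \<theta>))\<^sup>2) / (1 + y\<^sup>2)"
proof -
  define \<eta> where "\<eta> = min \<theta> (1 - \<theta>)"
  have \<eta>: "0 < \<eta>" "\<eta> \<le> 1" using \<theta> by (auto simp: \<eta>_def)
  then have "\<eta>\<^sup>2 \<le> 1" by (simp add: power_le_one)
  have "(1 + y\<^sup>2) * (\<eta>\<^sup>2 / 2) \<le> 1 + \<eta> * \<bar>y\<bar> + (\<eta> * \<bar>y\<bar>)\<^sup>2 / 2"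
    using \<open>\<eta>\<^sup>2 \<le> 1\<close> \<eta> by (simp add: power_mult_distrib algebra_simps) (smt (verit) mult_nonneg_nonneg abs_ge_zero)
  also have "\<dots> \<le> exp (\<eta> * \<bar>y\<bar>)" using \<eta> by (intro exp_lower_Taylor_quadratic) auto
  finally have *: "(1 + y\<^sup>2) * (\<eta>\<^sup>2 / 2) \<le> exp (\<eta> * \<bar>y\<bar>)" .
  have "1 + y\<^sup>2 > 0" by (simp add: add_pos_nonneg)
  then have "inverse (exp (\<eta> * \<bar>y\<bar>)) \<le> inverse ((1 + y\<^sup>2) * (\<eta>\<^sup>2 / 2))"
    using * \<eta> by (intro le_imp_inverse_le) auto
  then show ?thesis by (simp add: \<eta>_def[symmetric] exp_minus field_simps)
qed

text \<open>The constant is enlarged from 2 to 12 to agree with \<open>occ_lipschitz\<close>, where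
  the factor 2 e \<le> 6 appears; the local limit theorem takes one constant for both.\<close>

lemma occ_decay: "\<bar>occ \<theta> x\<bar> \<le> (12 / (min \<theta> (1 - \<theta>))\<^sup>2) / (1 + x\<^sup>2)"
proof -
  have "\<bar>occ \<theta> x\<bar> \<le> (2 / (min \<theta> (1 - \<theta>))\<^sup>2) / (1 + x\<^sup>2)"
    using occ_le[of x] exp_le_cauchy[of x] occ_nonneg[of \<theta> x] by simp
  also have "\<dots> \<le> (12 / (min \<theta> (1 - \<theta>))\<^sup>2) / (1 + x\<^sup>2)"
    by (intro divide_right_mono) auto
  finally show ?thesis .
qed

lemma occ_lipschitz:
  assumes u: "\<bar>u\<bar> \<le> 1"
  shows "\<bar>occ \<theta> x - occ \<theta> (x - u)\<bar> \<le> (12 / (min \<theta> (1 - \<theta>))\<^sup>2) * \<bar>u\<bar> / (1 + x\<^sup>2)"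
proof -
  define \<eta> where "\<eta> = min \<theta> (1 - \<theta>)"
  have \<eta>: "0 < \<eta>" "\<eta> \<le> 1" using \<theta> by (auto simp: \<eta>_def)
  have der: "\<bar>\<theta> * occ \<theta> y - exp (\<theta> * y) * (exp (- y) * exp (- exp (- y)))\<bar> \<le> 2 * exp 1 * exp (- (\<eta> * \<bar>x\<bar>))"
    if "\<bar>x - y\<bar> \<le> 1" for y
  proof -
    have "exp (- y) * exp (- exp (- y)) \<le> 1"
      by (rule exp_mult_exp_exp_le)
    moreover have "exp (- y) * exp (- exp (- y)) \<le> exp (- y)" by simp
    ultimately have 1: "exp (\<theta> * y) * (exp (- y) * exp (- exp (- y))) \<le> exp (- (\<eta> * \<bar>y\<bar>))"
      unfolding \<eta>_def by (intro exp_min_bound) auto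
    have "\<theta> * occ \<theta> y \<le> 1 * occ \<theta> y" using \<theta> by (intro mult_right_mono occ_nonneg) auto
    then have 2: "\<theta> * occ \<theta> y \<le> exp (- (\<eta> * \<bar>y\<bar>))" using occ_le[of y] by (simp add: \<eta>_def)
    have "0 \<le> \<theta> * occ \<theta> y" "0 \<le> exp (\<theta> * y) * (exp (- y) * exp (- exp (- y)))"
      using \<theta> occ_nonneg[of \<theta> y] by auto
    then have "\<bar>\<theta> * occ \<theta> y - exp (\<theta> * y) * (exp (- y) * exp (- exp (- y)))\<bar> \<le> 2 * exp (- (\<eta> * \<bar>y\<bar>))"
      using 1 2 by linarith
    also have "exp (- (\<eta> * \<bar>y\<bar>)) \<le> exp (1 - \<eta> * \<bar>x\<bar>)"
    proof -
      have "\<eta> * \<bar>x\<bar> \<le> \<eta> * (\<bar>y\<bar> + 1)" using that \<eta> by (intro mult_left_mono) auto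
      then show ?thesis using \<eta> by (simp add: algebra_simps)
    qed
    finally show ?thesis by (simp add: exp_diff exp_minus field_simps)
  qed
  have "\<bar>occ \<theta> x - occ \<theta> (x - u)\<bar> \<le> 2 * exp 1 * exp (- (\<eta> * \<bar>x\<bar>)) * \<bar>x - (x - u)\<bar>"
  proof (rule field_differentiable_bound[of "cball x 1", unfolded real_norm_def])
    show "(occ \<theta> has_field_derivative \<theta> * occ \<theta> z - exp (\<theta> * z) * (exp (- z) * exp (- exp (- z)))) (at z within cball x 1)" for z
      by (rule has_field_derivative_at_within[OF occ_deriv])
    show "\<bar>\<theta> * occ \<theta> z - exp (\<theta> * z) * (exp (- z) * exp (- exp (- z)))\<bar> \<le> 2 * exp 1 * exp (- (\<eta> * \<bar>x\<bar>))" if "z \<in> cball x 1" for z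
      using that by (intro der) (auto simp: dist_real_def)
  qed (use u in \<open>auto simp: dist_real_def\<close>)
  also have "\<dots> = 2 * exp 1 * (\<bar>u\<bar> * exp (- (\<eta> * \<bar>x\<bar>)))" by simp
  also have "\<dots> \<le> 6 * (\<bar>u\<bar> * ((2 / \<eta>\<^sup>2) / (1 + x\<^sup>2)))"
    using exp_le exp_le_cauchy[of x] by (intro mult_mono mult_left_mono) (auto simp: \<eta>_def)
  finally show ?thesis by (simp add: \<eta>_def)
qed

lemma integrable_occ: "integrable lborel (occ \<theta>)"
  using occ_decay by (intro Bochner_Integration.integrable_bound[OF integrable_mult_right[OF integrable_cauchy, of "12 / (min \<theta> (1 - \<theta>))\<^sup>2"]]) auto

text \<open>Integration by parts in disguise: the derivative of the profile is
  \<open>\<theta> * occ \<theta> y - g y\<close>, and its integral is 0 because the profile vanishes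
  at both ends. The substitution t = exp(-y) turns the integral of \<open>g\<close> into the Gamma
  integral at 1 - \<theta>.\<close>

lemma integral_occ: "(\<integral>y. occ \<theta> y \<partial>lborel) = Gamma (1 - \<theta>) / \<theta>"
proof -
  define g where "g y = exp (\<theta> * y) * (exp (- y) * exp (- exp (- y)))" for y
  have g0: "0 \<le> g y" for y by (simp add: g_def)
  have gle: "g y \<le> exp (- (min \<theta> (1 - \<theta>) * \<bar>y\<bar>))" for y
  proof -
    have "exp (- y) * exp (- exp (- y)) \<le> 1"
      by (rule exp_mult_exp_exp_le)
    then show ?thesis unfolding g_def by (intro exp_min_bound) auto
  qed
  have [measurable]: "g \<in> borel_measurable borel" by (simp add: g_def[abs_def])
  have gi: "integrable lborel g"
    using g0 order_trans[OF gle exp_le_cauchy] by (intro Bochner_Integration.integrable_bound[OF integrable_mult_right[OF integrable_cauchy, of "2 / (min \<theta> (1 - \<theta>))\<^sup>2"]]) auto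
  have E: "einterval (-\<infinity>) \<infinity> = UNIV" by simp
  have 1: "(\<integral>y. \<theta> * occ \<theta> y - g y \<partial>lborel) = 0"
  proof -
    have lim1: "(occ \<theta> \<longlongrightarrow> 0) at_bot"
      unfolding occ_def[abs_def] using \<theta> by real_asymp
    have lim2: "(occ \<theta> \<longlongrightarrow> 0) at_top"
      unfolding occ_def[abs_def] using \<theta> by real_asymp
    have "(LBINT y=-\<infinity>..\<infinity>. \<theta> * occ \<theta> y - g y) = 0 - 0"
    proof (rule interval_integral_FTC_integrable[where F="occ \<theta>"])
      show "(occ \<theta> has_vector_derivative \<theta> * occ \<theta> x - g x) (at x)" for x
        using occ_deriv[of \<theta> x] by (simp add: g_def has_real_derivative_iff_has_vector_derivative)
      show "isCont (\<lambda>y. \<theta> * occ \<theta> y - g y) x" for x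
        unfolding occ_def g_def by (intro continuous_intros)
      show "set_integrable lborel (einterval (-\<infinity>) \<infinity>) (\<lambda>y. \<theta> * occ \<theta> y - g y)"
        using integrable_occ gi by (auto simp: set_integrable_def)
    qed (use lim1 lim2 in \<open>auto simp: ereal_tendsto_simps\<close>)
    then show ?thesis by (simp add: interval_lebesgue_integral_def set_lebesgue_integral_def)
  qed
  define f where "f t = t powr (- \<theta>) / exp t" for t :: real
  have "(\<integral>y. g y \<partial>lborel) = (\<integral>y. g (- y) \<partial>lborel)"
    using lborel_integral_real_affine[of "-1" g 0] by simp
  also have "\<dots> = (\<integral>y. f (exp y) * exp y \<partial>lborel)"
    by (intro Bochner_Integration.integral_cong)
      (auto simp: g_def f_def powr_def exp_minus divide_inverse mult_ac)
  also have "\<dots> = Gamma (1 - \<theta>)"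
  proof -
    have fg: "f (exp y) * exp y = g (- y)" for y
      by (auto simp: g_def f_def powr_def exp_minus divide_inverse mult_ac)
    have "integrable lborel (\<lambda>y. g (- y))"
      using lborel_integrable_real_affine[OF gi, of "-1" 0] by simp
    then have si: "set_integrable lborel (einterval (-\<infinity>) \<infinity>) (\<lambda>y. f (exp y) * exp y)"
      by (simp add: set_integrable_def fg)
    have E0: "einterval 0 \<infinity> = {0<..}" by (auto simp: einterval_def)
    have f0: "0 \<le> f t" for t by (simp add: f_def)
    have c: "isCont f (exp x)" for x unfolding f_def by (intro continuous_intros) auto
    have l: "((ereal \<circ> exp \<circ> real_of_ereal) \<longlongrightarrow> 0) (at_right (- \<infinity>))" "((ereal \<circ> exp \<circ> real_of_ereal) \<longlongrightarrow> \<infinity>) (at_left \<infinity>)"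
      by (simp_all add: ereal_tendsto_simps zero_ereal_def exp_at_bot exp_at_top)
    have sub: "(LBINT x=0..\<infinity>. f x) = (LBINT x=-\<infinity>..\<infinity>. f (exp x) * exp x)"
      by (rule interval_integral_substitution_nonneg(2)[where g=exp and g'=exp and f=f, OF _ _ _ _ _ _ _ _ si])
         (use c l in \<open>auto simp: f0\<close>)
    have "(\<integral>x. indicator {0<..} x * f x \<partial>lborel) = enn2real (\<integral>\<^sup>+x. ennreal (indicator {0<..} x * f x) \<partial>lborel)"
      by (rule integral_eq_nn_integral) (auto simp: f_def)
    also have "(\<integral>\<^sup>+x. ennreal (indicator {0<..} x * f x) \<partial>lborel)
        = (\<integral>\<^sup>+t. ennreal (indicator {0..} t * t powr (1 - \<theta> - 1) / exp t) \<partial>lborel)"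
      by (intro nn_integral_cong) (auto simp: f_def indicator_def)
    also have "\<dots> = ennreal (Gamma (1 - \<theta>))"
      using Gamma_conv_nn_integral_real[of "1 - \<theta>"] \<theta> by simp
    also have "enn2real (ennreal (Gamma (1 - \<theta>))) = Gamma (1 - \<theta>)"
      using \<theta> by (simp add: Gamma_real_pos less_imp_le)
    finally show ?thesis using sub
      by (simp add: interval_lebesgue_integral_def set_lebesgue_integral_def E0)
  qed
  finally show ?thesis using 1 \<theta> integrable_occ gi by (simp add: field_simps)
qed

end

section \<open>Branching random walk\<close>

abbreviation seqM :: "(nat \<Rightarrow> real) measure" where "seqM \<equiv> Pi\<^sub>M UNIV (\<lambda>_. borel)"

definition words :: "nat \<Rightarrow> nat list set" where "words j = {u. length u = j}"

lemma countable_words [simp]: "countable (words j)"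
  by (rule countableI_type)

lemma Pprod_Nil [simp]: "Pprod Q [] = 1"
  by (simp add: Pprod_def)

lemma Pprod_snoc: "Pprod Q (v @ [k]) = Pprod Q v * Q v k"
  by (simp add: Pprod_def nth_append)

lemma disjoint_words: "{u. length u < i} \<inter> words i = {}"
  by (auto simp: words_def)

lemma Pprod_restrict: "v \<in> words i \<Longrightarrow> Pprod (restrict Q {u. length u < i}) v = Pprod Q v"
  unfolding Pprod_def words_def by (intro prod.cong) auto

lemma Pprod_nonneg: "(\<And>u k. 0 \<le> Q u k) \<Longrightarrow> 0 \<le> Pprod Q u"
  unfolding Pprod_def by (intro prod_nonneg) auto

lemma words_0: "words 0 = {[]}"
  by (auto simp: words_def)

lemma nn_integral_words_Suc:
  fixes f :: "nat list \<Rightarrow> ennreal"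
  shows "(\<integral>\<^sup>+u. f u \<partial>count_space (words (Suc i))) = (\<integral>\<^sup>+v. (\<Sum>k. f (v @ [k])) \<partial>count_space (words i))"
proof -
  have bij: "bij_betw (\<lambda>(v, k). v @ [k]) (words i \<times> UNIV) (words (Suc i))"
  proof (rule bij_betwI[where g="\<lambda>u. (butlast u, last u)"])
    show "(\<lambda>u. (butlast u, last u)) \<in> words (Suc i) \<rightarrow> words i \<times> UNIV" by (auto simp: words_def)
    show "(case (butlast u, last u) of (v, k) \<Rightarrow> v @ [k]) = u" if "u \<in> words (Suc i)" for u
      using that by (auto simp: words_def intro!: append_butlast_last_id)
  qed (auto simp: words_def)
  interpret sigma_finite_measure "count_space (UNIV :: nat set)" by (rule sigma_finite_measure_count_space)
  have "(\<integral>\<^sup>+u. f u \<partial>count_space (words (Suc i))) = (\<integral>\<^sup>+x. f (fst x @ [snd x]) \<partial>count_space (words i \<times> UNIV))"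
    unfolding nn_integral_bij_count_space[OF bij, symmetric] by (simp add: split_beta')
  also have "count_space (words i \<times> UNIV) = count_space (words i) \<Otimes>\<^sub>M count_space (UNIV :: nat set)"
    by (rule pair_measure_countable[symmetric]) auto
  also have "(\<integral>\<^sup>+x. f (fst x @ [snd x]) \<partial>(count_space (words i) \<Otimes>\<^sub>M count_space (UNIV :: nat set)))
     = (\<integral>\<^sup>+v. \<integral>\<^sup>+k. f (v @ [k]) \<partial>count_space UNIV \<partial>count_space (words i))"
    by (subst nn_integral_fst[symmetric]) (auto simp: pair_measure_countable)
  finally show ?thesis by (simp add: nn_integral_count_space_nat)
qed

text \<open>The tangent to the convex function x^\<pi> at c lies below its graph; this is Young's
  inequality rearranged.\<close>

lemma Youngs_tangent:
  fixes x c \<pi> :: real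
  assumes "x \<ge> 0" "c \<ge> 0" "\<pi> > 1"
  shows "\<pi> * c powr (\<pi> - 1) * x \<le> x powr \<pi> + (\<pi> - 1) * c powr \<pi>"
proof (cases "x = 0 \<or> c = 0")
  case True then show ?thesis using assms by auto
next
  case False
  then have xc: "x > 0" "c > 0" using assms by auto
  have "(x powr \<pi>) powr (1 / \<pi>) * (c powr \<pi>) powr (1 - 1 / \<pi>) \<le> 1 / \<pi> * x powr \<pi> + (1 - 1 / \<pi>) * c powr \<pi>"
    using assms xc by (intro Youngs_inequality_0) auto
  also have "(x powr \<pi>) powr (1 / \<pi>) = x" using assms xc by (simp add: powr_powr)
  also have "(c powr \<pi>) powr (1 - 1 / \<pi>) = c powr (\<pi> - 1)" using assms xc by (simp add: powr_powr right_diff_distrib)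
  finally have "\<pi> * (x * c powr (\<pi> - 1)) \<le> \<pi> * (1 / \<pi> * x powr \<pi> + (1 - 1 / \<pi>) * c powr \<pi>)"
    using assms by (intro mult_left_mono) auto
  also have "\<pi> * (1 / \<pi> * A + (1 - 1 / \<pi>) * C) = A + (\<pi> - 1) * C" for A C
    using assms by (simp add: field_simps)
  finally show ?thesis by (simp add: ac_simps)
qed

text \<open>Jensen's inequality for the probability weights \<open>q k\<close> and the values \<open>q k powr (\<theta> - 1)\<close>.\<close>

lemma powr_sum_le:
  fixes q :: "nat \<Rightarrow> real"
  assumes q: "\<And>k. 0 \<le> q k" "q sums 1" and \<pi>: "\<pi> > 1"
  shows "ennreal (enn2real (\<Sum>k. ennreal (q k powr \<theta>)) powr \<pi>) \<le> (\<Sum>k. ennreal (q k powr (1 - \<pi> * (1 - \<theta>))))"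
proof (cases "(\<Sum>k. ennreal (q k powr \<theta>)) = \<infinity>")
  case True then show ?thesis by simp
next
  case False
  \<comment> \<open>The tangent point is the mean itself, under the probability weights
    \<open>q k\<close>, of the values \<open>q k powr (\<theta> - 1)\<close>. With this choice the
    tangent bounds add up to Jensen's inequality.\<close>
  define c where "c = enn2real (\<Sum>k. ennreal (q k powr \<theta>))"
  have c: "(\<Sum>k. ennreal (q k powr \<theta>)) = ennreal c" "c \<ge> 0" using False by (simp_all add: c_def)
  have pw: "ennreal (\<pi> * c powr (\<pi> - 1)) * ennreal (q k powr \<theta>)
      \<le> ennreal (q k powr (1 - \<pi> * (1 - \<theta>))) + ennreal ((\<pi> - 1) * c powr \<pi>) * ennreal (q k)" for k
  proof (cases "q k = 0")
    case True then show ?thesis by simp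
  next
    case False
    then have qk: "q k > 0" using q(1)[of k] by simp
    have "q k * (\<pi> * c powr (\<pi> - 1) * (q k powr (\<theta> - 1))) \<le> q k * ((q k powr (\<theta> - 1)) powr \<pi> + (\<pi> - 1) * c powr \<pi>)"
      using qk c \<pi> by (intro mult_left_mono Youngs_tangent) auto
    moreover have "q k * q k powr (\<theta> - 1) = q k powr \<theta>"
      using qk by (simp add: powr_diff)
    moreover have "q k * (q k powr (\<theta> - 1)) powr \<pi> = q k powr (1 - \<pi> * (1 - \<theta>))"
      using qk powr_add[of "q k" 1 "(\<theta> - 1) * \<pi>"] by (simp add: powr_powr algebra_simps)
    moreover have "q k * (\<pi> * c powr (\<pi> - 1) * (q k powr (\<theta> - 1))) = \<pi> * c powr (\<pi> - 1) * (q k * q k powr (\<theta> - 1))"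
      by simp
    moreover have "q k * ((q k powr (\<theta> - 1)) powr \<pi> + (\<pi> - 1) * c powr \<pi>) = q k * (q k powr (\<theta> - 1)) powr \<pi> + (\<pi> - 1) * c powr \<pi> * q k"
      by (simp add: distrib_left)
    ultimately have "\<pi> * c powr (\<pi> - 1) * q k powr \<theta> \<le> q k powr (1 - \<pi> * (1 - \<theta>)) + (\<pi> - 1) * c powr \<pi> * q k"
      by (simp only:)
    then have "ennreal (\<pi> * c powr (\<pi> - 1) * q k powr \<theta>) \<le> ennreal (q k powr (1 - \<pi> * (1 - \<theta>)) + (\<pi> - 1) * c powr \<pi> * q k)"
      by (rule ennreal_leI)
    then show ?thesis using qk \<pi> by (simp add: ennreal_plus ennreal_mult)
  qed
  have sq: "(\<Sum>k. ennreal (q k)) = 1"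
    using suminf_ennreal2[OF q(1)] q(2) by (simp add: sums_iff)
  define S where "S = (\<Sum>k. ennreal (q k powr (1 - \<pi> * (1 - \<theta>))))"
  have "ennreal (\<pi> * c powr \<pi>) = ennreal (\<pi> * c powr (\<pi> - 1)) * ennreal c"
  proof (cases "c = 0")
    case False
    then have "c powr (\<pi> - 1) * c = c powr \<pi>" using c by (simp add: powr_diff)
    then show ?thesis using c \<pi> by (simp flip: ennreal_mult add: mult.assoc)
  qed simp
  also have "\<dots> = (\<Sum>k. ennreal (\<pi> * c powr (\<pi> - 1)) * ennreal (q k powr \<theta>))"
    by (simp add: c(1))
  also have "\<dots> \<le> (\<Sum>k. ennreal (q k powr (1 - \<pi> * (1 - \<theta>))) + ennreal ((\<pi> - 1) * c powr \<pi>) * ennreal (q k))"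
    by (intro suminf_le pw summableI)
  also have "\<dots> = S + ennreal ((\<pi> - 1) * c powr \<pi>)"
    by (simp add: suminf_add[symmetric] sq S_def)
  finally have *: "ennreal (\<pi> * c powr \<pi>) \<le> S + ennreal ((\<pi> - 1) * c powr \<pi>)" .
  have "ennreal (c powr \<pi>) \<le> S"
  proof (cases S)
    case (real s)
    then have "\<pi> * c powr \<pi> \<le> s + (\<pi> - 1) * c powr \<pi>"
      using * \<pi> by (simp flip: ennreal_plus)
    then show ?thesis using real by (simp add: algebra_simps ennreal_leI)
  qed simp
  then show ?thesis by (simp add: c_def S_def)
qed

locale brw = prob_space M for M :: "'a measure" +
  fixes P :: "'a \<Rightarrow> nat list \<Rightarrow> nat \<Rightarrow> real"
  assumes P_indep: "indep_vars (\<lambda>_. seqM) (\<lambda>u \<omega>. P \<omega> u) UNIV"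
    and P_ident: "\<And>u. distr M seqM (\<lambda>\<omega>. P \<omega> u) = distr M seqM (\<lambda>\<omega>. P \<omega> [])"
    and P_nonneg: "\<And>\<omega> u k. 0 \<le> P \<omega> u k"
    and P_sums: "\<And>\<omega> u. (\<lambda>k. P \<omega> u k) sums 1"
begin

abbreviation p :: "'a \<Rightarrow> nat list \<Rightarrow> real" where "p \<omega> u \<equiv> Pprod (P \<omega>) u"

lemma P_le_1: "P \<omega> u k \<le> 1"
proof -
  have "(\<Sum>i\<in>{k}. P \<omega> u i) \<le> (\<Sum>i. P \<omega> u i)"
    using P_sums[of \<omega> u] P_nonneg by (intro sum_le_suminf) (auto simp: sums_iff)
  then show ?thesis using P_sums[of \<omega> u] by (simp add: sums_iff)
qed

lemma p_nonneg: "0 \<le> p \<omega> u"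
  by (rule Pprod_nonneg) (rule P_nonneg)

lemma p_le_1: "p \<omega> u \<le> 1"
  unfolding Pprod_def by (intro prod_le_1) (auto simp: P_nonneg P_le_1)

lemma P_vec_measurable [measurable]: "(\<lambda>\<omega>. P \<omega> u) \<in> measurable M seqM"
  using P_indep by (auto simp: indep_vars_def)

lemma P_measurable [measurable]: "(\<lambda>\<omega>. P \<omega> u k) \<in> borel_measurable M"
  using measurable_compose[OF P_vec_measurable measurable_component_singleton[of k UNIV]] by simp

lemma p_measurable [measurable]: "(\<lambda>\<omega>. p \<omega> u) \<in> borel_measurable M"
  unfolding Pprod_def by measurable

lemma nn_integral_P:
  assumes [measurable]: "f \<in> borel_measurable seqM"
  shows "(\<integral>\<^sup>+\<omega>. f (P \<omega> u) \<partial>M) = (\<integral>\<^sup>+\<omega>. f (P \<omega> []) \<partial>M)"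
proof -
  have "(\<integral>\<^sup>+\<omega>. f (P \<omega> u) \<partial>M) = (\<integral>\<^sup>+q. f q \<partial>distr M seqM (\<lambda>\<omega>. P \<omega> u))"
    by (simp add: nn_integral_distr)
  also have "\<dots> = (\<integral>\<^sup>+\<omega>. f (P \<omega> []) \<partial>M)"
    by (subst P_ident) (simp add: nn_integral_distr)
  finally show ?thesis .
qed

text \<open>Independence of two disjoint blocks of words as a Fubini formula. A second sample point
  of the same space plays the independent copy, so no product space is built.\<close>

lemma decouple:
  assumes disj: "A \<inter> B = {}"
    and [measurable]: "\<Phi> \<in> borel_measurable (Pi\<^sub>M A (\<lambda>_. seqM) \<Otimes>\<^sub>M Pi\<^sub>M B (\<lambda>_. seqM))"
  shows "(\<integral>\<^sup>+\<omega>. \<Phi> (restrict (P \<omega>) A, restrict (P \<omega>) B) \<partial>M)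
    = (\<integral>\<^sup>+\<omega>. \<integral>\<^sup>+\<omega>'. \<Phi> (restrict (P \<omega>) A, restrict (P \<omega>') B) \<partial>M \<partial>M)"
proof -
  let ?A = "\<lambda>\<omega>. restrict (P \<omega>) A" and ?B = "\<lambda>\<omega>. restrict (P \<omega>) B"
  let ?MA = "Pi\<^sub>M A (\<lambda>_. seqM)" and ?MB = "Pi\<^sub>M B (\<lambda>_. seqM)"
  have "indep_var ?MA ?A ?MB ?B"
    by (rule indep_var_restrict[OF P_indep disj]) auto
  then have [measurable]: "?A \<in> measurable M ?MA" "?B \<in> measurable M ?MB"
    and eq: "distr M ?MA ?A \<Otimes>\<^sub>M distr M ?MB ?B = distr M (?MA \<Otimes>\<^sub>M ?MB) (\<lambda>\<omega>. (?A \<omega>, ?B \<omega>))"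
    by (auto simp: indep_var_distribution_eq)
  interpret B: prob_space "distr M ?MB ?B" by (rule prob_space_distr) simp
  have "(\<integral>\<^sup>+\<omega>. \<Phi> (?A \<omega>, ?B \<omega>) \<partial>M) = (\<integral>\<^sup>+x. \<Phi> x \<partial>distr M (?MA \<Otimes>\<^sub>M ?MB) (\<lambda>\<omega>. (?A \<omega>, ?B \<omega>)))"
    by (simp add: nn_integral_distr)
  also have "\<dots> = (\<integral>\<^sup>+a. \<integral>\<^sup>+b. \<Phi> (a, b) \<partial>distr M ?MB ?B \<partial>distr M ?MA ?A)"
    unfolding eq[symmetric] by (rule B.nn_integral_fst[symmetric]) simp
  also have "\<dots> = (\<integral>\<^sup>+\<omega>. \<integral>\<^sup>+b. \<Phi> (?A \<omega>, b) \<partial>distr M ?MB ?B \<partial>M)"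
    by (subst nn_integral_distr) auto
  also have "\<dots> = (\<integral>\<^sup>+\<omega>. \<integral>\<^sup>+\<omega>'. \<Phi> (?A \<omega>, ?B \<omega>') \<partial>M \<partial>M)"
    by (intro nn_integral_cong) (subst nn_integral_distr, auto)
  finally show ?thesis .
qed

lemma Pprod_fst_measurable:
  assumes "v \<in> words i"
  shows "(\<lambda>x. Pprod (fst x) v) \<in> borel_measurable (Pi\<^sub>M {u. length u < i} (\<lambda>_. seqM) \<Otimes>\<^sub>M Pi\<^sub>M (words i) (\<lambda>_. seqM))"
  unfolding Pprod_def
proof (rule borel_measurable_prod)
  fix k assume k: "k \<in> {..<length v}"
  have "(\<lambda>x. fst x (take k v)) \<in> measurable (Pi\<^sub>M {u. length u < i} (\<lambda>_. seqM) \<Otimes>\<^sub>M Pi\<^sub>M (words i) (\<lambda>_. seqM)) seqM"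
    by (rule measurable_compose[OF measurable_fst measurable_component_singleton]) (use k assms in \<open>auto simp: words_def\<close>)
  from measurable_compose[OF this measurable_component_singleton[of "v ! k" UNIV]]
  show "(\<lambda>x. fst x (take k v) (v ! k)) \<in> borel_measurable (Pi\<^sub>M {u. length u < i} (\<lambda>_. seqM) \<Otimes>\<^sub>M Pi\<^sub>M (words i) (\<lambda>_. seqM))"
    by simp
qed

lemma snd_measurable:
  assumes "v \<in> words i"
  shows "(\<lambda>x. snd x v) \<in> measurable (Pi\<^sub>M {u. length u < i} (\<lambda>_. seqM) \<Otimes>\<^sub>M Pi\<^sub>M (words i) (\<lambda>_. seqM)) seqM"
  by (rule measurable_compose[OF measurable_snd measurable_component_singleton]) (use assms in auto)

lemma one_step_expectation:
  fixes g :: "real \<Rightarrow> (nat \<Rightarrow> real) \<Rightarrow> ennreal"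
  assumes [measurable]: "(\<lambda>x. g (fst x) (snd x)) \<in> borel_measurable (borel \<Otimes>\<^sub>M seqM)"
  shows "(\<integral>\<^sup>+\<omega>. \<integral>\<^sup>+v. g (p \<omega> v) (P \<omega> v) \<partial>count_space (words i) \<partial>M)
     = (\<integral>\<^sup>+\<omega>. \<integral>\<^sup>+v. (\<integral>\<^sup>+\<omega>'. g (p \<omega> v) (P \<omega>' []) \<partial>M) \<partial>count_space (words i) \<partial>M)"
proof -
  define \<Phi> where "\<Phi> x = (\<integral>\<^sup>+v. g (Pprod (fst x) v) (snd x v) \<partial>count_space (words i))" for x :: "(nat list \<Rightarrow> nat \<Rightarrow> real) \<times> (nat list \<Rightarrow> nat \<Rightarrow> real)"
  have [measurable]: "\<Phi> \<in> borel_measurable (Pi\<^sub>M {u. length u < i} (\<lambda>_. seqM) \<Otimes>\<^sub>M Pi\<^sub>M (words i) (\<lambda>_. seqM))"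
    unfolding \<Phi>_def[abs_def]
  proof (rule borel_measurable_nn_integral_count_space[OF countable_words])
    fix v assume v: "v \<in> words i"
    show "(\<lambda>x. g (Pprod (fst x) v) (snd x v)) \<in> borel_measurable (Pi\<^sub>M {u. length u < i} (\<lambda>_. seqM) \<Otimes>\<^sub>M Pi\<^sub>M (words i) (\<lambda>_. seqM))"
      using measurable_compose[OF measurable_Pair[OF Pprod_fst_measurable[OF v] snd_measurable[OF v]] assms] by simp
  qed
  have meas: "g x \<in> borel_measurable seqM" for x
    using measurable_compose[OF measurable_Pair1' assms, of x] by simp
  have \<Phi>: "\<Phi> (restrict (P \<omega>) {u. length u < i}, restrict (P \<omega>') (words i)) = (\<integral>\<^sup>+v. g (p \<omega> v) (P \<omega>' v) \<partial>count_space (words i))" for \<omega> \<omega>'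
    unfolding \<Phi>_def by (intro nn_integral_cong) (simp add: Pprod_restrict)
  have "(\<integral>\<^sup>+\<omega>. \<integral>\<^sup>+v. g (p \<omega> v) (P \<omega> v) \<partial>count_space (words i) \<partial>M)
    = (\<integral>\<^sup>+\<omega>. \<integral>\<^sup>+\<omega>'. \<integral>\<^sup>+v. g (p \<omega> v) (P \<omega>' v) \<partial>count_space (words i) \<partial>M \<partial>M)"
    using decouple[of "{u. length u < i}" "words i" \<Phi>] unfolding \<Phi> by (simp add: disjoint_words)
  also have "\<dots> = (\<integral>\<^sup>+\<omega>. \<integral>\<^sup>+v. \<integral>\<^sup>+\<omega>'. g (p \<omega> v) (P \<omega>' v) \<partial>M \<partial>count_space (words i) \<partial>M)"
    by (intro nn_integral_cong nn_integral_count_space_nn_integral countable_words measurable_compose[OF P_vec_measurable meas])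
  also have "\<dots> = (\<integral>\<^sup>+\<omega>. \<integral>\<^sup>+v. (\<integral>\<^sup>+\<omega>'. g (p \<omega> v) (P \<omega>' []) \<partial>M) \<partial>count_space (words i) \<partial>M)"
    by (intro nn_integral_cong nn_integral_P meas)
  finally show ?thesis .
qed

text \<open>For frozen first i generations the contributions of the words of length i are
  independent, and \<open>L1_deviation_sum_le\<close> applies to them; the resulting bound is then
  averaged over the past. The word v enters the mean and the moment bound only through
  \<open>p \<omega> v\<close>, since all offspring vectors have the law of the root.\<close>

lemma one_step_L1:
  fixes g :: "real \<Rightarrow> (nat \<Rightarrow> real) \<Rightarrow> real"
  assumes [measurable]: "(\<lambda>x. g (fst x) (snd x)) \<in> borel_measurable (borel \<Otimes>\<^sub>M seqM)"
    and nonneg: "\<And>x q. 0 \<le> g x q" and \<pi>: "1 \<le> \<pi>" "\<pi> \<le> 2" and \<epsilon>: "\<epsilon> > 0"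
    and m: "\<And>\<omega> v. (\<integral>\<^sup>+\<omega>'. ennreal (g (p \<omega> v) (P \<omega>' [])) \<partial>M) = m (p \<omega> v)"
    and [measurable]: "m \<in> borel_measurable borel"
    and r: "\<And>\<omega> v. (\<integral>\<^sup>+\<omega>'. ennreal (g (p \<omega> v) (P \<omega>' []) powr \<pi>) \<partial>M) \<le> r (p \<omega> v)"
    and [measurable]: "r \<in> borel_measurable borel"
    and fin: "(\<integral>\<^sup>+\<omega>. \<integral>\<^sup>+v. m (p \<omega> v) \<partial>count_space (words i) \<partial>M) < \<infinity>"
  shows "(\<integral>\<^sup>+\<omega>. ennreal \<bar>enn2real (\<integral>\<^sup>+v. ennreal (g (p \<omega> v) (P \<omega> v)) \<partial>count_space (words i))
              - enn2real (\<integral>\<^sup>+v. m (p \<omega> v) \<partial>count_space (words i))\<bar> \<partial>M)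
     \<le> ennreal (\<epsilon> / 2) + ennreal (1 / (2 * \<epsilon>) + 2) * (\<integral>\<^sup>+\<omega>. \<integral>\<^sup>+v. r (p \<omega> v) \<partial>count_space (words i) \<partial>M)"
proof -
  define \<Phi> where "\<Phi> x = ennreal \<bar>enn2real (\<integral>\<^sup>+v. ennreal (g (Pprod (fst x) v) (snd x v)) \<partial>count_space (words i))
      - enn2real (\<integral>\<^sup>+v. m (Pprod (fst x) v) \<partial>count_space (words i))\<bar>" for x :: "(nat list \<Rightarrow> nat \<Rightarrow> real) \<times> (nat list \<Rightarrow> nat \<Rightarrow> real)"
  let ?MM = "Pi\<^sub>M {u. length u < i} (\<lambda>_. seqM) \<Otimes>\<^sub>M Pi\<^sub>M (words i) (\<lambda>_. seqM)"
  have 1: "(\<lambda>x. \<integral>\<^sup>+v. ennreal (g (Pprod (fst x) v) (snd x v)) \<partial>count_space (words i)) \<in> borel_measurable ?MM"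
  proof (rule borel_measurable_nn_integral_count_space[OF countable_words])
    fix v assume v: "v \<in> words i"
    show "(\<lambda>x. ennreal (g (Pprod (fst x) v) (snd x v))) \<in> borel_measurable ?MM"
      using measurable_compose[OF measurable_Pair[OF Pprod_fst_measurable[OF v] snd_measurable[OF v]] assms(1)] by simp
  qed
  have 2: "(\<lambda>x. \<integral>\<^sup>+v. m (Pprod (fst x) v) \<partial>count_space (words i)) \<in> borel_measurable ?MM"
  proof (rule borel_measurable_nn_integral_count_space[OF countable_words])
    fix v assume v: "v \<in> words i"
    show "(\<lambda>x. m (Pprod (fst x) v)) \<in> borel_measurable ?MM"
      using measurable_compose[OF Pprod_fst_measurable[OF v], of m borel] by simp
  qed
  have [measurable]: "\<Phi> \<in> borel_measurable ?MM"
    unfolding \<Phi>_def[abs_def] using 1 2 by measurable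
  have \<Phi>: "\<Phi> (restrict (P \<omega>) {u. length u < i}, restrict (P \<omega>') (words i)) =
     ennreal \<bar>enn2real (\<integral>\<^sup>+v. ennreal (g (p \<omega> v) (P \<omega>' v)) \<partial>count_space (words i))
              - enn2real (\<integral>\<^sup>+v. m (p \<omega> v) \<partial>count_space (words i))\<bar>" for \<omega> \<omega>'
  proof -
    have "(\<integral>\<^sup>+v. ennreal (g (Pprod (restrict (P \<omega>) {u. length u < i}) v) (restrict (P \<omega>') (words i) v)) \<partial>count_space (words i))
      = (\<integral>\<^sup>+v. ennreal (g (p \<omega> v) (P \<omega>' v)) \<partial>count_space (words i))"
      "(\<integral>\<^sup>+v. m (Pprod (restrict (P \<omega>) {u. length u < i}) v) \<partial>count_space (words i)) = (\<integral>\<^sup>+v. m (p \<omega> v) \<partial>count_space (words i))"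
      by (auto intro!: nn_integral_cong simp: Pprod_restrict)
    then show ?thesis unfolding \<Phi>_def fst_conv snd_conv by simp
  qed
  have meas_m: "(\<lambda>\<omega>. \<integral>\<^sup>+v. m (p \<omega> v) \<partial>count_space (words i)) \<in> borel_measurable M"
    by (rule borel_measurable_nn_integral_count_space) auto
  have meas_r: "(\<lambda>\<omega>. \<integral>\<^sup>+v. r (p \<omega> v) \<partial>count_space (words i)) \<in> borel_measurable M"
    by (rule borel_measurable_nn_integral_count_space) auto
  have finAE: "AE \<omega> in M. (\<integral>\<^sup>+v. m (p \<omega> v) \<partial>count_space (words i)) \<noteq> \<infinity>"
    using fin by (intro nn_integral_noteq_infinite meas_m) auto
  have "(\<integral>\<^sup>+\<omega>. \<Phi> (restrict (P \<omega>) {u. length u < i}, restrict (P \<omega>) (words i)) \<partial>M)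
    = (\<integral>\<^sup>+\<omega>. \<integral>\<^sup>+\<omega>'. \<Phi> (restrict (P \<omega>) {u. length u < i}, restrict (P \<omega>') (words i)) \<partial>M \<partial>M)"
    by (rule decouple[OF disjoint_words]) simp
  also have "\<dots> \<le> (\<integral>\<^sup>+\<omega>. ennreal (\<epsilon> / 2) + ennreal (1 / (2 * \<epsilon>) + 2) * (\<integral>\<^sup>+v. r (p \<omega> v) \<partial>count_space (words i)) \<partial>M)"
    using finAE
  proof (intro nn_integral_mono_AE, eventually_elim)
    case (elim \<omega>)
    have meas: "g (p \<omega> v) \<in> borel_measurable seqM" for v
      using measurable_compose[OF measurable_Pair1' assms(1), of "p \<omega> v"] by simp
    have eq: "(\<integral>\<^sup>+\<omega>'. ennreal (g (p \<omega> v) (P \<omega>' v)) \<partial>M) = m (p \<omega> v)" for v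
      using nn_integral_P[of "\<lambda>q. ennreal (g (p \<omega> v) q)" v] meas m by simp
    have le: "(\<integral>\<^sup>+\<omega>'. ennreal (g (p \<omega> v) (P \<omega>' v) powr \<pi>) \<partial>M) \<le> r (p \<omega> v)" for v
      using nn_integral_P[of "\<lambda>q. ennreal (g (p \<omega> v) q powr \<pi>)" v] meas r by simp
    have "indep_vars (\<lambda>_. borel) (\<lambda>v \<omega>'. g (p \<omega> v) (P \<omega>' v)) (words i)"
      by (rule indep_vars_compose2[OF indep_vars_subset[OF P_indep]]) (use meas in auto)
    from L1_deviation_sum_le[OF countable_words this nonneg \<pi> \<epsilon>]
    have "(\<integral>\<^sup>+\<omega>'. \<Phi> (restrict (P \<omega>) {u. length u < i}, restrict (P \<omega>') (words i)) \<partial>M)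
      \<le> ennreal (\<epsilon> / 2) + ennreal (1 / (2 * \<epsilon>) + 2) * (\<integral>\<^sup>+v. (\<integral>\<^sup>+\<omega>'. ennreal (g (p \<omega> v) (P \<omega>' v) powr \<pi>) \<partial>M) \<partial>count_space (words i))"
      unfolding \<Phi> eq using elim by (simp add: top.not_eq_extremum)
    also have "\<dots> \<le> ennreal (\<epsilon> / 2) + ennreal (1 / (2 * \<epsilon>) + 2) * (\<integral>\<^sup>+v. r (p \<omega> v) \<partial>count_space (words i))"
      by (intro add_left_mono mult_left_mono nn_integral_mono le) auto
    finally show ?case .
  qed
  also have "\<dots> = ennreal (\<epsilon> / 2) + ennreal (1 / (2 * \<epsilon>) + 2) * (\<integral>\<^sup>+\<omega>. \<integral>\<^sup>+v. r (p \<omega> v) \<partial>count_space (words i) \<partial>M)"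
    using meas_r by (simp add: nn_integral_add nn_integral_cmult emeasure_space_1)
  finally show ?thesis unfolding \<Phi> .
qed

end

section \<open>Moments, tilting and the cost of replacing one generation by its mean\<close>

lemma measurable_seqM_component:
  "f \<in> measurable M seqM \<Longrightarrow> (\<lambda>x. f x k) \<in> borel_measurable M"
  by (erule measurable_compose) (rule measurable_component_singleton, rule UNIV_I)

context brw begin

definition mg :: "real \<Rightarrow> ennreal" where
  "mg s = (\<integral>\<^sup>+\<omega>. (\<Sum>k. ennreal (P \<omega> [] k powr s)) \<partial>M)"

lemma mg_mono: "s \<le> t \<Longrightarrow> mg t \<le> mg s"
  unfolding mg_def by (intro nn_integral_mono suminf_le summableI ennreal_leI powr_mono' P_nonneg P_le_1)

lemma suminf_P: "(\<Sum>k. ennreal (P \<omega> u k)) = 1"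
  unfolding suminf_ennreal2[OF P_nonneg sums_summable[OF P_sums]] sums_unique[OF P_sums, symmetric] by simp

lemma mg_1: "mg 1 = 1"
  unfolding mg_def using P_nonneg by (simp add: suminf_P emeasure_space_1)

lemma moment: "(\<integral>\<^sup>+\<omega>. \<integral>\<^sup>+v. ennreal (p \<omega> v powr s) \<partial>count_space (words i) \<partial>M) = mg s ^ i"
proof (induction i)
  case 0
  then show ?case by (simp add: words_0 nn_integral_count_space_finite emeasure_space_1)
next
  case (Suc i)
  note [measurable (raw)] = measurable_seqM_component
  have "(\<integral>\<^sup>+\<omega>. \<integral>\<^sup>+v. ennreal (p \<omega> v powr s) \<partial>count_space (words (Suc i)) \<partial>M)
    = (\<integral>\<^sup>+\<omega>. \<integral>\<^sup>+v. (\<Sum>k. ennreal ((p \<omega> v * P \<omega> v k) powr s)) \<partial>count_space (words i) \<partial>M)"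
    by (simp add: nn_integral_words_Suc Pprod_snoc)
  also have "\<dots> = (\<integral>\<^sup>+\<omega>. \<integral>\<^sup>+v. (\<integral>\<^sup>+\<omega>'. (\<Sum>k. ennreal ((p \<omega> v * P \<omega>' [] k) powr s)) \<partial>M) \<partial>count_space (words i) \<partial>M)"
    by (rule one_step_expectation) measurable
  also have "\<dots> = (\<integral>\<^sup>+\<omega>. \<integral>\<^sup>+v. ennreal (p \<omega> v powr s) * mg s \<partial>count_space (words i) \<partial>M)"
  proof (intro nn_integral_cong)
    fix \<omega> v
    have "(\<integral>\<^sup>+\<omega>'. (\<Sum>k. ennreal ((p \<omega> v * P \<omega>' [] k) powr s)) \<partial>M)
      = (\<integral>\<^sup>+\<omega>'. ennreal (p \<omega> v powr s) * (\<Sum>k. ennreal (P \<omega>' [] k powr s)) \<partial>M)"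
      by (intro nn_integral_cong) (simp add: powr_mult p_nonneg P_nonneg ennreal_mult)
    then show "(\<integral>\<^sup>+\<omega>'. (\<Sum>k. ennreal ((p \<omega> v * P \<omega>' [] k) powr s)) \<partial>M) = ennreal (p \<omega> v powr s) * mg s"
      by (simp add: nn_integral_cmult mg_def)
  qed
  also have "\<dots> = (\<integral>\<^sup>+\<omega>. (\<integral>\<^sup>+v. ennreal (p \<omega> v powr s) \<partial>count_space (words i)) * mg s \<partial>M)"
    by (simp add: nn_integral_multc)
  also have "\<dots> = mg s ^ i * mg s"
    using borel_measurable_nn_integral_count_space[OF countable_words, of i "\<lambda>v \<omega>. ennreal (p \<omega> v powr s)" M]
    by (simp add: nn_integral_multc Suc.IH)
  finally show ?case by (simp add: mult.commute)
qed

end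

text \<open>The point \<open>s0\<close> records that \<theta> lies strictly to the right of the left
  end of the domain of \<lambda>; the gap is spent on moments of order greater than 1 and on
  exponential moments of the tilted step. The last assumption excludes a tree in which each word has
  exactly one child of positive weight, almost surely.\<close>

locale brw_theta = brw M P for M :: "'a measure" and P :: "'a \<Rightarrow> nat list \<Rightarrow> nat \<Rightarrow> real" +
  fixes \<theta> \<Lambda> s0 :: real
  assumes \<theta>: "0 < \<theta>" "\<theta> < 1" and mg_\<theta>: "mg \<theta> = ennreal (exp \<Lambda>)"
    and s0: "s0 < \<theta>" "mg s0 < \<infinity>"
    and branching: "\<not> (AE \<omega> in M. \<forall>k. P \<omega> [] k \<in> {0, 1})"
begin

lemma \<Lambda>_nonneg: "0 \<le> \<Lambda>"
proof -
  have "ennreal 1 \<le> ennreal (exp \<Lambda>)" using mg_mono[of \<theta> 1] \<theta> by (simp add: mg_1 mg_\<theta>)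
  then show ?thesis by simp
qed

text \<open>Weights lie in [0, 1], so powers decrease in the exponent. Equality of the two
  expectations would make the nonnegative differences vanish almost surely, forcing all weights into
  {0, 1} against \<open>branching\<close>.\<close>

lemma mg_strict: assumes "t > \<theta>" shows "mg t < mg \<theta>"
proof (rule ccontr)
  assume "\<not> mg t < mg \<theta>"
  with mg_mono[of \<theta> t] assms have eq: "mg t = mg \<theta>" by auto
  have le: "P \<omega> [] k powr t \<le> P \<omega> [] k powr \<theta>" for \<omega> k
    using assms by (intro powr_mono') (auto simp: P_nonneg P_le_1)
  have "mg \<theta> = (\<integral>\<^sup>+\<omega>. (\<Sum>k. ennreal (P \<omega> [] k powr \<theta> - P \<omega> [] k powr t) + ennreal (P \<omega> [] k powr t)) \<partial>M)"
    unfolding mg_def using le by (simp flip: ennreal_plus)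
  also have "\<dots> = (\<integral>\<^sup>+\<omega>. (\<Sum>k. ennreal (P \<omega> [] k powr \<theta> - P \<omega> [] k powr t)) \<partial>M) + mg t"
    unfolding mg_def by (simp add: suminf_add[symmetric] nn_integral_add)
  finally have "ennreal (exp \<Lambda>) + (\<integral>\<^sup>+\<omega>. (\<Sum>k. ennreal (P \<omega> [] k powr \<theta> - P \<omega> [] k powr t)) \<partial>M) = ennreal (exp \<Lambda>) + 0"
    unfolding eq mg_\<theta> by (simp add: add.commute)
  then have "(\<integral>\<^sup>+\<omega>. (\<Sum>k. ennreal (P \<omega> [] k powr \<theta> - P \<omega> [] k powr t)) \<partial>M) = 0"
    unfolding ennreal_add_left_cancel by simp
  then have "AE \<omega> in M. (\<Sum>k. ennreal (P \<omega> [] k powr \<theta> - P \<omega> [] k powr t)) = 0"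
    by (subst (asm) nn_integral_0_iff_AE) auto
  then have "AE \<omega> in M. \<forall>k. P \<omega> [] k \<in> {0, 1}"
  proof eventually_elim
    case (elim \<omega>)
    show ?case
    proof
      fix k
      have "ennreal (P \<omega> [] k powr \<theta> - P \<omega> [] k powr t) = 0"
        using elim by (subst (asm) suminf_eq_zero_iff) auto
      then have *: "P \<omega> [] k powr \<theta> \<le> P \<omega> [] k powr t" by (simp add: ennreal_eq_0_iff)
      show "P \<omega> [] k \<in> {0, 1}"
      proof (rule ccontr)
        assume "P \<omega> [] k \<notin> {0, 1}"
        then have "0 < P \<omega> [] k" "P \<omega> [] k < 1"
          using P_nonneg[of \<omega> "[]" k] P_le_1[of \<omega> "[]" k] by auto
        then have "P \<omega> [] k powr t < P \<omega> [] k powr \<theta>" using assms by (simp add: powr_def mult_less_cancel_right ln_less_zero)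
        with * show False by simp
      qed
    qed
  qed
  with branching show False by blast
qed

text \<open>The displacement of a child chosen with density P_k^\<theta> e^(-\<Lambda>), realised on
  the product of counting measure on the children with the probability space. A child of weight 0
  receives mass 0, so the default value of \<open>ln 0\<close> is harmless.\<close>

definition step :: "real measure" where
  "step = distr (density (count_space UNIV \<Otimes>\<^sub>M M) (\<lambda>x. ennreal (P (snd x) [] (fst x) powr \<theta> * exp (- \<Lambda>))))
     borel (\<lambda>x. - ln (P (snd x) [] (fst x)))"

lemma P_pair_measurable [measurable]: "(\<lambda>x. P (snd x) [] (fst x)) \<in> borel_measurable (count_space UNIV \<Otimes>\<^sub>M M)"
  by (rule measurable_pair_measure_countable1) auto

lemma nn_integral_step:
  assumes [measurable]: "f \<in> borel_measurable borel"
  shows "(\<integral>\<^sup>+s. f s \<partial>step) = (\<integral>\<^sup>+\<omega>. (\<Sum>k. ennreal (P \<omega> [] k powr \<theta> * exp (- \<Lambda>)) * f (- ln (P \<omega> [] k))) \<partial>M)"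
proof -
  have "(\<integral>\<^sup>+s. f s \<partial>step) = (\<integral>\<^sup>+x. ennreal (P (snd x) [] (fst x) powr \<theta> * exp (- \<Lambda>)) * f (- ln (P (snd x) [] (fst x)))
      \<partial>(count_space UNIV \<Otimes>\<^sub>M M))"
    unfolding step_def by (subst nn_integral_distr, simp, simp, subst nn_integral_density) auto
  also have "\<dots> = (\<integral>\<^sup>+k. \<integral>\<^sup>+\<omega>. ennreal (P \<omega> [] k powr \<theta> * exp (- \<Lambda>)) * f (- ln (P \<omega> [] k)) \<partial>M \<partial>count_space UNIV)"
    by (subst nn_integral_fst[symmetric]) auto
  also have "\<dots> = (\<integral>\<^sup>+\<omega>. \<integral>\<^sup>+k. ennreal (P \<omega> [] k powr \<theta> * exp (- \<Lambda>)) * f (- ln (P \<omega> [] k)) \<partial>count_space UNIV \<partial>M)"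
    by (rule nn_integral_count_space_nn_integral[symmetric]) auto
  finally show ?thesis by (simp add: nn_integral_count_space_nat)
qed

lemma real_distribution_step: "real_distribution step"
proof -
  have "emeasure step (space step) = (\<integral>\<^sup>+s. 1 \<partial>step)" by simp
  also have "\<dots> = (\<integral>\<^sup>+\<omega>. (\<Sum>k. ennreal (P \<omega> [] k powr \<theta>)) * ennreal (exp (- \<Lambda>)) \<partial>M)"
    by (subst nn_integral_step) (auto simp: ennreal_mult)
  also have "\<dots> = mg \<theta> * ennreal (exp (- \<Lambda>))"
    by (simp add: nn_integral_multc mg_def)
  also have "\<dots> = 1" by (simp add: mg_\<theta> exp_minus flip: ennreal_mult)
  finally show ?thesis
    by (auto simp: real_distribution_def real_distribution_axioms_def step_def intro!: prob_spaceI)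
qed

sublocale step: real_distribution step by (rule real_distribution_step)

text \<open>The transition operator of the random walk with the tilted step.\<close>

definition A :: "(real \<Rightarrow> real) \<Rightarrow> real \<Rightarrow> real" where "A H w = (\<integral>s. H (w + s) \<partial>step)"

text \<open>The additive martingale with each word of generation i weighted by H at its position; H
  = 1 gives W_i(\<theta>). The extended version avoids summability questions, and the real version
  \<open>G\<close> is 0 on the null set where it is infinite.\<close>

definition GG :: "nat \<Rightarrow> (real \<Rightarrow> real) \<Rightarrow> 'a \<Rightarrow> ennreal" where
  "GG i H \<omega> = (\<integral>\<^sup>+v. ennreal (exp (- \<Lambda> * i) * p \<omega> v powr \<theta> * H (- ln (p \<omega> v))) \<partial>count_space (words i))"

definition G :: "nat \<Rightarrow> (real \<Rightarrow> real) \<Rightarrow> 'a \<Rightarrow> real" where "G i H \<omega> = enn2real (GG i H \<omega>)"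

lemma GG_measurable [measurable]:
  assumes [measurable]: "H \<in> borel_measurable borel" shows "GG i H \<in> borel_measurable M"
  unfolding GG_def[abs_def] by (rule borel_measurable_nn_integral_count_space) auto

lemma G_measurable [measurable]:
  assumes [measurable]: "H \<in> borel_measurable borel" shows "G i H \<in> borel_measurable M"
  unfolding G_def[abs_def] by measurable

lemma G_nonneg: "0 \<le> G i H \<omega>" by (simp add: G_def)

lemma GG_mono: "(\<And>x. H x \<le> H' x) \<Longrightarrow> GG i H \<omega> \<le> GG i H' \<omega>"
  unfolding GG_def by (intro nn_integral_mono ennreal_leI mult_left_mono) auto

lemma expectation_GG_1: "(\<integral>\<^sup>+\<omega>. GG i (\<lambda>_. 1) \<omega> \<partial>M) = 1"
proof -
  have "(\<integral>\<^sup>+\<omega>. GG i (\<lambda>_. 1) \<omega> \<partial>M) = (\<integral>\<^sup>+\<omega>. ennreal (exp (- \<Lambda> * i)) * (\<integral>\<^sup>+v. ennreal (p \<omega> v powr \<theta>) \<partial>count_space (words i)) \<partial>M)"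
    unfolding GG_def by (intro nn_integral_cong) (simp add: ennreal_mult nn_integral_cmult)
  also have "\<dots> = ennreal (exp (- \<Lambda> * i)) * mg \<theta> ^ i"
    using borel_measurable_nn_integral_count_space[OF countable_words, of i "\<lambda>v \<omega>. ennreal (p \<omega> v powr \<theta>)" M]
    by (simp add: nn_integral_cmult moment)
  also have "\<dots> = ennreal (exp (- \<Lambda> * i) * exp \<Lambda> ^ i)" by (simp add: mg_\<theta> ennreal_power ennreal_mult)
  also have "exp (- \<Lambda> * i) * exp \<Lambda> ^ i = 1" by (simp add: exp_of_nat_mult[symmetric] exp_add[symmetric] mult.commute)
  finally show ?thesis by simp
qed

lemma GG_finite: "AE \<omega> in M. \<forall>i. GG i (\<lambda>_. 1) \<omega> \<noteq> \<infinity>"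
proof -
  have "AE \<omega> in M. GG i (\<lambda>_. 1) \<omega> \<noteq> \<infinity>" for i
    by (rule nn_integral_noteq_infinite) (simp_all add: expectation_GG_1)
  then show ?thesis by (subst AE_all_countable) blast
qed

lemma offspring_finite: "AE \<omega> in M. \<forall>v. (\<Sum>k. ennreal (P \<omega> v k powr \<theta>)) \<noteq> \<infinity>"
proof -
  have "AE \<omega> in M. (\<Sum>k. ennreal (P \<omega> v k powr \<theta>)) \<noteq> \<infinity>" for v
  proof (rule nn_integral_noteq_infinite)
    have "(\<integral>\<^sup>+\<omega>. (\<Sum>k. ennreal (P \<omega> v k powr \<theta>)) \<partial>M) = mg \<theta>"
      unfolding mg_def by (rule nn_integral_P) measurable
    then show "(\<integral>\<^sup>+\<omega>. (\<Sum>k. ennreal (P \<omega> v k powr \<theta>)) \<partial>M) \<noteq> \<infinity>" by (simp add: mg_\<theta>)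
  qed measurable
  then show ?thesis by (subst AE_all_countable) auto
qed

lemma A_measurable [measurable]:
  assumes [measurable]: "H \<in> borel_measurable borel" shows "A H \<in> borel_measurable borel"
  unfolding A_def[abs_def] by measurable

lemma ennreal_A:
  assumes [measurable]: "H \<in> borel_measurable borel" and H: "\<And>x. 0 \<le> H x" "\<And>x. H x \<le> 1"
  shows "ennreal (A H w) = (\<integral>\<^sup>+s. ennreal (H (w + s)) \<partial>step)"
proof -
  have "integrable step (\<lambda>s. H (w + s))"
    by (rule step.integrable_const_bound[where B=1]) (use H in auto)
  then show ?thesis unfolding A_def using H by (intro nn_integral_eq_integral[symmetric]) auto
qed

lemma A_bounds:
  assumes "H \<in> borel_measurable borel" and H: "\<And>x. 0 \<le> H x" "\<And>x. H x \<le> 1"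
  shows "0 \<le> A H w" "A H w \<le> 1"
proof -
  show "0 \<le> A H w" unfolding A_def using H by (intro integral_nonneg_AE) auto
  have "ennreal (A H w) \<le> (\<integral>\<^sup>+s. 1 \<partial>step)"
    unfolding ennreal_A[OF assms] by (intro nn_integral_mono) (use H in auto)
  also have "\<dots> = ennreal 1" using step.emeasure_space_1 by simp
  finally show "A H w \<le> 1" by simp
qed

text \<open>The many-to-one formula for one generation below a word of weight x: the additional
  factor e^(-\<Lambda>) and the power \<theta> of the child's weight are exactly the density in
  \<open>step\<close>.\<close>

lemma offspring_A:
  assumes [measurable]: "H \<in> borel_measurable borel" and H: "\<And>x. 0 \<le> H x" "\<And>x. H x \<le> 1" and x: "0 \<le> x"
  shows "(\<integral>\<^sup>+\<omega>. (\<Sum>k. ennreal (exp (- \<Lambda> * Suc i) * (x * P \<omega> [] k) powr \<theta> * H (- ln (x * P \<omega> [] k)))) \<partial>M)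
      = ennreal (exp (- \<Lambda> * i) * x powr \<theta> * A H (- ln x))"
proof (cases "x = 0")
  case True then show ?thesis by simp
next
  case False
  then have x: "x > 0" using x by simp
  define c where "c = exp (- \<Lambda> * i) * x powr \<theta>"
  have c: "c \<ge> 0" by (simp add: c_def)
  have "ennreal (exp (- \<Lambda> * Suc i) * (x * P \<omega> [] k) powr \<theta> * H (- ln (x * P \<omega> [] k)))
     = ennreal c * (ennreal (P \<omega> [] k powr \<theta> * exp (- \<Lambda>)) * ennreal (H (- ln x + - ln (P \<omega> [] k))))" for \<omega> k
  proof (cases "P \<omega> [] k = 0")
    case False
    then have "P \<omega> [] k > 0" using P_nonneg[of \<omega> "[]" k] by simp
    then have "exp (- \<Lambda> * Suc i) * (x * P \<omega> [] k) powr \<theta> * H (- ln (x * P \<omega> [] k))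
      = c * ((P \<omega> [] k powr \<theta> * exp (- \<Lambda>)) * H (- ln x + - ln (P \<omega> [] k)))"
    proof -
      have "exp (- \<Lambda> * Suc i) = exp (- \<Lambda> * i) * exp (- \<Lambda>)" by (simp add: exp_add[symmetric] algebra_simps)
      moreover have "(x * P \<omega> [] k) powr \<theta> = x powr \<theta> * P \<omega> [] k powr \<theta>" using x \<open>P \<omega> [] k > 0\<close> by (simp add: powr_mult)
      moreover have "- ln (x * P \<omega> [] k) = - ln x + - ln (P \<omega> [] k)" using x \<open>P \<omega> [] k > 0\<close> by (simp add: ln_mult)
      ultimately show ?thesis unfolding c_def by (simp only: mult_ac)
    qed
    then show ?thesis using c H by (simp add: ennreal_mult)
  qed simp
  then have "(\<integral>\<^sup>+\<omega>. (\<Sum>k. ennreal (exp (- \<Lambda> * Suc i) * (x * P \<omega> [] k) powr \<theta> * H (- ln (x * P \<omega> [] k)))) \<partial>M)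
    = (\<integral>\<^sup>+\<omega>. ennreal c * (\<Sum>k. ennreal (P \<omega> [] k powr \<theta> * exp (- \<Lambda>)) * ennreal (H (- ln x + - ln (P \<omega> [] k)))) \<partial>M)"
    by simp
  also have "\<dots> = ennreal c * (\<integral>\<^sup>+s. ennreal (H (- ln x + s)) \<partial>step)"
    by (subst nn_integral_step, measurable) (rule nn_integral_cmult, measurable)
  also have "\<dots> = ennreal (c * A H (- ln x))"
    unfolding ennreal_A[OF assms(1) H, symmetric] using c by (simp add: ennreal_mult')
  finally show ?thesis by (simp add: c_def)
qed

text \<open>Uniformity in H holds because only H \<le> 1 enters the moment bound. The expected sum
  of \<pi>-th powers over generation i is of order (e^(-\<pi> \<Lambda>) E sum P_k^(\<pi>
  \<theta>))^i; the base is below 1 because \<pi> > 1.\<close>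

lemma one_step_rate:
  obtains C r where "0 < r" "r < 1" "0 \<le> C"
    "\<And>H i. H \<in> borel_measurable borel \<Longrightarrow> (\<And>x. 0 \<le> H x) \<Longrightarrow> (\<And>x. H x \<le> 1) \<Longrightarrow>
       (\<integral>\<^sup>+\<omega>. ennreal \<bar>G (Suc i) H \<omega> - G i (A H) \<omega>\<bar> \<partial>M) \<le> ennreal (C * r ^ i)"
proof -
  note [measurable (raw)] = measurable_seqM_component
  \<comment> \<open>The moment order: as large as possible subject to \<pi> \<le> 2 and to the
    Jensen exponent 1 - \<pi>(1 - \<theta>) staying at or above \<open>s0\<close>.\<close>
  define \<pi> where "\<pi> = 1 + min 1 ((\<theta> - s0) / (1 - \<theta>))"
  have \<pi>: "1 < \<pi>" "\<pi> \<le> 2" using \<theta> s0 by (auto simp: \<pi>_def)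
  have "(\<pi> - 1) * (1 - \<theta>) \<le> (\<theta> - s0) / (1 - \<theta>) * (1 - \<theta>)" using \<theta> by (intro mult_right_mono) (auto simp: \<pi>_def)
  also have "\<dots> = \<theta> - s0" using \<theta> by simp
  finally have \<pi>s: "s0 \<le> 1 - \<pi> * (1 - \<theta>)" by (simp add: algebra_simps)
  have "\<theta> < \<pi> * \<theta>" using \<theta> \<pi> by simp
  from mg_strict[OF this] obtain k0 where k0: "mg (\<pi> * \<theta>) = ennreal k0" "0 \<le> k0" "k0 < exp \<Lambda>"
    by (cases "mg (\<pi> * \<theta>)") (auto simp: mg_\<theta> ennreal_less_iff)
  obtain B where B: "mg s0 = ennreal B" "0 \<le> B" using s0 by (cases "mg s0") auto
  \<comment> \<open>The factor by which the sum of \<pi>-th moments changes per generation. It is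
    below 1 since \<open>mg (\<pi> * \<theta>)\<close> is below e^\<Lambda>, hence below e^(\<pi>
    \<Lambda>) because \<Lambda> \<ge> 0.\<close>
  define K where "K = k0 * exp (- \<pi> * \<Lambda>)"
  have "1 * \<Lambda> \<le> \<pi> * \<Lambda>" using \<pi> \<Lambda>_nonneg by (intro mult_right_mono) auto
  then have "exp \<Lambda> \<le> exp (\<pi> * \<Lambda>)" by simp
  with k0 have "k0 < exp (\<pi> * \<Lambda>)" by linarith
  then have K: "0 \<le> K" "K < 1" using k0 by (auto simp: K_def exp_minus field_simps)
  define \<kappa> where "\<kappa> = max K (1/2)"
  have \<kappa>: "0 < \<kappa>" "\<kappa> < 1" "K \<le> \<kappa>" using K by (auto simp: \<kappa>_def)
  \<comment> \<open>With accuracy \<epsilon> = r^i in the deviation inequality, \<epsilon> and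
    \<kappa>^i / \<epsilon> are of the same size.\<close>
  define r where "r = sqrt \<kappa>"
  have r: "0 < r" "r < 1" "r\<^sup>2 = \<kappa>" using \<kappa> by (auto simp: r_def real_sqrt_lt_1_iff)
  \<comment> \<open>1/2 comes from \<epsilon>/2; the remaining terms B/2 and 2 B are rounded up to 3
    B.\<close>
  define C where "C = 1/2 + 3 * B"
  show ?thesis
  proof (rule that[OF r(1,2), of C])
    show "0 \<le> C" using B by (simp add: C_def)
    fix H :: "real \<Rightarrow> real" and i :: nat
    assume Hm [measurable]: "H \<in> borel_measurable borel" and H: "\<And>x. 0 \<le> H x" "\<And>x. H x \<le> 1"
    define S where "S x q = (\<Sum>k. ennreal (exp (- \<Lambda> * Suc i) * (x * q k) powr \<theta> * H (- ln (x * q k))))" for x :: real and q :: "nat \<Rightarrow> real"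
    have [measurable]: "(\<lambda>x. S (fst x) (snd x)) \<in> borel_measurable (borel \<Otimes>\<^sub>M seqM)"
      unfolding S_def by measurable
    define g where "g x q = enn2real (S x q)" for x q
    define w where "w \<omega> v = (\<Sum>k. ennreal (P \<omega> v k powr \<theta>))" for \<omega> v
    have Sle: "S x (P \<omega> v) \<le> ennreal (exp (- \<Lambda> * Suc i) * x powr \<theta>) * w \<omega> v" if "0 \<le> x" for x \<omega> v
    proof -
      have "ennreal (exp (- \<Lambda> * Suc i) * (x * P \<omega> v k) powr \<theta> * H (- ln (x * P \<omega> v k)))
         \<le> ennreal (exp (- \<Lambda> * Suc i) * x powr \<theta>) * ennreal (P \<omega> v k powr \<theta>)" for k
      proof -
        have "exp (- \<Lambda> * Suc i) * (x * P \<omega> v k) powr \<theta> * H (- ln (x * P \<omega> v k)) \<le> exp (- \<Lambda> * Suc i) * (x * P \<omega> v k) powr \<theta> * 1"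
          by (intro mult_left_mono H) auto
        also have "\<dots> = (exp (- \<Lambda> * Suc i) * x powr \<theta>) * (P \<omega> v k powr \<theta>)"
          using that P_nonneg by (simp add: powr_mult)
        finally show ?thesis by (simp add: ennreal_leI flip: ennreal_mult)
      qed
      then have "S x (P \<omega> v) \<le> (\<Sum>k. ennreal (exp (- \<Lambda> * Suc i) * x powr \<theta>) * ennreal (P \<omega> v k powr \<theta>))"
        unfolding S_def by (intro suminf_le summableI)
      then show ?thesis by (simp add: w_def)
    qed
    \<comment> \<open>\<open>S\<close> may be infinite on a null set, where \<open>g\<close> takes
      the default value 0. All identities that mention \<open>g\<close> are therefore almost
      sure.\<close>
    have Sfin: "AE \<omega> in M. \<forall>v x. 0 \<le> x \<longrightarrow> S x (P \<omega> v) = ennreal (g x (P \<omega> v))"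
      using offspring_finite
    proof eventually_elim
      case (elim \<omega>)
      show ?case
      proof (intro allI impI)
        fix v and x :: real assume "0 \<le> x"
        from Sle[OF this, of \<omega> v] elim have "S x (P \<omega> v) < \<infinity>"
          by (auto simp: w_def top.not_eq_extremum ennreal_mult_less_top intro: le_less_trans)
        then show "S x (P \<omega> v) = ennreal (g x (P \<omega> v))" by (simp add: g_def)
      qed
    qed
    define m where "m x = ennreal (exp (- \<Lambda> * i) * x powr \<theta> * A H (- ln x))" for x
    define rr where "rr x = ennreal (exp (- \<pi> * \<Lambda> * Suc i)) * ennreal (x powr (\<pi> * \<theta>)) * mg s0" for x
    have m: "(\<integral>\<^sup>+\<omega>'. ennreal (g (p \<omega> v) (P \<omega>' [])) \<partial>M) = m (p \<omega> v)" for \<omega> v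
    proof -
      have "(\<integral>\<^sup>+\<omega>'. ennreal (g (p \<omega> v) (P \<omega>' [])) \<partial>M) = (\<integral>\<^sup>+\<omega>'. S (p \<omega> v) (P \<omega>' []) \<partial>M)"
        using Sfin by (intro nn_integral_cong_AE, eventually_elim) (simp add: p_nonneg)
      then show ?thesis
        unfolding S_def m_def by (simp only: offspring_A[OF Hm H p_nonneg])
    qed
    have rle: "(\<integral>\<^sup>+\<omega>'. ennreal (g (p \<omega> v) (P \<omega>' []) powr \<pi>) \<partial>M) \<le> rr (p \<omega> v)" for \<omega> v
    proof -
      define x where "x = p \<omega> v"
      have x: "0 \<le> x" by (simp add: x_def p_nonneg)
      have "(\<integral>\<^sup>+\<omega>'. ennreal (g x (P \<omega>' []) powr \<pi>) \<partial>M)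
         \<le> (\<integral>\<^sup>+\<omega>'. ennreal (exp (- \<pi> * \<Lambda> * Suc i)) * ennreal (x powr (\<pi> * \<theta>)) * (\<Sum>k. ennreal (P \<omega>' [] k powr (1 - \<pi> * (1 - \<theta>)))) \<partial>M)"
        using offspring_finite
      proof (intro nn_integral_mono_AE, eventually_elim)
        case (elim \<omega>')
        define y where "y = enn2real (w \<omega>' [])"
        have y: "w \<omega>' [] = ennreal y" "0 \<le> y" using elim by (simp_all add: w_def y_def)
        have "g x (P \<omega>' []) \<le> exp (- \<Lambda> * Suc i) * x powr \<theta> * y"
          unfolding g_def using Sle[OF x, of \<omega>' "[]"] y by (intro enn2real_leI) (simp_all add: ennreal_mult)
        then have "g x (P \<omega>' []) powr \<pi> \<le> (exp (- \<Lambda> * Suc i) * x powr \<theta> * y) powr \<pi>"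
          using \<pi> by (intro powr_mono2) (auto simp: g_def)
        also have "\<dots> = exp (- \<pi> * \<Lambda> * Suc i) * x powr (\<pi> * \<theta>) * y powr \<pi>"
          using x y by (simp add: powr_mult powr_powr exp_powr_real mult_ac del: of_nat_Suc)
        finally have "ennreal (g x (P \<omega>' []) powr \<pi>) \<le> ennreal (exp (- \<pi> * \<Lambda> * Suc i)) * ennreal (x powr (\<pi> * \<theta>)) * ennreal (y powr \<pi>)"
          by (simp add: ennreal_leI flip: ennreal_mult)
        also have "\<dots> \<le> ennreal (exp (- \<pi> * \<Lambda> * Suc i)) * ennreal (x powr (\<pi> * \<theta>)) * (\<Sum>k. ennreal (P \<omega>' [] k powr (1 - \<pi> * (1 - \<theta>))))"
          unfolding y_def w_def by (intro mult_left_mono powr_sum_le[OF P_nonneg P_sums \<pi>(1)]) simp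
        finally show ?case .
      qed
      also have "\<dots> = ennreal (exp (- \<pi> * \<Lambda> * Suc i)) * ennreal (x powr (\<pi> * \<theta>)) * mg (1 - \<pi> * (1 - \<theta>))"
        unfolding mg_def by (rule nn_integral_cmult) simp
      also have "\<dots> \<le> rr x" unfolding rr_def by (intro mult_left_mono mg_mono \<pi>s) auto
      finally show ?thesis by (simp add: x_def)
    qed
    have fin: "(\<integral>\<^sup>+\<omega>. \<integral>\<^sup>+v. m (p \<omega> v) \<partial>count_space (words i) \<partial>M) < \<infinity>"
    proof -
      have "(\<integral>\<^sup>+\<omega>. \<integral>\<^sup>+v. m (p \<omega> v) \<partial>count_space (words i) \<partial>M) \<le> (\<integral>\<^sup>+\<omega>. GG i (\<lambda>_. 1) \<omega> \<partial>M)"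
        unfolding m_def GG_def by (intro nn_integral_mono ennreal_leI mult_left_mono A_bounds H) auto
      also have "\<dots> < \<infinity>" by (simp add: expectation_GG_1)
      finally show ?thesis .
    qed
    have rsum: "(\<integral>\<^sup>+\<omega>. \<integral>\<^sup>+v. rr (p \<omega> v) \<partial>count_space (words i) \<partial>M) \<le> ennreal (B * \<kappa> ^ i)"
    proof -
      have "(\<integral>\<^sup>+\<omega>. \<integral>\<^sup>+v. rr (p \<omega> v) \<partial>count_space (words i) \<partial>M)
        = (\<integral>\<^sup>+\<omega>. ennreal (exp (- \<pi> * \<Lambda> * Suc i)) * mg s0 * (\<integral>\<^sup>+v. ennreal (p \<omega> v powr (\<pi> * \<theta>)) \<partial>count_space (words i)) \<partial>M)"
        unfolding rr_def by (intro nn_integral_cong) (simp add: nn_integral_cmult[symmetric] mult_ac)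
      also have "\<dots> = ennreal (exp (- \<pi> * \<Lambda> * Suc i)) * mg s0 * mg (\<pi> * \<theta>) ^ i"
        using borel_measurable_nn_integral_count_space[OF countable_words, of i "\<lambda>v \<omega>. ennreal (p \<omega> v powr (\<pi> * \<theta>))" M]
        by (subst nn_integral_cmult) (auto simp: moment)
      also have "\<dots> = ennreal (exp (- \<pi> * \<Lambda> * Suc i) * B * k0 ^ i)"
        using B k0 by (simp add: ennreal_power ennreal_mult)
      also have "exp (- \<pi> * \<Lambda> * Suc i) * B * k0 ^ i = exp (- \<pi> * \<Lambda>) * (B * K ^ i)"
      proof -
        have "exp (- \<pi> * \<Lambda> * Suc i) = exp (- \<pi> * \<Lambda>) * exp (- \<pi> * \<Lambda>) ^ i"
          by (simp add: exp_of_nat_mult[symmetric] exp_add[symmetric] algebra_simps)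
        then show ?thesis by (simp add: K_def power_mult_distrib)
      qed
      also have "exp (- \<pi> * \<Lambda>) * (B * K ^ i) \<le> 1 * (B * \<kappa> ^ i)"
        using \<pi> \<Lambda>_nonneg B K \<kappa> by (intro mult_mono power_mono) auto
      finally show ?thesis by (simp add: ennreal_leI)
    qed
    have ri: "0 < r ^ i" "r ^ i \<le> 1" using r by (auto intro: power_le_one)
    have "AE \<omega> in M. ennreal \<bar>G (Suc i) H \<omega> - G i (A H) \<omega>\<bar> =
       ennreal \<bar>enn2real (\<integral>\<^sup>+v. ennreal (g (p \<omega> v) (P \<omega> v)) \<partial>count_space (words i))
              - enn2real (\<integral>\<^sup>+v. m (p \<omega> v) \<partial>count_space (words i))\<bar>"
      using Sfin
    proof eventually_elim
      case (elim \<omega>)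
      have "GG (Suc i) H \<omega> = (\<integral>\<^sup>+v. S (p \<omega> v) (P \<omega> v) \<partial>count_space (words i))"
        unfolding GG_def nn_integral_words_Suc S_def Pprod_snoc ..
      also have "\<dots> = (\<integral>\<^sup>+v. ennreal (g (p \<omega> v) (P \<omega> v)) \<partial>count_space (words i))"
        using elim by (intro nn_integral_cong) (simp add: p_nonneg)
      finally show ?case unfolding G_def GG_def[of i] m_def by simp
    qed
    then have "(\<integral>\<^sup>+\<omega>. ennreal \<bar>G (Suc i) H \<omega> - G i (A H) \<omega>\<bar> \<partial>M) =
       (\<integral>\<^sup>+\<omega>. ennreal \<bar>enn2real (\<integral>\<^sup>+v. ennreal (g (p \<omega> v) (P \<omega> v)) \<partial>count_space (words i))
              - enn2real (\<integral>\<^sup>+v. m (p \<omega> v) \<partial>count_space (words i))\<bar> \<partial>M)"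
      by (rule nn_integral_cong_AE)
    also have "\<dots> \<le> ennreal (r ^ i / 2) + ennreal (1 / (2 * r ^ i) + 2) * (\<integral>\<^sup>+\<omega>. \<integral>\<^sup>+v. rr (p \<omega> v) \<partial>count_space (words i) \<partial>M)"
    proof (rule one_step_L1[where g=g and m=m and r=rr and \<pi>=\<pi>])
      show "(\<lambda>x. g (fst x) (snd x)) \<in> borel_measurable (borel \<Otimes>\<^sub>M seqM)"
        unfolding g_def by measurable
      show "m \<in> borel_measurable borel" unfolding m_def[abs_def] by measurable
      show "rr \<in> borel_measurable borel" unfolding rr_def[abs_def] by measurable
    qed (use \<pi> ri m rle fin in \<open>auto simp: g_def\<close>)
    also have "\<dots> \<le> ennreal (r ^ i / 2) + ennreal (1 / (2 * r ^ i) + 2) * ennreal (B * \<kappa> ^ i)"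
      by (intro add_left_mono mult_left_mono rsum) auto
    also have "\<dots> = ennreal (r ^ i / 2 + (1 / (2 * r ^ i) + 2) * (B * \<kappa> ^ i))"
      using ri B \<kappa> by (simp flip: ennreal_mult ennreal_plus)
    also have "\<dots> \<le> ennreal (C * r ^ i)"
    proof (rule ennreal_leI)
      define z where "z = r ^ i"
      have "\<kappa> ^ i = z * z" by (simp add: r(3)[symmetric] z_def power2_eq_square power_mult_distrib)
      then have "r ^ i / 2 + (1 / (2 * r ^ i) + 2) * (B * \<kappa> ^ i) = z / 2 + z * B / 2 + 2 * B * (z * z)"
        using ri by (simp add: z_def[symmetric] field_simps)
      also have "z * z \<le> z" using ri by (simp add: z_def mult_left_le)
      then have "2 * B * (z * z) \<le> 2 * B * z" using B by (intro mult_left_mono) auto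
      then have "z / 2 + z * B / 2 + 2 * B * (z * z) \<le> (1/2 + 3 * B) * z"
        using mult_nonneg_nonneg[OF B(2), of z] ri by (simp add: algebra_simps z_def[symmetric])
      finally show "r ^ i / 2 + (1 / (2 * r ^ i) + 2) * (B * \<kappa> ^ i) \<le> C * r ^ i" by (simp add: C_def z_def)
    qed
    finally show "(\<integral>\<^sup>+\<omega>. ennreal \<bar>G (Suc i) H \<omega> - G i (A H) \<omega>\<bar> \<partial>M) \<le> ennreal (C * r ^ i)" .
  qed
qed

end

section \<open>The additive martingale\<close>

context brw_theta begin

definition AW :: "nat \<Rightarrow> (real \<Rightarrow> real) \<Rightarrow> real \<Rightarrow> real" where
  "AW m H w = (\<integral>s. H (w + s) \<partial>walk step m)"

lemma walk_rd: "real_distribution (walk step m)"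
  by (rule real_distribution_walk) (rule real_distribution_step)

context
  fixes H :: "real \<Rightarrow> real"
  assumes Hm [measurable]: "H \<in> borel_measurable borel" and H: "\<And>x. 0 \<le> H x" "\<And>x. H x \<le> 1"
begin

lemma AW_measurable [measurable]: "AW m H \<in> borel_measurable borel"
proof -
  interpret w: real_distribution "walk step m" by (rule walk_rd)
  show ?thesis unfolding AW_def[abs_def] by measurable
qed

lemma ennreal_AW: "ennreal (AW m H w) = (\<integral>\<^sup>+s. ennreal (H (w + s)) \<partial>walk step m)"
proof -
  interpret w: real_distribution "walk step m" by (rule walk_rd)
  show ?thesis unfolding AW_def
    by (rule nn_integral_eq_integral[symmetric]) (use H in \<open>auto intro!: w.integrable_const_bound[where B=1]\<close>)
qed

lemma AW_bounds: "0 \<le> AW m H w" "AW m H w \<le> 1"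
proof -
  interpret w: real_distribution "walk step m" by (rule walk_rd)
  show "0 \<le> AW m H w" unfolding AW_def using H by (intro integral_nonneg_AE) auto
  have "ennreal (AW m H w) \<le> (\<integral>\<^sup>+s. 1 \<partial>walk step m)"
    unfolding ennreal_AW by (intro nn_integral_mono) (use H in auto)
  also have "\<dots> = ennreal 1" using w.emeasure_space_1 by simp
  finally show "AW m H w \<le> 1" by simp
qed

lemma AW_0: "AW 0 H = H"
  by (simp add: AW_def[abs_def] integral_return)

lemma AW_Suc: "AW (Suc m) H = A (AW m H)"
proof
  fix w
  have "ennreal (AW (Suc m) H w) = (\<integral>\<^sup>+x. \<integral>\<^sup>+y. ennreal (H (w + (x + y))) \<partial>walk step m \<partial>step)"
    unfolding ennreal_AW by (rule nn_integral_walk_Suc[OF real_distribution_step]) measurable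
  also have "\<dots> = (\<integral>\<^sup>+x. ennreal (AW m H (w + x)) \<partial>step)"
    unfolding ennreal_AW by (simp add: add.assoc)
  also have "\<dots> = ennreal (A (AW m H) w)"
    by (rule ennreal_A[symmetric]) (auto simp: AW_bounds)
  finally show "AW (Suc m) H w = A (AW m H) w"
    using AW_bounds A_bounds[OF AW_measurable AW_bounds] by (subst (asm) ennreal_inj) auto
qed

end

text \<open>Generations j - 1 down to i are replaced by the transition operator one at a time. The
  cost at generation n is C r^n, uniformly in the test function, and the geometric series is bounded
  independently of j; C/(1 - r) is the constant that reproduces itself in the induction.\<close>

lemma rate:
  obtains C r where "0 < r" "r < 1" "0 \<le> C"
    "\<And>H i j. H \<in> borel_measurable borel \<Longrightarrow> (\<And>x. 0 \<le> H x) \<Longrightarrow> (\<And>x. H x \<le> 1) \<Longrightarrow> i \<le> j \<Longrightarrow>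
       (\<integral>\<^sup>+\<omega>. ennreal \<bar>G j H \<omega> - G i (AW (j - i) H) \<omega>\<bar> \<partial>M) \<le> ennreal (C * r ^ i)"
proof -
  obtain C r where r: "0 < r" "r < 1" "0 \<le> C" and one:
    "\<And>H i. H \<in> borel_measurable borel \<Longrightarrow> (\<And>x. 0 \<le> H x) \<Longrightarrow> (\<And>x. H x \<le> 1) \<Longrightarrow>
       (\<integral>\<^sup>+\<omega>. ennreal \<bar>G (Suc i) H \<omega> - G i (A H) \<omega>\<bar> \<partial>M) \<le> ennreal (C * r ^ i)"
    by (rule one_step_rate) blast
  show ?thesis
  proof (rule that[OF r(1,2), of "C / (1 - r)"])
    show "0 \<le> C / (1 - r)" using r by simp
    fix H :: "real \<Rightarrow> real" and i j :: nat
    assume Hm [measurable]: "H \<in> borel_measurable borel" and H: "\<And>x. 0 \<le> H x" "\<And>x. H x \<le> 1" and "i \<le> j"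
    note [measurable] = AW_measurable[OF Hm H]
    from \<open>i \<le> j\<close> show "(\<integral>\<^sup>+\<omega>. ennreal \<bar>G j H \<omega> - G i (AW (j - i) H) \<omega>\<bar> \<partial>M) \<le> ennreal (C / (1 - r) * r ^ i)"
    proof (induction i rule: inc_induct)
      case base
      show ?case by (simp add: AW_0[OF Hm H])
    next
      case (step n)
      have AWn: "AW (j - n) H = A (AW (j - Suc n) H)"
        using step.hyps AW_Suc[OF Hm H, of "j - Suc n"] by (simp add: Suc_diff_Suc)
      have "(\<integral>\<^sup>+\<omega>. ennreal \<bar>G j H \<omega> - G n (AW (j - n) H) \<omega>\<bar> \<partial>M)
         \<le> (\<integral>\<^sup>+\<omega>. ennreal \<bar>G j H \<omega> - G (Suc n) (AW (j - Suc n) H) \<omega>\<bar>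
              + ennreal \<bar>G (Suc n) (AW (j - Suc n) H) \<omega> - G n (A (AW (j - Suc n) H)) \<omega>\<bar> \<partial>M)"
        unfolding AWn by (intro nn_integral_mono) (simp flip: ennreal_plus)
      also have "\<dots> = (\<integral>\<^sup>+\<omega>. ennreal \<bar>G j H \<omega> - G (Suc n) (AW (j - Suc n) H) \<omega>\<bar> \<partial>M)
              + (\<integral>\<^sup>+\<omega>. ennreal \<bar>G (Suc n) (AW (j - Suc n) H) \<omega> - G n (A (AW (j - Suc n) H)) \<omega>\<bar> \<partial>M)"
        by (rule nn_integral_add) measurable
      also have "\<dots> \<le> ennreal (C / (1 - r) * r ^ Suc n) + ennreal (C * r ^ n)"
        by (intro add_mono step.IH one AW_measurable[OF Hm H] AW_bounds[OF Hm H])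
      also have "\<dots> = ennreal (C / (1 - r) * r ^ Suc n + C * r ^ n)"
        using r by (simp flip: ennreal_plus)
      also have "C / (1 - r) * r ^ Suc n + C * r ^ n = C / (1 - r) * r ^ n"
        using r by (simp add: field_simps)
      finally show ?case .
    qed
  qed
qed

lemma AW_one: "AW m (\<lambda>_. 1) = (\<lambda>_. 1)"
proof -
  interpret w: real_distribution "walk step m" by (rule walk_rd)
  show ?thesis using w.prob_space by (simp add: AW_def[abs_def])
qed

definition W :: "'a \<Rightarrow> real" where "W \<omega> = lim (\<lambda>i. G i (\<lambda>_. 1) \<omega>)"

text \<open>The function 1 is fixed by the transition operator, so the rate bounds the L1 norm of
  the martingale increments geometrically, and they are almost surely absolutely summable.\<close>

lemma martingale_limit: "AE \<omega> in M. (\<lambda>i. G i (\<lambda>_. 1) \<omega>) \<longlonglongrightarrow> W \<omega>"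
proof -
  obtain C r where r: "0 < r" "r < 1" "0 \<le> C" and rate:
    "\<And>H i j. H \<in> borel_measurable borel \<Longrightarrow> (\<And>x. 0 \<le> H x) \<Longrightarrow> (\<And>x. H x \<le> 1) \<Longrightarrow> i \<le> j \<Longrightarrow>
       (\<integral>\<^sup>+\<omega>. ennreal \<bar>G j H \<omega> - G i (AW (j - i) H) \<omega>\<bar> \<partial>M) \<le> ennreal (C * r ^ i)"
    by (rule rate) blast
  have "AE \<omega> in M. summable (\<lambda>i. \<bar>G (Suc i) (\<lambda>_. 1) \<omega> - G i (\<lambda>_. 1) \<omega>\<bar>)"
  proof (rule AE_summable_of_summable_nn_integral)
    show "(\<integral>\<^sup>+\<omega>. ennreal \<bar>G (Suc i) (\<lambda>_. 1) \<omega> - G i (\<lambda>_. 1) \<omega>\<bar> \<partial>M) \<le> ennreal (C * r ^ i)" for i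
      using rate[of "\<lambda>_. 1" i "Suc i"] by (simp add: AW_one)
    show "summable (\<lambda>i. C * r ^ i)" using r by (intro summable_mult summable_geometric) auto
  qed (use r in auto)
  then show ?thesis
  proof eventually_elim
    case (elim \<omega>)
    then have "summable (\<lambda>i. G (Suc i) (\<lambda>_. 1) \<omega> - G i (\<lambda>_. 1) \<omega>)"
      by (rule summable_rabs_cancel)
    from summable_LIMSEQ[OF this]
    have "(\<lambda>n. G n (\<lambda>_. 1) \<omega> - G 0 (\<lambda>_. 1) \<omega>) \<longlonglongrightarrow> (\<Sum>i. G (Suc i) (\<lambda>_. 1) \<omega> - G i (\<lambda>_. 1) \<omega>)"
      by (simp only: sum_lessThan_telescope[of "\<lambda>n. G n (\<lambda>_. 1) \<omega>"])
    from tendsto_add[OF this tendsto_const[of "G 0 (\<lambda>_. 1) \<omega>"]]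
    have "convergent (\<lambda>n. G n (\<lambda>_. 1) \<omega>)" by (auto simp: convergent_def)
    then show ?case unfolding W_def by (simp add: convergent_LIMSEQ_iff)
  qed
qed

lemma expectation_G_1: "(\<integral>\<^sup>+\<omega>. ennreal (G i (\<lambda>_. 1) \<omega>) \<partial>M) = 1"
proof -
  have "(\<integral>\<^sup>+\<omega>. ennreal (G i (\<lambda>_. 1) \<omega>) \<partial>M) = (\<integral>\<^sup>+\<omega>. GG i (\<lambda>_. 1) \<omega> \<partial>M)"
    using GG_finite by (intro nn_integral_cong_AE, eventually_elim) (simp add: G_def top.not_eq_extremum)
  then show ?thesis by (simp add: expectation_GG_1)
qed

text \<open>If the limit were 0 almost surely, Fatou's lemma would give 1 = E W_i \<le> liminf E
  |W_n - W_i| \<le> C r^i for every i.\<close>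

lemma W_not_zero: "\<not> (AE \<omega> in M. W \<omega> = 0)"
proof
  assume W0: "AE \<omega> in M. W \<omega> = 0"
  obtain C r where r: "0 < r" "r < 1" "0 \<le> C" and rate:
    "\<And>H i j. H \<in> borel_measurable borel \<Longrightarrow> (\<And>x. 0 \<le> H x) \<Longrightarrow> (\<And>x. H x \<le> 1) \<Longrightarrow> i \<le> j \<Longrightarrow>
       (\<integral>\<^sup>+\<omega>. ennreal \<bar>G j H \<omega> - G i (AW (j - i) H) \<omega>\<bar> \<partial>M) \<le> ennreal (C * r ^ i)"
    by (rule rate) blast
  have le: "1 \<le> C * r ^ i" for i
  proof -
    have "AE \<omega> in M. ennreal (G i (\<lambda>_. 1) \<omega>) = liminf (\<lambda>n. ennreal \<bar>G n (\<lambda>_. 1) \<omega> - G i (\<lambda>_. 1) \<omega>\<bar>)"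
      using W0 martingale_limit
    proof eventually_elim
      case (elim \<omega>)
      then have "(\<lambda>n. ennreal \<bar>G n (\<lambda>_. 1) \<omega> - G i (\<lambda>_. 1) \<omega>\<bar>) \<longlonglongrightarrow> ennreal \<bar>0 - G i (\<lambda>_. 1) \<omega>\<bar>"
        by (intro tendsto_ennrealI tendsto_rabs tendsto_diff) auto
      from lim_imp_Liminf[OF _ this] show ?case by (simp add: G_nonneg)
    qed
    then have "1 = (\<integral>\<^sup>+\<omega>. liminf (\<lambda>n. ennreal \<bar>G n (\<lambda>_. 1) \<omega> - G i (\<lambda>_. 1) \<omega>\<bar>) \<partial>M)"
      unfolding expectation_G_1[of i, symmetric] by (rule nn_integral_cong_AE)
    also have "\<dots> \<le> liminf (\<lambda>n. \<integral>\<^sup>+\<omega>. ennreal \<bar>G n (\<lambda>_. 1) \<omega> - G i (\<lambda>_. 1) \<omega>\<bar> \<partial>M)"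
      by (rule nn_integral_liminf) measurable
    also have "\<dots> \<le> ennreal (C * r ^ i)"
    proof (rule Liminf_le)
      show "\<forall>\<^sub>F n in sequentially. (\<integral>\<^sup>+\<omega>. ennreal \<bar>G n (\<lambda>_. 1) \<omega> - G i (\<lambda>_. 1) \<omega>\<bar> \<partial>M) \<le> ennreal (C * r ^ i)"
        using eventually_ge_at_top[of i]
      proof eventually_elim
        case (elim n)
        show ?case using rate[of "\<lambda>_. 1" i n] elim by (simp add: AW_one)
      qed
    qed simp
    finally show ?thesis using r by (simp add: ennreal_1[symmetric] del: ennreal_1)
  qed
  have "(\<lambda>i. C * r ^ i) \<longlonglongrightarrow> C * 0" using r by (intro tendsto_intros LIMSEQ_power_zero) auto
  from LIMSEQ_le_const[OF this, of 1] le show False by auto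
qed

text \<open>An exponential Chebyshev bound: beyond distance a0 i, part of the power \<theta> is
  traded for the factor exp(-\<eta> a0 i), leaving the power \<open>s0\<close> of finite mean. It
  discards the words of generation i that have moved further than linearly.\<close>

lemma tail_vanishes:
  obtains a0 :: real where "a0 > 0" "AE \<omega> in M. (\<lambda>i. G i (\<lambda>s. if s > a0 * i then 1 else 0) \<omega>) \<longlonglongrightarrow> 0"
proof -
  obtain B where B: "mg s0 = ennreal B" "0 \<le> B" using s0 by (cases "mg s0") auto
  have "mg \<theta> \<le> mg s0" using s0 by (intro mg_mono) simp
  then have "exp \<Lambda> \<le> B" using B by (simp add: mg_\<theta>)
  then have B1: "1 \<le> B" using \<Lambda>_nonneg one_le_exp_iff[of \<Lambda>] by linarith
  define \<eta> where "\<eta> = \<theta> - s0"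
  have \<eta>: "\<eta> > 0" using s0 by (simp add: \<eta>_def)
  \<comment> \<open>Chosen so that exp(-\<eta> a0) times the mean at \<open>s0\<close> is 1/e, which
    makes the expectations summable in i.\<close>
  define a0 where "a0 = (ln B + 1) / \<eta>"
  have a0: "a0 > 0" using \<eta> B1 by (simp add: a0_def add_nonneg_pos)
  have \<eta>a0: "\<eta> * a0 = ln B + 1" using \<eta> by (simp add: a0_def)
  define H where "H i s = (if s > a0 * real i then 1 else 0 :: real)" for i :: nat and s
  have [measurable]: "\<And>i. H i \<in> borel_measurable borel" unfolding H_def[abs_def] by measurable
  have "(\<integral>\<^sup>+\<omega>. ennreal (G i (H i) \<omega>) \<partial>M) \<le> ennreal (exp (- 1) ^ i)" for i
  proof -
    have pw: "ennreal (exp (- \<Lambda> * i) * p \<omega> v powr \<theta> * H i (- ln (p \<omega> v))) \<le> ennreal (exp (- (\<eta> * a0 * i))) * ennreal (p \<omega> v powr s0)" for \<omega> v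
    proof (cases "p \<omega> v = 0 \<or> - ln (p \<omega> v) \<le> a0 * i")
      case True then show ?thesis by (auto simp: H_def)
    next
      case False
      then have x: "p \<omega> v > 0" using p_nonneg[of \<omega> v] by (auto simp: less_le)
      have "p \<omega> v powr \<theta> = exp (\<eta> * ln (p \<omega> v)) * p \<omega> v powr s0"
        using x by (simp add: powr_def exp_add[symmetric] \<eta>_def algebra_simps)
      also have "exp (\<eta> * ln (p \<omega> v)) \<le> exp (- (\<eta> * a0 * i))"
      proof -
        have "\<eta> * (a0 * i) \<le> \<eta> * (- ln (p \<omega> v))" using False \<eta> by (intro mult_left_mono) auto
        then show ?thesis by simp
      qed
      finally have "p \<omega> v powr \<theta> \<le> exp (- (\<eta> * a0 * i)) * p \<omega> v powr s0" by (simp add: mult_right_mono)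
      then have "exp (- \<Lambda> * i) * p \<omega> v powr \<theta> * H i (- ln (p \<omega> v)) \<le> 1 * (exp (- (\<eta> * a0 * i)) * p \<omega> v powr s0) * 1"
        using \<Lambda>_nonneg by (intro mult_mono) (auto simp: H_def)
      then show ?thesis by (simp add: ennreal_leI flip: ennreal_mult)
    qed
    have "(\<integral>\<^sup>+\<omega>. ennreal (G i (H i) \<omega>) \<partial>M) \<le> (\<integral>\<^sup>+\<omega>. GG i (H i) \<omega> \<partial>M)"
      unfolding G_def by (intro nn_integral_mono) (simp add: ennreal_enn2real_if)
    also have "\<dots> \<le> (\<integral>\<^sup>+\<omega>. ennreal (exp (- (\<eta> * a0 * i))) * (\<integral>\<^sup>+v. ennreal (p \<omega> v powr s0) \<partial>count_space (words i)) \<partial>M)"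
      unfolding GG_def by (subst nn_integral_cmult[symmetric], simp, intro nn_integral_mono pw)
    also have "\<dots> = ennreal (exp (- (\<eta> * a0 * i))) * mg s0 ^ i"
      using borel_measurable_nn_integral_count_space[OF countable_words, of i "\<lambda>v \<omega>. ennreal (p \<omega> v powr s0)" M]
      by (simp add: nn_integral_cmult moment)
    also have "\<dots> = ennreal (exp (- (\<eta> * a0 * i)) * B ^ i)" using B by (simp add: ennreal_power ennreal_mult)
    also have "exp (- (\<eta> * a0 * i)) * B ^ i = exp (- 1) ^ i"
    proof -
      have "exp (- (\<eta> * a0 * i)) = (exp (- (\<eta> * a0))) ^ i" by (simp add: exp_of_nat_mult[symmetric] mult.commute)
      moreover have "exp (- (\<eta> * a0)) * B = exp (- 1)" using B1 by (simp add: \<eta>a0 exp_diff exp_minus field_simps)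
      ultimately show ?thesis by (simp add: power_mult_distrib[symmetric])
    qed
    finally show ?thesis .
  qed
  then have "AE \<omega> in M. summable (\<lambda>i. G i (H i) \<omega>)"
    by (intro AE_summable_of_summable_nn_integral[where c="\<lambda>i. exp (- 1) ^ i"] G_nonneg summable_geometric) auto
  then have "AE \<omega> in M. (\<lambda>i. G i (H i) \<omega>) \<longlonglongrightarrow> 0"
    by eventually_elim (rule summable_LIMSEQ_zero)
  then show ?thesis using that[OF a0] unfolding H_def by blast
qed

end

section \<open>Zero-one argument for the positivity of the martingale limit\<close>

lemma Pprod_Cons: "Pprod Q (k # u) = Q [] k * Pprod (\<lambda>w. Q (k # w)) u"
  unfolding Pprod_def by (simp add: prod.lessThan_Suc_shift del: prod.lessThan_Suc)

abbreviation fieldM :: "(nat list \<Rightarrow> nat \<Rightarrow> real) measure" where "fieldM \<equiv> Pi\<^sub>M UNIV (\<lambda>_. seqM)"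

lemma Pprod_measurable [measurable]: "(\<lambda>Q. Pprod Q v) \<in> borel_measurable fieldM"
  unfolding Pprod_def
proof (rule borel_measurable_prod)
  fix i
  have "(\<lambda>Q. Q (take i v)) \<in> measurable fieldM seqM" by (rule measurable_component_singleton) simp
  then show "(\<lambda>Q. Q (take i v) (v ! i)) \<in> borel_measurable fieldM" by (rule measurable_seqM_component)
qed

context brw_theta begin

definition mass :: "nat \<Rightarrow> (nat list \<Rightarrow> nat \<Rightarrow> real) \<Rightarrow> ennreal" where
  "mass n Q = (\<integral>\<^sup>+v. ennreal (exp (- \<Lambda> * n) * Pprod Q v powr \<theta>) \<partial>count_space (words n))"

text \<open>The lower limit of the mass is 0, written with countable quantifiers. As a property of
  the weight field alone it is measurable without knowing that a limit exists, and it can be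
  evaluated on the field of a subtree.\<close>

definition degenerate :: "(nat list \<Rightarrow> nat \<Rightarrow> real) \<Rightarrow> bool" where
  "degenerate Q \<longleftrightarrow> (\<forall>m n0. \<exists>n\<ge>n0. mass n Q < ennreal (1 / Suc m))"

lemma mass_measurable [measurable]: "mass n \<in> borel_measurable fieldM"
  unfolding mass_def[abs_def] by (rule borel_measurable_nn_integral_count_space) auto

lemma degenerate_measurable: "Measurable.pred fieldM degenerate"
  unfolding degenerate_def[abs_def] by measurable

lemma mass_eq_GG: "mass n (P \<omega>) = GG n (\<lambda>_. 1) \<omega>"
  by (simp add: mass_def GG_def)

lemma mass_Suc_ge:
  assumes Q: "\<And>u k. 0 \<le> Q u k"
  shows "ennreal (exp (- \<Lambda>) * Q [] k powr \<theta>) * mass n (\<lambda>w. Q (k # w)) \<le> mass (Suc n) Q"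
proof -
  have "ennreal (exp (- \<Lambda>) * Q [] k powr \<theta>) * mass n (\<lambda>w. Q (k # w))
     = (\<integral>\<^sup>+v. ennreal (exp (- \<Lambda> * Suc n) * Pprod Q (k # v) powr \<theta>) \<partial>count_space (words n))"
    unfolding mass_def
  proof (subst nn_integral_cmult[symmetric], simp, intro nn_integral_cong)
    fix v
    have "exp (- \<Lambda> * Suc n) = exp (- \<Lambda>) * exp (- \<Lambda> * n)" by (simp add: exp_add[symmetric] algebra_simps)
    then have "exp (- \<Lambda> * Suc n) * Pprod Q (k # v) powr \<theta>
      = (exp (- \<Lambda>) * Q [] k powr \<theta>) * (exp (- \<Lambda> * n) * Pprod (\<lambda>w. Q (k # w)) v powr \<theta>)"
      using Q Pprod_nonneg[of "\<lambda>w. Q (k # w)" v] by (simp add: Pprod_Cons powr_mult)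
    then show "ennreal (exp (- \<Lambda>) * Q [] k powr \<theta>) * ennreal (exp (- \<Lambda> * n) * Pprod (\<lambda>w. Q (k # w)) v powr \<theta>)
      = ennreal (exp (- \<Lambda> * Suc n) * Pprod Q (k # v) powr \<theta>)" by (simp add: ennreal_mult)
  qed
  also have "\<dots> = (\<integral>\<^sup>+u. ennreal (exp (- \<Lambda> * Suc n) * Pprod Q u powr \<theta>) \<partial>count_space (Cons k ` words n))"
    by (rule nn_integral_bij_count_space) (auto simp: bij_betw_def inj_on_def)
  also have "\<dots> = (\<integral>\<^sup>+u. ennreal (exp (- \<Lambda> * Suc n) * Pprod Q u powr \<theta>) * indicator (Cons k ` words n) u \<partial>count_space (words (Suc n)))"
    by (subst nn_integral_count_space_indicator, simp, subst nn_integral_count_space_indicator, simp)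
       (auto intro!: nn_integral_cong simp: words_def split: split_indicator)
  also have "\<dots> \<le> mass (Suc n) Q"
    unfolding mass_def by (intro nn_integral_mono) (auto split: split_indicator)
  finally show ?thesis .
qed

text \<open>Generation n + 1 of the tree contains a fixed positive multiple of generation n of the
  subtree, so small masses are inherited by every child of positive weight.\<close>

lemma degenerate_subtree:
  assumes Q: "\<And>u k. 0 \<le> Q u k" and "degenerate Q" and k: "Q [] k > 0"
  shows "degenerate (\<lambda>w. Q (k # w))"
  unfolding degenerate_def
proof (intro allI)
  fix m n0
  define c where "c = exp (- \<Lambda>) * Q [] k powr \<theta>"
  have c: "c > 0" using k by (simp add: c_def)
  obtain m' where m': "1 / real (Suc m') < c * (1 / Suc m)"
    using reals_Archimedean[of "c * (1 / Suc m)"] c by (auto simp: inverse_eq_divide)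
  obtain n where n: "n \<ge> Suc n0" "mass n Q < ennreal (1 / Suc m')"
    using assms(2) unfolding degenerate_def by blast
  then obtain n' where n': "n = Suc n'" "n' \<ge> n0" by (cases n) auto
  have "ennreal c * mass n' (\<lambda>w. Q (k # w)) \<le> mass n Q"
    unfolding n' c_def by (rule mass_Suc_ge[OF Q])
  also have "\<dots> < ennreal (1 / Suc m')" by fact
  also have "\<dots> \<le> ennreal (c * (1 / Suc m))" using m' by (intro ennreal_leI) simp
  also have "\<dots> = ennreal c * ennreal (1 / Suc m)" by (rule ennreal_mult) (use c in auto)
  finally have "mass n' (\<lambda>w. Q (k # w)) < ennreal (1 / Suc m)"
    by (meson linorder_not_less mult_left_mono zero_le)
  with n' show "\<exists>n\<ge>n0. mass n (\<lambda>w. Q (k # w)) < ennreal (1 / Suc m)" by blast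
qed

lemma P_field_measurable [measurable]: "P \<in> measurable M fieldM"
  by (rule measurable_PiM_single') (auto simp: space_PiM)

lemma subtree_measurable: "(\<lambda>Q w. Q (k # w)) \<in> measurable fieldM fieldM"
  by (rule measurable_PiM_single') (auto intro: measurable_component_singleton simp: space_PiM)

lemma subtree_pred_measurable [measurable]: "Measurable.pred M (\<lambda>\<omega>. degenerate (\<lambda>w. P \<omega> (k # w)))"
  using measurable_compose[OF measurable_compose[OF P_field_measurable subtree_measurable] degenerate_measurable] .

lemma degenerate_pred_measurable [measurable]: "Measurable.pred M (\<lambda>\<omega>. degenerate (P \<omega>))"
  using measurable_compose[OF P_field_measurable degenerate_measurable] .

definition dprob :: real where "dprob = prob {\<omega> \<in> space M. degenerate (P \<omega>)}"

text \<open>The field has a product law with equal factors, and reading it along the injection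
  \<open>Cons k\<close> merely reindexes the product.\<close>

lemma prob_subtree_degenerate: "prob {\<omega> \<in> space M. degenerate (\<lambda>w. P \<omega> (k # w))} = dprob"
proof -
  define D where "D = distr M seqM (\<lambda>\<omega>. P \<omega> [])"
  interpret D: prob_space D unfolding D_def by (rule prob_space_distr) simp
  have "distr M fieldM (\<lambda>\<omega>. \<lambda>u\<in>UNIV. P \<omega> u) = Pi\<^sub>M UNIV (\<lambda>u. distr M seqM (\<lambda>\<omega>. P \<omega> u))"
    using P_indep by (subst (asm) indep_vars_iff_distr_eq_PiM) auto
  moreover have "(\<lambda>u. distr M seqM (\<lambda>\<omega>. P \<omega> u)) = (\<lambda>_. D)"
    unfolding D_def by (rule ext) (rule P_ident)
  ultimately have law: "distr M fieldM P = Pi\<^sub>M UNIV (\<lambda>_. D)"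
    by (simp add: restrict_UNIV)
  have re: "distr (Pi\<^sub>M UNIV (\<lambda>_. D)) (Pi\<^sub>M UNIV (\<lambda>_. D)) (\<lambda>Q. \<lambda>w\<in>UNIV. Q (k # w)) = Pi\<^sub>M UNIV (\<lambda>_::nat list. D)"
    by (rule distr_PiM_reindex[of UNIV "\<lambda>_. D" "Cons k" UNIV]) (auto simp: D.prob_space_axioms inj_on_def)
  have sets: "sets (Pi\<^sub>M UNIV (\<lambda>_::nat list. D)) = sets fieldM"
    by (intro sets_PiM_cong) (auto simp: D_def)
  have "distr M fieldM (\<lambda>\<omega> w. P \<omega> (k # w)) = distr (distr M fieldM P) fieldM (\<lambda>Q w. Q (k # w))"
    by (simp add: distr_distr[OF subtree_measurable P_field_measurable] comp_def)
  also have "\<dots> = distr (Pi\<^sub>M UNIV (\<lambda>_. D)) (Pi\<^sub>M UNIV (\<lambda>_. D)) (\<lambda>Q. \<lambda>w\<in>UNIV. Q (k # w))"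
    unfolding law by (intro distr_cong) (auto simp: sets)
  also have "\<dots> = distr M fieldM P" unfolding re law ..
  finally have eq: "distr M fieldM (\<lambda>\<omega> w. P \<omega> (k # w)) = distr M fieldM P" .
  have m: "{Q \<in> space fieldM. degenerate Q} \<in> sets fieldM"
    using degenerate_measurable by measurable
  have "prob {\<omega> \<in> space M. degenerate (\<lambda>w. P \<omega> (k # w))} = measure (distr M fieldM (\<lambda>\<omega> w. P \<omega> (k # w))) {Q \<in> space fieldM. degenerate Q}"
    by (subst measure_distr[OF _ m]) (auto intro!: arg_cong[where f=prob] measurable_compose[OF P_field_measurable subtree_measurable] simp: space_PiM)
  also have "\<dots> = dprob"
    unfolding eq dprob_def by (subst measure_distr[OF _ m]) (auto intro!: arg_cong[where f=prob] simp: space_PiM)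
  finally show ?thesis .
qed

lemma subtree_block_measurable:
  "(\<lambda>b w. b (k # w)) \<in> measurable (Pi\<^sub>M (range (Cons k)) (\<lambda>_. seqM)) fieldM"
  by (rule measurable_PiM_single') (auto intro!: measurable_component_singleton simp: space_PiM)

lemma two_subtrees_degenerate:
  assumes "k \<noteq> l"
  shows "(\<integral>\<^sup>+\<omega>. indicator {\<omega>. degenerate (\<lambda>w. P \<omega> (k # w)) \<and> degenerate (\<lambda>w. P \<omega> (l # w))} \<omega> \<partial>M) = ennreal (dprob\<^sup>2)"
proof -
  let ?d = "\<lambda>b (k::nat). (if degenerate (\<lambda>w. b (k # w)) then 1 else 0 :: ennreal)"
  have m: "(\<lambda>b. ?d b k) \<in> borel_measurable (Pi\<^sub>M (range (Cons k)) (\<lambda>_. seqM))" for k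
    using measurable_compose[OF subtree_block_measurable degenerate_measurable] by measurable
  have int: "(\<integral>\<^sup>+\<omega>. ?d (P \<omega>) k \<partial>M) = ennreal dprob" for k
  proof -
    have "(\<integral>\<^sup>+\<omega>. ?d (P \<omega>) k \<partial>M) = (\<integral>\<^sup>+\<omega>. indicator {\<omega> \<in> space M. degenerate (\<lambda>w. P \<omega> (k # w))} \<omega> \<partial>M)"
      by (intro nn_integral_cong) (auto split: split_indicator)
    also have "\<dots> = ennreal dprob"
      by (subst nn_integral_indicator) (auto simp: prob_subtree_degenerate emeasure_eq_measure)
    finally show ?thesis .
  qed
  have [simp]: "?d (restrict (P \<omega>) (range (Cons k))) k = ?d (P \<omega>) k" for \<omega> k by simp
  have "(\<integral>\<^sup>+\<omega>. indicator {\<omega>. degenerate (\<lambda>w. P \<omega> (k # w)) \<and> degenerate (\<lambda>w. P \<omega> (l # w))} \<omega> \<partial>M)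
     = (\<integral>\<^sup>+\<omega>. ?d (P \<omega>) k * ?d (P \<omega>) l \<partial>M)"
    by (intro nn_integral_cong) (auto split: split_indicator)
  also have "\<dots> = (\<integral>\<^sup>+\<omega>. \<integral>\<^sup>+\<omega>'. ?d (P \<omega>) k * ?d (P \<omega>') l \<partial>M \<partial>M)"
  proof -
    have disj: "range (Cons k) \<inter> range (Cons l) = {}" using assms by auto
    have "(\<lambda>x. ?d (fst x) k * ?d (snd x) l) \<in> borel_measurable (Pi\<^sub>M (range (Cons k)) (\<lambda>_. seqM) \<Otimes>\<^sub>M Pi\<^sub>M (range (Cons l)) (\<lambda>_. seqM))"
      using measurable_compose[OF measurable_fst m] measurable_compose[OF measurable_snd m] by measurable
    from decouple[OF disj this] show ?thesis by simp
  qed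
  also have "\<dots> = (\<integral>\<^sup>+\<omega>. ?d (P \<omega>) k * ennreal dprob \<partial>M)"
    unfolding int[of l, symmetric] by (intro nn_integral_cong nn_integral_cmult) measurable
  also have "\<dots> = ennreal dprob * ennreal dprob"
    unfolding int[of k, symmetric] by (rule nn_integral_multc) measurable
  finally show ?thesis by (simp add: power2_eq_square dprob_def ennreal_mult)
qed

text \<open>A unique child of positive weight carries the whole sum 1, so almost surely at most one
  such child would contradict \<open>branching\<close>.\<close>

lemma two_children: "prob {\<omega> \<in> space M. \<exists>k l. k \<noteq> l \<and> P \<omega> [] k > 0 \<and> P \<omega> [] l > 0} > 0"
proof (rule ccontr)
  assume "\<not> ?thesis"
  then have "prob {\<omega> \<in> space M. \<exists>k l. k \<noteq> l \<and> P \<omega> [] k > 0 \<and> P \<omega> [] l > 0} = 0"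
    by (intro antisym) (auto simp: not_less)
  then have "AE \<omega> in M. \<not> (\<exists>k l. k \<noteq> l \<and> P \<omega> [] k > 0 \<and> P \<omega> [] l > 0)"
    by (subst (asm) prob_eq_0) auto
  then have "AE \<omega> in M. \<forall>k. P \<omega> [] k \<in> {0, 1}"
  proof eventually_elim
    case (elim \<omega>)
    show ?case
    proof
      fix k
      show "P \<omega> [] k \<in> {0, 1}"
      proof (cases "P \<omega> [] k = 0")
        case False
        then have "P \<omega> [] l = 0" if "l \<noteq> k" for l
          using elim that P_nonneg[of \<omega> "[]" k] P_nonneg[of \<omega> "[]" l] by (force simp: less_le)
        then have "(\<lambda>l. P \<omega> [] l) sums (\<Sum>l\<in>{k}. P \<omega> [] l)" by (intro sums_finite) auto
        from sums_unique2[OF this P_sums] show ?thesis by simp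
      qed simp
    qed
  qed
  with branching show False by blast
qed

lemma dprob_less_1: "dprob < 1"
proof (rule ccontr)
  assume "\<not> dprob < 1"
  then have "dprob = 1" using prob_le_1 by (simp add: dprob_def order_antisym)
  then have "AE \<omega> in M. degenerate (P \<omega>)" unfolding dprob_def by (subst (asm) prob_eq_1) auto
  then have "AE \<omega> in M. W \<omega> = 0" using martingale_limit GG_finite
  proof eventually_elim
    case (elim \<omega>)
    show ?case
    proof (rule ccontr)
      assume "W \<omega> \<noteq> 0"
      moreover have "W \<omega> \<ge> 0" by (rule LIMSEQ_le_const[OF elim(2)]) (auto simp: G_nonneg)
      ultimately have Wp: "W \<omega> > 0" by simp
      from order_tendstoD(1)[OF elim(2), of "W \<omega> / 2"] Wp
      obtain n0 where n0: "\<And>n. n \<ge> n0 \<Longrightarrow> W \<omega> / 2 < G n (\<lambda>_. 1) \<omega>"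
        by (auto simp: eventually_sequentially)
      obtain m where m: "1 / real (Suc m) < W \<omega> / 2"
        using reals_Archimedean[of "W \<omega> / 2"] Wp by (auto simp: inverse_eq_divide)
      from elim(1) obtain n where n: "n \<ge> n0" "mass n (P \<omega>) < ennreal (1 / Suc m)"
        unfolding degenerate_def by blast
      have "ennreal (G n (\<lambda>_. 1) \<omega>) = mass n (P \<omega>)"
        using elim(3) by (simp add: G_def mass_eq_GG top.not_eq_extremum)
      with n have "ennreal (G n (\<lambda>_. 1) \<omega>) < ennreal (1 / Suc m)" by (simp only:)
      then have "G n (\<lambda>_. 1) \<omega> < 1 / Suc m" using ennreal_less_iff G_nonneg by blast
      with n0[OF n(1)] m show False by linarith
    qed
  qed
  with W_not_zero show False by blast
qed

text \<open>A degenerate tree has degenerate subtrees at all children of positive weight. There is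
  always one such child, and at least two on an event R; different subtrees are independent. Hence q
  \<le> q^2 Pr(R) + q (1 - Pr(R)), that is Pr(R) q (1 - q) \<le> 0. As Pr(R) > 0 and q < 1, q
  vanishes.\<close>

lemma dprob_eq_0: "dprob = 0"
proof -
  define R where "R = {\<omega> \<in> space M. \<exists>k l. k \<noteq> l \<and> P \<omega> [] k > 0 \<and> P \<omega> [] l > 0}"
  have [measurable]: "R \<in> sets M" unfolding R_def by measurable
  define q where "q = dprob"
  have q: "0 \<le> q" "q < 1" using dprob_less_1 by (auto simp: q_def dprob_def)
  let ?MA = "Pi\<^sub>M {[]} (\<lambda>_. seqM)" and ?MB = "Pi\<^sub>M (- {[]}) (\<lambda>_. seqM)"
  \<comment> \<open>The weights of the children are read from the first block, the root vector, and
    degeneracy of the subtrees from the second, so that the two can be decoupled.\<close>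
  define \<Phi> where "\<Phi> x = (if \<forall>k. fst x [] k > 0 \<longrightarrow> degenerate (\<lambda>w. snd x (k # w)) then 1 else 0 :: ennreal)"
    for x :: "(nat list \<Rightarrow> nat \<Rightarrow> real) \<times> (nat list \<Rightarrow> nat \<Rightarrow> real)"
  have [measurable]: "\<Phi> \<in> borel_measurable (?MA \<Otimes>\<^sub>M ?MB)"
  proof -
    have "(\<lambda>x. fst x []) \<in> measurable (?MA \<Otimes>\<^sub>M ?MB) seqM"
      by (rule measurable_compose[OF measurable_fst measurable_component_singleton]) simp
    then have [measurable]: "(\<lambda>x. fst x [] k) \<in> borel_measurable (?MA \<Otimes>\<^sub>M ?MB)" for k
      by (rule measurable_seqM_component)
    have "(\<lambda>b w. b (k # w)) \<in> measurable ?MB fieldM" for k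
      by (rule measurable_PiM_single') (auto intro!: measurable_component_singleton simp: space_PiM)
    from measurable_compose[OF measurable_compose[OF measurable_snd this] degenerate_measurable]
    have [measurable]: "Measurable.pred (?MA \<Otimes>\<^sub>M ?MB) (\<lambda>x. degenerate (\<lambda>w. snd x (k # w)))" for k .
    show ?thesis unfolding \<Phi>_def[abs_def] by measurable
  qed
  have \<Phi>: "\<Phi> (restrict (P \<omega>) {[]}, restrict (P \<omega>') (- {[]}))
     = (if \<forall>k. P \<omega> [] k > 0 \<longrightarrow> degenerate (\<lambda>w. P \<omega>' (k # w)) then 1 else 0)" for \<omega> \<omega>'
    by (simp add: \<Phi>_def)
  have "ennreal q = (\<integral>\<^sup>+\<omega>. indicator {\<omega> \<in> space M. degenerate (P \<omega>)} \<omega> \<partial>M)"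
    by (subst nn_integral_indicator) (auto simp: q_def dprob_def emeasure_eq_measure)
  also have "\<dots> \<le> (\<integral>\<^sup>+\<omega>. \<Phi> (restrict (P \<omega>) {[]}, restrict (P \<omega>) (- {[]})) \<partial>M)"
    unfolding \<Phi> by (intro nn_integral_mono) (auto split: split_indicator intro: degenerate_subtree P_nonneg)
  also have "\<dots> = (\<integral>\<^sup>+\<omega>. \<integral>\<^sup>+\<omega>'. \<Phi> (restrict (P \<omega>) {[]}, restrict (P \<omega>') (- {[]})) \<partial>M \<partial>M)"
    by (rule decouple) auto
  also have "\<dots> \<le> (\<integral>\<^sup>+\<omega>. ennreal (q\<^sup>2) * indicator R \<omega> + ennreal q * indicator (space M - R) \<omega> \<partial>M)"
  proof (intro nn_integral_mono)
    fix \<omega> assume \<omega>: "\<omega> \<in> space M"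
    show "(\<integral>\<^sup>+\<omega>'. \<Phi> (restrict (P \<omega>) {[]}, restrict (P \<omega>') (- {[]})) \<partial>M) \<le> ennreal (q\<^sup>2) * indicator R \<omega> + ennreal q * indicator (space M - R) \<omega>"
    proof (cases "\<omega> \<in> R")
      case True
      then obtain k l where kl: "k \<noteq> l" "P \<omega> [] k > 0" "P \<omega> [] l > 0" by (auto simp: R_def)
      have "(\<integral>\<^sup>+\<omega>'. \<Phi> (restrict (P \<omega>) {[]}, restrict (P \<omega>') (- {[]})) \<partial>M)
         \<le> (\<integral>\<^sup>+\<omega>. indicator {\<omega>. degenerate (\<lambda>w. P \<omega> (k # w)) \<and> degenerate (\<lambda>w. P \<omega> (l # w))} \<omega> \<partial>M)"
        unfolding \<Phi> using kl by (intro nn_integral_mono) (auto split: split_indicator)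
      also have "\<dots> = ennreal (q\<^sup>2)" unfolding two_subtrees_degenerate[OF kl(1)] q_def ..
      finally show ?thesis using True by simp
    next
      case False
      have "\<exists>k. P \<omega> [] k > 0"
      proof (rule ccontr)
        assume "\<not> ?thesis"
        then have "P \<omega> [] k = 0" for k using P_nonneg[of \<omega> "[]" k] by (metis less_le)
        then have "(\<lambda>k. P \<omega> [] k) sums 0" by simp
        from sums_unique2[OF this P_sums] show False by simp
      qed
      then obtain k where k: "P \<omega> [] k > 0" ..
      have "(\<integral>\<^sup>+\<omega>'. \<Phi> (restrict (P \<omega>) {[]}, restrict (P \<omega>') (- {[]})) \<partial>M)
         \<le> (\<integral>\<^sup>+\<omega>. indicator {\<omega> \<in> space M. degenerate (\<lambda>w. P \<omega> (k # w))} \<omega> \<partial>M)"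
        unfolding \<Phi> using k by (intro nn_integral_mono) (auto split: split_indicator)
      also have "\<dots> = ennreal q"
        by (subst nn_integral_indicator) (auto simp: emeasure_eq_measure prob_subtree_degenerate q_def)
      finally show ?thesis using False \<omega> by simp
    qed
  qed
  also have "\<dots> = ennreal (q\<^sup>2 * prob R + q * (1 - prob R))"
    using q by (simp add: nn_integral_add nn_integral_cmult emeasure_eq_measure prob_compl ennreal_mult)
  finally have "q \<le> q\<^sup>2 * prob R + q * (1 - prob R)"
    using q by (subst (asm) ennreal_le_iff) auto
  then have "prob R * (q * (1 - q)) \<le> 0" by (simp add: power2_eq_square algebra_simps)
  moreover have "prob R > 0" unfolding R_def by (rule two_children)
  ultimately have "q * (1 - q) \<le> 0" by (simp add: mult_le_0_iff)
  then show ?thesis using q by (auto simp: mult_le_0_iff q_def)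
qed

lemma W_positive: "AE \<omega> in M. W \<omega> > 0"
proof -
  have "AE \<omega> in M. \<not> degenerate (P \<omega>)"
    using dprob_eq_0 unfolding dprob_def by (subst (asm) prob_eq_0) auto
  then show ?thesis using martingale_limit GG_finite
  proof eventually_elim
    case (elim \<omega>)
    have "W \<omega> \<ge> 0" by (rule LIMSEQ_le_const[OF elim(2)]) (auto simp: G_nonneg)
    moreover have "W \<omega> \<noteq> 0"
    proof
      assume "W \<omega> = 0"
      have "degenerate (P \<omega>)" unfolding degenerate_def
      proof (intro allI)
        fix m n0
        from order_tendstoD(2)[OF elim(2), of "1 / Suc m"] \<open>W \<omega> = 0\<close>
        obtain N where N: "\<And>n. n \<ge> N \<Longrightarrow> G n (\<lambda>_. 1) \<omega> < 1 / Suc m" by (auto simp: eventually_sequentially)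
        have "mass n (P \<omega>) = ennreal (G n (\<lambda>_. 1) \<omega>)" for n
          using elim(3) by (simp add: G_def mass_eq_GG top.not_eq_extremum)
        then have "mass (max N n0) (P \<omega>) < ennreal (1 / Suc m)"
          using N[of "max N n0"] by (simp add: ennreal_less_iff G_nonneg)
        then show "\<exists>n\<ge>n0. mass n (P \<omega>) < ennreal (1 / Suc m)" by (intro exI[of _ "max N n0"]) auto
      qed
      with elim show False by blast
    qed
    ultimately show ?case by simp
  qed
qed

end

section \<open>Occupancy of boxes\<close>

text \<open>Valid without summability: a divergent \<open>infsum\<close> is 0 by default, and so is
  \<open>enn2real\<close> of infinity.\<close>

lemma infsum_eq_nn_integral:
  fixes f :: "'b \<Rightarrow> real"
  assumes "\<And>x. 0 \<le> f x"
  shows "infsum f S = enn2real (\<integral>\<^sup>+x. ennreal (f x) \<partial>count_space S)"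
proof (cases "f summable_on S")
  case True
  then have "(\<lambda>x. norm (f x)) summable_on S" using assms by simp
  then have *: "Infinite_Set_Sum.abs_summable_on f S" by (rule abs_summable_equivalent[THEN iffD1])
  show ?thesis
    using nn_integral_conv_infsetsum[OF * assms] infsetsum_infsum[OF *] infsum_nonneg[of S f] assms by simp
next
  case False
  have "(\<integral>\<^sup>+x. ennreal (f x) \<partial>count_space S) = \<infinity>"
  proof (rule ccontr)
    assume *: "\<not> ?thesis"
    have "Infinite_Set_Sum.abs_summable_on f S"
      unfolding Infinite_Set_Sum.abs_summable_on_def
      by (rule integrableI_nonneg) (use assms * in \<open>auto simp: top.not_eq_extremum\<close>)
    then have "(\<lambda>x. norm (f x)) summable_on S" by (rule abs_summable_equivalent[THEN iffD2])
    then show False using False assms by simp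
  qed
  then show ?thesis using False by (simp add: infsum_not_exists)
qed

lemma nn_integral_count_space_restrict:
  "(\<integral>\<^sup>+x. f x \<partial>count_space X) = (\<integral>\<^sup>+x. f x * indicator X x \<partial>count_space UNIV)"
  by (simp add: nn_integral_restrict_space[symmetric] restrict_count_space)

lemma nn_integral_count_space_mono_set:
  "X \<subseteq> Y \<Longrightarrow> (\<integral>\<^sup>+x. f x \<partial>count_space X) \<le> (\<integral>\<^sup>+x. f x \<partial>count_space Y)"
  unfolding nn_integral_count_space_restrict[where f=f and X=X] nn_integral_count_space_restrict[where f=f and X=Y]
  by (intro nn_integral_mono) (auto split: split_indicator)

lemma nn_integral_count_space_Un_disjoint:
  "X \<inter> Y = {} \<Longrightarrow> (\<integral>\<^sup>+x. f x \<partial>count_space (X \<union> Y)) = (\<integral>\<^sup>+x. f x \<partial>count_space X) + (\<integral>\<^sup>+x. f x \<partial>count_space Y)"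
  unfolding nn_integral_count_space_restrict[where f=f and X=X] nn_integral_count_space_restrict[where f=f and X=Y] nn_integral_count_space_restrict[where f=f and X="X \<union> Y"]
  by (subst nn_integral_add[symmetric]) (auto intro!: nn_integral_cong split: split_indicator)

text \<open>Raising 1 - x^2 \<le> (1 - x) e^x to the n-th power with Bernoulli's inequality gives an
  error x (n x e^(-n x)), and y e^(-y) \<le> 1. A bound by x, free of n, can be summed over a whole
  level.\<close>

lemma exp_minus_power_le:
  fixes x :: real
  assumes "0 \<le> x" "x \<le> 1"
  shows "(1 - x) ^ n \<le> exp (- (n * x))" and "exp (- (n * x)) - (1 - x) ^ n \<le> x"
proof -
  have "1 - x \<le> exp (- x)" using exp_ge_add_one_self[of "- x"] by simp
  then have "(1 - x) ^ n \<le> exp (- x) ^ n" using assms by (intro power_mono) auto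
  then show "(1 - x) ^ n \<le> exp (- (n * x))" by (simp add: exp_of_nat_mult[symmetric])
  have "1 - x\<^sup>2 = (1 - x) * (1 + x)" by (simp add: power2_eq_square algebra_simps)
  also have "\<dots> \<le> (1 - x) * exp x" using assms by (intro mult_left_mono exp_ge_add_one_self) auto
  finally have 1: "1 - x\<^sup>2 \<le> (1 - x) * exp x" .
  have x2: "x\<^sup>2 \<le> 1" using assms by (simp add: power_le_one)
  have "1 - n * x\<^sup>2 \<le> (1 - x\<^sup>2) ^ n" using Bernoulli_inequality[of "- x\<^sup>2" n] x2 by simp
  also have "\<dots> \<le> ((1 - x) * exp x) ^ n" using 1 x2 by (intro power_mono) auto
  also have "\<dots> = (1 - x) ^ n * exp (n * x)" by (simp add: power_mult_distrib exp_of_nat_mult[symmetric])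
  finally have "(1 - n * x\<^sup>2) * exp (- (n * x)) \<le> ((1 - x) ^ n * exp (n * x)) * exp (- (n * x))"
    by (intro mult_right_mono) auto
  also have "\<dots> = (1 - x) ^ n" by (simp add: mult.assoc exp_add[symmetric])
  finally have "exp (- (n * x)) - (1 - x) ^ n \<le> x * (n * x * exp (- (n * x)))"
    by (simp add: algebra_simps power2_eq_square)
  also have "n * x * exp (- (n * x)) \<le> 1"
  proof -
    have "n * x \<le> exp (n * x)" using exp_ge_add_one_self[of "n * x"] by linarith
    then show ?thesis by (simp add: exp_minus divide_inverse[symmetric])
  qed
  then have "x * (n * x * exp (- (n * x))) \<le> x * 1" using assms by (intro mult_left_mono) auto
  finally show "exp (- (n * x)) - (1 - x) ^ n \<le> x" by simp
qed

section \<open>Order and geometry of the boxes of one level\<close>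

lemma lexlt_linear: "lexlt u v \<or> u = v \<or> lexlt v u"
  unfolding lexlt_def using lexord_linear[of "{(x, y). x < y}" u v] by force

lemma lexlt_trans: "lexlt u v \<Longrightarrow> lexlt v w \<Longrightarrow> lexlt u w"
  unfolding lexlt_def by (rule lexord_trans) (auto simp: trans_def)

lemma lexlt_irrefl: "\<not> lexlt u u"
  unfolding lexlt_def by (rule lexord_irreflexive) auto

text \<open>The left end of a box with the infinite sum taken as an integral, which makes its
  measurability in the weight field immediate.\<close>

definition boxl :: "(nat list \<Rightarrow> nat \<Rightarrow> real) \<Rightarrow> nat list \<Rightarrow> real" where
  "boxl Q u = enn2real (\<integral>\<^sup>+v. ennreal (Pprod Q v) \<partial>count_space {v. length v = length u \<and> lexlt v u})"

definition mbox :: "(nat list \<Rightarrow> nat \<Rightarrow> real) \<Rightarrow> nat list \<Rightarrow> real set" where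
  "mbox Q u = {boxl Q u ..< boxl Q u + Pprod Q u}"

lemma boxl_measurable [measurable]: "(\<lambda>Q. boxl Q u) \<in> borel_measurable fieldM"
proof -
  have "(\<lambda>Q. \<integral>\<^sup>+v. ennreal (Pprod Q v) \<partial>count_space {v. length v = length u \<and> lexlt v u}) \<in> borel_measurable fieldM"
    by (rule borel_measurable_nn_integral_count_space) auto
  then show ?thesis unfolding boxl_def by measurable
qed

context
  fixes Q :: "nat list \<Rightarrow> nat \<Rightarrow> real"
  assumes Q: "\<And>u k. 0 \<le> Q u k" "\<And>u. (\<lambda>k. Q u k) sums 1"
begin

lemma box_eq_mbox: "box Q u = mbox Q u"
  unfolding box_def mbox_def box_left_def boxl_def infsum_eq_nn_integral[OF Pprod_nonneg[OF Q(1)]] ..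

lemma level_sum: "(\<integral>\<^sup>+u. ennreal (Pprod Q u) \<partial>count_space (words j)) = 1"
proof (induction j)
  case 0
  then show ?case by (simp add: words_0 nn_integral_count_space_finite)
next
  case (Suc j)
  have "(\<Sum>k. ennreal (Q v k)) = 1" for v
    unfolding suminf_ennreal2[OF Q(1) sums_summable[OF Q(2)]] sums_unique[OF Q(2), symmetric] by simp
  then have "(\<Sum>k. ennreal (Pprod Q v * Q v k)) = ennreal (Pprod Q v)" for v
    using Q by (simp add: ennreal_mult Pprod_nonneg)
  then show ?case using Suc.IH by (simp add: nn_integral_words_Suc Pprod_snoc)
qed

lemma boxl_add_le:
  assumes u: "u \<in> words j"
  shows "boxl Q u + Pprod Q u \<le> 1"
    and "w \<in> words j \<Longrightarrow> lexlt u w \<Longrightarrow> boxl Q u + Pprod Q u \<le> boxl Q w"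
proof -
  let ?L = "\<lambda>u. {v. length v = length u \<and> lexlt v u}"
  have sub: "?L u \<subseteq> words j" if "u \<in> words j" for u using that by (auto simp: words_def)
  have le: "(\<integral>\<^sup>+v. ennreal (Pprod Q v) \<partial>count_space (?L u)) \<le> 1" if "u \<in> words j" for u
  proof -
    have "(\<integral>\<^sup>+v. ennreal (Pprod Q v) \<partial>count_space (?L u)) \<le> (\<integral>\<^sup>+v. ennreal (Pprod Q v) \<partial>count_space (words j))"
      using sub[OF that] by (rule nn_integral_count_space_mono_set)
    then show ?thesis by (simp add: level_sum)
  qed
  have e: "ennreal (boxl Q u) = (\<integral>\<^sup>+v. ennreal (Pprod Q v) \<partial>count_space (?L u))" if "u \<in> words j" for u
    unfolding boxl_def using le[OF that] by (subst ennreal_enn2real) (auto simp: top.not_eq_extremum intro: le_less_trans)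
  \<comment> \<open>The right end of a box is the mass of all words up to and including u. These
    words precede any w with u before w, so the boxes are ordered like the words.\<close>
  have ins: "ennreal (boxl Q u + Pprod Q u) = (\<integral>\<^sup>+v. ennreal (Pprod Q v) \<partial>count_space (insert u (?L u)))"
  proof -
    have "ennreal (boxl Q u + Pprod Q u) = ennreal (boxl Q u) + ennreal (Pprod Q u)"
      using Q by (simp add: boxl_def Pprod_nonneg)
    also have "\<dots> = (\<integral>\<^sup>+v. ennreal (Pprod Q v) \<partial>count_space (?L u)) + (\<integral>\<^sup>+v. ennreal (Pprod Q v) \<partial>count_space {u})"
      by (simp add: e[OF u] nn_integral_count_space_finite)
    also have "\<dots> = (\<integral>\<^sup>+v. ennreal (Pprod Q v) \<partial>count_space (?L u \<union> {u}))"
      by (rule nn_integral_count_space_Un_disjoint[symmetric]) (auto simp: lexlt_irrefl)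
    finally show ?thesis by simp
  qed
  have "(\<integral>\<^sup>+v. ennreal (Pprod Q v) \<partial>count_space (insert u (?L u))) \<le> (\<integral>\<^sup>+v. ennreal (Pprod Q v) \<partial>count_space (words j))"
    using sub[OF u] u by (intro nn_integral_count_space_mono_set) auto
  then have "ennreal (boxl Q u + Pprod Q u) \<le> ennreal 1" unfolding ins level_sum by simp
  then show "boxl Q u + Pprod Q u \<le> 1" by simp
  assume w: "w \<in> words j" "lexlt u w"
  have "(\<integral>\<^sup>+v. ennreal (Pprod Q v) \<partial>count_space (insert u (?L u))) \<le> (\<integral>\<^sup>+v. ennreal (Pprod Q v) \<partial>count_space (?L w))"
    using u w by (intro nn_integral_count_space_mono_set) (auto simp: words_def intro: lexlt_trans)
  then have "ennreal (boxl Q u + Pprod Q u) \<le> ennreal (boxl Q w)" unfolding ins e[OF w(1)] .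
  then show "boxl Q u + Pprod Q u \<le> boxl Q w" by (subst (asm) ennreal_le_iff) (auto simp: boxl_def)
qed

lemma mbox_disjoint:
  assumes "u \<in> words j" "v \<in> words j" "u \<noteq> v"
  shows "mbox Q u \<inter> mbox Q v = {}"
  using lexlt_linear[of u v] boxl_add_le(2)[OF assms(1) assms(2)] boxl_add_le(2)[OF assms(2) assms(1)] assms(3)
  by (auto simp: mbox_def)

lemma mbox_subset: "u \<in> words j \<Longrightarrow> mbox Q u \<subseteq> {0..1}"
  using boxl_add_le(1)[of u j] by (auto simp: mbox_def boxl_def intro: order_trans[OF enn2real_nonneg])

lemma emeasure_mbox: "emeasure lborel (mbox Q u) = ennreal (Pprod Q u)"
  using Pprod_nonneg[of Q u] Q by (simp add: mbox_def)

end

definition hit :: "(nat list \<Rightarrow> nat \<Rightarrow> real) \<Rightarrow> (nat \<Rightarrow> real) \<Rightarrow> nat \<Rightarrow> nat list \<Rightarrow> ennreal" where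
  "hit Q y n u = (if \<exists>i\<in>{1..n}. y i \<in> mbox Q u then 1 else 0)"

text \<open>Boxes of one level are disjoint, so each ball occupies at most one of them. Finiteness
  matters for the meaning of the count, because \<open>card\<close> of an infinite set is 0.\<close>

lemma occupied_boxes:
  assumes Q: "\<And>u k. 0 \<le> Q u k" "\<And>u. (\<lambda>k. Q u k) sums 1"
  shows "finite {u \<in> words j. \<exists>i\<in>{1..n}. y i \<in> mbox Q u}" (is "finite ?S")
    and "Kocc Q y j n = card {u \<in> words j. \<exists>i\<in>{1..n}. y i \<in> mbox Q u}"
proof -
  have "?S = (\<Union>i\<in>{1..n}. {u \<in> words j. y i \<in> mbox Q u})" by auto
  moreover have "finite {u \<in> words j. y i \<in> mbox Q u}" for i
  proof (cases "\<exists>u\<in>words j. y i \<in> mbox Q u")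
    case True
    then obtain u where "u \<in> words j" "y i \<in> mbox Q u" by blast
    then have "{u \<in> words j. y i \<in> mbox Q u} \<subseteq> {u}" using mbox_disjoint[of Q, OF Q] by blast
    then show ?thesis by (rule finite_subset) simp
  next
    case False
    then have "{u \<in> words j. y i \<in> mbox Q u} = {}" by blast
    then show ?thesis by (simp only: finite.emptyI)
  qed
  ultimately show "finite ?S" by simp
  have c: "card {i \<in> {1..n}. y i \<in> box Q u} \<ge> 1 \<longleftrightarrow> (\<exists>i\<in>{1..n}. y i \<in> mbox Q u)" for u
    unfolding box_eq_mbox[of Q, OF Q] using card_0_eq[of "{i \<in> {1..n}. y i \<in> mbox Q u}"] by (auto simp: Suc_le_eq card_gt_0_iff)
  show "Kocc Q y j n = card ?S"
    unfolding Kocc_def Kcount_def c words_def by simp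
qed

lemma Kocc_eq:
  assumes Q: "\<And>u k. 0 \<le> Q u k" "\<And>u. (\<lambda>k. Q u k) sums 1"
  shows "real (Kocc Q y j n) = enn2real (\<integral>\<^sup>+u. hit Q y n u \<partial>count_space (words j))"
proof -
  define S where "S = {u \<in> words j. \<exists>i\<in>{1..n}. y i \<in> mbox Q u}"
  have fin: "finite S" and K: "Kocc Q y j n = card S"
    using occupied_boxes[of Q, OF Q] by (simp_all add: S_def)
  have "(\<integral>\<^sup>+u. hit Q y n u \<partial>count_space (words j)) = (\<Sum>u\<in>S. hit Q y n u)"
    by (rule nn_integral_count_space'[OF fin]) (auto simp: S_def hit_def)
  also have "\<dots> = (\<Sum>u\<in>S. 1)" by (intro sum.cong) (auto simp: S_def hit_def)
  finally show ?thesis by (simp add: K enn2real_of_nat)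
qed

lemma Kocc_mono:
  assumes Q: "\<And>u k. 0 \<le> Q u k" "\<And>u. (\<lambda>k. Q u k) sums 1" and "n \<le> n'"
  shows "Kocc Q y j n \<le> Kocc Q y j n'"
  unfolding occupied_boxes(2)[of Q, OF Q]
  by (intro card_mono occupied_boxes(1)[of Q, OF Q]) (use \<open>n \<le> n'\<close> in fastforce)

section \<open>Independent uniform balls for frozen weights\<close>

abbreviation ballsM :: "(nat \<Rightarrow> real) measure" where "ballsM \<equiv> Pi\<^sub>M UNIV (\<lambda>_. borel)"

locale uniform_balls = prob_space M for M :: "'a measure" +
  fixes U :: "'a \<Rightarrow> nat \<Rightarrow> real"
  assumes indep_U: "indep_vars (\<lambda>_. borel) (\<lambda>i \<omega>. U \<omega> i) UNIV"
    and unif_U: "\<And>i. distr M lborel (\<lambda>\<omega>. U \<omega> i) = uniform_measure lborel {0..1}"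
begin

lemma U_measurable [measurable]: "(\<lambda>\<omega>. U \<omega> i) \<in> borel_measurable M"
  using indep_U by (auto simp: indep_vars_def)

lemma U_vec_measurable [measurable]: "U \<in> measurable M ballsM"
  by (rule measurable_PiM_single') (auto simp: space_PiM)

lemma prob_ball:
  assumes S: "S \<in> sets borel" "S \<subseteq> {0..1}"
  shows "emeasure M {\<omega> \<in> space M. U \<omega> i \<in> S} = emeasure lborel S"
proof -
  have "emeasure M {\<omega> \<in> space M. U \<omega> i \<in> S} = emeasure (distr M lborel (\<lambda>\<omega>. U \<omega> i)) S"
    using S by (subst emeasure_distr) (auto intro!: arg_cong[where f="emeasure M"])
  also have "\<dots> = emeasure lborel S"
    unfolding unif_U using S by (subst emeasure_uniform_measure) (auto simp: Int_absorb1 divide_ennreal_def)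
  finally show ?thesis .
qed

lemma prob_no_ball:
  assumes S: "S \<in> sets borel" "S \<subseteq> {0..1}" and x: "emeasure lborel S = ennreal x" "0 \<le> x" "x \<le> 1"
  shows "prob {\<omega> \<in> space M. \<forall>i\<in>{1..n}. U \<omega> i \<notin> S} = (1 - x) ^ n"
proof -
  have [measurable]: "S \<in> sets borel" by fact
  have 1: "(\<integral>\<^sup>+\<omega>. indicator (- S) (U \<omega> i) \<partial>M) = ennreal (1 - x)" for i
  proof -
    have "prob {\<omega> \<in> space M. U \<omega> i \<in> S} = x"
      using prob_ball[OF S, of i] x by (simp add: emeasure_eq_measure)
    then have "prob {\<omega> \<in> space M. U \<omega> i \<notin> S} = 1 - x"
      by (subst prob_neg) auto
    moreover have "(\<integral>\<^sup>+\<omega>. indicator (- S) (U \<omega> i) \<partial>M) = (\<integral>\<^sup>+\<omega>. indicator {\<omega> \<in> space M. U \<omega> i \<notin> S} \<omega> \<partial>M)"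
      by (intro nn_integral_cong) (auto split: split_indicator)
    ultimately show ?thesis by (simp add: emeasure_eq_measure)
  qed
  have "ennreal (prob {\<omega> \<in> space M. \<forall>i\<in>{1..n}. U \<omega> i \<notin> S}) = (\<integral>\<^sup>+\<omega>. indicator {\<omega> \<in> space M. \<forall>i\<in>{1..n}. U \<omega> i \<notin> S} \<omega> \<partial>M)"
    by (subst nn_integral_indicator) (auto simp: emeasure_eq_measure)
  also have "\<dots> = (\<integral>\<^sup>+\<omega>. (\<Prod>i\<in>{1..n}. indicator (- S) (U \<omega> i)) \<partial>M)"
    by (intro nn_integral_cong) (auto split: split_indicator simp: prod_zero_iff)
  also have "\<dots> = (\<Prod>i\<in>{1..n}. \<integral>\<^sup>+\<omega>. indicator (- S) (U \<omega> i) \<partial>M)"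
    by (rule indep_vars_nn_integral) (auto intro!: indep_vars_compose2[OF indep_vars_subset[OF indep_U], where Y="\<lambda>_. indicator (- S)"])
  also have "\<dots> = ennreal ((1 - x) ^ n)" using x by (simp add: 1 ennreal_power)
  finally show ?thesis using x by simp
qed

context
  fixes Q :: "nat list \<Rightarrow> nat \<Rightarrow> real"
  assumes Q: "\<And>u k. 0 \<le> Q u k" "\<And>u. (\<lambda>k. Q u k) sums 1"
begin

lemma mbox_sets [measurable]: "mbox Q u \<in> sets borel" by (simp add: mbox_def)

lemma Pprod_le_1: "u \<in> words j \<Longrightarrow> Pprod Q u \<le> 1"
  using boxl_add_le(1)[of Q u j, OF Q] by (simp add: boxl_def) (smt (verit) enn2real_nonneg)

lemma miss_prob:
  assumes "u \<in> words j"
  shows "prob {\<omega> \<in> space M. \<forall>i\<in>{1..n}. U \<omega> i \<notin> mbox Q u} = (1 - Pprod Q u) ^ n"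
  by (rule prob_no_ball[OF mbox_sets mbox_subset[of Q, OF Q assms] emeasure_mbox[of Q, OF Q] Pprod_nonneg[OF Q(1)] Pprod_le_1[OF assms]])

lemma miss_prob_two:
  assumes "u \<in> words j" "v \<in> words j" "u \<noteq> v"
  shows "prob {\<omega> \<in> space M. \<forall>i\<in>{1..n}. U \<omega> i \<notin> mbox Q u \<union> mbox Q v} = (1 - (Pprod Q u + Pprod Q v)) ^ n"
    and "Pprod Q u + Pprod Q v \<le> 1"
proof -
  have e: "emeasure lborel (mbox Q u \<union> mbox Q v) = ennreal (Pprod Q u + Pprod Q v)"
    using mbox_disjoint[of Q, OF Q assms] Q
    by (subst plus_emeasure[symmetric]) (auto simp: emeasure_mbox Pprod_nonneg)
  have sub: "mbox Q u \<union> mbox Q v \<subseteq> {0..1}"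
    using mbox_subset[of Q, OF Q assms(1)] mbox_subset[of Q, OF Q assms(2)] by auto
  then have "emeasure lborel (mbox Q u \<union> mbox Q v) \<le> emeasure lborel {0..1::real}" by (intro emeasure_mono) auto
  then show le: "Pprod Q u + Pprod Q v \<le> 1" by (simp add: e)
  show "prob {\<omega> \<in> space M. \<forall>i\<in>{1..n}. U \<omega> i \<notin> mbox Q u \<union> mbox Q v} = (1 - (Pprod Q u + Pprod Q v)) ^ n"
    by (rule prob_no_ball[OF _ sub e]) (use Q le in \<open>auto simp: Pprod_nonneg\<close>)
qed

lemma hit_expectation:
  assumes "u \<in> words j"
  shows "(\<integral>\<^sup>+\<omega>. hit Q (U \<omega>) n u \<partial>M) = ennreal (1 - (1 - Pprod Q u) ^ n)"
proof -
  have "(\<integral>\<^sup>+\<omega>. hit Q (U \<omega>) n u \<partial>M) = (\<integral>\<^sup>+\<omega>. indicator {\<omega> \<in> space M. \<not> (\<forall>i\<in>{1..n}. U \<omega> i \<notin> mbox Q u)} \<omega> \<partial>M)"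
    by (intro nn_integral_cong) (auto simp: hit_def split: split_indicator)
  also have "\<dots> = ennreal (prob {\<omega> \<in> space M. \<not> (\<forall>i\<in>{1..n}. U \<omega> i \<notin> mbox Q u)})"
    by (subst nn_integral_indicator) (auto simp: emeasure_eq_measure)
  also have "\<dots> = ennreal (1 - (1 - Pprod Q u) ^ n)"
    by (subst prob_neg) (auto simp: miss_prob[OF assms, unfolded One_nat_def])
  finally show ?thesis .
qed

text \<open>Two disjoint boxes are both missed with probability (1 - x - y)^n \<le> ((1 - x)(1 -
  y))^n, and inclusion-exclusion carries the sign of this correlation over to the hits.\<close>

lemma hit_two_expectation:
  assumes uv: "u \<in> words j" "v \<in> words j" "u \<noteq> v"
  shows "(\<integral>\<^sup>+\<omega>. hit Q (U \<omega>) n u * hit Q (U \<omega>) n v \<partial>M) \<le> (\<integral>\<^sup>+\<omega>. hit Q (U \<omega>) n u \<partial>M) * (\<integral>\<^sup>+\<omega>. hit Q (U \<omega>) n v \<partial>M)"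
proof -
  define x where "x = Pprod Q u" define y where "y = Pprod Q v"
  have xy: "0 \<le> x" "0 \<le> y" "x \<le> 1" "y \<le> 1" "x + y \<le> 1"
    using Pprod_le_1[OF uv(1)] Pprod_le_1[OF uv(2)] Pprod_nonneg[OF Q(1)] miss_prob_two(2)[OF uv] by (simp_all add: x_def y_def)
  define Nu where "Nu = {\<omega> \<in> space M. \<forall>i\<in>{1..n}. U \<omega> i \<notin> mbox Q u}"
  define Nv where "Nv = {\<omega> \<in> space M. \<forall>i\<in>{1..n}. U \<omega> i \<notin> mbox Q v}"
  have [measurable]: "Nu \<in> sets M" "Nv \<in> sets M" unfolding Nu_def Nv_def by measurable
  have "Nu \<inter> Nv = {\<omega> \<in> space M. \<forall>i\<in>{1..n}. U \<omega> i \<notin> mbox Q u \<union> mbox Q v}" by (auto simp: Nu_def Nv_def)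
  then have N: "prob Nu = (1 - x) ^ n" "prob Nv = (1 - y) ^ n" "prob (Nu \<inter> Nv) = (1 - (x + y)) ^ n"
    using miss_prob[OF uv(1)] miss_prob[OF uv(2)] miss_prob_two(1)[OF uv] by (simp_all add: Nu_def Nv_def x_def y_def)
  have "(\<integral>\<^sup>+\<omega>. hit Q (U \<omega>) n u * hit Q (U \<omega>) n v \<partial>M) = (\<integral>\<^sup>+\<omega>. indicator (space M - (Nu \<union> Nv)) \<omega> \<partial>M)"
    by (intro nn_integral_cong) (auto simp: hit_def Nu_def Nv_def split: split_indicator)
  also have "\<dots> = ennreal (1 - prob (Nu \<union> Nv))"
    by (subst nn_integral_indicator) (auto simp: emeasure_eq_measure prob_compl)
  also have "prob (Nu \<union> Nv) = prob Nu + prob Nv - prob (Nu \<inter> Nv)"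
    using measure_Un3[of Nu M Nv] by (simp add: fmeasurable_eq_sets)
  also have "1 - (prob Nu + prob Nv - prob (Nu \<inter> Nv)) \<le> (1 - (1 - x) ^ n) * (1 - (1 - y) ^ n)"
  proof -
    have "(1 - (x + y)) ^ n \<le> ((1 - x) * (1 - y)) ^ n" using xy by (intro power_mono) (auto simp: algebra_simps)
    then show ?thesis unfolding N unfolding power_mult_distrib by (simp add: right_diff_distrib left_diff_distrib)
  qed
  finally show ?thesis
    unfolding hit_expectation[OF uv(1)] hit_expectation[OF uv(2)] x_def[symmetric] y_def[symmetric]
    using xy by (subst ennreal_mult[symmetric]) (auto intro!: power_le_one ennreal_leI)
qed

text \<open>An indicator equals its square, so \<open>second_moment_sum_le\<close> bounds the
  variance by the mean.\<close>

lemma occupancy_variance: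
  "(\<integral>\<^sup>+\<omega>. ennreal ((enn2real (\<integral>\<^sup>+u. hit Q (U \<omega>) n u \<partial>count_space (words j))
       - enn2real (\<integral>\<^sup>+u. ennreal (1 - (1 - Pprod Q u) ^ n) \<partial>count_space (words j)))\<^sup>2) \<partial>M)
     \<le> (\<integral>\<^sup>+u. ennreal (1 - (1 - Pprod Q u) ^ n) \<partial>count_space (words j))"
proof -
  have m: "(\<integral>\<^sup>+u. \<integral>\<^sup>+\<omega>. hit Q (U \<omega>) n u \<partial>M \<partial>count_space (words j)) = (\<integral>\<^sup>+u. ennreal (1 - (1 - Pprod Q u) ^ n) \<partial>count_space (words j))"
    by (intro nn_integral_cong) (simp add: hit_expectation)
  have sq: "(hit Q y n u)\<^sup>2 = hit Q y n u" for y u by (simp add: hit_def)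
  have fin: "(\<integral>\<^sup>+u. \<integral>\<^sup>+\<omega>. hit Q (U \<omega>) n u \<partial>M \<partial>count_space (words j)) < \<infinity>"
  proof -
    have "(\<integral>\<^sup>+u. ennreal (1 - (1 - Pprod Q u) ^ n) \<partial>count_space (words j)) \<le> (\<integral>\<^sup>+u. ennreal (real n) * ennreal (Pprod Q u) \<partial>count_space (words j))"
    proof (intro nn_integral_mono)
      fix u assume "u \<in> space (count_space (words j))"
      then have "0 \<le> Pprod Q u" "Pprod Q u \<le> 1" using Q Pprod_le_1[of u j] by (auto simp: Pprod_nonneg)
      then have "1 - (1 - Pprod Q u) ^ n \<le> n * Pprod Q u"
        using Bernoulli_inequality[of "- Pprod Q u" n] by simp
      then show "ennreal (1 - (1 - Pprod Q u) ^ n) \<le> ennreal (real n) * ennreal (Pprod Q u)"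
        using Q by (simp add: ennreal_leI Pprod_nonneg flip: ennreal_mult)
    qed
    also have "\<dots> = ennreal (real n)" by (simp add: nn_integral_cmult level_sum[of Q, OF Q])
    finally show ?thesis unfolding m by (rule le_less_trans) simp
  qed
  have meas: "(\<lambda>\<omega>. hit Q (U \<omega>) n u) \<in> borel_measurable M" for u unfolding hit_def by measurable
  show ?thesis
    using second_moment_sum_le[OF countable_words meas hit_two_expectation fin]
    unfolding sq m .
qed

end
end

section \<open>The tilted step law\<close>

lemma power_le_exp:
  fixes y :: real assumes "0 \<le> y" "m > 0" shows "y ^ m \<le> real m ^ m * exp y"
proof -
  have "y / m \<le> 1 + y / m" by simp
  then have "(y / m) ^ m \<le> (1 + y / m) ^ m" using assms by (intro power_mono) auto
  also have "\<dots> \<le> exp y" using assms by (intro exp_ge_one_plus_x_over_n_power_n) auto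
  finally show ?thesis using assms by (simp add: power_divide field_simps)
qed

lemma exp_second_order: "\<bar>exp y - 1 - y\<bar> \<le> y\<^sup>2 * exp \<bar>y\<bar>" for y :: real
proof -
  obtain t where t: "\<bar>t\<bar> \<le> \<bar>y\<bar>" "exp y = (\<Sum>m<2. y ^ m / fact m) + exp t / fact 2 * y ^ 2"
    using Maclaurin_exp_le[of y 2] by blast
  then have "exp y - 1 - y = exp t / 2 * y\<^sup>2" by (simp add: numeral_2_eq_2)
  moreover have "\<bar>exp t / 2 * y\<^sup>2\<bar> = exp t / 2 * y\<^sup>2" by (intro abs_of_nonneg) simp
  ultimately have "\<bar>exp y - 1 - y\<bar> = exp t / 2 * y\<^sup>2" by (simp only:)
  also have "\<dots> \<le> exp \<bar>y\<bar> * y\<^sup>2"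
  proof (rule mult_right_mono)
    have "exp t \<le> exp \<bar>y\<bar>" using t(1) by (subst exp_le_cancel_iff) linarith
    then show "exp t / 2 \<le> exp \<bar>y\<bar>" using exp_gt_zero[of t] by linarith
  qed simp
  finally show ?thesis by (simp add: mult.commute)
qed

text \<open>The exponential moment makes the Laplace transform finite on a neighbourhood of 0, so
  that it can be differentiated there from both sides.\<close>

locale exp_moment_law = real_distribution \<mu> for \<mu> +
  fixes \<eta> :: real
  assumes \<eta>: "\<eta> > 0" and pos: "AE s in \<mu>. 0 \<le> s" and exp_moment: "integrable \<mu> (\<lambda>s. exp (\<eta> * s))"
begin

lemma integrable_power_exp:
  assumes "t > - \<eta>"
  shows "integrable \<mu> (\<lambda>s. s ^ m * exp (- (t * s)))"
proof (cases "m = 0")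
  case True
  have "integrable \<mu> (\<lambda>s. exp (- (t * s)))"
  proof (rule Bochner_Integration.integrable_bound[OF exp_moment])
    show "AE s in \<mu>. norm (exp (- (t * s))) \<le> norm (exp (\<eta> * s))"
      using pos
    proof eventually_elim
      case (elim s)
      then have "0 \<le> (\<eta> + t) * s" using assms by (intro mult_nonneg_nonneg) auto
      then show ?case by (simp add: distrib_right)
    qed
  qed simp
  then show ?thesis using True by simp
next
  case False
  define \<delta> where "\<delta> = \<eta> + t"
  have \<delta>: "\<delta> > 0" using assms by (simp add: \<delta>_def)
  have "integrable \<mu> (\<lambda>s. (real m ^ m / \<delta> ^ m) * exp (\<eta> * s))" by (intro integrable_mult_right exp_moment)
  then show ?thesis
  proof (rule Bochner_Integration.integrable_bound)
    show "AE s in \<mu>. norm (s ^ m * exp (- (t * s))) \<le> norm ((real m ^ m / \<delta> ^ m) * exp (\<eta> * s))"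
      using pos
    proof eventually_elim
      case (elim s)
      have "(\<delta> * s) ^ m \<le> real m ^ m * exp (\<delta> * s)" using \<delta> elim False by (intro power_le_exp) auto
      then have "s ^ m \<le> (real m ^ m / \<delta> ^ m) * exp (\<delta> * s)" using \<delta> by (simp add: power_mult_distrib field_simps)
      then have "s ^ m * exp (- (t * s)) \<le> (real m ^ m / \<delta> ^ m) * exp (\<delta> * s) * exp (- (t * s))" by (intro mult_right_mono) auto
      moreover have "exp (\<delta> * s) * exp (- (t * s)) = exp (\<eta> * s)" by (simp add: \<delta>_def exp_add[symmetric] algebra_simps)
      ultimately show ?case using elim \<delta> by (simp add: mult.assoc)
    qed
  qed measurable
qed

definition F :: "nat \<Rightarrow> real \<Rightarrow> real" where "F k t = (\<integral>s. s ^ k * exp (- (t * s)) \<partial>\<mu>)"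

text \<open>The remainder of the difference quotient is bounded pointwise by |h| s^(k+2) exp(-(t -
  \<delta>) s). With \<delta> half the distance from t to -\<eta> this is integrable, uniformly for
  |h| < \<delta>.\<close>

lemma F_deriv:
  assumes t: "t > - \<eta>"
  shows "(F k has_real_derivative - F (Suc k) t) (at t)"
proof -
  define \<delta> where "\<delta> = (\<eta> + t) / 2"
  have \<delta>: "\<delta> > 0" "t - \<delta> > - \<eta>" using t by (auto simp: \<delta>_def field_simps)
  define C where "C = F (k + 2) (t - \<delta>)"
  have bound: "\<bar>(F k (t + h) - F k t) / h - - F (Suc k) t\<bar> \<le> C * \<bar>h\<bar>" if h: "h \<noteq> 0" "\<bar>h\<bar> < \<delta>" for h
  proof -
    have th: "t + h > - \<eta>" using h \<delta> by linarith
    have eq1: "(F k (t + h) - F k t) / h - - F (Suc k) t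
      = (\<integral>s. (s ^ k * exp (- ((t + h) * s)) - s ^ k * exp (- (t * s))) / h + s ^ Suc k * exp (- (t * s)) \<partial>\<mu>)"
      unfolding F_def using integrable_power_exp[OF t] integrable_power_exp[OF th] by (simp del: power_Suc)
    have le1: "\<bar>\<integral>s. (s ^ k * exp (- ((t + h) * s)) - s ^ k * exp (- (t * s))) / h + s ^ Suc k * exp (- (t * s)) \<partial>\<mu>\<bar>
       \<le> (\<integral>s. \<bar>h\<bar> * (s ^ (k + 2) * exp (- ((t - \<delta>) * s))) \<partial>\<mu>)"
    proof (rule order_trans[OF integral_abs_bound integral_mono_AE])
      show "integrable \<mu> (\<lambda>s. \<bar>(s ^ k * exp (- ((t + h) * s)) - s ^ k * exp (- (t * s))) / h + s ^ Suc k * exp (- (t * s))\<bar>)"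
        using integrable_power_exp[OF t] integrable_power_exp[OF th]
        by (intro integrable_abs Bochner_Integration.integrable_add integrable_divide Bochner_Integration.integrable_diff) (auto simp del: power_Suc)
      show "integrable \<mu> (\<lambda>s. \<bar>h\<bar> * (s ^ (k + 2) * exp (- ((t - \<delta>) * s))))"
        by (intro integrable_mult_right integrable_power_exp \<delta>)
      show "AE s in \<mu>. \<bar>(s ^ k * exp (- ((t + h) * s)) - s ^ k * exp (- (t * s))) / h + s ^ Suc k * exp (- (t * s))\<bar>
          \<le> \<bar>h\<bar> * (s ^ (k + 2) * exp (- ((t - \<delta>) * s)))"
        using pos
      proof eventually_elim
        case (elim s)
        have eq: "(s ^ k * exp (- ((t + h) * s)) - s ^ k * exp (- (t * s))) / h + s ^ Suc k * exp (- (t * s))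
           = s ^ k * exp (- (t * s)) * ((exp (- (h * s)) - 1 - - (h * s)) / h)"
        proof -
          have "exp (- ((t + h) * s)) = exp (- (t * s)) * exp (- (h * s))" by (simp add: exp_add[symmetric] algebra_simps)
          then show ?thesis using h by (simp add: field_simps)
        qed
        have "\<bar>(exp (- (h * s)) - 1 - - (h * s)) / h\<bar> \<le> ((h * s)\<^sup>2 * exp \<bar>h * s\<bar>) / \<bar>h\<bar>"
          using exp_second_order[of "- (h * s)"] by (simp add: divide_right_mono abs_divide)
        also have "\<dots> = \<bar>h\<bar> * (s\<^sup>2 * exp (\<bar>h\<bar> * s))"
          using h elim by (simp add: power_mult_distrib abs_mult power2_eq_square field_simps)
        also have "\<dots> \<le> \<bar>h\<bar> * (s\<^sup>2 * exp (\<delta> * s))"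
          using h elim by (intro mult_left_mono) (auto intro: mult_right_mono)
        finally have "s ^ k * exp (- (t * s)) * \<bar>(exp (- (h * s)) - 1 - - (h * s)) / h\<bar> \<le> s ^ k * exp (- (t * s)) * (\<bar>h\<bar> * (s\<^sup>2 * exp (\<delta> * s)))"
          using elim by (intro mult_left_mono) auto
        also have "\<dots> = \<bar>h\<bar> * (s ^ (k + 2) * (exp (- (t * s)) * exp (\<delta> * s)))" by (simp add: power_add power2_eq_square mult_ac)
        finally have fin: "s ^ k * exp (- (t * s)) * \<bar>(exp (- (h * s)) - 1 - - (h * s)) / h\<bar> \<le> \<bar>h\<bar> * (s ^ (k + 2) * (exp (- (t * s)) * exp (\<delta> * s)))" .
        have e: "exp (- (t * s)) * exp (\<delta> * s) = exp (- ((t - \<delta>) * s))" by (simp add: exp_add[symmetric] algebra_simps)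
        have ab: "\<bar>s ^ k * exp (- (t * s)) * ((exp (- (h * s)) - 1 - - (h * s)) / h)\<bar> = s ^ k * exp (- (t * s)) * \<bar>(exp (- (h * s)) - 1 - - (h * s)) / h\<bar>"
          using elim by (simp only: abs_mult abs_of_nonneg[OF zero_le_power[OF elim]] abs_exp_cancel)
        show ?case unfolding eq ab using fin unfolding e .
      qed
    qed
    have "(\<integral>s. \<bar>h\<bar> * (s ^ (k + 2) * exp (- ((t - \<delta>) * s))) \<partial>\<mu>) = \<bar>h\<bar> * C"
      unfolding C_def F_def by (rule integral_mult_right_zero)
    with le1 show ?thesis unfolding eq1 by (simp only: mult.commute)
  qed
  have "((\<lambda>h. (F k (t + h) - F k t) / h - - F (Suc k) t) \<longlongrightarrow> 0) (at 0)"
  proof (rule Lim_null_comparison)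
    show "\<forall>\<^sub>F h in at 0. norm ((F k (t + h) - F k t) / h - - F (Suc k) t) \<le> C * \<bar>h\<bar>"
      unfolding eventually_at using \<delta>(1) bound by (intro exI[of _ \<delta>]) (auto simp: dist_real_def)
    show "((\<lambda>h. C * \<bar>h\<bar>) \<longlongrightarrow> 0) (at 0)" by (auto intro!: tendsto_eq_intros)
  qed
  then show ?thesis unfolding DERIV_def by (rule LIM_zero_cancel)
qed

lemma F_0: "F 0 0 = 1" using prob_space by (simp add: F_def)

lemma F_pos: assumes "t > - \<eta>" shows "F 0 t > 0"
proof -
  have i: "integrable \<mu> (\<lambda>s. exp (- (t * s)))" using integrable_power_exp[OF assms, of 0] by simp
  have "F 0 t \<noteq> 0"
  proof
    assume "F 0 t = 0"
    then have "AE s in \<mu>. exp (- (t * s)) = 0"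
      unfolding F_def using i by (subst (asm) integral_nonneg_eq_0_iff_AE) auto
    then have "AE s in \<mu>. False" by simp
    then show False by simp
  qed
  moreover have "F 0 t \<ge> 0" unfolding F_def by (intro integral_nonneg_AE) auto
  ultimately show ?thesis by simp
qed

lemma log_F_deriv:
  assumes "t > - \<eta>"
  shows "((\<lambda>t. ln (F 0 t)) has_real_derivative - F 1 t / F 0 t) (at t)"
  by (rule DERIV_cong[OF DERIV_chain2[OF DERIV_ln_divide[OF F_pos[OF assms]] F_deriv[OF assms]]]) simp

lemma log_F_deriv2: "((\<lambda>t. - F 1 t / F 0 t) has_real_derivative F 2 0 - (F 1 0)\<^sup>2) (at 0)"
proof -
  have t: "0 > - \<eta>" using \<eta> by simp
  have "((\<lambda>t. - F 1 t / F 0 t) has_real_derivative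
      ((- (- F (Suc 1) 0)) * F 0 0 - (- F 1 0) * (- F (Suc 0) 0)) / (F 0 0 * F 0 0)) (at 0)"
    by (intro DERIV_divide DERIV_minus F_deriv t) (simp add: F_0)
  then show ?thesis by (simp add: F_0 numeral_2_eq_2 power2_eq_square)
qed

end

section \<open>Mean, variance and nonlattice property of the tilted step\<close>

locale brw_nonlattice = brw_theta M P \<theta> \<Lambda> s0
  for M :: "'a measure" and P :: "'a \<Rightarrow> nat list \<Rightarrow> nat \<Rightarrow> real" and \<theta> \<Lambda> s0 :: real +
  assumes nonlat: "\<And>c d. c > 0 \<Longrightarrow> \<not> (AE \<omega> in M. \<forall>k. P \<omega> [] k > 0 \<longrightarrow> (\<exists>z::int. - ln (P \<omega> [] k) = c * real_of_int z + d))"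
begin

text \<open>Every child of positive weight has positive density in \<open>step\<close>, so a null
  set of the tilted law is avoided by all such children simultaneously.\<close>

lemma AE_step_imp:
  assumes [measurable]: "Measurable.pred borel R" and R: "AE s in step. R s"
  shows "AE \<omega> in M. \<forall>k. P \<omega> [] k > 0 \<longrightarrow> R (- ln (P \<omega> [] k))"
proof -
  have "(\<integral>\<^sup>+s. indicator {s. \<not> R s} s \<partial>step) = (\<integral>\<^sup>+s. 0 \<partial>step)"
    using R by (intro nn_integral_cong_AE, eventually_elim) auto
  then have "(\<integral>\<^sup>+\<omega>. (\<Sum>k. ennreal (P \<omega> [] k powr \<theta> * exp (- \<Lambda>)) * indicator {s. \<not> R s} (- ln (P \<omega> [] k))) \<partial>M) = 0"
    by (subst nn_integral_step[symmetric]) auto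
  then have "AE \<omega> in M. (\<Sum>k. ennreal (P \<omega> [] k powr \<theta> * exp (- \<Lambda>)) * indicator {s. \<not> R s} (- ln (P \<omega> [] k))) = 0"
    by (subst (asm) nn_integral_0_iff_AE) auto
  then show ?thesis
  proof eventually_elim
    case (elim \<omega>)
    show ?case
    proof (intro allI impI)
      fix k assume "P \<omega> [] k > 0"
      moreover have "ennreal (P \<omega> [] k powr \<theta> * exp (- \<Lambda>)) * indicator {s. \<not> R s} (- ln (P \<omega> [] k)) = 0"
        using elim by (subst (asm) suminf_eq_zero_iff) auto
      ultimately show "R (- ln (P \<omega> [] k))" by (cases "R (- ln (P \<omega> [] k))") (auto simp: ennreal_eq_0_iff mult_le_0_iff)
    qed
  qed
qed

lemma step_nonneg: "AE s in step. 0 \<le> s"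
proof -
  have "(\<integral>\<^sup>+s. indicator {..<0} s \<partial>step) = (\<integral>\<^sup>+\<omega>. (\<Sum>k. 0) \<partial>M)"
    unfolding nn_integral_step[OF borel_measurable_indicator[OF borel_open[OF open_lessThan]]]
  proof (intro nn_integral_cong arg_cong[where f=suminf] ext)
    fix \<omega> k
    have "0 \<le> - ln (P \<omega> [] k)"
      using P_nonneg[of \<omega> "[]" k] P_le_1[of \<omega> "[]" k] by (cases "P \<omega> [] k = 0") (auto simp: ln_le_zero_iff)
    then show "ennreal (P \<omega> [] k powr \<theta> * exp (- \<Lambda>)) * indicator {..<0} (- ln (P \<omega> [] k)) = 0" by simp
  qed
  then have "emeasure step {..<0} = 0" by simp
  then show ?thesis by (intro AE_I[where N="{..<0}"]) auto
qed

lemma step_exp_moment: "(\<integral>\<^sup>+s. ennreal (exp (- (t * s))) \<partial>step) = mg (\<theta> + t) * ennreal (exp (- \<Lambda>))"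
proof -
  have *: "ennreal (P \<omega> [] k powr \<theta> * exp (- \<Lambda>)) * ennreal (exp (- (t * - ln (P \<omega> [] k)))) = ennreal (P \<omega> [] k powr (\<theta> + t)) * ennreal (exp (- \<Lambda>))" for \<omega> k
  proof (cases "P \<omega> [] k = 0")
    case False
    then have "P \<omega> [] k > 0" using P_nonneg[of \<omega> "[]" k] by simp
    then have "P \<omega> [] k powr (\<theta> + t) = P \<omega> [] k powr \<theta> * exp (- (t * - ln (P \<omega> [] k)))"
      by (simp add: powr_def exp_add[symmetric] algebra_simps)
    then show ?thesis by (simp add: ennreal_mult mult_ac)
  qed simp
  have "(\<integral>\<^sup>+s. ennreal (exp (- (t * s))) \<partial>step) = (\<integral>\<^sup>+\<omega>. (\<Sum>k. ennreal (P \<omega> [] k powr (\<theta> + t)) * ennreal (exp (- \<Lambda>))) \<partial>M)"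
    by (subst nn_integral_step) (measurable, simp only: *)
  then show ?thesis by (simp add: nn_integral_multc mg_def)
qed

sublocale exp_moment_law step "\<theta> - s0"
proof
  show "\<theta> - s0 > 0" using s0 by simp
  show "AE s in step. 0 \<le> s" by (rule step_nonneg)
  have "(\<integral>\<^sup>+s. ennreal (exp (- ((s0 - \<theta>) * s))) \<partial>step) < \<infinity>"
    unfolding step_exp_moment using s0 by (auto simp: ennreal_mult_less_top)
  then show "integrable step (\<lambda>s. exp ((\<theta> - s0) * s))"
    by (intro integrableI_nonneg) (auto simp: algebra_simps)
qed

definition LAM :: "real \<Rightarrow> real" where "LAM x = ln (enn2real (mg x))"

text \<open>Tilting by \<theta> shifts the argument of the Laplace transform. The derivatives of
  \<lambda> at \<theta> thereby become cumulants of the tilted step: -\<lambda>' is its mean and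
  \<lambda>'' its variance.\<close>

lemma LAM_eq: assumes "x > s0" shows "LAM x = \<Lambda> + ln (F 0 (x - \<theta>))"
proof -
  have t: "x - \<theta> > - (\<theta> - s0)" using assms by simp
  have "mg x * ennreal (exp (- \<Lambda>)) = (\<integral>\<^sup>+s. ennreal (exp (- ((x - \<theta>) * s))) \<partial>step)"
    unfolding step_exp_moment by simp
  also have "\<dots> = ennreal (F 0 (x - \<theta>))"
    unfolding F_def using integrable_power_exp[OF t, of 0] by (subst nn_integral_eq_integral) auto
  finally have *: "mg x * ennreal (exp (- \<Lambda>)) = ennreal (F 0 (x - \<theta>))" .
  have "mg x \<le> mg s0" using assms by (intro mg_mono) auto
  with s0 obtain y where y: "mg x = ennreal y" "0 \<le> y" by (cases "mg x") auto
  then have "y * exp (- \<Lambda>) = F 0 (x - \<theta>)"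
    using * F_pos[OF t] by (simp flip: ennreal_mult)
  then have "y = exp \<Lambda> * F 0 (x - \<theta>)" by (simp add: exp_minus field_simps)
  then show ?thesis using F_pos[OF t] y by (simp add: LAM_def ln_mult)
qed

lemma LAM_deriv: assumes "x > s0" shows "(LAM has_real_derivative - F 1 (x - \<theta>) / F 0 (x - \<theta>)) (at x)"
proof -
  have "((\<lambda>t. ln (F 0 t)) has_real_derivative - F 1 (x - \<theta>) / F 0 (x - \<theta>)) (at (x + - \<theta>))"
    using log_F_deriv[of "x - \<theta>"] assms by simp
  then have "((\<lambda>x. ln (F 0 (x + - \<theta>))) has_real_derivative - F 1 (x - \<theta>) / F 0 (x - \<theta>)) (at x)"
    by (subst (asm) DERIV_shift)
  from DERIV_add[OF DERIV_const[of \<Lambda>] this]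
  have "((\<lambda>x. \<Lambda> + ln (F 0 (x - \<theta>))) has_real_derivative - F 1 (x - \<theta>) / F 0 (x - \<theta>)) (at x)" by simp
  then show ?thesis
    by (rule has_field_derivative_transform_within_open[where S="{s0<..}"]) (use assms LAM_eq in auto)
qed

lemma deriv_LAM: "deriv LAM \<theta> = - F 1 0"
  using DERIV_imp_deriv[OF LAM_deriv[of \<theta>]] s0 F_0 by simp

lemma deriv2_LAM: "deriv (deriv LAM) \<theta> = F 2 0 - (F 1 0)\<^sup>2"
proof -
  have "((\<lambda>t. - F 1 t / F 0 t) has_real_derivative F 2 0 - (F 1 0)\<^sup>2) (at (\<theta> + - \<theta>))"
    using log_F_deriv2 by simp
  then have "((\<lambda>x. - F 1 (x + - \<theta>) / F 0 (x + - \<theta>)) has_real_derivative F 2 0 - (F 1 0)\<^sup>2) (at \<theta>)"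
    by (subst (asm) DERIV_shift)
  then have "(deriv LAM has_real_derivative F 2 0 - (F 1 0)\<^sup>2) (at \<theta>)"
    by (rule has_field_derivative_transform_within_open[where S="{s0<..}"])
       (use s0 DERIV_imp_deriv[OF LAM_deriv] in auto)
  then show ?thesis by (rule DERIV_imp_deriv)
qed

definition a :: real where "a = F 1 0"
definition \<sigma> :: real where "\<sigma> = sqrt (F 2 0 - (F 1 0)\<^sup>2)"

lemma step_mean: "integrable step (\<lambda>s. s)" "(\<integral>s. s \<partial>step) = a"
  using integrable_power_exp[of 0 1] \<eta> by (simp_all add: a_def F_def)

lemma step_square: "integrable step (\<lambda>s. s\<^sup>2)" "(\<integral>s. s\<^sup>2 \<partial>step) = F 2 0"
  using integrable_power_exp[of 0 2] \<eta> by (simp_all add: F_def)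

lemma step_centered: "integrable step (\<lambda>s. (s - a)\<^sup>2)" "(\<integral>s. (s - a)\<^sup>2 \<partial>step) = F 2 0 - (F 1 0)\<^sup>2"
proof -
  have eq: "(s - a)\<^sup>2 = s\<^sup>2 - 2 * a * s + a\<^sup>2" for s by (simp add: power2_diff)
  show "integrable step (\<lambda>s. (s - a)\<^sup>2)" unfolding eq using step_mean step_square by simp
  have "(\<integral>s. (s - a)\<^sup>2 \<partial>step) = F 2 0 - 2 * a * a + a\<^sup>2"
    unfolding eq using step_mean step_square step.prob_space by simp
  then show "(\<integral>s. (s - a)\<^sup>2 \<partial>step) = F 2 0 - (F 1 0)\<^sup>2" by (simp add: a_def power2_eq_square)
qed

text \<open>A constant displacement d lies on the lattice of span 1 through d, with integer
  0.\<close>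

lemma step_not_constant: "\<not> (AE s in step. s = d)"
proof
  assume "AE s in step. s = d"
  then have "AE \<omega> in M. \<forall>k. P \<omega> [] k > 0 \<longrightarrow> - ln (P \<omega> [] k) = d" by (intro AE_step_imp) auto
  then have "AE \<omega> in M. \<forall>k. P \<omega> [] k > 0 \<longrightarrow> (\<exists>z::int. - ln (P \<omega> [] k) = 1 * real_of_int z + d)"
    by eventually_elim (auto intro!: exI[of _ 0])
  with nonlat[of 1 d] show False by simp
qed

lemma variance_pos: "F 2 0 - (F 1 0)\<^sup>2 > 0"
proof -
  have "(\<integral>s. (s - a)\<^sup>2 \<partial>step) \<noteq> 0"
  proof
    assume "(\<integral>s. (s - a)\<^sup>2 \<partial>step) = 0"
    then have "AE s in step. (s - a)\<^sup>2 = 0" using step_centered(1) by (subst (asm) integral_nonneg_eq_0_iff_AE) auto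
    then have "AE s in step. s = a" by simp
    with step_not_constant show False by blast
  qed
  moreover have "(\<integral>s. (s - a)\<^sup>2 \<partial>step) \<ge> 0" by simp
  ultimately show ?thesis by (simp add: step_centered)
qed

lemma \<sigma>_pos: "\<sigma> > 0" and \<sigma>_square: "\<sigma>\<^sup>2 = F 2 0 - (F 1 0)\<^sup>2"
  using variance_pos by (simp_all add: \<sigma>_def)

lemma a_pos: "a > 0"
proof -
  have "a \<noteq> 0"
  proof
    assume "a = 0"
    then have "(\<integral>s. s \<partial>step) = 0" using step_mean(2) by simp
    then have "AE s in step. s = 0"
      using integral_nonneg_eq_0_iff_AE[OF step_mean(1) step_nonneg] by simp
    with step_not_constant show False by blast
  qed
  moreover have "a \<ge> 0" unfolding step_mean(2)[symmetric] by (rule integral_nonneg_AE) (rule step_nonneg)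
  ultimately show ?thesis by simp
qed

text \<open>If the modulus is 1 with argument \<alpha>, then cos(t s - \<alpha>) has mean 1 and is
  therefore 1 almost surely. This confines s to a lattice of span 2 pi / |t| through \<alpha> /
  t.\<close>

lemma step_char: assumes "t \<noteq> 0" shows "cmod (char step t) \<noteq> 1"
proof
  assume "cmod (char step t) = 1"
  then have "exp (\<i> * of_real (Arg2pi (char step t))) = char step t" by (simp only: complex_norm_eq_1_exp)
  moreover define \<alpha> where "\<alpha> = Arg2pi (char step t)"
  ultimately have \<alpha>: "char step t = iexp \<alpha>" by (simp only:)
  have i: "integrable step (\<lambda>s. cos (t * s - \<alpha>))" by (rule step.integrable_const_bound[where B=1]) auto
  have "iexp (- \<alpha>) * char step t = (\<integral>s. iexp (- \<alpha>) * iexp (t * s) \<partial>step)" by (simp add: char_def)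
  also have "\<dots> = (\<integral>s. iexp (t * s - \<alpha>) \<partial>step)" by (simp add: exp_add[symmetric] algebra_simps)
  finally have "Re (\<integral>s. iexp (t * s - \<alpha>) \<partial>step) = 1" unfolding \<alpha> by (simp add: exp_add[symmetric])
  then have "(\<integral>s. cos (t * s - \<alpha>) \<partial>step) = 1"
    by (subst (asm) integral_Re[symmetric]) (auto intro!: step.integrable_const_bound[where B=1] simp: Re_exp)
  then have "(\<integral>s. 1 - cos (t * s - \<alpha>) \<partial>step) = 0" using i step.prob_space by simp
  then have "AE s in step. 1 - cos (t * s - \<alpha>) = 0"
    using i by (subst (asm) integral_nonneg_eq_0_iff_AE) auto
  then have "AE \<omega> in M. \<forall>k. P \<omega> [] k > 0 \<longrightarrow> 1 - cos (t * (- ln (P \<omega> [] k)) - \<alpha>) = 0"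
    by (intro AE_step_imp) auto
  then have "AE \<omega> in M. \<forall>k. P \<omega> [] k > 0 \<longrightarrow> (\<exists>z::int. - ln (P \<omega> [] k) = (2 * pi / \<bar>t\<bar>) * real_of_int z + \<alpha> / t)"
  proof (eventually_elim, intro allI impI)
    fix \<omega> k
    define s where "s = - ln (P \<omega> [] k)"
    assume "\<forall>k. P \<omega> [] k > 0 \<longrightarrow> 1 - cos (t * (- ln (P \<omega> [] k)) - \<alpha>) = 0" "P \<omega> [] k > 0"
    then have "cos (t * s - \<alpha>) = 1" unfolding s_def by (metis eq_iff_diff_eq_0)
    then obtain z :: int where z: "t * s - \<alpha> = real_of_int z * 2 * pi" using cos_one_2pi_int by blast
    then have "s = (2 * pi / t) * z + \<alpha> / t" using assms by (simp add: field_simps)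
    \<comment> \<open>The span has to be positive, so for negative t the sign moves to the
      integer.\<close>
    then have "s = (2 * pi / \<bar>t\<bar>) * real_of_int (if t > 0 then z else - z) + \<alpha> / t" using assms by (auto simp: abs_if)
    then show "\<exists>z::int. - ln (P \<omega> [] k) = (2 * pi / \<bar>t\<bar>) * real_of_int z + \<alpha> / t" unfolding s_def[symmetric] by blast
  qed
  moreover have "2 * pi / \<bar>t\<bar> > 0" using assms by simp
  ultimately show False using nonlat by blast
qed

sublocale nonlattice_law step a \<sigma>
proof
  show "integrable step (\<lambda>x. x)" "(\<integral>x. x \<partial>step) = a" by (rule step_mean)+
  show "integrable step (\<lambda>x. (x - a)\<^sup>2)" by (rule step_centered)
  show "(\<integral>x. (x - a)\<^sup>2 \<partial>step) = \<sigma>\<^sup>2" by (simp add: step_centered \<sigma>_square)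
  show "\<sigma> > 0" by (rule \<sigma>_pos)
  show "cmod (char step t) \<noteq> 1" if "t \<noteq> 0" for t using that by (rule step_char)
  \<comment> \<open>This is (s + a)^3 expanded; it dominates |s - a|^3 because the step and its mean
    are nonnegative.\<close>
  have "integrable step (\<lambda>s. s ^ 3 + a ^ 3 + 3 * a * s ^ 2 + 3 * a ^ 2 * s)"
  proof -
    have "integrable step (\<lambda>s. s ^ 3)" using integrable_power_exp[of 0 3] \<eta> by simp
    then show ?thesis using step_mean(1) step_square(1)
      by (intro Bochner_Integration.integrable_add integrable_mult_right) auto
  qed
  then show "integrable step (\<lambda>x. \<bar>x - a\<bar> ^ 3)"
  proof (rule Bochner_Integration.integrable_bound)
    show "AE s in step. norm (\<bar>s - a\<bar> ^ 3) \<le> norm (s ^ 3 + a ^ 3 + 3 * a * s ^ 2 + 3 * a ^ 2 * s)"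
      using step_nonneg
    proof eventually_elim
      case (elim s)
      have "\<bar>s - a\<bar> ^ 3 \<le> (s + a) ^ 3" using elim a_pos by (intro power_mono) auto
      also have "\<dots> = s ^ 3 + a ^ 3 + 3 * a * s ^ 2 + 3 * a ^ 2 * s" by (simp add: power3_eq_cube power2_eq_square algebra_simps)
      finally show ?case by simp
    qed
  qed simp
qed

end

section \<open>Almost sure asymptotics\<close>

context brw_theta begin

text \<open>Positions are nonnegative: weights are at most 1, and for weight 0 the default
  \<open>ln 0 = 0\<close> applies. Hence test functions need comparing only on the half
  line.\<close>

lemma GG_mono_nonneg: "(\<And>w. 0 \<le> w \<Longrightarrow> H w \<le> H' w) \<Longrightarrow> GG i H \<omega> \<le> GG i H' \<omega>"
  unfolding GG_def
proof (intro nn_integral_mono ennreal_leI mult_left_mono)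
  fix v assume *: "\<And>w. 0 \<le> w \<Longrightarrow> H w \<le> H' w"
  have "0 \<le> - ln (p \<omega> v)"
    using p_nonneg[of \<omega> v] p_le_1[of \<omega> v] by (cases "p \<omega> v = 0") (auto simp: ln_le_zero_iff)
  then show "H (- ln (p \<omega> v)) \<le> H' (- ln (p \<omega> v))" by (rule *)
qed auto

lemma GG_add:
  assumes "\<And>w. 0 \<le> H w" "\<And>w. 0 \<le> H' w"
  shows "GG i (\<lambda>w. H w + H' w) \<omega> = GG i H \<omega> + GG i H' \<omega>"
proof -
  have "GG i (\<lambda>w. H w + H' w) \<omega> = (\<integral>\<^sup>+v. ennreal (exp (- \<Lambda> * i) * p \<omega> v powr \<theta> * H (- ln (p \<omega> v)))
     + ennreal (exp (- \<Lambda> * i) * p \<omega> v powr \<theta> * H' (- ln (p \<omega> v))) \<partial>count_space (words i))"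
    unfolding GG_def using assms by (simp add: distrib_left ennreal_plus)
  then show ?thesis unfolding GG_def by (simp add: nn_integral_add)
qed

lemma GG_cmult:
  assumes "0 \<le> c" "\<And>w. 0 \<le> H w"
  shows "GG i (\<lambda>w. c * H w) \<omega> = ennreal c * GG i H \<omega>"
proof -
  have "GG i (\<lambda>w. c * H w) \<omega> = (\<integral>\<^sup>+v. ennreal c * ennreal (exp (- \<Lambda> * i) * p \<omega> v powr \<theta> * H (- ln (p \<omega> v))) \<partial>count_space (words i))"
    unfolding GG_def using assms by (intro nn_integral_cong) (simp add: mult_ac flip: ennreal_mult)
  then show ?thesis unfolding GG_def by (simp add: nn_integral_cmult)
qed

lemma GG_finite_bounded:
  assumes fin: "GG i (\<lambda>_. 1) \<omega> \<noteq> \<infinity>" and H: "\<And>w. 0 \<le> H w" "\<And>w. H w \<le> K"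
  shows "GG i H \<omega> \<noteq> \<infinity>"
proof -
  have K: "0 \<le> K" using order_trans[OF H(1) H(2)] .
  have "GG i H \<omega> \<le> GG i (\<lambda>_. K * 1) \<omega>" using H by (intro GG_mono) auto
  also have "\<dots> = ennreal K * GG i (\<lambda>_. 1) \<omega>" using K by (intro GG_cmult) auto
  also have "\<dots> < \<infinity>" using fin by (auto simp: ennreal_mult_less_top top.not_eq_extremum)
  finally show ?thesis by simp
qed

lemma G_add:
  assumes "GG i (\<lambda>_. 1) \<omega> \<noteq> \<infinity>" "\<And>w. 0 \<le> H w" "\<And>w. H w \<le> K" "\<And>w. 0 \<le> H' w" "\<And>w. H' w \<le> K'"
  shows "G i (\<lambda>w. H w + H' w) \<omega> = G i H \<omega> + G i H' \<omega>"
  using GG_finite_bounded[OF assms(1-3)] GG_finite_bounded[OF assms(1,4,5)] assms(2,4)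
  by (simp add: G_def GG_add enn2real_plus top.not_eq_extremum)

lemma G_cmult: "0 \<le> c \<Longrightarrow> (\<And>w. 0 \<le> H w) \<Longrightarrow> G i (\<lambda>w. c * H w) \<omega> = c * G i H \<omega>"
  by (simp add: G_def GG_cmult enn2real_mult)

lemma G_mono:
  assumes "GG i (\<lambda>_. 1) \<omega> \<noteq> \<infinity>" "\<And>w. 0 \<le> w \<Longrightarrow> H w \<le> H' w" "\<And>w. 0 \<le> H' w" "\<And>w. H' w \<le> K"
  shows "G i H \<omega> \<le> G i H' \<omega>"
  unfolding G_def
  by (intro enn2real_mono GG_mono_nonneg assms(2)) (use GG_finite_bounded[OF assms(1,3,4)] in \<open>auto simp: top.not_eq_extremum\<close>)

end

context brw_nonlattice begin

abbreviation occ_at :: "real \<Rightarrow> real \<Rightarrow> real" where "occ_at x \<equiv> (\<lambda>s. occ \<theta> (s - x))"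

definition gauss_const :: "real \<Rightarrow> real" where
  "gauss_const z = Gamma (1 - \<theta>) / \<theta> * (exp (- (z\<^sup>2 / (2 * \<sigma>\<^sup>2))) / (sqrt (2 * pi) * \<sigma>))"

lemma gauss_const_pos: "gauss_const z > 0"
  unfolding gauss_const_def using \<theta> \<sigma>_pos Gamma_real_pos[of "1 - \<theta>"] by simp

lemma AW_occ: "AW m (occ_at x) w = E m (\<lambda>s. occ \<theta> (s - (x - w)))"
  unfolding AW_def E_def by (simp add: algebra_simps)

lemma AW_occ_bound:
  obtains C where "C \<ge> 0" "\<And>m x w. m > 0 \<Longrightarrow> sqrt m * AW m (occ_at x) w \<le> C"
proof -
  obtain C where "C \<ge> 0" "\<And>m y. m > 0 \<Longrightarrow> sqrt m * E m (\<lambda>s. \<bar>occ \<theta> (s - y)\<bar>) \<le> C"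
    using local_limit_bound[OF occ_measurable _ occ_decay[OF \<theta>]] by (metis zero_le_divide_iff zero_le_numeral zero_le_power2)
  then show ?thesis using that[of C] by (simp add: AW_occ occ_nonneg)
qed

lemma AW_occ_limit:
  fixes m :: "nat \<Rightarrow> nat" and y :: "nat \<Rightarrow> real"
  assumes m: "filterlim m at_top sequentially" "\<And>n. m n > 0"
    and y: "(\<lambda>n. (x n - w n - a * m n) / sqrt (m n)) \<longlonglongrightarrow> z"
  shows "(\<lambda>n. sqrt (m n) * AW (m n) (occ_at (x n)) (w n)) \<longlonglongrightarrow> gauss_const z"
proof -
  have "12 / (min \<theta> (1 - \<theta>))\<^sup>2 \<ge> 0" by simp
  from local_limit[OF occ_measurable this occ_decay[OF \<theta>] occ_lipschitz[OF \<theta>] m y]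
  show ?thesis unfolding AW_occ gauss_const_def integral_occ[OF \<theta>] .
qed

lemma sqrt_ratio_limit:
  fixes j i :: "nat \<Rightarrow> nat"
  assumes j: "filterlim j at_top sequentially" and i: "\<And>n. i n < j n" and ij: "(\<lambda>n. real (i n) / sqrt (j n)) \<longlonglongrightarrow> 0"
  shows "(\<lambda>n. sqrt (j n) / sqrt (j n - i n)) \<longlonglongrightarrow> 1" and "filterlim (\<lambda>n. j n - i n) at_top sequentially"
proof -
  have jr: "filterlim (\<lambda>n. real (j n)) at_top sequentially" by (rule filterlim_compose[OF filterlim_real_sequentially j])
  have "(\<lambda>n. 1 / sqrt (j n)) \<longlonglongrightarrow> 0"
  proof (rule filterlim_compose[OF _ jr])
    show "((\<lambda>x::real. 1 / sqrt x) \<longlongrightarrow> 0) at_top" by real_asymp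
  qed
  from tendsto_mult[OF ij this] have "(\<lambda>n. real (i n) / j n) \<longlonglongrightarrow> 0" by (simp add: real_sqrt_mult[symmetric])
  then have *: "(\<lambda>n. 1 - real (i n) / j n) \<longlonglongrightarrow> 1 - 0" by (intro tendsto_intros)
  have "(\<lambda>n. sqrt (1 / (1 - real (i n) / j n))) \<longlonglongrightarrow> sqrt (1 / (1 - 0))"
    by (intro tendsto_real_sqrt tendsto_divide tendsto_const *) simp
  moreover have "sqrt (1 / (1 - real (i n) / j n)) = sqrt (j n) / sqrt (j n - i n)" for n
  proof -
    have "1 / (1 - real (i n) / j n) = j n / (real (j n) - i n)" using i[of n] by (simp add: field_simps)
    then show ?thesis using i[of n] by (simp add: real_sqrt_divide of_nat_diff less_imp_le)
  qed
  ultimately show "(\<lambda>n. sqrt (j n) / sqrt (j n - i n)) \<longlonglongrightarrow> 1" by simp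
  have "filterlim (\<lambda>n. (1 - real (i n) / j n) * real (j n)) at_top sequentially"
    by (rule filterlim_tendsto_pos_mult_at_top[OF * _ jr]) simp
  moreover have "(1 - real (i n) / j n) * real (j n) = real (j n - i n)" for n
    using i[of n] by (simp add: left_diff_distrib of_nat_diff less_imp_le)
  ultimately have "filterlim (\<lambda>n. real (j n - i n)) at_top sequentially" by simp
  then show "filterlim (\<lambda>n. j n - i n) at_top sequentially"
    by (simp add: filterlim_sequentially_iff_filterlim_real)
qed

text \<open>Conditioning on generation \<open>i n\<close> with \<open>i n = o(sqrt (j n))\<close>: the displacements of
  that generation are negligible on the Gaussian scale, so only \<open>W\<close> survives.\<close>

lemma conditional_limit:
  fixes j i :: "nat \<Rightarrow> nat" and x :: "nat \<Rightarrow> real" and a0 :: real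
  assumes fin: "\<And>i. GG i (\<lambda>_. 1) \<omega> \<noteq> \<infinity>" and W: "(\<lambda>i. G i (\<lambda>_. 1) \<omega>) \<longlonglongrightarrow> W \<omega>"
    and a0: "a0 > 0" and tail: "(\<lambda>i. G i (\<lambda>s. if s > a0 * i then 1 else 0) \<omega>) \<longlonglongrightarrow> 0"
    and j: "filterlim j at_top sequentially" and i: "\<And>n. i n < j n" "filterlim i at_top sequentially"
    and ij: "(\<lambda>n. real (i n) / sqrt (j n)) \<longlonglongrightarrow> 0"
    and x: "(\<lambda>n. (x n - a * j n) / sqrt (j n)) \<longlonglongrightarrow> z"
  shows "(\<lambda>n. sqrt (j n) * G (i n) (AW (j n - i n) (occ_at (x n))) \<omega>) \<longlonglongrightarrow> gauss_const z * W \<omega>"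
proof -
  define L where "L = gauss_const z"
  have L: "L > 0" unfolding L_def by (rule gauss_const_pos)
  define m where "m n = j n - i n" for n
  have m0: "m n > 0" for n using i(1)[of n] by (simp add: m_def)
  note ratio = sqrt_ratio_limit(1)[OF j i(1) ij, folded m_def]
  note m = sqrt_ratio_limit(2)[OF j i(1) ij, folded m_def]
  define A1 where "A1 n w = AW (m n) (occ_at (x n)) w" for n w
  have occm: "occ_at (x n) \<in> borel_measurable borel" for n
    by (rule measurable_compose[OF _ occ_measurable]) simp
  have occb: "0 \<le> occ_at (x n) s" "occ_at (x n) s \<le> 1" for n s by (simp_all add: occ_nonneg occ_le_1[OF \<theta>])
  have A1b: "0 \<le> A1 n w" "A1 n w \<le> 1" for n w
    unfolding A1_def by (rule AW_bounds[OF occm occb])+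
  obtain C0 where C0: "C0 \<ge> 0" "\<And>m x w. m > 0 \<Longrightarrow> sqrt m * AW m (occ_at x) w \<le> C0"
    using AW_occ_bound by blast
  \<comment> \<open>The factor 2 eventually bounds sqrt (j n) / sqrt (m n), whose limit is
    1.\<close>
  define C where "C = 2 * C0"
  have bnd: "\<forall>\<^sub>F n in sequentially. \<forall>w. sqrt (j n) * A1 n w \<le> C"
  proof -
    have "\<forall>\<^sub>F n in sequentially. sqrt (j n) / sqrt (m n) < 2" by (rule order_tendstoD(2)[OF ratio]) simp
    then show ?thesis
  proof eventually_elim
    case (elim n)
    show ?case
    proof
      fix w
      have "sqrt (j n) * A1 n w = (sqrt (j n) / sqrt (m n)) * (sqrt (m n) * A1 n w)" using m0[of n] by simp
      also have "\<dots> \<le> 2 * C0" using elim C0(2)[OF m0[of n], of "x n" w] C0(1) A1b[of n w]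
        by (intro mult_mono) (auto simp: A1_def)
      finally show "sqrt (j n) * A1 n w \<le> C" by (simp add: C_def)
    qed
  qed
  qed
  have unif: "\<forall>\<^sub>F n in sequentially. \<forall>w. 0 \<le> w \<and> w \<le> a0 * i n \<longrightarrow> \<bar>sqrt (j n) * A1 n w - L\<bar> \<le> \<epsilon>" if \<epsilon>: "\<epsilon> > 0" for \<epsilon>
  proof -
    \<comment> \<open>Uniformity over the window is reduced to convergence along one sequence:
      \<open>w n\<close> is a point violating the bound if there is one, and 0 otherwise. Such
      points are O(i n) = o(sqrt (j n)).\<close>
    define w where "w n = (if \<exists>w. 0 \<le> w \<and> w \<le> a0 * i n \<and> \<not> \<bar>sqrt (j n) * A1 n w - L\<bar> \<le> \<epsilon>
      then SOME w. 0 \<le> w \<and> w \<le> a0 * i n \<and> \<not> \<bar>sqrt (j n) * A1 n w - L\<bar> \<le> \<epsilon> else 0)" for n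
    have w: "0 \<le> w n \<and> w n \<le> a0 * i n \<and> ((\<exists>w. 0 \<le> w \<and> w \<le> a0 * i n \<and> \<not> \<bar>sqrt (j n) * A1 n w - L\<bar> \<le> \<epsilon>) \<longrightarrow> \<not> \<bar>sqrt (j n) * A1 n (w n) - L\<bar> \<le> \<epsilon>)" for n
    proof (cases "\<exists>w. 0 \<le> w \<and> w \<le> a0 * i n \<and> \<not> \<bar>sqrt (j n) * A1 n w - L\<bar> \<le> \<epsilon>")
      case True
      then have "w n = (SOME w. 0 \<le> w \<and> w \<le> a0 * i n \<and> \<not> \<bar>sqrt (j n) * A1 n w - L\<bar> \<le> \<epsilon>)" by (simp only: w_def if_True)
      with someI_ex[OF True] show ?thesis by (simp only:) blast
    next
      case False
      then have "w n = 0" by (simp only: w_def if_False)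
      with False show ?thesis using a0 by simp
    qed
    have wj: "(\<lambda>n. w n / sqrt (j n)) \<longlonglongrightarrow> 0"
    proof (rule tendsto_sandwich[OF _ _ tendsto_const])
      show "\<forall>\<^sub>F n in sequentially. 0 \<le> w n / sqrt (j n)" using w by auto
      show "\<forall>\<^sub>F n in sequentially. w n / sqrt (j n) \<le> a0 * (i n / sqrt (j n))"
        using w by (intro always_eventually allI) (simp add: divide_right_mono)
      show "(\<lambda>n. a0 * (i n / sqrt (j n))) \<longlonglongrightarrow> 0" using tendsto_mult[OF tendsto_const[of a0] ij] by simp
    qed
    \<comment> \<open>Passing from x and j to x - w and m = j - i moves the standardised target by w
      / sqrt j and a i / sqrt j, which both vanish.\<close>
    have "(\<lambda>n. ((x n - a * j n) / sqrt (j n) - w n / sqrt (j n) + a * (i n / sqrt (j n))) * (sqrt (j n) / sqrt (m n))) \<longlonglongrightarrow> (z - 0 + a * 0) * 1"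
      by (intro tendsto_intros x wj ij ratio)
    moreover have "((x n - a * j n) / sqrt (j n) - w n / sqrt (j n) + a * (i n / sqrt (j n))) * (sqrt (j n) / sqrt (m n)) = (x n - w n - a * m n) / sqrt (m n)" for n
    proof -
      have "sqrt (j n) > 0" using i(1)[of n] by simp
      moreover have "real (m n) = real (j n) - real (i n)" using i(1)[of n] by (simp add: m_def of_nat_diff less_imp_le)
      moreover have "(X - a * J) / r - w' / r + a * (I / r) = (X - w' - a * (J - I)) / r" for X J r w' I :: real
        by (simp add: add_divide_distrib diff_divide_distrib right_diff_distrib)
      ultimately show ?thesis by simp
    qed
    ultimately have "(\<lambda>n. (x n - w n - a * m n) / sqrt (m n)) \<longlonglongrightarrow> (z - 0 + a * 0) * 1" by (simp only:)
    then have "(\<lambda>n. (x n - w n - a * m n) / sqrt (m n)) \<longlonglongrightarrow> z" by simp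
    from tendsto_mult[OF ratio AW_occ_limit[OF m m0 this]]
    have "(\<lambda>n. sqrt (j n) * A1 n (w n)) \<longlonglongrightarrow> L" using m0[THEN less_imp_neq, THEN not_sym] by (simp add: A1_def L_def)
    from tendstoD[OF this \<epsilon>]
    show ?thesis
    proof eventually_elim
      case (elim n)
      then show ?case using w[of n] by (auto simp: dist_real_def)
    qed
  qed
  define g1 where "g1 n = G (i n) (\<lambda>_. 1) \<omega>" for n
  define gt where "gt n = G (i n) (\<lambda>s. if s > a0 * i n then 1 else 0) \<omega>" for n
  have g1: "g1 \<longlonglongrightarrow> W \<omega>" unfolding g1_def by (rule filterlim_compose[OF W i(2)])
  have gt: "gt \<longlonglongrightarrow> 0" unfolding gt_def by (rule filterlim_compose[OF tail i(2)])
  \<comment> \<open>On the window the function is within \<epsilon> of L, elsewhere it lies between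
    0 and C. The constant C + L in front of the tail serves the upper and the lower comparison at
    once.\<close>
  have main: "\<forall>\<^sub>F n in sequentially. \<bar>sqrt (j n) * G (i n) (A1 n) \<omega> - L * g1 n\<bar> \<le> \<epsilon> * g1 n + (C + L) * gt n" if \<epsilon>: "\<epsilon> > 0" for \<epsilon>
    using unif[OF \<epsilon>] bnd
  proof eventually_elim
    case (elim n)
    let ?I = "\<lambda>s. if s > a0 * i n then 1 else 0 :: real"
    have CL: "0 \<le> C + L" using C0 L by (simp add: C_def)
    have s1: "G (i n) (\<lambda>w. c * 1) \<omega> = c * g1 n" if "0 \<le> c" for c using that unfolding g1_def by (intro G_cmult) auto
    have s2: "G (i n) (\<lambda>w. (C + L) * ?I w) \<omega> = (C + L) * gt n" using CL unfolding gt_def by (intro G_cmult) auto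
    have s3: "G (i n) (\<lambda>w. sqrt (j n) * A1 n w) \<omega> = sqrt (j n) * G (i n) (A1 n) \<omega>" using A1b by (intro G_cmult) auto
    have up: "sqrt (j n) * A1 n w \<le> (L + \<epsilon>) * 1 + (C + L) * ?I w" if "0 \<le> w" for w
    proof (cases "w \<le> a0 * i n")
      case True
      then have "\<bar>sqrt (j n) * A1 n w - L\<bar> \<le> \<epsilon>" using elim(1) that by blast
      then show ?thesis using True by simp
    next
      case False
      then show ?thesis using elim(2) L \<epsilon> by (auto intro: order_trans[of _ C])
    qed
    have lo: "L * 1 \<le> (sqrt (j n) * A1 n w + \<epsilon> * 1) + (C + L) * ?I w" if "0 \<le> w" for w
    proof (cases "w \<le> a0 * i n")
      case True
      then have "\<bar>sqrt (j n) * A1 n w - L\<bar> \<le> \<epsilon>" using elim(1) that by blast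
      then show ?thesis using True by simp
    next
      case False
      then show ?thesis using C0 A1b[of n w] \<epsilon> by (simp add: C_def)
    qed
    have jA: "sqrt (j n) * A1 n w \<le> C" for w using elim(2) by blast
    have "sqrt (j n) * G (i n) (A1 n) \<omega> \<le> G (i n) (\<lambda>w. (L + \<epsilon>) * 1 + (C + L) * ?I w) \<omega>"
      unfolding s3[symmetric] by (rule G_mono[OF fin up, where K="(L + \<epsilon>) * 1 + (C + L)"]) (use CL L \<epsilon> in auto)
    also have "\<dots> = G (i n) (\<lambda>w. (L + \<epsilon>) * 1) \<omega> + G (i n) (\<lambda>w. (C + L) * ?I w) \<omega>"
      by (rule G_add[OF fin, where K="L + \<epsilon>" and K'="C + L"]) (use CL L \<epsilon> in auto)
    also have "\<dots> = (L + \<epsilon>) * g1 n + (C + L) * gt n" using L \<epsilon> by (subst s1) (auto simp: s2)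
    finally have 1: "sqrt (j n) * G (i n) (A1 n) \<omega> \<le> (L + \<epsilon>) * g1 n + (C + L) * gt n" .
    have "L * g1 n = G (i n) (\<lambda>w. L * 1) \<omega>" using L by (intro s1[symmetric]) simp
    also have "\<dots> \<le> G (i n) (\<lambda>w. (sqrt (j n) * A1 n w + \<epsilon> * 1) + (C + L) * ?I w) \<omega>"
    proof (rule G_mono[OF fin lo, where K="(C + \<epsilon>) + (C + L)"])
      fix w
      show "0 \<le> (sqrt (j n) * A1 n w + \<epsilon> * 1) + (C + L) * ?I w" using A1b[of n w] CL \<epsilon> by simp
      show "(sqrt (j n) * A1 n w + \<epsilon> * 1) + (C + L) * ?I w \<le> (C + \<epsilon>) + (C + L)" using jA[of w] CL by simp
    qed
    also have "\<dots> = G (i n) (\<lambda>w. sqrt (j n) * A1 n w + \<epsilon> * 1) \<omega> + G (i n) (\<lambda>w. (C + L) * ?I w) \<omega>"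
      by (rule G_add[OF fin, where K="C + \<epsilon>" and K'="C + L"]) (use CL L \<epsilon> jA A1b in auto)
    also have "G (i n) (\<lambda>w. sqrt (j n) * A1 n w + \<epsilon> * 1) \<omega> = G (i n) (\<lambda>w. sqrt (j n) * A1 n w) \<omega> + G (i n) (\<lambda>w. \<epsilon> * 1) \<omega>"
      by (rule G_add[OF fin, where K=C and K'=\<epsilon>]) (use \<epsilon> jA A1b in auto)
    also have "G (i n) (\<lambda>w. \<epsilon> * 1) \<omega> = \<epsilon> * g1 n" using \<epsilon> by (intro s1) simp
    finally have 2: "L * g1 n \<le> sqrt (j n) * G (i n) (A1 n) \<omega> + \<epsilon> * g1 n + (C + L) * gt n" unfolding s2 s3 .
    show ?case using 1 2 by (simp add: abs_le_iff algebra_simps)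
  qed
  have W0: "0 \<le> W \<omega>" by (rule LIMSEQ_le_const[OF W]) (auto simp: G_nonneg)
  have "(\<lambda>n. sqrt (j n) * G (i n) (A1 n) \<omega> - L * g1 n) \<longlonglongrightarrow> 0"
  proof (rule tendstoI)
    fix \<epsilon> :: real assume \<epsilon>: "\<epsilon> > 0"
    define \<delta> where "\<delta> = \<epsilon> / (2 * (W \<omega> + 1))"
    have \<delta>: "\<delta> > 0" using \<epsilon> W0 by (simp add: \<delta>_def)
    have "(\<lambda>n. \<delta> * g1 n + (C + L) * gt n) \<longlonglongrightarrow> \<delta> * W \<omega> + (C + L) * 0" by (intro tendsto_intros g1 gt)
    moreover have "\<delta> * W \<omega> + (C + L) * 0 < \<epsilon>"
    proof -
      have "\<delta> * W \<omega> \<le> \<delta> * (W \<omega> + 1)" using \<delta> by (intro mult_left_mono) auto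
      also have "\<dots> = \<epsilon> / 2" unfolding \<delta>_def using W0 by (intro divide_double_mult) simp
      finally show ?thesis using \<epsilon> by simp
    qed
    ultimately have "\<forall>\<^sub>F n in sequentially. \<delta> * g1 n + (C + L) * gt n < \<epsilon>" by (rule order_tendstoD(2))
    then show "\<forall>\<^sub>F n in sequentially. dist (sqrt (j n) * G (i n) (A1 n) \<omega> - L * g1 n) 0 < \<epsilon>"
      using main[OF \<delta>] by eventually_elim (simp add: dist_real_def)
  qed
  from tendsto_add[OF this tendsto_mult[OF tendsto_const[of L] g1]]
  show ?thesis by (simp add: A1_def[abs_def] m_def L_def)
qed

end

section \<open>Concentration and conditioning along the grid\<close>

locale brw_balls = brw_nonlattice M P \<theta> \<Lambda> s0 + uniform_balls M U
  for M :: "'a measure" and P :: "'a \<Rightarrow> nat list \<Rightarrow> nat \<Rightarrow> real" and \<theta> \<Lambda> s0 :: real and U :: "'a \<Rightarrow> nat \<Rightarrow> real" +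
  assumes indep_PU: "distr M (fieldM \<Otimes>\<^sub>M ballsM) (\<lambda>\<omega>. (P \<omega>, U \<omega>)) = distr M fieldM P \<Otimes>\<^sub>M distr M ballsM U"
begin

lemma nn_integral_PU:
  assumes [measurable]: "\<Phi> \<in> borel_measurable (fieldM \<Otimes>\<^sub>M ballsM)"
  shows "(\<integral>\<^sup>+\<omega>. \<Phi> (P \<omega>, U \<omega>) \<partial>M) = (\<integral>\<^sup>+\<omega>. \<integral>\<^sup>+\<omega>'. \<Phi> (P \<omega>, U \<omega>') \<partial>M \<partial>M)"
proof -
  interpret B: prob_space "distr M ballsM U" by (rule prob_space_distr) simp
  have "(\<integral>\<^sup>+\<omega>. \<Phi> (P \<omega>, U \<omega>) \<partial>M) = (\<integral>\<^sup>+x. \<Phi> x \<partial>distr M (fieldM \<Otimes>\<^sub>M ballsM) (\<lambda>\<omega>. (P \<omega>, U \<omega>)))"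
    by (subst nn_integral_distr) auto
  also have "\<dots> = (\<integral>\<^sup>+a. \<integral>\<^sup>+b. \<Phi> (a, b) \<partial>distr M ballsM U \<partial>distr M fieldM P)"
    unfolding indep_PU by (rule B.nn_integral_fst[symmetric]) simp
  also have "\<dots> = (\<integral>\<^sup>+\<omega>. \<integral>\<^sup>+b. \<Phi> (P \<omega>, b) \<partial>distr M ballsM U \<partial>M)"
    by (subst nn_integral_distr) auto
  also have "\<dots> = (\<integral>\<^sup>+\<omega>. \<integral>\<^sup>+\<omega>'. \<Phi> (P \<omega>, U \<omega>') \<partial>M \<partial>M)"
    by (intro nn_integral_cong) (subst nn_integral_distr, auto)
  finally show ?thesis .
qed

definition rho_sum :: "nat \<Rightarrow> nat \<Rightarrow> (nat list \<Rightarrow> nat \<Rightarrow> real) \<Rightarrow> ennreal" where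
  "rho_sum j n Q = (\<integral>\<^sup>+u. ennreal (1 - (1 - Pprod Q u) ^ n) \<partial>count_space (words j))"

definition rho :: "nat \<Rightarrow> nat \<Rightarrow> 'a \<Rightarrow> real" where "rho j n \<omega> = enn2real (rho_sum j n (P \<omega>))"

lemma rho_sum_measurable [measurable]: "rho_sum j n \<in> borel_measurable fieldM"
  unfolding rho_sum_def[abs_def] by (rule borel_measurable_nn_integral_count_space) auto

lemma hit_measurable: "(\<lambda>x. hit (fst x) (snd x) n u) \<in> borel_measurable (fieldM \<Otimes>\<^sub>M ballsM)"
proof -
  have [measurable]: "(\<lambda>x. snd x i) \<in> borel_measurable (fieldM \<Otimes>\<^sub>M ballsM)" for i
    by (rule measurable_compose[OF measurable_snd measurable_component_singleton]) simp
  show ?thesis unfolding hit_def mbox_def atLeastLessThan_iff by measurable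
qed

definition balls :: "nat \<Rightarrow> nat \<Rightarrow> 'a \<Rightarrow> real" where "balls j n \<omega> = real (Kocc (P \<omega>) (U \<omega>) j n)"

lemma balls_eq: "balls j n \<omega> = enn2real (\<integral>\<^sup>+u. hit (P \<omega>) (U \<omega>) n u \<partial>count_space (words j))"
  unfolding balls_def by (rule Kocc_eq) (auto simp: P_nonneg P_sums)

lemma balls_measurable [measurable]: "balls j n \<in> borel_measurable M"
proof -
  have "(\<lambda>\<omega>. hit (P \<omega>) (U \<omega>) n u) \<in> borel_measurable M" for u
    using measurable_compose[OF measurable_Pair[OF P_field_measurable U_vec_measurable] hit_measurable] by simp
  then have "(\<lambda>\<omega>. \<integral>\<^sup>+u. hit (P \<omega>) (U \<omega>) n u \<partial>count_space (words j)) \<in> borel_measurable M"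
    by (intro borel_measurable_nn_integral_count_space) auto
  then show ?thesis unfolding balls_eq[abs_def] by measurable
qed

lemma rho_measurable [measurable]: "rho j n \<in> borel_measurable M"
  unfolding rho_def[abs_def] by measurable

text \<open>For frozen weights the variance of the count is at most its mean; independence of
  weights and balls allows averaging this over the weights.\<close>

lemma balls_variance:
  "(\<integral>\<^sup>+\<omega>. ennreal ((balls j n \<omega> - rho j n \<omega>)\<^sup>2) \<partial>M) \<le> (\<integral>\<^sup>+\<omega>. rho_sum j n (P \<omega>) \<partial>M)"
proof -
  define \<Phi> where "\<Phi> x = ennreal ((enn2real (\<integral>\<^sup>+u. hit (fst x) (snd x) n u \<partial>count_space (words j))
     - enn2real (rho_sum j n (fst x)))\<^sup>2)" for x :: "(nat list \<Rightarrow> nat \<Rightarrow> real) \<times> (nat \<Rightarrow> real)"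
  have "(\<lambda>x. \<integral>\<^sup>+u. hit (fst x) (snd x) n u \<partial>count_space (words j)) \<in> borel_measurable (fieldM \<Otimes>\<^sub>M ballsM)"
    by (intro borel_measurable_nn_integral_count_space hit_measurable) auto
  then have [measurable]: "\<Phi> \<in> borel_measurable (fieldM \<Otimes>\<^sub>M ballsM)"
    unfolding \<Phi>_def[abs_def] by measurable
  have "(\<integral>\<^sup>+\<omega>. ennreal ((balls j n \<omega> - rho j n \<omega>)\<^sup>2) \<partial>M) = (\<integral>\<^sup>+\<omega>. \<Phi> (P \<omega>, U \<omega>) \<partial>M)"
    by (simp add: \<Phi>_def balls_eq rho_def)
  also have "\<dots> = (\<integral>\<^sup>+\<omega>. \<integral>\<^sup>+\<omega>'. \<Phi> (P \<omega>, U \<omega>') \<partial>M \<partial>M)" by (rule nn_integral_PU) simp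
  also have "\<dots> \<le> (\<integral>\<^sup>+\<omega>. rho_sum j n (P \<omega>) \<partial>M)"
    unfolding \<Phi>_def fst_conv snd_conv rho_sum_def
    by (intro nn_integral_mono occupancy_variance) (auto simp: P_nonneg P_sums)
  finally show ?thesis .
qed

definition scale :: "nat \<Rightarrow> nat \<Rightarrow> real" where "scale j n = real n powr \<theta> * exp (\<Lambda> * j)"

lemma scale_pos: "n > 0 \<Longrightarrow> scale j n > 0"
  by (simp add: scale_def)

lemma exp_sum_eq:
  assumes n: "n > 0"
  shows "(\<integral>\<^sup>+u. ennreal (1 - exp (- (n * p \<omega> u))) \<partial>count_space (words j)) = ennreal (scale j n) * GG j (occ_at (ln n)) \<omega>"
proof -
  have "ennreal (1 - exp (- (n * p \<omega> u))) = ennreal (scale j n) * ennreal (exp (- \<Lambda> * j) * p \<omega> u powr \<theta> * occ \<theta> (- ln (p \<omega> u) - ln n))" for u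
  proof (cases "p \<omega> u = 0")
    case False
    then have x: "p \<omega> u > 0" using p_nonneg[of \<omega> u] by simp
    define x where "x = p \<omega> u"
    have "exp (\<theta> * (- ln x - ln n)) = 1 / (real n powr \<theta> * x powr \<theta>)"
      using x n by (simp add: x_def powr_def exp_diff exp_minus algebra_simps exp_add divide_inverse)
    moreover have "exp (- (- ln x - ln n)) = n * x"
      using x n by (simp add: x_def exp_add)
    ultimately have "scale j n * (exp (- \<Lambda> * j) * x powr \<theta> * occ \<theta> (- ln x - ln n)) = (exp (\<Lambda> * j) * exp (- \<Lambda> * j)) * (1 - exp (- (n * x)))"
      unfolding occ_def scale_def using x n by (simp add: x_def)
    also have "\<dots> = 1 - exp (- (n * x))" by (simp add: exp_add[symmetric])
    finally have "scale j n * (exp (- \<Lambda> * j) * x powr \<theta> * occ \<theta> (- ln x - ln n)) = 1 - exp (- (n * x))" .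
    then show ?thesis using n by (simp add: x_def[symmetric] ennreal_mult'[symmetric] scale_pos less_imp_le)
  qed simp
  then show ?thesis unfolding GG_def by (simp add: nn_integral_cmult)
qed

text \<open>Replacing (1 - p)^n by exp(-n p) costs at most p for each box, and the weights of a
  level sum to 1.\<close>

lemma rho_sum_bounds:
  assumes n: "n > 0"
  shows "ennreal (scale j n) * GG j (occ_at (ln n)) \<omega> \<le> rho_sum j n (P \<omega>)"
    and "rho_sum j n (P \<omega>) \<le> ennreal (scale j n) * GG j (occ_at (ln n)) \<omega> + 1"
proof -
  show "ennreal (scale j n) * GG j (occ_at (ln n)) \<omega> \<le> rho_sum j n (P \<omega>)"
    unfolding exp_sum_eq[OF n, symmetric] rho_sum_def
    by (intro nn_integral_mono ennreal_leI) (simp add: exp_minus_power_le p_nonneg p_le_1)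
  have "rho_sum j n (P \<omega>) \<le> (\<integral>\<^sup>+u. ennreal (1 - exp (- (n * p \<omega> u))) + ennreal (p \<omega> u) \<partial>count_space (words j))"
    unfolding rho_sum_def
  proof (intro nn_integral_mono)
    fix u
    have "1 - (1 - p \<omega> u) ^ n \<le> (1 - exp (- (n * p \<omega> u))) + p \<omega> u"
      using exp_minus_power_le(2)[OF p_nonneg p_le_1, of n \<omega> u] by simp
    then show "ennreal (1 - (1 - p \<omega> u) ^ n) \<le> ennreal (1 - exp (- (n * p \<omega> u))) + ennreal (p \<omega> u)"
      using p_nonneg[of \<omega> u] by (simp add: ennreal_leI flip: ennreal_plus)
  qed
  also have "\<dots> = ennreal (scale j n) * GG j (occ_at (ln n)) \<omega> + 1"
    using level_sum[of "P \<omega>" j] by (simp add: nn_integral_add exp_sum_eq[OF n] P_nonneg P_sums)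
  finally show "rho_sum j n (P \<omega>) \<le> ennreal (scale j n) * GG j (occ_at (ln n)) \<omega> + 1" .
qed

lemma expectation_rho_sum:
  assumes n: "n > 0" shows "(\<integral>\<^sup>+\<omega>. rho_sum j n (P \<omega>) \<partial>M) \<le> ennreal (scale j n + 1)"
proof -
  have "(\<integral>\<^sup>+\<omega>. rho_sum j n (P \<omega>) \<partial>M) \<le> (\<integral>\<^sup>+\<omega>. ennreal (scale j n) * GG j (\<lambda>_. 1) \<omega> + 1 \<partial>M)"
    by (intro nn_integral_mono order_trans[OF rho_sum_bounds(2)[OF n]] add_right_mono mult_left_mono GG_mono occ_le_1[OF \<theta>]) auto
  also have "\<dots> = ennreal (scale j n) + 1"
    by (simp add: nn_integral_add nn_integral_cmult expectation_GG_1 emeasure_space_1)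
  also have "\<dots> = ennreal (scale j n + 1)" using scale_pos[OF n, of j] by simp
  finally show ?thesis .
qed

lemma rho_close:
  assumes n: "n > 0" and fin: "GG j (\<lambda>_. 1) \<omega> \<noteq> \<infinity>"
  shows "\<bar>rho j n \<omega> - scale j n * G j (occ_at (ln n)) \<omega>\<bar> \<le> 1"
proof -
  have "GG j (occ_at (ln n)) \<omega> \<noteq> \<infinity>"
    by (rule GG_finite_bounded[OF fin occ_nonneg occ_le_1[OF \<theta>]])
  then obtain g where g: "GG j (occ_at (ln n)) \<omega> = ennreal g" "0 \<le> g" by (cases "GG j (occ_at (ln n)) \<omega>") auto
  have sg: "0 \<le> scale j n * g" using scale_pos[OF n, of j] g by simp
  have b: "ennreal (scale j n * g) \<le> rho_sum j n (P \<omega>)" "rho_sum j n (P \<omega>) \<le> ennreal (scale j n * g + 1)"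
    using rho_sum_bounds[OF n, of j \<omega>] scale_pos[OF n, of j] g sg by (simp_all add: ennreal_mult)
  then obtain q where q: "rho_sum j n (P \<omega>) = ennreal q" "0 \<le> q" by (cases "rho_sum j n (P \<omega>)") (auto simp: top_unique)
  have "scale j n * g \<le> q" "q \<le> scale j n * g + 1" using b sg q by (simp_all del: ennreal_plus)
  then show ?thesis using q g by (simp add: rho_def G_def)
qed

definition gridpt :: "nat \<Rightarrow> nat \<Rightarrow> nat" where "gridpt m i = nat \<lceil>exp (real i / real m)\<rceil>"

text \<open>Indices whose grid point has logarithm between a j / 2 and 2 a j. As (log n) / j_n tends
  to a, the factors 1/2 and 2 leave room for both neighbours of every large n, while only O(j)
  indices belong to a level.\<close>

definition grid :: "nat \<Rightarrow> nat \<Rightarrow> nat set" where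
  "grid m j = {i. real m * a * real j / 2 \<le> real i \<and> real i \<le> 2 * real m * a * real j}"

lemma gridpt_ge: "exp (real i / real m) \<le> real (gridpt m i)"
  unfolding gridpt_def by linarith

lemma gridpt_le: "real (gridpt m i) \<le> exp (real i / real m) + 1"
  unfolding gridpt_def by (simp add: of_nat_nat order.trans[OF of_int_ceiling_le_add_one])

lemma gridpt_pos: "gridpt m i > 0"
  using less_le_trans[OF exp_gt_zero gridpt_ge[of i m]] by simp

lemma grid_finite: "finite (grid m j)"
  and grid_card: "real (card (grid m j)) \<le> 2 * real m * a * real j + 1"
proof -
  have nn: "0 \<le> 2 * real m * a * real j" using a_pos by simp
  have sub: "grid m j \<subseteq> {..nat \<lfloor>2 * real m * a * real j\<rfloor>}"
    unfolding grid_def by (auto simp: le_nat_floor)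
  then show "finite (grid m j)" by (rule finite_subset) simp
  have "card (grid m j) \<le> card {..nat \<lfloor>2 * real m * a * real j\<rfloor>}" by (rule card_mono[OF _ sub]) simp
  then have "real (card (grid m j)) \<le> real (nat \<lfloor>2 * real m * a * real j\<rfloor>) + 1" by simp
  also have "real (nat \<lfloor>2 * real m * a * real j\<rfloor>) \<le> 2 * real m * a * real j" by (rule of_nat_floor[OF nn])
  finally show "real (card (grid m j)) \<le> 2 * real m * a * real j + 1" by simp
qed

lemma grid_scale:
  assumes m: "m > 0" and i: "i \<in> grid m j"
  shows "exp (\<theta> * a / 2 * j) \<le> scale j (gridpt m i)"
proof -
  have "a * j / 2 \<le> real i / real m" using i m by (simp add: grid_def field_simps)
  then have "exp (a * j / 2) \<le> real (gridpt m i)" using gridpt_ge[of i m] by (meson exp_le_cancel_iff order_trans)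
  then have "exp (a * j / 2) powr \<theta> \<le> real (gridpt m i) powr \<theta>" using \<theta> by (intro powr_mono2) auto
  also have "real (gridpt m i) powr \<theta> \<le> scale j (gridpt m i)" using \<Lambda>_nonneg by (simp add: scale_def mult_le_cancel_left1)
  finally show ?thesis by (simp add: exp_powr_real mult_ac)
qed

lemma summable_of_bigo: "f \<in> O(\<lambda>j. 1 / real j ^ 2) \<Longrightarrow> summable f" for f :: "nat \<Rightarrow> real"
  by (rule summable_comparison_test_bigo[of "\<lambda>j. 1 / real j ^ 2"]) (use inverse_power_summable[of 2] in \<open>auto simp: divide_inverse\<close>)

lemma bigo_exp:
  fixes K k :: real
  assumes "k > 0"
  shows "(\<lambda>j. (K * real j + 1) * (2 * real j * exp (- (k / 2 * real j)))) \<in> O(\<lambda>j. 1 / real j ^ 2)"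
  using assms by real_asymp

lemma bigo_powr:
  fixes K C :: real
  shows "(\<lambda>j. (K * real j + 1) * (sqrt (real j) * (C * real j powr - 6))) \<in> O(\<lambda>j. 1 / real j ^ 2)"
  by real_asymp

text \<open>Relative to the squared scale the variance is of order 1/scale, which on the grid is
  exponentially small in j. The normalisation by j and the O(j) grid points do not spoil
  summability.\<close>

lemma balls_concentrate:
  assumes m: "m > 0"
  shows "AE \<omega> in M. (\<lambda>j. \<Sum>i\<in>grid m j. (sqrt j * (balls j (gridpt m i) \<omega> - rho j (gridpt m i) \<omega>) / scale j (gridpt m i))\<^sup>2) \<longlonglongrightarrow> 0"
proof -
  define c where "c j = (2 * real m * a * real j + 1) * (2 * real j * exp (- (\<theta> * a / 2 * j)))" for j :: nat
  let ?D = "\<lambda>j \<omega>. \<Sum>i\<in>grid m j. (sqrt j * (balls j (gridpt m i) \<omega> - rho j (gridpt m i) \<omega>) / scale j (gridpt m i))\<^sup>2"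
  have one: "(\<integral>\<^sup>+\<omega>. ennreal ((sqrt j * (balls j (gridpt m i) \<omega> - rho j (gridpt m i) \<omega>) / scale j (gridpt m i))\<^sup>2) \<partial>M)
      \<le> ennreal (2 * real j * exp (- (\<theta> * a / 2 * j)))" if i: "i \<in> grid m j" for i j
  proof -
    define S where "S = scale j (gridpt m i)"
    define e where "e = exp (\<theta> * a / 2 * j)"
    have eS: "e \<le> S" unfolding e_def S_def by (rule grid_scale[OF m i])
    have e1: "1 \<le> e" using \<theta> a_pos by (simp add: e_def)
    have S: "S \<ge> 1" "S > 0" using eS e1 by linarith+
    have "(\<integral>\<^sup>+\<omega>. ennreal ((sqrt j * (balls j (gridpt m i) \<omega> - rho j (gridpt m i) \<omega>) / S)\<^sup>2) \<partial>M)
      = (\<integral>\<^sup>+\<omega>. ennreal (real j / S\<^sup>2) * ennreal ((balls j (gridpt m i) \<omega> - rho j (gridpt m i) \<omega>)\<^sup>2) \<partial>M)"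
      by (intro nn_integral_cong) (simp add: power_divide power_mult_distrib flip: ennreal_mult)
    also have "\<dots> = ennreal (real j / S\<^sup>2) * (\<integral>\<^sup>+\<omega>. ennreal ((balls j (gridpt m i) \<omega> - rho j (gridpt m i) \<omega>)\<^sup>2) \<partial>M)"
      by (rule nn_integral_cmult) simp
    also have "\<dots> \<le> ennreal (real j / S\<^sup>2) * ennreal (S + 1)"
      unfolding S_def by (intro mult_left_mono order_trans[OF balls_variance] expectation_rho_sum gridpt_pos) auto
    also have "\<dots> = ennreal (real j / S\<^sup>2 * (S + 1))" using S by (intro ennreal_mult[symmetric]) auto
    also have "\<dots> \<le> ennreal (2 * real j * exp (- (\<theta> * a / 2 * j)))"
    proof (rule ennreal_leI)
      have S2: "S\<^sup>2 > 0" using S by simp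
      have "(S + 1) / S\<^sup>2 \<le> (2 * S) / S\<^sup>2" using S by (intro divide_right_mono) auto
      moreover have "(2 * S) / S\<^sup>2 = 2 * inverse S" using S by (simp add: power2_eq_square field_simps)
      moreover have "inverse S \<le> inverse e" using eS e1 by (intro le_imp_inverse_le) auto
      moreover have "inverse e = exp (- (\<theta> * a / 2 * j))" by (simp add: e_def exp_minus)
      ultimately have "(S + 1) / S\<^sup>2 \<le> 2 * exp (- (\<theta> * a / 2 * j))" by simp
      then have "real j * ((S + 1) / S\<^sup>2) \<le> real j * (2 * exp (- (\<theta> * a / 2 * j)))"
        by (rule mult_left_mono) simp
      then show "real j / S\<^sup>2 * (S + 1) \<le> 2 * real j * exp (- (\<theta> * a / 2 * j))"
        by (simp add: mult_ac)
    qed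
    finally show ?thesis by (simp add: S_def)
  qed
  have "AE \<omega> in M. summable (\<lambda>j. ?D j \<omega>)"
  proof (rule AE_summable_of_summable_nn_integral)
    fix j
    have "(\<integral>\<^sup>+\<omega>. ennreal (?D j \<omega>) \<partial>M) = (\<Sum>i\<in>grid m j. \<integral>\<^sup>+\<omega>. ennreal ((sqrt j * (balls j (gridpt m i) \<omega> - rho j (gridpt m i) \<omega>) / scale j (gridpt m i))\<^sup>2) \<partial>M)"
      by (subst sum_ennreal[symmetric], simp, rule nn_integral_sum, simp)
    also have "\<dots> \<le> (\<Sum>i\<in>grid m j. ennreal (2 * real j * exp (- (\<theta> * a / 2 * j))))"
      by (intro sum_mono one)
    also have "\<dots> = ennreal (real (card (grid m j)) * (2 * real j * exp (- (\<theta> * a / 2 * j))))"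
      by (simp add: ennreal_mult ennreal_of_nat_eq_real_of_nat)
    also have "\<dots> \<le> ennreal (c j)"
      unfolding c_def using grid_card[of m j] by (intro ennreal_leI mult_right_mono) auto
    finally show "(\<integral>\<^sup>+\<omega>. ennreal (?D j \<omega>) \<partial>M) \<le> ennreal (c j)" .
    show "0 \<le> c j" using a_pos by (simp add: c_def)
  next
    have k: "\<theta> * a > 0" using \<theta> a_pos by simp
    have "c \<in> O(\<lambda>j. 1 / real j ^ 2)" unfolding c_def using bigo_exp[OF k, of "2 * real m * a"] by simp
    then show "summable c" by (rule summable_of_bigo)
  qed (auto intro!: sum_nonneg)
  then show ?thesis by eventually_elim (rule summable_LIMSEQ_zero)
qed

text \<open>The depth is a function of the level only; the same choice serves all grid finenesses m,
  which allows m to grow afterwards.\<close>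

lemma conditional_approximation:
  obtains i :: "nat \<Rightarrow> nat" where "\<And>j. j > 0 \<Longrightarrow> i j < j" "filterlim i at_top sequentially"
    "(\<lambda>j. real (i j) / sqrt j) \<longlonglongrightarrow> 0"
    "\<And>m. m > 0 \<Longrightarrow> AE \<omega> in M. (\<lambda>j. \<Sum>k\<in>grid m j. sqrt j *
        \<bar>G j (occ_at (ln (gridpt m k))) \<omega> - G (i j) (AW (j - i j) (occ_at (ln (gridpt m k)))) \<omega>\<bar>) \<longlonglongrightarrow> 0"
proof -
  obtain C r where r: "0 < r" "r < 1" "0 \<le> C" and rate:
    "\<And>H i j. H \<in> borel_measurable borel \<Longrightarrow> (\<And>x. 0 \<le> H x) \<Longrightarrow> (\<And>x. H x \<le> 1) \<Longrightarrow> i \<le> j \<Longrightarrow>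
       (\<integral>\<^sup>+\<omega>. ennreal \<bar>G j H \<omega> - G i (AW (j - i) H) \<omega>\<bar> \<partial>M) \<le> ennreal (C * r ^ i)"
    by (rule rate) blast
  \<comment> \<open>Makes r^(c0 log j) equal to j^(-6), enough to absorb sqrt j and the O(j) grid
    points and still leave O(j^(-2)).\<close>
  define c0 where "c0 = 6 / (- ln r)"
  have c0: "c0 > 0" using r by (simp add: c0_def divide_pos_pos)
  \<comment> \<open>The minimum with j - 1 keeps the depth strictly below every positive level; for
    large j it is inactive, since log j is of smaller order than j.\<close>
  define i where "i j = min (j - 1) (nat \<lceil>c0 * ln (real j)\<rceil>)" for j :: nat
  have ilow: "\<forall>\<^sub>F j in sequentially. c0 * ln (real j) \<le> real (i j) \<and> j > 0"
  proof -
    have "filterlim (\<lambda>j. real j - 1 - c0 * ln (real j)) at_top sequentially" using c0 by real_asymp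
    then have "\<forall>\<^sub>F j in sequentially. 0 \<le> real j - 1 - c0 * ln (real j)" unfolding filterlim_at_top by blast
    with eventually_gt_at_top[of 0] show ?thesis
    proof eventually_elim
      case (elim j)
      have "c0 * ln (real j) \<le> real (nat \<lceil>c0 * ln (real j)\<rceil>)" by linarith
      moreover have "c0 * ln (real j) \<le> real (j - 1)" using elim by (simp add: of_nat_diff)
      ultimately show ?case using elim by (simp add: i_def min_def)
    qed
  qed
  have iup: "real (i j) \<le> c0 * ln (real j) + 1" if "j > 0" for j
  proof -
    have "0 \<le> c0 * ln (real j)" using c0 that by simp
    then have "real (nat \<lceil>c0 * ln (real j)\<rceil>) \<le> c0 * ln (real j) + 1" by linarith
    then show ?thesis by (simp add: i_def min_def)
  qed
  show ?thesis
  proof (rule that[of i])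
    show ij: "i j < j" if "j > 0" for j using that by (simp add: i_def)
    have "filterlim (\<lambda>j. c0 * ln (real j)) at_top sequentially" using c0 by real_asymp
    then have "filterlim (\<lambda>j. real (i j)) at_top sequentially"
      by (rule filterlim_at_top_mono) (use ilow in \<open>auto elim: eventually_mono\<close>)
    then show "filterlim i at_top sequentially" by (simp add: filterlim_sequentially_iff_filterlim_real)
    show "(\<lambda>j. real (i j) / sqrt j) \<longlonglongrightarrow> 0"
    proof (rule tendsto_sandwich[OF _ _ tendsto_const])
      show "\<forall>\<^sub>F j in sequentially. real (i j) / sqrt j \<le> (c0 * ln (real j) + 1) / sqrt j"
        using eventually_gt_at_top[of 0] by eventually_elim (simp add: divide_right_mono iup)
      show "(\<lambda>j. (c0 * ln (real j) + 1) / sqrt j) \<longlonglongrightarrow> 0" using c0 by real_asymp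
    qed simp
    fix m :: nat assume m: "m > 0"
    let ?B = "\<lambda>j \<omega>. \<Sum>k\<in>grid m j. sqrt j * \<bar>G j (occ_at (ln (gridpt m k))) \<omega> - G (i j) (AW (j - i j) (occ_at (ln (gridpt m k)))) \<omega>\<bar>"
    have hm [measurable]: "occ_at x \<in> borel_measurable borel" for x
      by (rule measurable_compose[OF _ occ_measurable]) simp
    have hb: "0 \<le> occ_at x s" "occ_at x s \<le> 1" for x s by (simp_all add: occ_nonneg occ_le_1[OF \<theta>])
    have [measurable]: "AW l (occ_at x) \<in> borel_measurable borel" for l x
      by (rule AW_measurable[OF hm hb])
    define c where "c j = (2 * real m * a * real j + 1) * (sqrt j * (C * r ^ i j))" for j :: nat
    have "AE \<omega> in M. summable (\<lambda>j. ?B j \<omega>)"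
    proof (rule AE_summable_of_summable_nn_integral)
      fix j
      have "i j \<le> j" by (simp add: i_def)
      have "(\<integral>\<^sup>+\<omega>. ennreal (?B j \<omega>) \<partial>M) = (\<Sum>k\<in>grid m j. \<integral>\<^sup>+\<omega>. ennreal (sqrt j *
          \<bar>G j (occ_at (ln (gridpt m k))) \<omega> - G (i j) (AW (j - i j) (occ_at (ln (gridpt m k)))) \<omega>\<bar>) \<partial>M)"
        by (subst sum_ennreal[symmetric], simp, rule nn_integral_sum, simp)
      also have "\<dots> = (\<Sum>k\<in>grid m j. ennreal (sqrt j) *
          (\<integral>\<^sup>+\<omega>. ennreal \<bar>G j (occ_at (ln (gridpt m k))) \<omega> - G (i j) (AW (j - i j) (occ_at (ln (gridpt m k)))) \<omega>\<bar> \<partial>M))"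
        by (intro sum.cong refl) (subst ennreal_mult, simp, simp, rule nn_integral_cmult, simp)
      also have "\<dots> \<le> (\<Sum>k\<in>grid m j. ennreal (sqrt j) * ennreal (C * r ^ i j))"
        by (intro sum_mono mult_left_mono rate hm hb \<open>i j \<le> j\<close>) auto
      also have "\<dots> = ennreal (real (card (grid m j)) * (sqrt j * (C * r ^ i j)))"
        using r by (simp add: ennreal_mult ennreal_of_nat_eq_real_of_nat)
      also have "\<dots> \<le> ennreal (c j)"
        unfolding c_def using r grid_card[of m j] by (intro ennreal_leI mult_right_mono) auto
      finally show "(\<integral>\<^sup>+\<omega>. ennreal (?B j \<omega>) \<partial>M) \<le> ennreal (c j)" .
      show "0 \<le> c j" using a_pos r by (simp add: c_def)
    next
      define d where "d j = (2 * real m * a * real j + 1) * (sqrt j * (C * real j powr (- 6)))" for j :: nat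
      have "d \<in> O(\<lambda>j. 1 / real j ^ 2)" unfolding d_def by (rule bigo_powr)
      then have "summable d" by (rule summable_of_bigo)
      then show "summable c"
      proof (rule summable_comparison_test_ev[rotated])
        show "\<forall>\<^sub>F j in sequentially. norm (c j) \<le> d j"
          using ilow
        proof eventually_elim
          case (elim j)
          have "r ^ i j = r powr real (i j)" using r by (simp add: powr_realpow)
          also have "\<dots> \<le> r powr (c0 * ln (real j))" using r elim by (intro powr_mono') auto
          also have "\<dots> = real j powr (- 6)" using r elim by (simp add: powr_def c0_def)
          finally have "c j \<le> d j" unfolding c_def d_def using a_pos r by (intro mult_left_mono) auto
          moreover have "0 \<le> c j" using a_pos r by (simp add: c_def)
          ultimately show ?case by simp
        qed
      qed
    qed (auto intro!: sum_nonneg)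
    then show "AE \<omega> in M. (\<lambda>j. ?B j \<omega>) \<longlonglongrightarrow> 0" by eventually_elim (rule summable_LIMSEQ_zero)
  qed
qed

end

text \<open>The hypothesis is normalised by sqrt (log n), the local limit theorem by sqrt (j_n).
  Their ratio tends to sqrt a, which turns b into b sqrt a.\<close>

lemma level_asymptotics:
  fixes a b :: real and j :: "nat \<Rightarrow> nat"
  assumes a: "a > 0" and j: "\<And>n. j n > 0"
    and lim: "(\<lambda>n. (ln (real n) - a * real (j n)) / sqrt (ln (real n))) \<longlonglongrightarrow> b"
  shows "(\<lambda>n. ln (real n) / real (j n)) \<longlonglongrightarrow> a"
    and "filterlim j at_top sequentially"
    and "(\<lambda>n. (ln (real n) - a * real (j n)) / sqrt (real (j n))) \<longlonglongrightarrow> b * sqrt a"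
proof -
  define u where "u n = (ln (real n) - a * real (j n)) / sqrt (ln (real n))" for n
  have u: "u \<longlonglongrightarrow> b" using lim by (simp add: u_def[abs_def])
  have ln_top: "filterlim (\<lambda>n. ln (real n)) at_top sequentially" by real_asymp
  have "(\<lambda>n. 1 / sqrt (ln (real n))) \<longlonglongrightarrow> 0" by real_asymp
  note tendsto_divide[OF tendsto_diff[OF tendsto_const[of 1] tendsto_mult[OF u this]] tendsto_const[of a]]
  then have "(\<lambda>n. (1 - u n * (1 / sqrt (ln (real n)))) / a) \<longlonglongrightarrow> (1 - b * 0) / a" using a by simp
  moreover have "\<forall>\<^sub>F n in sequentially. (1 - u n * (1 / sqrt (ln (real n)))) / a = real (j n) / ln (real n)"
    using eventually_gt_at_top[of 1]
  proof eventually_elim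
    case (elim n)
    then have y: "ln (real n) > 0" by simp
    have "u n * (1 / sqrt (ln (real n))) = (ln (real n) - a * real (j n)) / ln (real n)"
      using y by (simp add: u_def real_sqrt_mult_self flip: power2_eq_square)
    then show ?case using y a by (simp add: diff_divide_distrib)
  qed
  ultimately have jl: "(\<lambda>n. real (j n) / ln (real n)) \<longlonglongrightarrow> 1 / a"
    by (simp add: tendsto_cong)
  from tendsto_inverse[OF this] a show lj: "(\<lambda>n. ln (real n) / real (j n)) \<longlonglongrightarrow> a" by simp
  have "filterlim (\<lambda>n. real (j n) / ln (real n) * ln (real n)) at_top sequentially"
    by (rule filterlim_tendsto_pos_mult_at_top[OF jl _ ln_top]) (use a in simp)
  moreover have "\<forall>\<^sub>F n in sequentially. real (j n) / ln (real n) * ln (real n) = real (j n)"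
    using eventually_gt_at_top[of 1] by eventually_elim simp
  ultimately have "filterlim (\<lambda>n. real (j n)) at_top sequentially"
    by (simp cong: filterlim_cong)
  then show "filterlim j at_top sequentially" by (simp add: filterlim_sequentially_iff_filterlim_real)
  have "(\<lambda>n. u n * sqrt (ln (real n) / real (j n))) \<longlonglongrightarrow> b * sqrt a"
    by (intro tendsto_intros u lj)
  moreover have "\<forall>\<^sub>F n in sequentially. u n * sqrt (ln (real n) / real (j n)) = (ln (real n) - a * real (j n)) / sqrt (real (j n))"
    using eventually_gt_at_top[of 1]
    by eventually_elim (simp add: u_def real_sqrt_divide)
  ultimately show "(\<lambda>n. (ln (real n) - a * real (j n)) / sqrt (real (j n))) \<longlonglongrightarrow> b * sqrt a"
    by (simp add: tendsto_cong)
qed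

section \<open>From the grid to all ball numbers\<close>

context brw_balls begin

text \<open>A deterministic statement about one realisation, with the almost sure facts as
  hypotheses. Each n selects one grid point of its level, and the error there is a single
  nonnegative summand of the grid sum known to vanish.\<close>

lemma grid_limit:
  fixes a0 :: real and i j k :: "nat \<Rightarrow> nat"
  assumes fin: "\<And>i. GG i (\<lambda>_. 1) \<omega> \<noteq> \<infinity>" and W: "(\<lambda>i. G i (\<lambda>_. 1) \<omega>) \<longlonglongrightarrow> W \<omega>"
    and a0: "a0 > 0" and tail: "(\<lambda>i. G i (\<lambda>s. if s > a0 * i then 1 else 0) \<omega>) \<longlonglongrightarrow> 0"
    and i: "\<And>j. j > 0 \<Longrightarrow> i j < j" "filterlim i at_top sequentially" "(\<lambda>j. real (i j) / sqrt j) \<longlonglongrightarrow> 0"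
    and approx: "(\<lambda>j. \<Sum>k\<in>grid m j. sqrt j *
        \<bar>G j (occ_at (ln (gridpt m k))) \<omega> - G (i j) (AW (j - i j) (occ_at (ln (gridpt m k)))) \<omega>\<bar>) \<longlonglongrightarrow> 0"
    and conc: "(\<lambda>j. \<Sum>i\<in>grid m j. (sqrt j * (balls j (gridpt m i) \<omega> - rho j (gridpt m i) \<omega>) / scale j (gridpt m i))\<^sup>2) \<longlonglongrightarrow> 0"
    and m: "m > 0" and j: "filterlim j at_top sequentially" "\<And>n. j n > 0"
    and k: "\<forall>\<^sub>F n in sequentially. k n \<in> grid m (j n)"
    and x: "(\<lambda>n. (ln (gridpt m (k n)) - a * j n) / sqrt (j n)) \<longlonglongrightarrow> z"
  shows "(\<lambda>n. sqrt (j n) * balls (j n) (gridpt m (k n)) \<omega> / scale (j n) (gridpt m (k n))) \<longlonglongrightarrow> gauss_const z * W \<omega>"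
proof -
  define N where "N n = gridpt m (k n)" for n
  define S where "S n = scale (j n) (N n)" for n
  define g where "g n = G (j n) (occ_at (ln (N n))) \<omega>" for n
  define h where "h n = G (i (j n)) (AW (j n - i (j n)) (occ_at (ln (N n)))) \<omega>" for n
  have S: "S n > 0" for n unfolding S_def N_def by (intro scale_pos gridpt_pos)
  have A: "(\<lambda>n. sqrt (j n) * h n) \<longlonglongrightarrow> gauss_const z * W \<omega>"
    unfolding h_def
  proof (rule conditional_limit[OF fin W a0 tail j(1)])
    show "i (j n) < j n" for n by (rule i(1)[OF j(2)])
    show "filterlim (\<lambda>n. i (j n)) at_top sequentially" by (rule filterlim_compose[OF i(2) j(1)])
    show "(\<lambda>n. real (i (j n)) / sqrt (j n)) \<longlonglongrightarrow> 0" by (rule filterlim_compose[OF i(3) j(1)])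
  qed (use x in \<open>simp add: N_def\<close>)
  have B: "(\<lambda>n. sqrt (j n) * (g n - h n)) \<longlonglongrightarrow> 0"
  proof (rule Lim_null_comparison[OF _ filterlim_compose[OF approx j(1)]])
    show "\<forall>\<^sub>F n in sequentially. norm (sqrt (j n) * (g n - h n)) \<le> (\<Sum>k\<in>grid m (j n). sqrt (j n) *
        \<bar>G (j n) (occ_at (ln (gridpt m k))) \<omega> - G (i (j n)) (AW (j n - i (j n)) (occ_at (ln (gridpt m k)))) \<omega>\<bar>)"
      using k
    proof eventually_elim
      case (elim n)
      have "sqrt (j n) * \<bar>G (j n) (occ_at (ln (gridpt m (k n)))) \<omega> - G (i (j n)) (AW (j n - i (j n)) (occ_at (ln (gridpt m (k n))))) \<omega>\<bar>
        \<le> (\<Sum>k\<in>grid m (j n). sqrt (j n) *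
        \<bar>G (j n) (occ_at (ln (gridpt m k))) \<omega> - G (i (j n)) (AW (j n - i (j n)) (occ_at (ln (gridpt m k)))) \<omega>\<bar>)"
        by (rule member_le_sum[OF elim _ grid_finite]) simp
      then show ?case by (simp add: abs_mult g_def h_def N_def)
    qed
  qed
  have "(\<lambda>n. (sqrt (j n) * (balls (j n) (N n) \<omega> - rho (j n) (N n) \<omega>) / S n)\<^sup>2) \<longlonglongrightarrow> 0"
  proof (rule Lim_null_comparison[OF _ filterlim_compose[OF conc j(1)]])
    show "\<forall>\<^sub>F n in sequentially. norm ((sqrt (j n) * (balls (j n) (N n) \<omega> - rho (j n) (N n) \<omega>) / S n)\<^sup>2) \<le>
      (\<Sum>i\<in>grid m (j n). (sqrt (j n) * (balls (j n) (gridpt m i) \<omega> - rho (j n) (gridpt m i) \<omega>) / scale (j n) (gridpt m i))\<^sup>2)"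
      using k
    proof eventually_elim
      case (elim n)
      have "(sqrt (j n) * (balls (j n) (gridpt m (k n)) \<omega> - rho (j n) (gridpt m (k n)) \<omega>) / scale (j n) (gridpt m (k n)))\<^sup>2
        \<le> (\<Sum>i\<in>grid m (j n). (sqrt (j n) * (balls (j n) (gridpt m i) \<omega> - rho (j n) (gridpt m i) \<omega>) / scale (j n) (gridpt m i))\<^sup>2)"
        by (rule member_le_sum[OF elim _ grid_finite]) simp
      then show ?case by (simp add: N_def S_def)
    qed
  qed
  from tendsto_real_sqrt[OF this]
  have D: "(\<lambda>n. sqrt (j n) * (balls (j n) (N n) \<omega> - rho (j n) (N n) \<omega>) / S n) \<longlonglongrightarrow> 0"
    unfolding real_sqrt_abs real_sqrt_zero by (rule tendsto_rabs_zero_cancel)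
  have R: "(\<lambda>n. sqrt (j n) * (rho (j n) (N n) \<omega> - S n * g n) / S n) \<longlonglongrightarrow> 0"
  proof -
    have c: "\<theta> * a / 2 > 0" using \<theta> a_pos by simp
    have "(\<lambda>j. sqrt (real j) * exp (- (c * real j))) \<longlonglongrightarrow> 0" if "c > 0" for c :: real using that by real_asymp
    from filterlim_compose[OF this[OF c] j(1)] show ?thesis
    proof (rule Lim_null_comparison[rotated])
      show "\<forall>\<^sub>F n in sequentially. norm (sqrt (j n) * (rho (j n) (N n) \<omega> - S n * g n) / S n) \<le> sqrt (j n) * exp (- (\<theta> * a / 2 * j n))"
        using k
      proof eventually_elim
        case (elim n)
        have r: "\<bar>rho (j n) (N n) \<omega> - S n * g n\<bar> \<le> 1"
          unfolding S_def g_def N_def by (rule rho_close[OF gridpt_pos fin])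
        have e: "exp (\<theta> * a / 2 * j n) \<le> S n" unfolding S_def N_def by (rule grid_scale[OF m elim])
        have "\<bar>rho (j n) (N n) \<omega> - S n * g n\<bar> / S n \<le> 1 / exp (\<theta> * a / 2 * j n)"
          using r e by (intro frac_le) auto
        also have "1 / exp (\<theta> * a / 2 * j n) = exp (- (\<theta> * a / 2 * j n))" unfolding exp_minus by (rule inverse_eq_divide[symmetric])
        finally have "sqrt (j n) * (\<bar>rho (j n) (N n) \<omega> - S n * g n\<bar> / S n) \<le> sqrt (j n) * exp (- (\<theta> * a / 2 * j n))"
          by (rule mult_left_mono) simp
        moreover have "norm (sqrt (j n) * (rho (j n) (N n) \<omega> - S n * g n) / S n) = sqrt (j n) * (\<bar>rho (j n) (N n) \<omega> - S n * g n\<bar> / S n)"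
          using S[of n] by (simp add: abs_mult)
        ultimately show ?case by (simp only:)
      qed
    qed
  qed
  \<comment> \<open>Four pieces: fluctuation of the balls for given weights, exponential in place of
    n-th power, tail of the tree replaced by its conditional mean, and the main term.\<close>
  have "sqrt (j n) * balls (j n) (N n) \<omega> / S n = sqrt (j n) * (balls (j n) (N n) \<omega> - rho (j n) (N n) \<omega>) / S n
      + sqrt (j n) * (rho (j n) (N n) \<omega> - S n * g n) / S n + sqrt (j n) * (g n - h n) + sqrt (j n) * h n" for n
  proof -
    have *: "s * B / C = s * (B - R) / C + s * (R - C * x) / C + s * (x - y) + s * y" if "C \<noteq> 0" for s B C R x y :: real
      using that by (simp add: right_diff_distrib diff_divide_distrib)
    show ?thesis by (rule *) (use S[of n] in simp)
  qed
  with tendsto_add[OF tendsto_add[OF tendsto_add[OF D R] B] A] show ?thesis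
    by (simp add: N_def S_def)
qed

lemma gridpt_bracket:
  fixes m :: nat
  assumes m: "m > 0"
  defines "k \<equiv> \<lambda>n::nat. nat \<lfloor>real m * ln (real n)\<rfloor>"
  shows "n > 0 \<Longrightarrow> gridpt m (k n) \<le> n" "n > 0 \<Longrightarrow> n \<le> gridpt m (k n + 1)"
    and "n > 0 \<Longrightarrow> ln n - 1 / m \<le> ln (gridpt m (k n))"
    and "\<forall>\<^sub>F n in sequentially. ln (gridpt m (k n + 1)) \<le> ln n + 2 / m"
proof -
  have kn: "real (k n) \<le> m * ln n" "m * ln n \<le> real (k n) + 1" if "n > 0" for n
  proof -
    have "0 \<le> m * ln n" using that by simp
    then show "real (k n) \<le> m * ln n" "m * ln n \<le> real (k n) + 1" unfolding k_def by linarith+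
  qed
  have up: "exp (real (k n) / m) \<le> n" if "n > 0" for n
  proof -
    have "real (k n) / m \<le> ln n" using kn(1)[OF that] m by (simp add: field_simps)
    then show ?thesis using that by (metis exp_le_cancel_iff exp_ln of_nat_0_less_iff)
  qed
  have lo: "n \<le> exp (real (k n + 1) / m)" if "n > 0" for n
  proof -
    have "ln n \<le> real (k n + 1) / m" using kn(2)[OF that] m by (simp add: field_simps)
    then show ?thesis using that by (metis exp_le_cancel_iff exp_ln of_nat_0_less_iff)
  qed
  \<comment> \<open>Rounding exp(k/m) up does not pass n, because n is an integer.\<close>
  show "gridpt m (k n) \<le> n" if "n > 0"
    using up[OF that] unfolding gridpt_def by (simp add: nat_le_iff ceiling_le_iff)
  show "n \<le> gridpt m (k n + 1)" if "n > 0"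
    using order_trans[OF lo[OF that] gridpt_ge] by simp
  show "ln n - 1 / m \<le> ln (gridpt m (k n))" if "n > 0"
  proof -
    have "ln n \<le> (real (k n) + 1) / m" using kn(2)[OF that] m by (simp add: pos_le_divide_eq mult.commute)
    then have "ln n - 1 / m \<le> real (k n) / m" by (simp add: add_divide_distrib)
    also have "\<dots> \<le> ln (gridpt m (k n))" using gridpt_ge[of "k n" m] gridpt_pos[of m "k n"] by (simp add: ln_ge_iff)
    finally show ?thesis .
  qed
  \<comment> \<open>One step of the grid multiplies by q. A second factor q absorbs the 1 added by
    rounding up, once n is large; hence 2/m.\<close>
  define q where "q = exp (1 / real m)"
  have q: "q > 1" using m by (simp add: q_def)
  have "filterlim (\<lambda>n. real n * (q * q - q)) at_top sequentially" using q by real_asymp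
  then have "\<forall>\<^sub>F n in sequentially. 1 \<le> real n * (q * q - q)" unfolding filterlim_at_top by blast
  with eventually_gt_at_top[of 0] show "\<forall>\<^sub>F n in sequentially. ln (gridpt m (k n + 1)) \<le> ln n + 2 / m"
  proof eventually_elim
    case (elim n)
    have "exp (real (k n + 1) / m) = exp (real (k n) / m) * q" by (simp add: q_def add_divide_distrib exp_add)
    also have "\<dots> \<le> n * q" using up[of n] elim q by (intro mult_right_mono) auto
    finally have "real (gridpt m (k n + 1)) \<le> n * q + 1" using gridpt_le[of m "k n + 1"] by linarith
    also have "\<dots> \<le> n * (q * q)" using elim by (simp add: algebra_simps)
    finally have "ln (gridpt m (k n + 1)) \<le> ln (n * (q * q))" using elim q gridpt_pos[of m "k n + 1"] by (subst ln_le_cancel_iff) auto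
    also have "\<dots> = ln n + 2 / m" using elim q by (simp add: ln_mult q_def)
    finally show ?case .
  qed
qed

text \<open>For fixed m the normalised count is squeezed between its values at the neighbouring grid
  points, up to the change of n^\<theta>, a factor between exp(-\<theta>/m) and exp(2 \<theta>/m).
  Both grid values have the same limit, and m is sent to infinity last, after n.\<close>

lemma occupancy_limit:
  fixes b :: real and j :: "nat \<Rightarrow> nat"
  assumes j_pos: "\<And>n. j n > 0"
    and j_lim: "(\<lambda>n. (ln (real n) - a * real (j n)) / sqrt (ln (real n))) \<longlonglongrightarrow> b"
  shows "AE \<omega> in M. (\<lambda>n. sqrt (j n) * balls (j n) n \<omega> / scale (j n) n) \<longlonglongrightarrow> gauss_const (b * sqrt a) * W \<omega>"
proof -
  note lv = level_asymptotics[OF a_pos j_pos j_lim]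
  define z where "z = b * sqrt a"
  have top: "filterlim (\<lambda>n. real (j n)) at_top sequentially"
    using lv(2) by (simp add: filterlim_sequentially_iff_filterlim_real)
  obtain a0 :: real where a0: "a0 > 0" and tail: "AE \<omega> in M. (\<lambda>i. G i (\<lambda>s. if s > a0 * i then 1 else 0) \<omega>) \<longlonglongrightarrow> 0"
    by (rule tail_vanishes)
  obtain i :: "nat \<Rightarrow> nat" where i: "\<And>j. j > 0 \<Longrightarrow> i j < j" "filterlim i at_top sequentially"
    "(\<lambda>j. real (i j) / sqrt j) \<longlonglongrightarrow> 0"
    and approx: "\<And>m. m > 0 \<Longrightarrow> AE \<omega> in M. (\<lambda>j. \<Sum>k\<in>grid m j. sqrt j *
        \<bar>G j (occ_at (ln (gridpt m k))) \<omega> - G (i j) (AW (j - i j) (occ_at (ln (gridpt m k)))) \<omega>\<bar>) \<longlonglongrightarrow> 0"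
    by (rule conditional_approximation) blast
  \<comment> \<open>Only countably many finenesses m occur, so they share one null set.\<close>
  have approx': "AE \<omega> in M. \<forall>m\<in>{0<..}. (\<lambda>j. \<Sum>k\<in>grid m j. sqrt j *
        \<bar>G j (occ_at (ln (gridpt m k))) \<omega> - G (i j) (AW (j - i j) (occ_at (ln (gridpt m k)))) \<omega>\<bar>) \<longlonglongrightarrow> 0"
    using approx by (intro AE_ball_countable[THEN iffD2]) auto
  have conc': "AE \<omega> in M. \<forall>m\<in>{0<..}. (\<lambda>j. \<Sum>i\<in>grid m j. (sqrt j * (balls j (gridpt m i) \<omega> - rho j (gridpt m i) \<omega>) / scale j (gridpt m i))\<^sup>2) \<longlonglongrightarrow> 0"
    using balls_concentrate by (intro AE_ball_countable[THEN iffD2]) auto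
  from GG_finite martingale_limit tail approx' conc' show ?thesis
  proof eventually_elim
    case (elim \<omega>)
    define L where "L = gauss_const z * W \<omega>"
    define X where "X n = sqrt (j n) * balls (j n) n \<omega> / scale (j n) n" for n
    have bounds: "\<exists>Y Z. Y \<longlonglongrightarrow> L * exp (- (\<theta> / m)) \<and> Z \<longlonglongrightarrow> L * exp (2 * \<theta> / m) \<and>
        (\<forall>\<^sub>F n in sequentially. Y n \<le> X n \<and> X n \<le> Z n)" if m: "m > 0" for m :: nat
    proof -
      define k where "k n = nat \<lfloor>real m * ln (real n)\<rfloor>" for n :: nat
      note br = gridpt_bracket[OF m, folded k_def]
      \<comment> \<open>Moving log n by at most 2/m is invisible on the scale sqrt j, so both
        neighbours have the standardised limit z.\<close>
      have near: "(\<lambda>n. (ln (gridpt m (k' n)) - a * j n) / sqrt (j n)) \<longlonglongrightarrow> z"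
        if k': "\<forall>\<^sub>F n in sequentially. \<bar>ln (gridpt m (k' n)) - ln (real n)\<bar> \<le> 2 / m" for k'
      proof -
        have "(\<lambda>n. (2 / m) * (1 / sqrt (real (j n)))) \<longlonglongrightarrow> (2 / m) * 0"
          by (intro tendsto_mult tendsto_const filterlim_compose[OF _ lv(2)]) real_asymp
        then have 0: "(\<lambda>n. (2 / m) * (1 / sqrt (real (j n)))) \<longlonglongrightarrow> 0" by simp
        have "(\<lambda>n. (ln (gridpt m (k' n)) - ln (real n)) / sqrt (j n)) \<longlonglongrightarrow> 0"
        proof (rule Lim_null_comparison[OF _ 0])
          show "\<forall>\<^sub>F n in sequentially. norm ((ln (gridpt m (k' n)) - ln (real n)) / sqrt (j n)) \<le> (2 / m) * (1 / sqrt (real (j n)))"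
            using k'
          proof eventually_elim
            case (elim n)
            then have "\<bar>ln (gridpt m (k' n)) - ln (real n)\<bar> / sqrt (j n) \<le> (2 / m) / sqrt (j n)"
              by (rule divide_right_mono) simp
            then show ?case by simp
          qed
        qed
        from tendsto_add[OF this lv(3)] show ?thesis by (simp add: z_def flip: add_divide_distrib)
      qed
      \<comment> \<open>The quotient (log n) / j_n tends to a, strictly inside the range from a/2 to
        2 a; rounding to an index shifts m log n by at most 1, which is negligible after division by
        j_n.\<close>
      have gr: "\<forall>\<^sub>F n in sequentially. k n \<in> grid m (j n) \<and> k n + 1 \<in> grid m (j n)"
      proof -
        have "(\<lambda>n. 1 / real (j n)) \<longlonglongrightarrow> 0" by (rule filterlim_compose[OF _ lv(2)]) real_asymp
        then have l1: "(\<lambda>n. m * (ln (real n) / real (j n)) - 1 / real (j n)) \<longlonglongrightarrow> m * a - 0"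
          and l2: "(\<lambda>n. m * (ln (real n) / real (j n)) + 1 / real (j n)) \<longlonglongrightarrow> m * a + 0"
          by (intro tendsto_intros lv(1); assumption)+
        have ma: "m * a > 0" using m a_pos by simp
        have "\<forall>\<^sub>F n in sequentially. m * a / 2 < m * (ln (real n) / real (j n)) - 1 / real (j n)"
          by (rule order_tendstoD(1)[OF l1]) (use ma in linarith)
        moreover have "\<forall>\<^sub>F n in sequentially. m * (ln (real n) / real (j n)) + 1 / real (j n) < 2 * (m * a)"
          by (rule order_tendstoD(2)[OF l2]) (use ma in linarith)
        ultimately show ?thesis using eventually_gt_at_top[of 0]
        proof eventually_elim
          case (elim n)
          have jn: "real (j n) > 0" using j_pos[of n] by simp
          have "m * a / 2 * j n < (m * (ln (real n) / real (j n)) - 1 / real (j n)) * j n"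
            using elim(1) jn by (rule mult_strict_right_mono)
          then have 1: "m * a / 2 * j n < m * ln (real n) - 1" using jn by (simp add: left_diff_distrib)
          have "(m * (ln (real n) / real (j n)) + 1 / real (j n)) * j n < 2 * (m * a) * j n"
            using elim(2) jn by (rule mult_strict_right_mono)
          then have 2: "m * ln (real n) + 1 < 2 * (m * a) * j n" using jn by (simp add: distrib_right)
          have "0 \<le> m * ln (real n)" using elim(3) by simp
          then have "real (k n) \<le> m * ln (real n)" "m * ln (real n) - 1 \<le> real (k n)" unfolding k_def by linarith+
          then show ?case using 1 2 by (simp add: grid_def mult_ac)
        qed
      qed
      have lim: "(\<lambda>n. sqrt (j n) * balls (j n) (gridpt m (k' n)) \<omega> / scale (j n) (gridpt m (k' n))) \<longlonglongrightarrow> L"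
        if "\<forall>\<^sub>F n in sequentially. k' n \<in> grid m (j n)"
           "\<forall>\<^sub>F n in sequentially. \<bar>ln (gridpt m (k' n)) - ln (real n)\<bar> \<le> 2 / m" for k'
        unfolding L_def
        by (rule grid_limit[OF _ elim(2) a0 elim(3) i _ _ m lv(2) j_pos that(1) near[OF that(2)]])
           (use elim(1,4,5) m in auto)
      have 3: "(\<lambda>n. sqrt (j n) * balls (j n) (gridpt m (k n)) \<omega> / scale (j n) (gridpt m (k n))) \<longlonglongrightarrow> L"
      proof (rule lim)
        show "\<forall>\<^sub>F n in sequentially. \<bar>ln (gridpt m (k n)) - ln (real n)\<bar> \<le> 2 / m"
          using eventually_gt_at_top[of 0]
        proof eventually_elim
          case (elim n)
          have "ln (gridpt m (k n)) \<le> ln (real n)" using br(1)[OF elim] gridpt_pos[of m "k n"] elim by simp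
          moreover have "1 / real m \<le> 2 / m" by (rule divide_right_mono) auto
          ultimately show ?case using br(3)[OF elim] by linarith
        qed
      qed (use gr in \<open>auto elim: eventually_mono\<close>)
      have 4: "(\<lambda>n. sqrt (j n) * balls (j n) (gridpt m (k n + 1)) \<omega> / scale (j n) (gridpt m (k n + 1))) \<longlonglongrightarrow> L"
      proof (rule lim)
        show "\<forall>\<^sub>F n in sequentially. \<bar>ln (gridpt m (k n + 1)) - ln (real n)\<bar> \<le> 2 / m"
          using eventually_gt_at_top[of 0] br(4)
        proof eventually_elim
          case (elim n)
          have "ln (real n) \<le> ln (gridpt m (k n + 1))" using br(2)[OF elim(1)] elim(1) gridpt_pos[of m "k n + 1"] by (subst ln_le_cancel_iff) auto
          then show ?case using elim(2) by linarith
        qed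
      qed (use gr in \<open>auto elim: eventually_mono\<close>)
      \<comment> \<open>The level stays that of n while the ball number moves, so the count is
        monotone and the scale changes only through n^\<theta>.\<close>
      have mono: "sqrt (j n) * balls (j n) n1 \<omega> / scale (j n) n1 * exp (- d) \<le> sqrt (j n) * balls (j n) n2 \<omega> / scale (j n) n2"
        if n: "n1 \<le> n2" "n1 > 0" and d: "\<theta> * (ln n2 - ln n1) \<le> d" for n n1 n2 :: nat and d :: real
      proof -
        have s: "scale (j n) n2 = scale (j n) n1 * exp (\<theta> * (ln n2 - ln n1))"
          using n by (simp add: scale_def powr_def exp_diff right_diff_distrib)
        have "balls (j n) n1 \<omega> \<le> balls (j n) n2 \<omega>"
          unfolding balls_def using Kocc_mono[of "P \<omega>", OF P_nonneg P_sums n(1)] by simp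
        then have "sqrt (j n) * balls (j n) n1 \<omega> / scale (j n) n1 * exp (- d)
          \<le> sqrt (j n) * balls (j n) n2 \<omega> / scale (j n) n1 * exp (- (\<theta> * (ln n2 - ln n1)))"
          using scale_pos[OF n(2), of "j n"] d
          by (intro mult_mono divide_right_mono mult_left_mono) (auto simp: balls_def)
        also have "\<dots> = sqrt (j n) * balls (j n) n2 \<omega> / scale (j n) n2"
          unfolding s exp_minus by (simp add: divide_inverse mult_ac)
        finally show ?thesis .
      qed
      have low: "\<forall>\<^sub>F n in sequentially. sqrt (j n) * balls (j n) (gridpt m (k n)) \<omega> / scale (j n) (gridpt m (k n)) * exp (- (\<theta> / m)) \<le> X n"
        using eventually_gt_at_top[of 0]
      proof eventually_elim
        case (elim n)
        have "\<theta> * (ln n - ln (gridpt m (k n))) \<le> \<theta> * (1 / m)"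
          using br(3)[OF elim] \<theta> by (intro mult_left_mono) auto
        then show ?case unfolding X_def by (intro mono br(1)[OF elim] gridpt_pos) simp
      qed
      have upp: "\<forall>\<^sub>F n in sequentially. X n \<le> sqrt (j n) * balls (j n) (gridpt m (k n + 1)) \<omega> / scale (j n) (gridpt m (k n + 1)) * exp (2 * \<theta> / m)"
        using eventually_gt_at_top[of 0] br(4)
      proof eventually_elim
        case (elim n)
        have "\<theta> * (ln (gridpt m (k n + 1)) - ln n) \<le> \<theta> * (2 / m)"
          using elim(2) \<theta> by (intro mult_left_mono) auto
        then have "X n * exp (- (2 * \<theta> / m)) \<le> sqrt (j n) * balls (j n) (gridpt m (k n + 1)) \<omega> / scale (j n) (gridpt m (k n + 1))"
          unfolding X_def by (intro mono br(2)[OF elim(1)] elim(1)) (simp add: mult.commute)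
        then have "X n * exp (- (2 * \<theta> / m)) * exp (2 * \<theta> / m) \<le> sqrt (j n) * balls (j n) (gridpt m (k n + 1)) \<omega> / scale (j n) (gridpt m (k n + 1)) * exp (2 * \<theta> / m)"
          by (rule mult_right_mono) simp
        then show ?case by (simp add: mult.assoc flip: exp_add)
      qed
      from low upp have "\<forall>\<^sub>F n in sequentially.
          sqrt (j n) * balls (j n) (gridpt m (k n)) \<omega> / scale (j n) (gridpt m (k n)) * exp (- (\<theta> / m)) \<le> X n \<and>
          X n \<le> sqrt (j n) * balls (j n) (gridpt m (k n + 1)) \<omega> / scale (j n) (gridpt m (k n + 1)) * exp (2 * \<theta> / m)"
        by eventually_elim blast
      with tendsto_mult[OF 3 tendsto_const[of "exp (- (\<theta> / m))"]] tendsto_mult[OF 4 tendsto_const[of "exp (2 * \<theta> / m)"]]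
      show ?thesis by blast
    qed
    have "(\<lambda>m. L * exp (- (\<theta> / real m))) \<longlonglongrightarrow> L" "(\<lambda>m. L * exp (2 * \<theta> / real m)) \<longlonglongrightarrow> L"
      by real_asymp+
    note m_lim = this
    have "X \<longlonglongrightarrow> L"
    proof (rule order_tendstoI)
      fix y assume "y < L"
      from order_tendstoD(1)[OF m_lim(1) this] eventually_gt_at_top[of 0]
      have "\<forall>\<^sub>F m in sequentially. m > 0 \<and> y < L * exp (- (\<theta> / real m))" by eventually_elim blast
      then obtain m :: nat where m: "m > 0" "y < L * exp (- (\<theta> / real m))" by (auto simp: eventually_sequentially)
      obtain Y Z where YZ: "Y \<longlonglongrightarrow> L * exp (- (\<theta> / m))" "\<forall>\<^sub>F n in sequentially. Y n \<le> X n \<and> X n \<le> Z n"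
        using bounds[OF m(1)] by blast
      from order_tendstoD(1)[OF YZ(1) m(2)] YZ(2)
      show "\<forall>\<^sub>F n in sequentially. y < X n" by eventually_elim linarith
    next
      fix y assume "L < y"
      from order_tendstoD(2)[OF m_lim(2) this] eventually_gt_at_top[of 0]
      have "\<forall>\<^sub>F m in sequentially. m > 0 \<and> L * exp (2 * \<theta> / real m) < y" by eventually_elim blast
      then obtain m :: nat where m: "m > 0" "L * exp (2 * \<theta> / real m) < y" by (auto simp: eventually_sequentially)
      obtain Y Z where YZ: "Z \<longlonglongrightarrow> L * exp (2 * \<theta> / m)" "\<forall>\<^sub>F n in sequentially. Y n \<le> X n \<and> X n \<le> Z n"
        using bounds[OF m(1)] by blast
      from order_tendstoD(2)[OF YZ(1) m(2)] YZ(2)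
      show "\<forall>\<^sub>F n in sequentially. X n < y" by eventually_elim linarith
    qed
    then show ?case by (simp add: X_def[abs_def] L_def z_def)
  qed
qed

text \<open>The relative error is the normalised count divided by its limit, minus 1; this requires
  the limit to be nonzero, which is \<open>W_positive\<close>.\<close>

lemma occupancy_asymptotics:
  fixes b :: real and j :: "nat \<Rightarrow> nat"
  assumes j_pos: "\<And>n. j n > 0"
    and j_lim: "(\<lambda>n. (ln (real n) - a * real (j n)) / sqrt (ln (real n))) \<longlonglongrightarrow> b"
  shows "AE \<omega> in M. \<exists>e::nat \<Rightarrow> real. e \<longlonglongrightarrow> 0 \<and> (\<forall>\<^sub>F n in sequentially.
      real (Kocc (P \<omega>) (U \<omega>) (j n) n) = gauss_const (b * sqrt a) * W \<omega> * (scale (j n) n / sqrt (j n)) * (1 + e n))"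
  using occupancy_limit[OF j_pos j_lim] W_positive
proof eventually_elim
  case (elim \<omega>)
  define L where "L = gauss_const (b * sqrt a) * W \<omega>"
  have L: "L > 0" using elim(2) gauss_const_pos by (simp add: L_def)
  define X where "X n = sqrt (j n) * balls (j n) n \<omega> / scale (j n) n" for n
  have "(\<lambda>n. X n / L - 1) \<longlonglongrightarrow> L / L - 1"
    using elim(1) L unfolding X_def[symmetric] L_def[symmetric] by (intro tendsto_intros) auto
  moreover have "\<forall>\<^sub>F n in sequentially. balls (j n) n \<omega> = L * (scale (j n) n / sqrt (j n)) * (1 + (X n / L - 1))"
    using eventually_gt_at_top[of 0]
  proof eventually_elim
    case (elim n)
    then show ?case using L scale_pos[of n "j n"] j_pos[of n] by (simp add: X_def)
  qed
  ultimately show ?case using L unfolding balls_def L_def[symmetric] by (intro exI[of _ "\<lambda>n. X n / L - 1"]) simp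
qed

end

section \<open>Reduction of the almost sure hypotheses\<close>

definition weights :: "(nat \<Rightarrow> real) \<Rightarrow> bool" where
  "weights f \<longleftrightarrow> (\<forall>k. 0 \<le> f k) \<and> (\<Sum>k. ennreal (f k)) = 1"

text \<open>The weights are only almost surely probability weights; redefining them on the null set makes
  the locales above, which ask for this everywhere, applicable.\<close>

definition clean :: "(nat \<Rightarrow> real) \<Rightarrow> nat \<Rightarrow> real" where
  "clean f = (if weights f then f else (\<lambda>k. if k = 0 then 1 else 0))"

lemma weights_measurable [measurable]: "Measurable.pred seqM weights"
proof -
  have [measurable]: "(\<lambda>f. f k) \<in> borel_measurable seqM" for k :: nat
    by (rule measurable_component_singleton) simp
  show ?thesis unfolding weights_def[abs_def] by measurable
qed

lemma clean_measurable: "clean \<in> measurable seqM seqM"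
proof (rule measurable_PiM_single')
  fix k :: nat
  have [measurable]: "(\<lambda>f. f k) \<in> borel_measurable seqM" by (rule measurable_component_singleton) simp
  have "(\<lambda>f. clean f k) = (\<lambda>f. if weights f then f k else if k = 0 then 1 else 0)" by (auto simp: clean_def)
  then show "(\<lambda>f. clean f k) \<in> borel_measurable seqM" by simp
qed (simp add: space_PiM)

lemma weights_sums:
  assumes "weights f" shows "f sums 1"
proof -
  have nn: "\<And>k. 0 \<le> f k" and one: "(\<Sum>k. ennreal (f k)) = 1" using assms by (auto simp: weights_def)
  have s: "summable f" by (rule summable_suminf_not_top) (simp_all add: nn one)
  have "ennreal (suminf f) = ennreal 1" unfolding suminf_ennreal2[OF nn s, symmetric] one by simp
  then have "suminf f = 1" by (subst (asm) ennreal_inj) (simp_all add: suminf_nonneg s nn)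
  with summable_sums[OF s] show ?thesis by simp
qed

text \<open>In \<open>weights\<close> the sum is a series in \<open>ennreal\<close>, which makes
  measurability immediate; for nonnegative terms it agrees with real convergence.\<close>

lemma weights_iff: "weights f \<longleftrightarrow> (\<forall>k. 0 \<le> f k) \<and> f sums 1"
proof
  assume "(\<forall>k. 0 \<le> f k) \<and> f sums 1"
  then have nn: "\<And>k. 0 \<le> f k" and s: "f sums 1" by auto
  show "weights f"
    unfolding weights_def suminf_ennreal2[OF nn sums_summable[OF s]] sums_unique[OF s, symmetric] by (simp add: nn)
qed (auto simp: weights_sums, simp add: weights_def)

lemma clean_nonneg: "0 \<le> clean f k"
  by (auto simp: clean_def weights_def)

lemma clean_sums: "clean f sums 1"
  using sums_single[of 0 "\<lambda>_. 1 :: real"] by (simp add: clean_def weights_sums)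

lemma (in brw_theta) Wlim_eq_W: "Wlim (P \<omega>) \<Lambda> \<theta> = W \<omega>"
proof -
  have "Wj (P \<omega>) \<Lambda> \<theta> i = G i (\<lambda>_. 1) \<omega>" for i
  proof -
    have "GG i (\<lambda>_. 1) \<omega> = ennreal (exp (- \<Lambda> * i)) * (\<integral>\<^sup>+v. ennreal (p \<omega> v powr \<theta>) \<partial>count_space (words i))"
      unfolding GG_def by (simp add: ennreal_mult nn_integral_cmult)
    then show ?thesis
      unfolding Wj_def G_def words_def[symmetric] by (subst infsum_eq_nn_integral) (simp_all add: enn2real_mult)
  qed
  then show ?thesis by (simp add: Wlim_def W_def)
qed

text \<open>With z = b sqrt a the exponent z^2 / (2 \<sigma>^2) is a b^2 / (2 \<sigma>^2), and
  \<sigma>^2 is \<lambda>''(\<theta>).\<close>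

lemma (in brw_nonlattice) gauss_const_eq:
  "gauss_const (b * sqrt a) = Gamma (1 - \<theta>) / (\<theta> * sqrt (2 * pi * \<sigma>\<^sup>2)) * exp (- a * b\<^sup>2 / (2 * \<sigma>\<^sup>2))"
  using \<sigma>_pos a_pos by (simp add: gauss_const_def real_sqrt_mult power_mult_distrib mult.commute)

theorem theorem1:
  fixes M :: "'a measure"
    and P :: "'a \<Rightarrow> nat list \<Rightarrow> nat \<Rightarrow> real"
    and U :: "'a \<Rightarrow> nat \<Rightarrow> real"
    and a b \<theta> :: real and abar :: ereal and j :: "nat \<Rightarrow> nat"
  assumes "prob_space M"
    and meas_P: "P \<in> measurable M (PiM UNIV (\<lambda>u. PiM UNIV (\<lambda>k. borel)))"
    and meas_U: "U \<in> measurable M (PiM UNIV (\<lambda>i. borel))"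
    and indep_P: "prob_space.indep_vars M (\<lambda>_. PiM UNIV (\<lambda>k. borel)) (\<lambda>u \<omega>. P \<omega> u) UNIV"
    and ident_P: "\<And>u. distr M (PiM UNIV (\<lambda>k. borel)) (\<lambda>\<omega>. P \<omega> u)
                       = distr M (PiM UNIV (\<lambda>k. borel)) (\<lambda>\<omega>. P \<omega> [])"
    and indep_U: "prob_space.indep_vars M (\<lambda>_. borel) (\<lambda>i \<omega>. U \<omega> i) UNIV"
    and unif_U: "\<And>i. distr M lborel (\<lambda>\<omega>. U \<omega> i) = uniform_measure lborel {0..1}"
    and indep_PU: "distr M (PiM UNIV (\<lambda>u. PiM UNIV (\<lambda>k. borel)) \<Otimes>\<^sub>M PiM UNIV (\<lambda>i. borel))
                       (\<lambda>\<omega>. (P \<omega>, U \<omega>))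
                   = distr M (PiM UNIV (\<lambda>u. PiM UNIV (\<lambda>k. borel))) P
                       \<Otimes>\<^sub>M distr M (PiM UNIV (\<lambda>i. borel)) U"
    and nonneg: "AE \<omega> in M. \<forall>k. P \<omega> [] k \<ge> 0"
    and sum1: "AE \<omega> in M. (\<lambda>k. P \<omega> [] k) sums 1"
    and supercrit: "(\<integral>\<^sup>+ \<omega>. (\<Sum>k. ennreal (if P \<omega> [] k > 0 then 1 else 0)) \<partial>M) > 1"
    and nonlattice: "\<And>c d. c > 0 \<Longrightarrow>
        measure M {\<omega> \<in> space M. \<forall>k. P \<omega> [] k > 0 \<longrightarrow> (\<exists>z::int. - ln (P \<omega> [] k) = c * real_of_int z + d)} < 1"
    and theta_star: "\<exists>\<theta>s. ereal \<theta>s > theta_low M (\<lambda>\<omega>. P \<omega> [])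
        \<and> \<theta>s * deriv (lam M (\<lambda>\<omega>. P \<omega> [])) \<theta>s - lam M (\<lambda>\<omega>. P \<omega> []) \<theta>s = 0"
    and abar: "((\<lambda>t. ereal (- deriv (lam M (\<lambda>\<omega>. P \<omega> [])) t)) \<longlongrightarrow> abar)
                 (at_right (real_of_ereal (max (theta_low M (\<lambda>\<omega>. P \<omega> [])) 0)))"
    and a_lo: "- deriv (lam M (\<lambda>\<omega>. P \<omega> [])) 1 < a"
    and a_hi: "ereal a < abar"
    and theta: "0 < \<theta>" "\<theta> < 1" "ereal \<theta> > theta_low M (\<lambda>\<omega>. P \<omega> [])"
    and a_theta: "a = - deriv (lam M (\<lambda>\<omega>. P \<omega> [])) \<theta>"
    and j_pos: "\<And>n. j n > 0"
    and j_lim: "(\<lambda>n. (ln (real n) - a * real (j n)) / sqrt (ln (real n))) \<longlonglongrightarrow> b"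
  shows "AE \<omega> in M. \<exists>e::nat \<Rightarrow> real. e \<longlonglongrightarrow> 0 \<and>
     (\<forall>\<^sub>F n in sequentially.
        real (Kocc (P \<omega>) (U \<omega>) (j n) n)
        = Gamma (1 - \<theta>) / (\<theta> * sqrt (2 * pi * deriv (deriv (lam M (\<lambda>\<omega>. P \<omega> []))) \<theta>))
          * exp (- a * b\<^sup>2 / (2 * deriv (deriv (lam M (\<lambda>\<omega>. P \<omega> []))) \<theta>))
          * Wlim (P \<omega>) (lam M (\<lambda>\<omega>. P \<omega> []) \<theta>) \<theta>
          * (real n powr \<theta> * exp (lam M (\<lambda>\<omega>. P \<omega> []) \<theta> * real (j n)) / sqrt (real (j n)))
          * (1 + e n))"
  proof -
  interpret prob_space M by fact
  define P' where "P' \<omega> u = clean (P \<omega> u)" for \<omega> u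
  have Pu [measurable]: "(\<lambda>\<omega>. P \<omega> u) \<in> measurable M seqM" for u
    using measurable_compose[OF meas_P measurable_component_singleton[of u UNIV]] by simp
  have P'u [measurable]: "(\<lambda>\<omega>. P' \<omega> u) \<in> measurable M seqM" for u
    unfolding P'_def by (rule measurable_compose[OF Pu clean_measurable])
  have P'_meas [measurable]: "P' \<in> measurable M fieldM"
    by (rule measurable_PiM_single') (use P'u in \<open>auto simp: space_PiM\<close>)
  have root: "AE \<omega> in M. weights (P \<omega> [])"
    using nonneg sum1 by eventually_elim (simp add: weights_iff)
  \<comment> \<open>Nonnegativity and unit sum are assumed for the root only; equality in law
    carries them to each word, and there are countably many words.\<close>
  have "AE \<omega> in M. weights (P \<omega> u)" for u
  proof -
    have "AE f in distr M seqM (\<lambda>\<omega>. P \<omega> []). weights f"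
      by (subst AE_distr_iff[OF Pu]) (use root weights_measurable in \<open>auto simp: pred_def\<close>)
    then have "AE f in distr M seqM (\<lambda>\<omega>. P \<omega> u). weights f" unfolding ident_P[of u] .
    then show ?thesis
      by (subst (asm) AE_distr_iff[OF Pu]) (use weights_measurable in \<open>auto simp: pred_def\<close>)
  qed
  then have "AE \<omega> in M. \<forall>u. weights (P \<omega> u)" by (simp add: AE_all_countable)
  then have eq: "AE \<omega> in M. P' \<omega> = P \<omega>"
    by eventually_elim (auto simp: P'_def clean_def)
  have equ: "AE \<omega> in M. P' \<omega> u = P \<omega> u" for u using eq by eventually_elim simp
  interpret B: brw M P'
  proof
    show "indep_vars (\<lambda>_. seqM) (\<lambda>u \<omega>. P' \<omega> u) UNIV"
      unfolding P'_def by (rule indep_vars_compose2[OF indep_P]) (rule clean_measurable)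
    have d: "distr M seqM (\<lambda>\<omega>. P' \<omega> u) = distr M seqM (\<lambda>\<omega>. P \<omega> u)" for u
      by (rule distr_cong_AE[OF refl refl equ]) measurable
    show "distr M seqM (\<lambda>\<omega>. P' \<omega> u) = distr M seqM (\<lambda>\<omega>. P' \<omega> [])" for u
      unfolding d by (rule ident_P)
    show "0 \<le> P' \<omega> u k" "(\<lambda>k. P' \<omega> u k) sums 1" for \<omega> u k
      unfolding P'_def using clean_sums[of "P \<omega> u"] by (auto simp: clean_nonneg)
  qed
  have mgf: "mgf M (\<lambda>\<omega>. P \<omega> []) t = B.mg t" for t
    unfolding mgf_def B.mg_def by (rule nn_integral_cong_AE) (use equ[of "[]"] in \<open>auto elim: eventually_mono\<close>)
  define \<Lambda> where "\<Lambda> = lam M (\<lambda>\<omega>. P \<omega> []) \<theta>"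
  \<comment> \<open>A point below \<theta> where the moment function is finite exists because
    \<theta> exceeds the infimum of all such points.\<close>
  from theta(3) obtain s0 where s0: "s0 < \<theta>" "B.mg s0 < \<infinity>"
    unfolding theta_low_def Inf_less_iff by (auto simp: mgf)
  have "B.mg \<theta> \<le> B.mg s0" "B.mg 1 \<le> B.mg \<theta>"
    using s0 theta by (auto intro!: B.mg_mono)
  then have fin: "1 \<le> B.mg \<theta>" "B.mg \<theta> < \<infinity>" using s0(2) by (auto simp: B.mg_1)
  then obtain x where x: "B.mg \<theta> = ennreal x" "x \<ge> 0" by (cases "B.mg \<theta>") auto
  with fin(1) have "x \<ge> 1" by simp
  with x have mg_th: "B.mg \<theta> = ennreal (exp \<Lambda>)" by (simp add: \<Lambda>_def lam_def mgf)
  have nonlat: "\<not> (AE \<omega> in M. \<forall>k. P' \<omega> [] k > 0 \<longrightarrow> (\<exists>z::int. - ln (P' \<omega> [] k) = c * real_of_int z + d))"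
    if c: "c > 0" for c d
  proof
    assume "AE \<omega> in M. \<forall>k. P' \<omega> [] k > 0 \<longrightarrow> (\<exists>z::int. - ln (P' \<omega> [] k) = c * real_of_int z + d)"
    then have ae: "AE \<omega> in M. \<forall>k. P \<omega> [] k > 0 \<longrightarrow> (\<exists>z::int. - ln (P \<omega> [] k) = c * real_of_int z + d)"
      using equ[of "[]"] by eventually_elim simp
    have [measurable]: "(\<lambda>\<omega>. P \<omega> [] k) \<in> borel_measurable M" for k
      by (rule measurable_compose[OF Pu measurable_component_singleton]) simp
    have "{\<omega> \<in> space M. \<forall>k. P \<omega> [] k > 0 \<longrightarrow> (\<exists>z::int. - ln (P \<omega> [] k) = c * real_of_int z + d)} \<in> events"
      by measurable
    with ae have "prob {\<omega> \<in> space M. \<forall>k. P \<omega> [] k > 0 \<longrightarrow> (\<exists>z::int. - ln (P \<omega> [] k) = c * real_of_int z + d)} = 1"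
      by (subst prob_eq_1) auto
    with nonlattice[OF c, of d] show False by simp
  qed
  interpret N: brw_balls M P' \<theta> \<Lambda> s0 U
  proof unfold_locales
    show "0 < \<theta>" "\<theta> < 1" "B.mg \<theta> = ennreal (exp \<Lambda>)" "s0 < \<theta>" "B.mg s0 < \<infinity>" by fact+
    show "indep_vars (\<lambda>_. borel) (\<lambda>i \<omega>. U \<omega> i) UNIV" by fact
    show "distr M lborel (\<lambda>\<omega>. U \<omega> i) = uniform_measure lborel {0..1}" for i by (rule unif_U)
    show "\<not> (AE \<omega> in M. \<forall>k. P' \<omega> [] k > 0 \<longrightarrow> (\<exists>z::int. - ln (P' \<omega> [] k) = c * real_of_int z + d))"
      if "c > 0" for c d by (rule nonlat[OF that])
    \<comment> \<open>Weights in {0, 1} would put all displacements at 0, which is a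
      lattice.\<close>
    show "\<not> (AE \<omega> in M. \<forall>k. P' \<omega> [] k \<in> {0, 1})"
    proof
      assume "AE \<omega> in M. \<forall>k. P' \<omega> [] k \<in> {0, 1}"
      then have "AE \<omega> in M. \<forall>k. P' \<omega> [] k > 0 \<longrightarrow> (\<exists>z::int. - ln (P' \<omega> [] k) = 1 * real_of_int z + 0)"
        by eventually_elim (force intro: exI[of _ 0])
      with nonlat[of 1 0] show False by simp
    qed
    have 1: "distr M fieldM P' = distr M fieldM P"
      by (rule distr_cong_AE[OF refl refl eq P'_meas meas_P])
    have "distr M (fieldM \<Otimes>\<^sub>M ballsM) (\<lambda>\<omega>. (P' \<omega>, U \<omega>)) = distr M (fieldM \<Otimes>\<^sub>M ballsM) (\<lambda>\<omega>. (P \<omega>, U \<omega>))"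
      by (rule distr_cong_AE[OF refl refl _ measurable_Pair[OF P'_meas meas_U] measurable_Pair[OF meas_P meas_U]])
         (use eq in \<open>auto elim: eventually_mono\<close>)
    then show "distr M (fieldM \<Otimes>\<^sub>M ballsM) (\<lambda>\<omega>. (P' \<omega>, U \<omega>)) = distr M fieldM P' \<Otimes>\<^sub>M distr M ballsM U"
      unfolding 1 indep_PU .
  qed
  have lam: "lam M (\<lambda>\<omega>. P \<omega> []) = N.LAM"
    by (rule ext) (simp add: lam_def N.LAM_def mgf)
  have a: "N.a = a" unfolding a_theta lam N.deriv_LAM by (simp add: N.a_def)
  have \<sigma>: "deriv (deriv (lam M (\<lambda>\<omega>. P \<omega> []))) \<theta> = N.\<sigma>\<^sup>2"
    unfolding lam N.deriv2_LAM N.\<sigma>_square ..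
  from N.occupancy_asymptotics[OF j_pos, unfolded a, OF j_lim] eq show ?thesis
  proof eventually_elim
    case (elim \<omega>)
    then show ?case
      unfolding N.gauss_const_eq[unfolded a] N.scale_def N.Wlim_eq_W[symmetric] \<sigma> \<Lambda>_def[symmetric] by simp
  qed
qed


end
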